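(* Let $\phi:(\mathcal X,\mathfrak S)\to(\mathcal X',\mathfrak S')$ be a full hieromorphism between hierarchically hyperbolic spaces with hierarchically quasiconvex image, and let $S$ be the $\sqsubseteq$-maximal element of $\mathfrak S$. The following are equivalent: (1) $\phi$ is coarsely lipschitz; (2) $\phi$ is a quasi-isometric embedding; (3) the gate maps $\mathfrak g_{\phi(\mathcal X)}:\mathbf F_{\phi^\lozenge(S)}\to\phi(\mathcal X)$ and $\mathfrak g_{\mathbf F_{\phi^\lozenge(S)}}:\phi(\mathcal X)\to\mathbf F_{\phi^\lozenge(S)}$ are quasi-inverses of each other, and in particular quasi-isometries; (4) the subspace $\phi(\mathcal X)\subseteq\mathcal X'$, endowed with the subspace metric, admits a hierarchically hyperbolic structure obtained from the one of $\mathcal X$ by composition with the map $\phi$ (and its induced maps at the level of hyperbolic spaces); (5) $\pi_W(\phi(\mathcal X))$ is uniformly bounded for every $W\in\mathfrak S'\setminus\phi^\lozenge(\mathfrak S)$, i.e. there is $\mu$ with $\mathrm{diam}_{\mathcal CW}\,\pi_W(\phi(\mathcal X))\le\mu$ for all such $W$.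
   Context: **Hierarchically hyperbolic space (HHS).** Distances between subsets are infima; $2^Y$ denotes the set of subsets of $Y$; $f$ is $(K,C)$-coarsely lipschitz if $d(f(x),f(y))\le K d(x,y)+C$. A $q$-quasigeodesic metric space $(\mathcal X,d_{\mathcal X})$ (any two points are joined by a $(q,q)$-quasigeodesic) is an HHS $(\mathcal X,\mathfrak S)$ if there are $\delta\ge0$, an index set $\mathfrak S$ and $\delta$-hyperbolic spaces $(\mathcal CW,d_W)$, $W\in\mathfrak S$, such that: (1) *Projections.* There are maps $\pi_W:\mathcal X\to2^{\mathcal CW}$ sending points to sets of diameter $\le\xi$; there is $K$ such that every $\pi_W$ is $(K,K)$-coarsely lipschitz and $\pi_W(\mathcal X)=\bigcup_x\pi_W(x)$ is $K$-quasiconvex. (2) *Nesting.* $\mathfrak S$ has a partial order $\sqsubseteq$ and is empty or has a unique $\sqsubseteq$-maximal element. $\mathfrak S_W=\{V: V\sqsubseteq W\}$. If $V\sqsubsetneq W$ there are a set $\rho^V_W\subseteq\mathcal CW$ of diameter $\le\xi$ and a map $\rho^W_V:\mathcal CW\to2^{\mathcal CV}$. (3) *Orthogonality.* $\mathfrak S$ has a symmetric antireflexive relation $\perp$; if $V\sqsubseteq W$ and $W\perp U$ then $V\perp U$. For $Z\in\mathfrak S$ and $U\in\mathfrak S_Z$ with $\{V\in\mathfrak S_Z: V\perp U\}\ne\emptyset$ there is an orthogonal container $\mathrm{cont}^Z_\perp U\in\mathfrak S_Z\setminus\{Z\}$ such that $V\perp U$, $V\sqsubseteq Z$ imply $V\sqsubseteq\mathrm{cont}^Z_\perp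 U$. (4) *Transversality and consistency.* If $V,W$ are not orthogonal and neither is nested in the other, they are transverse, $V\pitchfork W$ (nesting, orthogonality, transversality are mutually exclusive). There is $\kappa_0$ such that if $V\pitchfork W$ there are sets $\rho^V_W\subseteq\mathcal CW$, $\rho^W_V\subseteq\mathcal CV$ of diameter $\le\xi$ with $\min\{d_W(\pi_W(x),\rho^V_W),d_V(\pi_V(x),\rho^W_V)\}\le\kappa_0$ for all $x$; if $V\sqsubsetneq W$ then $\min\{d_W(\pi_W(x),\rho^V_W),\mathrm{diam}_{\mathcal CV}(\pi_V(x)\cup\rho^W_V(\pi_W(x)))\}\le\kappa_0$ for all $x$. If $V\sqsubseteq W$, then $d_U(\rho^V_U,\rho^W_U)\le\kappa_0$ whenever $W\sqsubsetneq U$, or $W\pitchfork U$ and $U\not\perp V$. (5) *Finite complexity.* There is $n$ such that any set of pairwise $\sqsubseteq$-comparable elements has at most $n$ elements. (6) *Large links.* There are $\lambda\ge1$, $E\ge\max\{\xi,\kappa_0\}$ such that for $W\in\mathfrak S$, $x,x'\in\mathcal X$ and $N=\lambda d_W(\pi_W(x),\pi_W(x'))+\lambda$ there are $T_1,\dots,T_{\lfloor N\rfloor}\in\mathfrak S_W\setminus\{W\}$ such that each $T\in\mathfrak S_W\setminus\{W\}$ satisfies $T\in\mathfrak S_{T_i}$ for some $i$ or $d_T(\pi_T(x),\pi_T(x'))<E$; moreover $d_W(\pi_W(x),\rho^{T_i}_W)\le N$ for all $i$. (7) *Bounded geodesic image.* For $V\sqsubsetneq W$ and every geodesic $\gamma$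 of $\mathcal CW$, $\mathrm{diam}(\rho^W_V(\gamma))\le E$ or $\gamma\cap\mathcal N_E(\rho^V_W)\ne\emptyset$. (8) *Partial realization.* There is $\alpha$ such that for pairwise orthogonal $\{V_j\}$ and $p_j\in\pi_{V_j}(\mathcal X)$ there is $x\in\mathcal X$ with $d_{V_j}(\pi_{V_j}(x),p_j)\le\alpha$ for all $j$, and $d_V(\pi_V(x),\rho^{V_j}_V)\le\alpha$ whenever $V_j\sqsubsetneq V$ or $V\pitchfork V_j$. (9) *Uniqueness.* For each $\kappa\ge0$ there is $\theta_u(\kappa)$ such that $d_{\mathcal X}(x,y)\ge\theta_u(\kappa)$ implies $d_V(\pi_V(x),\pi_V(y))\ge\kappa$ for some $V$. Standing assumption: all $\pi_W$ are uniformly coarsely surjective. **Hieromorphism** $\phi:(\mathcal X,\mathfrak S)\to(\mathcal X',\mathfrak S')$: a map $\phi:\mathcal X\to\mathcal X'$, an injective map $\phi^\lozenge:\mathfrak S\to\mathfrak S'$ preserving nesting, transversality and orthogonality, and uniform quasi-isometric embeddings $\phi^*_U:\mathcal CU\to\mathcal C\phi^\lozenge(U)$, such that, with uniform constants, $\pi_{\phi^\lozenge(U)}\circ\phi$ coarsely equals $\phi^*_U\circ\pi_U$, and $\phi_V^*\circ\rho^U_V$ coarsely equals $\rho^{\phi^\lozenge(U)}_{\phi^\lozenge(V)}\circ\phi^*_U$ for non-orthogonal $U,V$ (for sets $\rho$: $\phi^*_V(\rho^U_V)$ coarsely equals $\rho^{\phi^\lozenge(U)}_{\phi^\lozenge(V)}$).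 It is *full* if there is $\xi$ such that all $\phi^*_U$ are $(\xi,\xi)$-quasi-isometries and every $U'\sqsubseteq\phi^\lozenge(S)$ lies in $\phi^\lozenge(\mathfrak S)$. **Hierarchical quasiconvexity.** $\mathcal Y\subseteq\mathcal X'$ is hierarchically quasiconvex if for some $k:[0,\infty)\to[0,\infty)$ every $\pi_U(\mathcal Y)$, $U\in\mathfrak S'$, is $k(0)$-quasiconvex in $\mathcal CU$, and for all $\kappa\ge0$, if $d_U(\pi_U(x),\pi_U(\mathcal Y))\le\kappa$ for all $U\in\mathfrak S'$ then $d_{\mathcal X'}(x,\mathcal Y)\le k(\kappa)$. For such $\mathcal Y$ there is a coarsely lipschitz *gate map* $\mathfrak g_{\mathcal Y}:\mathcal X'\to\mathcal Y$, characterised (up to uniformly bounded error) by: for all $x$ and all $V\in\mathfrak S'$, $\pi_V(\mathfrak g_{\mathcal Y}(x))$ coarsely coincides, with uniform constants, with the closest-point projection of $\pi_V(x)$ to $\pi_V(\mathcal Y)$ in $\mathcal CV$. In (3) gate maps are restricted to the indicated subspaces. **The subspaces $\mathbf F_U$.** A tuple $(b_V)$ of subsets $b_V\subseteq\mathcal CV$ of diameter $\le\kappa$, indexed by a set of indices $V$, is $\kappa$-consistent if $\min\{d_W(b_W,\rho^V_W),d_V(b_V,\rho^W_V)\}\le\kappa$ for $V\pitchfork W$ and $\min\{d_W(b_W,\rho^V_W),\mathrm{diam}_{\mathcal CV}(b_V\cup\rho^W_V(b_W))\}\le\kappa$ for $V\sqsubsetneq W$. Every $\kappa$-consistent tuple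 over the full index set is realized: there is a point $x$ with $\pi_V(x)$ uniformly close to $b_V$ for all $V$ (known realization theorem). Fix a large $\kappa\ge\kappa_0$. For $U\in\mathfrak S'$, $\mathbf E_U$ is the set of $\kappa$-consistent tuples indexed by $\{V: V\perp U\}$. For $e\in\mathbf E_U$, the parallel copy $\mathbf F_U\times\{e\}\subseteq\mathcal X'$ is the set of realization points of the tuples with coordinates $b_V$ for $V\sqsubseteq U$ (where $(b_V)_{V\sqsubseteq U}$ is any $\kappa$-consistent tuple), $e_V$ for $V\perp U$, and $\rho^U_V$ for $V\pitchfork U$ or $U\sqsubsetneq V$. $\mathbf F_U$ denotes such a parallel copy, with the subspace metric; it is hierarchically quasiconvex. **Structure in (4).** The index set is $\phi^\lozenge(\mathfrak S)$ with the relations of $\mathfrak S$ transported by $\phi^\lozenge$; the hyperbolic spaces are $\mathcal C\phi^\lozenge(U)$; the projection of $y=\phi(x)$ to $\mathcal C\phi^\lozenge(U)$ is $\phi^*_U(\pi_U(x))$ (well defined up to uniformly bounded error, since it coarsely equals $\pi_{\phi^\lozenge(U)}(y)$); the sets and maps $\rho$ are those of $\mathfrak S$ transported via the quasi-isometries $\phi^*_U$ and their quasi-inverses. *)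

theory Defs
  imports "HOL-Analysis.Analysis"
begin

section \<open>Coarse geometry of abstract metric spaces\<close>

(* Infimal distance and diameter take values in ennreal, so that an unbounded set has diameter
   infinity and the distance to the empty set is infinity. *)

definition msetdist :: "'a metric \<Rightarrow> 'a set \<Rightarrow> 'a set \<Rightarrow> ennreal" where
  "msetdist m A B = (INF a\<in>A. INF b\<in>B. ennreal (mdist m a b))"

definition mdiam :: "'a metric \<Rightarrow> 'a set \<Rightarrow> ennreal" where
  "mdiam m A = (SUP a\<in>A. SUP b\<in>A. ennreal (mdist m a b))"

definition mneighbourhood :: "'a metric \<Rightarrow> real \<Rightarrow> 'a set \<Rightarrow> 'a set" where
  "mneighbourhood m r A = {x \<in> mspace m. msetdist m {x} A \<le> ennreal r}"

(* Hausdorff distance at most r. *)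
definition coarsely_equal :: "'a metric \<Rightarrow> real \<Rightarrow> 'a set \<Rightarrow> 'a set \<Rightarrow> bool" where
  "coarsely_equal m r A B \<longleftrightarrow> A \<subseteq> mneighbourhood m r B \<and> B \<subseteq> mneighbourhood m r A"

definition geodesic_segment :: "'a metric \<Rightarrow> 'a \<Rightarrow> 'a \<Rightarrow> 'a set \<Rightarrow> bool" where
  "geodesic_segment m x y A \<longleftrightarrow>
     (\<exists>(c :: real \<Rightarrow> 'a) L. 0 \<le> L \<and> c ` {0..L} \<subseteq> mspace m \<and>
        (\<forall>s\<in>{0..L}. \<forall>t\<in>{0..L}. mdist m (c s) (c t) = \<bar>s - t\<bar>) \<and>
        c 0 = x \<and> c L = y \<and> A = c ` {0..L})"

definition quasigeodesic_space :: "real \<Rightarrow> 'a metric \<Rightarrow> bool" where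
  "quasigeodesic_space q m \<longleftrightarrow>
     (\<forall>x\<in>mspace m. \<forall>y\<in>mspace m. \<exists>(c :: real \<Rightarrow> 'a) L. 0 \<le> L \<and> c ` {0..L} \<subseteq> mspace m \<and>
        (\<forall>s\<in>{0..L}. \<forall>t\<in>{0..L}. \<bar>s - t\<bar> / q - q \<le> mdist m (c s) (c t) \<and>
                                 mdist m (c s) (c t) \<le> q * \<bar>s - t\<bar> + q) \<and>
        c 0 = x \<and> c L = y)"

(* Geodesic space all of whose geodesic triangles are delta-slim. *)
definition hyperbolic_space :: "real \<Rightarrow> 'a metric \<Rightarrow> bool" where
  "hyperbolic_space \<delta> m \<longleftrightarrow>
     (\<forall>x\<in>mspace m. \<forall>y\<in>mspace m. \<exists>A. geodesic_segment m x y A) \<and>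
     (\<forall>x y z A B C. geodesic_segment m x y A \<and> geodesic_segment m y z B \<and> geodesic_segment m x z C
        \<longrightarrow> A \<subseteq> mneighbourhood m \<delta> (B \<union> C))"

definition quasiconvex :: "'a metric \<Rightarrow> real \<Rightarrow> 'a set \<Rightarrow> bool" where
  "quasiconvex m k A \<longleftrightarrow> A \<subseteq> mspace m \<and>
     (\<forall>x\<in>A. \<forall>y\<in>A. \<forall>G. geodesic_segment m x y G \<longrightarrow> G \<subseteq> mneighbourhood m k A)"

definition coarsely_lipschitz :: "'a metric \<Rightarrow> 'b metric \<Rightarrow> ('a \<Rightarrow> 'b) \<Rightarrow> bool" where
  "coarsely_lipschitz m1 m2 f \<longleftrightarrow> f \<in> mspace m1 \<rightarrow> mspace m2 \<and>
     (\<exists>K C. \<forall>x\<in>mspace m1. \<forall>y\<in>mspace m1. mdist m2 (f x) (f y) \<le> K * mdist m1 x y + C)"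

definition qi_embedding :: "real \<Rightarrow> real \<Rightarrow> 'a metric \<Rightarrow> 'b metric \<Rightarrow> ('a \<Rightarrow> 'b) \<Rightarrow> bool" where
  "qi_embedding K C m1 m2 f \<longleftrightarrow> 1 \<le> K \<and> 0 \<le> C \<and> f \<in> mspace m1 \<rightarrow> mspace m2 \<and>
     (\<forall>x\<in>mspace m1. \<forall>y\<in>mspace m1. mdist m1 x y / K - C \<le> mdist m2 (f x) (f y) \<and>
                                  mdist m2 (f x) (f y) \<le> K * mdist m1 x y + C)"

definition quasi_isometry :: "real \<Rightarrow> real \<Rightarrow> 'a metric \<Rightarrow> 'b metric \<Rightarrow> ('a \<Rightarrow> 'b) \<Rightarrow> bool" where
  "quasi_isometry K C m1 m2 f \<longleftrightarrow> qi_embedding K C m1 m2 f \<and>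
     mspace m2 \<subseteq> mneighbourhood m2 C (f ` mspace m1)"

definition quasi_inverses ::
    "real \<Rightarrow> 'a metric \<Rightarrow> 'b metric \<Rightarrow> ('a \<Rightarrow> 'b) \<Rightarrow> ('b \<Rightarrow> 'a) \<Rightarrow> bool" where
  "quasi_inverses C m1 m2 f g \<longleftrightarrow> f \<in> mspace m1 \<rightarrow> mspace m2 \<and> g \<in> mspace m2 \<rightarrow> mspace m1 \<and>
     (\<forall>x\<in>mspace m1. mdist m1 (g (f x)) x \<le> C) \<and> (\<forall>y\<in>mspace m2. mdist m2 (f (g y)) y \<le> C)"

(* Nearest points need not exist, so closest means up to an additive error 1. *)
definition closest_point_projection :: "'a metric \<Rightarrow> 'a set \<Rightarrow> 'a set \<Rightarrow> 'a set" where
  "closest_point_projection m B A =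
     {b \<in> B. \<exists>a\<in>A. ennreal (mdist m a b) \<le> msetdist m {a} B + 1}"


section \<open>Hierarchically hyperbolic spaces\<close>

(* rho_set V W is the subset rho^V_W of the space at W, meaningful for V properly nested in W or V
   transverse to W.  rho_map W V is the map rho^W_V from the space at W to subsets of the space
   at V, meaningful for V properly nested in W. *)
record ('x, 'i, 'h) hhs_data =
  ambient :: "'x metric"
  index :: "'i set"
  hyp :: "'i \<Rightarrow> 'h metric"
  prj :: "'i \<Rightarrow> 'x \<Rightarrow> 'h set"
  nest :: "'i \<Rightarrow> 'i \<Rightarrow> bool"
  orth :: "'i \<Rightarrow> 'i \<Rightarrow> bool"
  rho_set :: "'i \<Rightarrow> 'i \<Rightarrow> 'h set"
  rho_map :: "'i \<Rightarrow> 'i \<Rightarrow> 'h \<Rightarrow> 'h set"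

abbreviation points :: "('x, 'i, 'h) hhs_data \<Rightarrow> 'x set" where
  "points H \<equiv> mspace (ambient H)"

abbreviation hdist :: "('x, 'i, 'h) hhs_data \<Rightarrow> 'i \<Rightarrow> 'h set \<Rightarrow> 'h set \<Rightarrow> ennreal" where
  "hdist H W \<equiv> msetdist (hyp H W)"

abbreviation hdiam :: "('x, 'i, 'h) hhs_data \<Rightarrow> 'i \<Rightarrow> 'h set \<Rightarrow> ennreal" where
  "hdiam H W \<equiv> mdiam (hyp H W)"

definition prj_image :: "('x, 'i, 'h) hhs_data \<Rightarrow> 'i \<Rightarrow> 'x set \<Rightarrow> 'h set" where
  "prj_image H W Y = (\<Union>x\<in>Y. prj H W x)"

definition rho_image :: "('x, 'i, 'h) hhs_data \<Rightarrow> 'i \<Rightarrow> 'i \<Rightarrow> 'h set \<Rightarrow> 'h set" where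
  "rho_image H W V A = (\<Union>p\<in>A. rho_map H W V p)"

definition snest :: "('x, 'i, 'h) hhs_data \<Rightarrow> 'i \<Rightarrow> 'i \<Rightarrow> bool" where
  "snest H V W \<longleftrightarrow> nest H V W \<and> V \<noteq> W"

definition transverse :: "('x, 'i, 'h) hhs_data \<Rightarrow> 'i \<Rightarrow> 'i \<Rightarrow> bool" where
  "transverse H V W \<longleftrightarrow> \<not> orth H V W \<and> \<not> nest H V W \<and> \<not> nest H W V"

definition nested_in :: "('x, 'i, 'h) hhs_data \<Rightarrow> 'i \<Rightarrow> 'i set" where
  "nested_in H W = {V \<in> index H. nest H V W}"

definition orth_to :: "('x, 'i, 'h) hhs_data \<Rightarrow> 'i \<Rightarrow> 'i set" where
  "orth_to H W = {V \<in> index H. orth H V W}"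

definition maximal_index :: "('x, 'i, 'h) hhs_data \<Rightarrow> 'i \<Rightarrow> bool" where
  "maximal_index H S \<longleftrightarrow> S \<in> index H \<and> (\<forall>V\<in>index H. nest H S V \<longrightarrow> V = S)"

(* A nonempty subset of the space at W of diameter at most r: the values of coarse maps. *)
definition bounded_piece :: "('x, 'i, 'h) hhs_data \<Rightarrow> real \<Rightarrow> 'i \<Rightarrow> 'h set \<Rightarrow> bool" where
  "bounded_piece H r W A \<longleftrightarrow> A \<noteq> {} \<and> A \<subseteq> mspace (hyp H W) \<and> hdiam H W A \<le> ennreal r"

definition hhs_projections :: "('x, 'i, 'h) hhs_data \<Rightarrow> real \<Rightarrow> real \<Rightarrow> bool" where
  "hhs_projections H \<xi> K \<longleftrightarrow> (\<forall>W\<in>index H.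
     (\<forall>x\<in>points H. bounded_piece H \<xi> W (prj H W x)) \<and>
     (\<forall>x\<in>points H. \<forall>y\<in>points H.
        hdist H W (prj H W x) (prj H W y) \<le> ennreal (K * mdist (ambient H) x y + K)) \<and>
     quasiconvex (hyp H W) K (prj_image H W (points H)))"

definition hhs_nesting :: "('x, 'i, 'h) hhs_data \<Rightarrow> real \<Rightarrow> bool" where
  "hhs_nesting H \<xi> \<longleftrightarrow>
     reflp_on (index H) (nest H) \<and> antisymp_on (index H) (nest H) \<and> transp_on (index H) (nest H) \<and>
     (index H = {} \<or> (\<exists>!S. maximal_index H S)) \<and>
     (\<forall>V\<in>index H. \<forall>W\<in>index H. snest H V W \<longrightarrow>
        bounded_piece H \<xi> W (rho_set H V W) \<and>
        (\<forall>p\<in>mspace (hyp H W). rho_map H W V p \<noteq> {} \<and> rho_map H W V p \<subseteq> mspace (hyp H V)))"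

definition hhs_orthogonality :: "('x, 'i, 'h) hhs_data \<Rightarrow> bool" where
  "hhs_orthogonality H \<longleftrightarrow>
     symp_on (index H) (orth H) \<and> irreflp_on (index H) (orth H) \<and>
     (\<forall>U\<in>index H. \<forall>V\<in>index H. \<forall>W\<in>index H. nest H V W \<and> orth H W U \<longrightarrow> orth H V U) \<and>
     (\<forall>Z\<in>index H. \<forall>U\<in>nested_in H Z. (\<exists>V\<in>nested_in H Z. orth H V U) \<longrightarrow>
        (\<exists>T\<in>nested_in H Z - {Z}. \<forall>V\<in>nested_in H Z. orth H V U \<longrightarrow> nest H V T))"

definition hhs_consistency :: "('x, 'i, 'h) hhs_data \<Rightarrow> real \<Rightarrow> real \<Rightarrow> bool" where
  "hhs_consistency H \<xi> \<kappa>0 \<longleftrightarrow>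
     (\<forall>V\<in>index H. \<forall>W\<in>index H. \<not> (nest H V W \<and> orth H V W)) \<and>
     (\<forall>V\<in>index H. \<forall>W\<in>index H. transverse H V W \<longrightarrow>
        bounded_piece H \<xi> W (rho_set H V W) \<and> bounded_piece H \<xi> V (rho_set H W V) \<and>
        (\<forall>x\<in>points H. min (hdist H W (prj H W x) (rho_set H V W))
                           (hdist H V (prj H V x) (rho_set H W V)) \<le> ennreal \<kappa>0)) \<and>
     (\<forall>V\<in>index H. \<forall>W\<in>index H. snest H V W \<longrightarrow>
        (\<forall>x\<in>points H. min (hdist H W (prj H W x) (rho_set H V W))
                           (hdiam H V (prj H V x \<union> rho_image H W V (prj H W x))) \<le> ennreal \<kappa>0)) \<and>
     (\<forall>U\<in>index H. \<forall>V\<in>index H. \<forall>W\<in>index H.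
        nest H V W \<and> (snest H W U \<or> transverse H W U \<and> \<not> orth H U V) \<longrightarrow>
        hdist H U (rho_set H V U) (rho_set H W U) \<le> ennreal \<kappa>0)"

definition hhs_finite_complexity :: "('x, 'i, 'h) hhs_data \<Rightarrow> bool" where
  "hhs_finite_complexity H \<longleftrightarrow> (\<exists>n. \<forall>\<C>. \<C> \<subseteq> index H \<and>
     (\<forall>V\<in>\<C>. \<forall>W\<in>\<C>. nest H V W \<or> nest H W V) \<longrightarrow> finite \<C> \<and> card \<C> \<le> n)"

(* The family T_1, ..., T_floor(N) is a set of at most floor(N) elements: it has to be allowed to be
   empty, since nothing is properly nested in a minimal W. *)
definition hhs_large_links :: "('x, 'i, 'h) hhs_data \<Rightarrow> real \<Rightarrow> real \<Rightarrow> bool" where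
  "hhs_large_links H l E \<longleftrightarrow> (\<forall>W\<in>index H. \<forall>x\<in>points H. \<forall>y\<in>points H. \<forall>N.
     N = l * enn2real (hdist H W (prj H W x) (prj H W y)) + l \<longrightarrow>
     (\<exists>\<T> \<subseteq> nested_in H W - {W}. finite \<T> \<and> int (card \<T>) \<le> \<lfloor>N\<rfloor> \<and>
        (\<forall>T\<in>nested_in H W - {W}. (\<exists>T'\<in>\<T>. T \<in> nested_in H T') \<or>
           hdist H T (prj H T x) (prj H T y) < ennreal E) \<and>
        (\<forall>T'\<in>\<T>. hdist H W (prj H W x) (rho_set H T' W) \<le> ennreal N)))"

definition hhs_bounded_geodesic_image :: "('x, 'i, 'h) hhs_data \<Rightarrow> real \<Rightarrow> bool" where
  "hhs_bounded_geodesic_image H E \<longleftrightarrow> (\<forall>V\<in>index H. \<forall>W\<in>index H. snest H V W \<longrightarrow>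
     (\<forall>p q G. geodesic_segment (hyp H W) p q G \<longrightarrow>
        hdiam H V (rho_image H W V G) \<le> ennreal E \<or>
        G \<inter> mneighbourhood (hyp H W) E (rho_set H V W) \<noteq> {}))"

definition hhs_partial_realization :: "('x, 'i, 'h) hhs_data \<Rightarrow> real \<Rightarrow> bool" where
  "hhs_partial_realization H \<alpha> \<longleftrightarrow> (\<forall>\<V> p. \<V> \<subseteq> index H \<and>
     (\<forall>V\<in>\<V>. \<forall>W\<in>\<V>. V \<noteq> W \<longrightarrow> orth H V W) \<and>
     (\<forall>V\<in>\<V>. p V \<in> prj_image H V (points H)) \<longrightarrow>
     (\<exists>x\<in>points H. \<forall>V\<in>\<V>. hdist H V (prj H V x) {p V} \<le> ennreal \<alpha> \<and>
        (\<forall>U\<in>index H. snest H V U \<or> transverse H U V \<longrightarrow>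
           hdist H U (prj H U x) (rho_set H V U) \<le> ennreal \<alpha>)))"

definition hhs_uniqueness :: "('x, 'i, 'h) hhs_data \<Rightarrow> bool" where
  "hhs_uniqueness H \<longleftrightarrow> (\<exists>\<theta> :: real \<Rightarrow> real. \<forall>\<kappa>\<ge>0. \<forall>x\<in>points H. \<forall>y\<in>points H.
     mdist (ambient H) x y \<ge> \<theta> \<kappa> \<longrightarrow>
     (\<exists>V\<in>index H. hdist H V (prj H V x) (prj H V y) \<ge> ennreal \<kappa>))"

definition hhs_coarsely_surjective :: "('x, 'i, 'h) hhs_data \<Rightarrow> bool" where
  "hhs_coarsely_surjective H \<longleftrightarrow> (\<exists>C. \<forall>W\<in>index H.
     mspace (hyp H W) \<subseteq> mneighbourhood (hyp H W) C (prj_image H W (points H)))"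

definition hhs :: "('x, 'i, 'h) hhs_data \<Rightarrow> bool" where
  "hhs H \<longleftrightarrow>
     (\<exists>q\<ge>1. quasigeodesic_space q (ambient H)) \<and>
     (\<exists>\<delta>\<ge>0. \<forall>W\<in>index H. hyperbolic_space \<delta> (hyp H W)) \<and>
     (\<exists>\<xi> K \<kappa>0 l E. 0 \<le> \<xi> \<and> 0 \<le> K \<and> 0 \<le> \<kappa>0 \<and> 1 \<le> l \<and> max \<xi> \<kappa>0 \<le> E \<and>
        hhs_projections H \<xi> K \<and> hhs_nesting H \<xi> \<and> hhs_orthogonality H \<and>
        hhs_consistency H \<xi> \<kappa>0 \<and> hhs_large_links H l E \<and> hhs_bounded_geodesic_image H E) \<and>
     hhs_finite_complexity H \<and>
     (\<exists>\<alpha>\<ge>0. hhs_partial_realization H \<alpha>) \<and>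
     hhs_uniqueness H \<and>
     hhs_coarsely_surjective H"


section \<open>Hieromorphisms\<close>

definition hieromorphism ::
    "('x, 'i, 'h) hhs_data \<Rightarrow> ('y, 'j, 'k) hhs_data \<Rightarrow> ('x \<Rightarrow> 'y) \<Rightarrow> ('i \<Rightarrow> 'j) \<Rightarrow> ('i \<Rightarrow> 'h \<Rightarrow> 'k) \<Rightarrow> bool"
  where
  "hieromorphism H H' \<phi> \<phi>d \<phi>s \<longleftrightarrow>
     \<phi> \<in> points H \<rightarrow> points H' \<and>
     \<phi>d \<in> index H \<rightarrow> index H' \<and> inj_on \<phi>d (index H) \<and>
     (\<forall>U\<in>index H. \<forall>V\<in>index H.
        (nest H U V \<longrightarrow> nest H' (\<phi>d U) (\<phi>d V)) \<and>
        (transverse H U V \<longrightarrow> transverse H' (\<phi>d U) (\<phi>d V)) \<and>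
        (orth H U V \<longrightarrow> orth H' (\<phi>d U) (\<phi>d V))) \<and>
     (\<exists>K. (\<forall>U\<in>index H. qi_embedding K K (hyp H U) (hyp H' (\<phi>d U)) (\<phi>s U)) \<and>
        (\<forall>U\<in>index H. \<forall>x\<in>points H.
           coarsely_equal (hyp H' (\<phi>d U)) K (prj H' (\<phi>d U) (\<phi> x)) (\<phi>s U ` prj H U x)) \<and>
        (\<forall>U\<in>index H. \<forall>V\<in>index H. snest H U V \<or> transverse H U V \<longrightarrow>
           coarsely_equal (hyp H' (\<phi>d V)) K (\<phi>s V ` rho_set H U V) (rho_set H' (\<phi>d U) (\<phi>d V))) \<and>
        (\<forall>U\<in>index H. \<forall>V\<in>index H. snest H V U \<longrightarrow> (\<forall>p\<in>mspace (hyp H U).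
           coarsely_equal (hyp H' (\<phi>d V)) K
             (\<phi>s V ` rho_map H U V p) (rho_map H' (\<phi>d U) (\<phi>d V) (\<phi>s U p)))))"

definition full_hieromorphism ::
    "('x, 'i, 'h) hhs_data \<Rightarrow> ('y, 'j, 'k) hhs_data \<Rightarrow> ('x \<Rightarrow> 'y) \<Rightarrow> ('i \<Rightarrow> 'j) \<Rightarrow> ('i \<Rightarrow> 'h \<Rightarrow> 'k) \<Rightarrow> bool"
  where
  "full_hieromorphism H H' \<phi> \<phi>d \<phi>s \<longleftrightarrow> hieromorphism H H' \<phi> \<phi>d \<phi>s \<and>
     (\<exists>\<xi>. \<forall>U\<in>index H. quasi_isometry \<xi> \<xi> (hyp H U) (hyp H' (\<phi>d U)) (\<phi>s U)) \<and>
     (\<forall>S. maximal_index H S \<longrightarrow> nested_in H' (\<phi>d S) \<subseteq> \<phi>d ` index H)"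


section \<open>Hierarchical quasiconvexity and gate maps\<close>

definition hierarchically_quasiconvex :: "('x, 'i, 'h) hhs_data \<Rightarrow> 'x set \<Rightarrow> bool" where
  "hierarchically_quasiconvex H Y \<longleftrightarrow> Y \<subseteq> points H \<and>
     (\<exists>k :: real \<Rightarrow> real. (\<forall>\<kappa>\<ge>0. 0 \<le> k \<kappa>) \<and>
        (\<forall>U\<in>index H. quasiconvex (hyp H U) (k 0) (prj_image H U Y)) \<and>
        (\<forall>\<kappa>\<ge>0. \<forall>x\<in>points H.
           (\<forall>U\<in>index H. hdist H U (prj H U x) (prj_image H U Y) \<le> ennreal \<kappa>) \<longrightarrow>
           msetdist (ambient H) {x} Y \<le> ennreal (k \<kappa>)))"

definition gate_map :: "('x, 'i, 'h) hhs_data \<Rightarrow> 'x set \<Rightarrow> ('x \<Rightarrow> 'x) \<Rightarrow> bool" where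
  "gate_map H Y g \<longleftrightarrow> coarsely_lipschitz (ambient H) (submetric (ambient H) Y) g \<and>
     (\<exists>C. \<forall>x\<in>points H. \<forall>V\<in>index H. coarsely_equal (hyp H V) C (prj H V (g x))
        (closest_point_projection (hyp H V) (prj_image H V Y) (prj H V x)))"

(* Gate maps are only determined up to bounded error: they exist, and any choice of them restricts
   to quasi-inverse quasi-isometries. *)
definition gates_quasi_inverse :: "('x, 'i, 'h) hhs_data \<Rightarrow> 'x set \<Rightarrow> 'x set \<Rightarrow> bool" where
  "gates_quasi_inverse H Y Z \<longleftrightarrow>
     (\<exists>g. gate_map H Y g) \<and> (\<exists>h. gate_map H Z h) \<and>
     (\<forall>g h. gate_map H Y g \<and> gate_map H Z h \<longrightarrow>
        (\<exists>C. quasi_inverses C (submetric (ambient H) Z) (submetric (ambient H) Y) g h) \<and>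
        (\<exists>K C. quasi_isometry K C (submetric (ambient H) Z) (submetric (ambient H) Y) g) \<and>
        (\<exists>K C. quasi_isometry K C (submetric (ambient H) Y) (submetric (ambient H) Z) h))"


section \<open>Consistent tuples and the subspaces F\<close>

definition consistent_tuple ::
    "('x, 'i, 'h) hhs_data \<Rightarrow> real \<Rightarrow> 'i set \<Rightarrow> ('i \<Rightarrow> 'h set) \<Rightarrow> bool" where
  "consistent_tuple H \<kappa> I b \<longleftrightarrow>
     (\<forall>V\<in>I. bounded_piece H \<kappa> V (b V)) \<and>
     (\<forall>V\<in>I. \<forall>W\<in>I. transverse H V W \<longrightarrow>
        min (hdist H W (b W) (rho_set H V W)) (hdist H V (b V) (rho_set H W V)) \<le> ennreal \<kappa>) \<and>
     (\<forall>V\<in>I. \<forall>W\<in>I. snest H V W \<longrightarrow>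
        min (hdist H W (b W) (rho_set H V W)) (hdiam H V (b V \<union> rho_image H W V (b W)))
          \<le> ennreal \<kappa>)"

definition E_tuples :: "('x, 'i, 'h) hhs_data \<Rightarrow> real \<Rightarrow> 'i \<Rightarrow> ('i \<Rightarrow> 'h set) set" where
  "E_tuples H \<kappa> U = {e. consistent_tuple H \<kappa> (orth_to H U) e}"

definition realizes ::
    "('x, 'i, 'h) hhs_data \<Rightarrow> real \<Rightarrow> ('i \<Rightarrow> 'h set) \<Rightarrow> 'x \<Rightarrow> bool" where
  "realizes H \<theta> b x \<longleftrightarrow>
     x \<in> points H \<and> (\<forall>V\<in>index H. hdist H V (prj H V x) (b V) \<le> ennreal \<theta>)"

definition F_copy ::
    "('x, 'i, 'h) hhs_data \<Rightarrow> real \<Rightarrow> real \<Rightarrow> 'i \<Rightarrow> ('i \<Rightarrow> 'h set) \<Rightarrow> 'x set" where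
  "F_copy H \<kappa> \<theta> U e = {x. \<exists>b. consistent_tuple H \<kappa> (nested_in H U) b \<and>
     realizes H \<theta> (\<lambda>V. if nest H V U then b V else if orth H V U then e V else rho_set H U V) x}"


section \<open>The structure induced on the image\<close>

(* psi U is a quasi-inverse of phis U.  The projection of y collects the contributions of all
   preimages of y, which avoids choosing one. *)
definition transported_structure ::
    "('x, 'i, 'h) hhs_data \<Rightarrow> ('y, 'j, 'k) hhs_data \<Rightarrow> ('x \<Rightarrow> 'y) \<Rightarrow> ('i \<Rightarrow> 'j) \<Rightarrow> ('i \<Rightarrow> 'h \<Rightarrow> 'k) \<Rightarrow>
     ('i \<Rightarrow> 'k \<Rightarrow> 'h) \<Rightarrow> ('y, 'j, 'k) hhs_data" where
  "transported_structure H H' \<phi> \<phi>d \<phi>s \<psi> = (let \<iota> = inv_into (index H) \<phi>d in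
     \<lparr> ambient = submetric (ambient H') (\<phi> ` points H),
       index = \<phi>d ` index H,
       hyp = hyp H',
       prj = (\<lambda>W y. \<Union>x\<in>{x \<in> points H. \<phi> x = y}. \<phi>s (\<iota> W) ` prj H (\<iota> W) x),
       nest = (\<lambda>V W. nest H (\<iota> V) (\<iota> W)),
       orth = (\<lambda>V W. orth H (\<iota> V) (\<iota> W)),
       rho_set = (\<lambda>V W. \<phi>s (\<iota> W) ` rho_set H (\<iota> V) (\<iota> W)),
       rho_map = (\<lambda>W V p. \<phi>s (\<iota> V) ` rho_map H (\<iota> W) (\<iota> V) (\<psi> (\<iota> W) p)) \<rparr>)"

definition image_admits_transported_hhs ::
    "('x, 'i, 'h) hhs_data \<Rightarrow> ('y, 'j, 'k) hhs_data \<Rightarrow> ('x \<Rightarrow> 'y) \<Rightarrow> ('i \<Rightarrow> 'j) \<Rightarrow> ('i \<Rightarrow> 'h \<Rightarrow> 'k) \<Rightarrow> bool"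
  where
  "image_admits_transported_hhs H H' \<phi> \<phi>d \<phi>s \<longleftrightarrow>
     (\<exists>\<psi> C. (\<forall>U\<in>index H. quasi_inverses C (hyp H U) (hyp H' (\<phi>d U)) (\<phi>s U) (\<psi> U)) \<and>
            hhs (transported_structure H H' \<phi> \<phi>d \<phi>s \<psi>))"

end

theory Submission
  imports Defs
begin

text \<open>
  A consistent tuple is realized by keeping a family of pairwise orthogonal domains such that the
  tuple lies close to the product region of each of them. Starting from the maximal domain, such a
  family can be refined (by passing to a smaller domain or adding an orthogonal one) until partial
  realization applied to it determines all coordinates. In a refinement step one compares the tuple
  with a partial realization \<open>q\<close>; the domains on which they differ are ordered by the order in which
  a path from \<open>q\<close> to the tuple traverses them, and large links yields a last one. Realization gives
  gate maps onto hierarchically quasiconvex sets and onto the product regions.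

  For the theorem, chains of bounded step length together with uniqueness reduce every coarse
  Lipschitz estimate to uniform control of the coordinates. The gate onto the image followed by a
  choice of preimages is a coarse left inverse of \<open>\<phi>\<close>, which upgrades coarsely Lipschitz to
  quasi-isometric embedding. If \<open>\<phi>\<close> is coarsely Lipschitz, a point of the product region with the
  same inner coordinates as \<open>\<phi> x\<close> has its gate close to \<open>\<phi> x\<close>; since its outer coordinates do not
  depend on \<open>x\<close>, the outer coordinates of the image are bounded.
\<close>

section \<open>Infimal distances, diameters and coarse maps\<close>

text \<open>The asymmetry behind the theorem is uniqueness. Points of the source are coarsely
  determined by the coordinates of their images at the domains in the image of
  \<open>\<phi>d\<close>; points of the target need the remaining domains as well. Boundedness there
  is exactly the missing control, so condition (5) is the hub for the gates and the Lipschitz bound.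

  The refinement for realization stops because nesting chains and orthogonal families have bounded
  size, and each step adds a fixed error, so the final constant is uniform. The last domain is the
  right one: a transverse domain where the tuple is away from its rho point would come still later
  if it were bad, and if it is good its coordinate can be read off from \<open>q\<close>.

  Values of \<open>rho_map\<close> carry no diameter bound, so arguments with nested domains are
  split by the distance to the rho point: near it consistency holds outright, and geodesics that
  avoid it have bounded image.\<close>

definition all_within :: "'a metric \<Rightarrow> real \<Rightarrow> 'a set \<Rightarrow> 'a set \<Rightarrow> bool" where
  "all_within m r A B \<longleftrightarrow> (\<forall>a\<in>A. \<forall>b\<in>B. mdist m a b \<le> r)"

lemma all_withinI: "(\<And>a b. a \<in> A \<Longrightarrow> b \<in> B \<Longrightarrow> mdist m a b \<le> r) \<Longrightarrow> all_within m r A B"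
  by (simp add: all_within_def)

lemma all_withinD: "all_within m r A B \<Longrightarrow> a \<in> A \<Longrightarrow> b \<in> B \<Longrightarrow> mdist m a b \<le> r"
  by (simp add: all_within_def)

lemma all_within_mono: "all_within m r A B \<Longrightarrow> r \<le> s \<Longrightarrow> all_within m s A B"
  by (meson all_within_def order_trans)

lemma msetdist_le:
  assumes "a \<in> A" "b \<in> B" "mdist m a b \<le> r"
  shows "msetdist m A B \<le> ennreal r"
proof -
  have "msetdist m A B \<le> (INF b\<in>B. ennreal (mdist m a b))"
    unfolding msetdist_def using assms(1) by (rule INF_lower)
  also have "\<dots> \<le> ennreal (mdist m a b)" using assms(2) by (rule INF_lower)
  also have "\<dots> \<le> ennreal r" using assms(3) by (rule ennreal_leI)
  finally show ?thesis .
qed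

lemma msetdist_less_obtain:
  assumes "msetdist m A B < ennreal r"
  obtains a b where "a \<in> A" "b \<in> B" "mdist m a b < r"
proof -
  from assms obtain a where a: "a \<in> A" "(INF b\<in>B. ennreal (mdist m a b)) < ennreal r"
    unfolding msetdist_def by (auto simp: INF_less_iff)
  then obtain b where "b \<in> B" "ennreal (mdist m a b) < ennreal r"
    by (auto simp: INF_less_iff)
  with a that show ?thesis by (simp add: ennreal_less_iff)
qed

text \<open>The infimum need not be attained, so the bound is relaxed from \<open>r\<close> to
  \<open>s\<close>. Since \<open>ennreal\<close> truncates negative reals to 0, \<open>r < s\<close>
  alone would not give a strict inequality there; \<open>0 < s\<close> does.\<close>

lemma msetdist_le_obtain:
  assumes "msetdist m A B \<le> ennreal r" "r < s" "0 < s"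
  obtains a b where "a \<in> A" "b \<in> B" "mdist m a b < s"
proof -
  have "ennreal r < ennreal s" using assms by (simp add: ennreal_lessI)
  then show ?thesis using msetdist_less_obtain assms(1) that by (metis order_le_less_trans)
qed

lemma msetdist_ge:
  assumes "\<And>a b. a \<in> A \<Longrightarrow> b \<in> B \<Longrightarrow> r \<le> mdist m a b"
  shows "ennreal r \<le> msetdist m A B"
  unfolding msetdist_def using assms by (auto intro!: INF_greatest ennreal_leI)

lemma enn2real_msetdist_le:
  assumes "a \<in> A" "b \<in> B"
  shows "enn2real (msetdist m A B) \<le> mdist m a b"
  using msetdist_le[OF assms order_refl] by (simp add: enn2real_leI)

text \<open>Both sets must be nonempty: otherwise the infimum is infinite and
  \<open>enn2real\<close> turns it into 0.\<close>

lemma enn2real_msetdist_ge: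
  assumes "A \<noteq> {}" "B \<noteq> {}" "\<And>a b. a \<in> A \<Longrightarrow> b \<in> B \<Longrightarrow> r \<le> mdist m a b"
  shows "r \<le> enn2real (msetdist m A B)"
proof -
  obtain a b where ab: "a \<in> A" "b \<in> B" using assms by auto
  have fin: "msetdist m A B < top"
    using msetdist_le[OF ab order_refl, of m] by (simp add: le_less_trans)
  have "ennreal r \<le> msetdist m A B" using assms(3) by (rule msetdist_ge)
  then have "enn2real (ennreal r) \<le> enn2real (msetdist m A B)" using fin by (rule enn2real_mono)
  then show ?thesis
    by (metis enn2real_ennreal enn2real_nonneg linorder_linear order_trans)
qed

lemma mdiam_leI:
  assumes "\<And>a b. a \<in> A \<Longrightarrow> b \<in> A \<Longrightarrow> mdist m a b \<le> r"
  shows "mdiam m A \<le> ennreal r"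
  unfolding mdiam_def using assms by (auto intro!: SUP_least ennreal_leI)

lemma mdiam_leD:
  assumes "mdiam m A \<le> ennreal r" "a \<in> A" "b \<in> A" "0 \<le> r"
  shows "mdist m a b \<le> r"
proof -
  have "ennreal (mdist m a b) \<le> (SUP b\<in>A. ennreal (mdist m a b))"
    using assms(3) by (rule SUP_upper)
  also have "\<dots> \<le> mdiam m A"
    unfolding mdiam_def using assms(2) by (rule SUP_upper)
  finally show ?thesis using assms(1,4) by (metis ennreal_le_iff order_trans)
qed

lemma bounded_pieceD:
  assumes "bounded_piece H r W A" "0 \<le> r"
  shows "A \<noteq> {}" "A \<subseteq> mspace (hyp H W)" "\<And>a b. a \<in> A \<Longrightarrow> b \<in> A \<Longrightarrow> mdist (hyp H W) a b \<le> r"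
proof -
  show "A \<noteq> {}" "A \<subseteq> mspace (hyp H W)" using assms by (auto simp: bounded_piece_def)
  fix a b assume "a \<in> A" "b \<in> A"
  then show "mdist (hyp H W) a b \<le> r"
    using assms mdiam_leD[of "hyp H W" A r a b] by (simp add: bounded_piece_def)
qed

lemma bounded_pieceI:
  assumes "A \<noteq> {}" "A \<subseteq> mspace (hyp H W)" "\<And>a b. a \<in> A \<Longrightarrow> b \<in> A \<Longrightarrow> mdist (hyp H W) a b \<le> r"
  shows "bounded_piece H r W A"
  unfolding bounded_piece_def using assms(1,2) mdiam_leI[OF assms(3)] by blast

lemma mneighbourhoodI:
  assumes "x \<in> mspace m" "a \<in> A" "mdist m x a \<le> r"
  shows "x \<in> mneighbourhood m r A"
  using assms msetdist_le[of x "{x}" a A m r] by (auto simp: mneighbourhood_def)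

text \<open>The radius is weakened twice: by 1 because the infimum need not be attained, and to the
  absolute value because \<open>ennreal\<close> treats a negative radius as 0.\<close>

lemma mneighbourhoodD:
  assumes "x \<in> mneighbourhood m r A"
  obtains a where "x \<in> mspace m" "a \<in> A" "mdist m x a \<le> \<bar>r\<bar> + 1"
proof -
  have "msetdist m {x} A \<le> ennreal r" "x \<in> mspace m"
    using assms by (auto simp: mneighbourhood_def)
  moreover have "r < \<bar>r\<bar> + 1" "0 < \<bar>r\<bar> + 1" by auto
  ultimately obtain y a where "y \<in> {x}" "a \<in> A" "mdist m y a < \<bar>r\<bar> + 1"
    by (metis msetdist_le_obtain)
  then show ?thesis using that \<open>x \<in> mspace m\<close> by auto
qed

lemma coarsely_equalI:
  assumes "A \<subseteq> mspace m" "B \<subseteq> mspace m"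
    "\<And>a. a \<in> A \<Longrightarrow> \<exists>b\<in>B. mdist m a b \<le> r" "\<And>b. b \<in> B \<Longrightarrow> \<exists>a\<in>A. mdist m b a \<le> r"
  shows "coarsely_equal m r A B"
proof -
  have "a \<in> mneighbourhood m r B" if "a \<in> A" for a
    using assms(1) assms(3)[OF that] that mneighbourhoodI by fast
  moreover have "b \<in> mneighbourhood m r A" if "b \<in> B" for b
    using assms(2) assms(4)[OF that] that mneighbourhoodI by fast
  ultimately show ?thesis by (auto simp: coarsely_equal_def)
qed

lemma coarsely_equalD1:
  assumes "coarsely_equal m r A B" "a \<in> A"
  obtains b where "a \<in> mspace m" "b \<in> B" "mdist m a b \<le> \<bar>r\<bar> + 1"
proof (rule mneighbourhoodD)
  show "a \<in> mneighbourhood m r B" using assms by (auto simp: coarsely_equal_def)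
qed

lemma coarsely_equalD2:
  assumes "coarsely_equal m r A B" "b \<in> B"
  obtains a where "b \<in> mspace m" "a \<in> A" "mdist m b a \<le> \<bar>r\<bar> + 1"
proof (rule mneighbourhoodD)
  show "b \<in> mneighbourhood m r A" using assms by (auto simp: coarsely_equal_def)
qed

lemma mdist_self [simp]: "x \<in> mspace m \<Longrightarrow> mdist m x x = 0"
  by simp

lemma mdist_triangle3:
  assumes "x \<in> mspace m" "y \<in> mspace m" "z \<in> mspace m" "w \<in> mspace m"
  shows "mdist m x w \<le> mdist m x y + mdist m y z + mdist m z w"
  using mdist_triangle[of x m y w] mdist_triangle[of y m z w] assms by linarith

text \<open>The middle set must be nonempty, since \<open>all_within\<close> is vacuous for empty
  sets.\<close>

lemma all_within_trans:
  assumes "all_within m r A B" "all_within m s B D" "B \<noteq> {}"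
    "A \<subseteq> mspace m" "B \<subseteq> mspace m" "D \<subseteq> mspace m"
  shows "all_within m (r + s) A D"
proof (rule all_withinI)
  fix a c assume ac: "a \<in> A" "c \<in> D"
  obtain b where b: "b \<in> B" using assms(3) by blast
  have "mdist m a c \<le> mdist m a b + mdist m b c"
    using ac b assms(4-6) by (intro mdist_triangle) auto
  with assms(1,2) ac b show "mdist m a c \<le> r + s"
    unfolding all_within_def by fastforce
qed

text \<open>One almost minimising pair controls all pairs once the diameters \<open>s\<close> and
  \<open>t\<close> are added; the final 1 pays for the infimum. This is the passage from infimal
  distances to distances of arbitrary elements.\<close>

lemma all_within_of_msetdist:
  assumes "msetdist m A B \<le> ennreal r" "0 \<le> r" "A \<subseteq> mspace m" "B \<subseteq> mspace m"
    "\<And>a a'. a \<in> A \<Longrightarrow> a' \<in> A \<Longrightarrow> mdist m a a' \<le> s"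
    "\<And>b b'. b \<in> B \<Longrightarrow> b' \<in> B \<Longrightarrow> mdist m b b' \<le> t"
  shows "all_within m (r + s + t + 1) A B"
proof (rule all_withinI)
  fix a b assume ab: "a \<in> A" "b \<in> B"
  obtain a' b' where *: "a' \<in> A" "b' \<in> B" "mdist m a' b' < r + 1"
    by (rule msetdist_le_obtain[OF assms(1), of "r + 1"]) (use assms(2) in auto)
  have "mdist m a b \<le> mdist m a a' + mdist m a' b' + mdist m b' b"
    using ab * assms(3,4) by (intro mdist_triangle3) auto
  with assms(5)[OF ab(1) *(1)] assms(6)[OF *(2) ab(2)] * show "mdist m a b \<le> r + s + t + 1"
    by linarith
qed

lemma quasigeodesic_space_mono:
  assumes "quasigeodesic_space q m" "1 \<le> q" "q \<le> q'"
  shows "quasigeodesic_space q' m"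
  unfolding quasigeodesic_space_def
proof (intro ballI)
  fix x y assume "x \<in> mspace m" "y \<in> mspace m"
  then obtain c L where c: "0 \<le> L" "c ` {0..L} \<subseteq> mspace m" "c 0 = x" "c L = y"
    "\<forall>s\<in>{0..L}. \<forall>t\<in>{0..L}. \<bar>s - t\<bar> / q - q \<le> mdist m (c s) (c t) \<and> mdist m (c s) (c t) \<le> q * \<bar>s - t\<bar> + q"
    using assms(1) unfolding quasigeodesic_space_def by blast
  have "\<bar>s - t\<bar> / q' - q' \<le> mdist m (c s) (c t) \<and> mdist m (c s) (c t) \<le> q' * \<bar>s - t\<bar> + q'"
    if st: "s \<in> {0..L}" "t \<in> {0..L}" for s t
  proof -
    have "\<bar>s - t\<bar> / q' \<le> \<bar>s - t\<bar> / q" using assms by (simp add: frac_le)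
    moreover have "q * \<bar>s - t\<bar> \<le> q' * \<bar>s - t\<bar>" using assms by (simp add: mult_right_mono)
    ultimately show ?thesis using c(5) st assms(3) by (smt (verit, best))
  qed
  with c show "\<exists>(c :: real \<Rightarrow> 'a) L. 0 \<le> L \<and> c ` {0..L} \<subseteq> mspace m \<and>
        (\<forall>s\<in>{0..L}. \<forall>t\<in>{0..L}. \<bar>s - t\<bar> / q' - q' \<le> mdist m (c s) (c t) \<and>
                                 mdist m (c s) (c t) \<le> q' * \<bar>s - t\<bar> + q') \<and>
        c 0 = x \<and> c L = y" by blast
qed

lemma mneighbourhood_mono: "r \<le> s \<Longrightarrow> mneighbourhood m r A \<subseteq> mneighbourhood m s A"
  by (auto simp: mneighbourhood_def intro: order_trans ennreal_leI)

lemma hyperbolic_space_mono: "hyperbolic_space \<delta> m \<Longrightarrow> \<delta> \<le> \<delta>' \<Longrightarrow> hyperbolic_space \<delta>' m"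
  using mneighbourhood_mono unfolding hyperbolic_space_def by (meson order_trans)

text \<open>A quasigeodesic is cut at unit parameter steps. Each step has length at most
  \<open>2 * q\<close>, so its image moves at most \<open>B\<close>, and the number of steps is
  linear in the distance of the endpoints. A bound at one fixed scale thus gives a coarse Lipschitz
  bound.\<close>

lemma quasigeodesic_bornologous_lipschitz:
  assumes qg: "quasigeodesic_space q m" and q: "1 \<le> q"
    and f: "f \<in> mspace m \<rightarrow> mspace m'"
    and B: "\<And>x y. x \<in> mspace m \<Longrightarrow> y \<in> mspace m \<Longrightarrow> mdist m x y \<le> 2 * q \<Longrightarrow> mdist m' (f x) (f y) \<le> B"
  shows "\<exists>K K'. 0 \<le> K \<and> 0 \<le> K' \<and>
    (\<forall>x\<in>mspace m. \<forall>y\<in>mspace m. mdist m' (f x) (f y) \<le> K * mdist m x y + K')"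
proof -
  define B' where "B' = \<bar>B\<bar>"
  have est: "mdist m' (f x) (f y) \<le> B' * q * mdist m x y + (B' * q * q + B')"
    if xy: "x \<in> mspace m" "y \<in> mspace m" for x y
  proof -
    obtain c L where L: "0 \<le> L" and cm: "c ` {0..L} \<subseteq> mspace m" and c0: "c 0 = x" and cL: "c L = y"
      and c: "\<And>s t. s \<in> {0..L} \<Longrightarrow> t \<in> {0..L} \<Longrightarrow>
         \<bar>s - t\<bar> / q - q \<le> mdist m (c s) (c t) \<and> mdist m (c s) (c t) \<le> q * \<bar>s - t\<bar> + q"
      using qg xy unfolding quasigeodesic_space_def by meson
    have cin: "c t \<in> mspace m" if "t \<in> {0..L}" for t using cm that by auto
    have step: "\<forall>t\<in>{0..L}. t \<le> real n \<longrightarrow> mdist m' (f x) (f (c t)) \<le> B' * real n" for n :: nat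
    proof (induction n)
      case 0
      have "mdist m' (f x) (f x) = 0" using xy f by (simp add: Pi_iff)
      then show ?case using c0 by auto
    next
      case (Suc n)
      show ?case
      proof (intro ballI impI)
        fix t assume t: "t \<in> {0..L}" "t \<le> real (Suc n)"
        define s where "s = max 0 (t - 1)"
        have s: "s \<in> {0..L}" "s \<le> real n" "\<bar>s - t\<bar> \<le> 1" using t by (auto simp: s_def)
        have "mdist m (c s) (c t) \<le> q * \<bar>s - t\<bar> + q" using c s(1) t(1) by blast
        also have "\<dots> \<le> q * 1 + q" using s(3) q by (intro add_right_mono mult_left_mono) auto
        finally have "mdist m' (f (c s)) (f (c t)) \<le> B'"
          using B[of "c s" "c t"] cin s(1) t(1) by (force simp: B'_def)
        moreover have "mdist m' (f x) (f (c s)) \<le> B' * real n" using Suc s by blast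
        moreover have "mdist m' (f x) (f (c t)) \<le> mdist m' (f x) (f (c s)) + mdist m' (f (c s)) (f (c t))"
          using f xy cin s(1) t(1) by (intro mdist_triangle) auto
        ultimately show "mdist m' (f x) (f (c t)) \<le> B' * real (Suc n)" by (simp add: algebra_simps)
      qed
    qed
    define n where "n = nat \<lceil>L\<rceil>"
    have n: "L \<le> real n" "real n \<le> L + 1" using L unfolding n_def by linarith+
    have "L / q - q \<le> mdist m x y" using c[of 0 L] L c0 cL by auto
    then have "L \<le> q * (mdist m x y + q)" using q by (simp add: field_simps)
    then have "real n \<le> q * mdist m x y + q * q + 1" using n by (simp add: algebra_simps)
    then have "B' * real n \<le> B' * (q * mdist m x y + q * q + 1)"
      by (intro mult_left_mono) (auto simp: B'_def)
    moreover have "mdist m' (f x) (f y) \<le> B' * real n" using step n(1) L cL by force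
    ultimately show ?thesis by (simp add: algebra_simps)
  qed
  show ?thesis
    by (intro exI[of _ "B' * q"] exI[of _ "B' * q * q + B'"]) (use est q in \<open>auto simp: B'_def\<close>)
qed

text \<open>Halfway between two near-closest points the geodesic joining them is close to the set,
  and hyperbolicity moves it close to a geodesic issuing from the projected point.\<close>

lemma near_closest_points_close:
  assumes hyp: "hyperbolic_space \<delta> m" and qc: "quasiconvex m k A" and pos: "0 \<le> \<delta>" "0 \<le> k"
    and mem: "p \<in> mspace m" "a1 \<in> A" "a2 \<in> A"
    and near: "\<And>a. a \<in> A \<Longrightarrow> mdist m p a1 \<le> mdist m p a + s"
      "\<And>a. a \<in> A \<Longrightarrow> mdist m p a2 \<le> mdist m p a + s"
  shows "mdist m a1 a2 \<le> 2 * s + 4 * \<delta> + 2 * k + 6"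
proof -
  have A: "A \<subseteq> mspace m" using qc by (simp add: quasiconvex_def)
  then have in_m: "a1 \<in> mspace m" "a2 \<in> mspace m" using mem by auto
  have sym: "geodesic_segment m y x G" if "geodesic_segment m x y G" for x y G
  proof -
    obtain c L where c: "0 \<le> L" "c ` {0..L} \<subseteq> mspace m"
      "\<forall>s\<in>{0..L}. \<forall>t\<in>{0..L}. mdist m (c s) (c t) = \<bar>s - t\<bar>" "c 0 = x" "c L = y" "G = c ` {0..L}"
      using \<open>geodesic_segment m x y G\<close> unfolding geodesic_segment_def by blast
    have "(\<lambda>t. L - t) ` {0..L} = {0..L}" by (auto simp: image_iff intro!: bexI[where x="L - _"])
    then have "(\<lambda>t. c (L - t)) ` {0..L} = c ` {0..L}" by (metis (no_types) image_image)
    then show ?thesis unfolding geodesic_segment_def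
      by (intro exI[of _ "\<lambda>t. c (L - t)"] exI[of _ L]) (use c in auto)
  qed
  obtain G where G: "geodesic_segment m a1 a2 G"
    using hyp in_m unfolding hyperbolic_space_def by blast
  obtain G1 where G1: "geodesic_segment m p a1 G1"
    using hyp in_m mem unfolding hyperbolic_space_def by blast
  obtain G2 where G2: "geodesic_segment m p a2 G2"
    using hyp in_m mem unfolding hyperbolic_space_def by blast
  obtain c L where c: "0 \<le> L" "c ` {0..L} \<subseteq> mspace m"
      "\<And>s t. s\<in>{0..L} \<Longrightarrow> t\<in>{0..L} \<Longrightarrow> mdist m (c s) (c t) = \<bar>s - t\<bar>" "c 0 = a1" "c L = a2" "G = c ` {0..L}"
      using G unfolding geodesic_segment_def by blast
  have L: "mdist m a1 a2 = L" using c(3)[of 0 L] c by auto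
  define mid where "mid = c (L / 2)"
  have mid: "mid \<in> G" "mid \<in> mspace m" "mdist m a1 mid = L / 2" "mdist m mid a2 = L / 2"
    using c(1,2,6) c(3)[of 0 "L/2"] c(3)[of "L/2" L] c(4,5) by (auto simp: mid_def image_subset_iff)
  have "mid \<in> mneighbourhood m k A" using qc mem G mid(1) unfolding quasiconvex_def by blast
  then obtain a where a: "a \<in> A" "mdist m mid a \<le> k + 1" using mneighbourhoodD pos by (metis abs_of_nonneg)
  have main: "mdist m a1 a2 \<le> 2 * s + 4 * \<delta> + 2 * k + 6"
    if b: "b \<in> Gb" "mdist m mid b \<le> \<delta> + 1" and Gb: "geodesic_segment m p ab Gb"
      and ab: "ab \<in> A" "mdist m ab mid = L / 2" and nb: "\<And>a. a \<in> A \<Longrightarrow> mdist m p ab \<le> mdist m p a + s"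
    for b Gb ab
  proof -
    obtain e N where e: "0 \<le> N" "e ` {0..N} \<subseteq> mspace m"
      "\<And>s t. s\<in>{0..N} \<Longrightarrow> t\<in>{0..N} \<Longrightarrow> mdist m (e s) (e t) = \<bar>s - t\<bar>" "e 0 = p" "e N = ab" "Gb = e ` {0..N}"
      using Gb unfolding geodesic_segment_def by blast
    obtain t where t: "t \<in> {0..N}" "b = e t" using b e by auto
    have bm: "b \<in> mspace m" using t e by auto
    have split: "mdist m p ab = mdist m p b + mdist m b ab"
      using e(3)[of 0 N] e(3)[of 0 t] e(3)[of t N] t e by auto
    \<comment> \<open>Both \<open>ab\<close> and \<open>a\<close> are reached through
      \<open>b\<close>, which is near \<open>mid\<close>. From there \<open>a\<close> costs about
      \<open>\<delta> + k\<close>, but \<open>ab\<close> costs about \<open>L / 2\<close>.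
      Near-minimality of \<open>ab\<close> allows a gain of at most \<open>s\<close>, which bounds
      \<open>L\<close>.\<close>
    have "mdist m p a \<le> mdist m p b + mdist m b mid + mdist m mid a"
      using mem bm mid a A by (intro mdist_triangle3) auto
    moreover have "mdist m ab mid \<le> mdist m ab b + mdist m b mid"
      using mem bm mid ab A by (intro mdist_triangle) auto
    ultimately show ?thesis
      using nb[OF a(1)] split ab(2) a(2) b(2) L mdist_commute[of m] by (smt (verit) field_sum_of_halves)
  qed
  have "G \<subseteq> mneighbourhood m \<delta> (G1 \<union> G2)"
    using hyp sym[OF G1] sym[OF G2] G unfolding hyperbolic_space_def by (metis sup_commute)
  then obtain b where b: "b \<in> G1 \<union> G2" "mdist m mid b \<le> \<delta> + 1"
    using mid(1) mneighbourhoodD pos by (metis abs_of_nonneg subsetD)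
  show ?thesis
  proof (cases "b \<in> G1")
    case True
    then show ?thesis using main[OF True b(2) G1 mem(2) mid(3) near(1)] by simp
  next
    case False
    then have "b \<in> G2" using b by auto
    then show ?thesis
      using main[OF _ b(2) G2 mem(3) _ near(2)] mid(4) mdist_commute[of m] by metis
  qed
qed

text \<open>In \<open>2 * s + 1\<close> the 1 is the slack of the definition, and \<open>s\<close>
  is paid twice for exchanging \<open>p\<close> with the point of \<open>A\<close> for which
  \<open>b\<close> is almost closest.\<close>

lemma closest_point_projectionD:
  assumes "b \<in> closest_point_projection m B A" "A \<subseteq> mspace m"  "B \<subseteq> mspace m"
    "\<And>a a'. a \<in> A \<Longrightarrow> a' \<in> A \<Longrightarrow> mdist m a a' \<le> s" "p \<in> A" "b' \<in> B"
  shows "b \<in> B" "mdist m p b \<le> mdist m p b' + (2 * s + 1)"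
proof -
  obtain a where a: "a \<in> A" "ennreal (mdist m a b) \<le> msetdist m {a} B + 1" and b: "b \<in> B"
    using assms(1) unfolding closest_point_projection_def by blast
  show "b \<in> B" by fact
  have "msetdist m {a} B \<le> ennreal (mdist m a b')"
    using assms(6) by (intro msetdist_le) auto
  then have "ennreal (mdist m a b) \<le> ennreal (mdist m a b') + ennreal 1"
    using a(2) by (metis add_right_mono ennreal_1 order_trans)
  also have "\<dots> = ennreal (mdist m a b' + 1)" by (simp add: ennreal_plus)
  finally have "mdist m a b \<le> mdist m a b' + 1" using ennreal_le_iff[of "mdist m a b' + 1" "mdist m a b"]
    by (simp add: add_nonneg_nonneg)
  moreover have "mdist m p b \<le> mdist m p a + mdist m a b"
    using a b assms by (intro mdist_triangle) auto
  moreover have "mdist m a b' \<le> mdist m a p + mdist m p b'"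
    using a assms by (intro mdist_triangle) auto
  ultimately show "mdist m p b \<le> mdist m p b' + (2 * s + 1)"
    using assms(4)[OF a(1) assms(5)] assms(4)[OF assms(5) a(1)] by linarith
qed

lemma closest_point_projection_nonempty:
  assumes "A \<noteq> {}" "B \<noteq> {}"
  shows "closest_point_projection m B A \<noteq> {}"
proof -
  obtain a b0 where a: "a \<in> A" "b0 \<in> B" using assms by auto
  have fin: "msetdist m {a} B < top"
    using msetdist_le[of a "{a}" b0 B m _ , OF _ _ order_refl] a by (simp add: le_less_trans)
  define r where "r = enn2real (msetdist m {a} B)"
  have r: "msetdist m {a} B = ennreal r" "0 \<le> r" using fin by (auto simp: r_def)
  obtain a' b where "a' \<in> {a}" "b \<in> B" "mdist m a' b < r + 1"
    using msetdist_le_obtain[of m "{a}" B r "r + 1"] r by auto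
  then have "ennreal (mdist m a b) \<le> msetdist m {a} B + 1"
    using r by (metis ennreal_1 ennreal_leI ennreal_plus less_eq_real_def singletonD zero_le_one)
  then show ?thesis using a \<open>b \<in> B\<close> unfolding closest_point_projection_def by blast
qed

section \<open>Chains in strict orders\<close>

lemma finite_chain_greatest:
  assumes "finite A" "A \<noteq> {}"
    and "\<And>x y. x \<in> A \<Longrightarrow> y \<in> A \<Longrightarrow> x \<noteq> y \<Longrightarrow> R x y \<or> R y x"
    and "\<And>x y z. x \<in> A \<Longrightarrow> y \<in> A \<Longrightarrow> z \<in> A \<Longrightarrow> R x y \<Longrightarrow> R y z \<Longrightarrow> R x z"
  shows "\<exists>m\<in>A. \<forall>x\<in>A. x \<noteq> m \<longrightarrow> R x m"
  using assms
proof (induction A rule: finite_ne_induct)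
  case (singleton x)
  show ?case by simp
next
  case (insert x F)
  have "\<exists>m\<in>F. \<forall>y\<in>F. y \<noteq> m \<longrightarrow> R y m"
  proof (rule insert.IH)
    show "R u v \<or> R v u" if "u \<in> F" "v \<in> F" "u \<noteq> v" for u v
      using insert.prems(1)[of u v] that by simp
    show "R u w" if "u \<in> F" "v \<in> F" "w \<in> F" "R u v" "R v w" for u v w
      using insert.prems(2)[of u v w] that by simp
  qed
  then obtain m where m: "m \<in> F" "\<And>y. y \<in> F \<Longrightarrow> y \<noteq> m \<Longrightarrow> R y m" by blast
  have "x \<noteq> m" using m insert.hyps by auto
  then consider "R x m" | "R m x" using insert.prems(1)[of x m] m by auto
  then show ?case
  proof cases
    case 1
    then show ?thesis using m by (intro bexI[of _ m]) auto
  next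
    case 2
    have "R y x" if "y \<in> F" for y
      using m(1) m(2)[OF that] 2 insert.prems(2)[of y m x] that by (cases "y = m") auto
    then show ?thesis by (intro bexI[of _ x]) auto
  qed
qed

text \<open>\<open>A\<close> may be infinite. Among the finite chains with first element
  \<open>a\<close> one has maximal size, because sizes are bounded; an element above its greatest
  member would extend it.\<close>

lemma bounded_chains_maximal_above:
  assumes "a \<in> A"
    and irrefl: "\<And>x. x \<in> A \<Longrightarrow> \<not> R x x"
    and trans: "\<And>x y z. x \<in> A \<Longrightarrow> y \<in> A \<Longrightarrow> z \<in> A \<Longrightarrow> R x y \<Longrightarrow> R y z \<Longrightarrow> R x z"
    and bound: "\<And>C. finite C \<Longrightarrow> C \<subseteq> A \<Longrightarrow>
      (\<And>x y. x \<in> C \<Longrightarrow> y \<in> C \<Longrightarrow> x \<noteq> y \<Longrightarrow> R x y \<or> R y x) \<Longrightarrow> card C \<le> n"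
  shows "\<exists>m\<in>A. (m = a \<or> R a m) \<and> (\<forall>z\<in>A. \<not> R m z)"
proof -
  define P where "P C \<longleftrightarrow> finite C \<and> a \<in> C \<and> C \<subseteq> A \<and>
     (\<forall>x\<in>C. \<forall>y\<in>C. x \<noteq> y \<longrightarrow> R x y \<or> R y x) \<and> (\<forall>x\<in>C. x = a \<or> R a x)" for C
  have "P {a}" using assms(1) by (auto simp: P_def)
  moreover have "card C \<le> n" if "P C" for C using that bound by (auto simp: P_def)
  ultimately obtain C where C: "P C" "\<And>D. P D \<Longrightarrow> card D \<le> card C"
    using ex_has_greatest_nat[of P "{a}" card "Suc n"] by (metis less_Suc_eq_le)
  have Cfacts: "finite C" "a \<in> C" "C \<subseteq> A" using C(1) by (auto simp: P_def)
  have "\<exists>m\<in>C. \<forall>x\<in>C. x \<noteq> m \<longrightarrow> R x m"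
  proof (rule finite_chain_greatest)
    show "C \<noteq> {}" using Cfacts by blast
    show "R x y \<or> R y x" if "x \<in> C" "y \<in> C" "x \<noteq> y" for x y
      using C(1) that by (simp add: P_def)
    show "R x z" if "x \<in> C" "y \<in> C" "z \<in> C" "R x y" "R y z" for x y z
      using trans[of x y z] that Cfacts(3) by (simp add: subset_iff)
  qed (rule Cfacts)
  then obtain m where m: "m \<in> C" "\<And>x. x \<in> C \<Longrightarrow> x \<noteq> m \<Longrightarrow> R x m" by blast
  have "\<not> R m z" if z: "z \<in> A" for z
  proof
    assume mz: "R m z"
    have below: "R x z" if "x \<in> C" for x
      using m(1) m(2)[OF that] trans[of x m z] mz z that Cfacts by (cases "x = m") auto
    then have "z \<notin> C" using irrefl z by blast
    moreover have "P (insert z C)"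
      using C(1) z below below[OF Cfacts(2)] unfolding P_def by auto
    ultimately show False using C(2)[of "insert z C"] Cfacts by simp
  qed
  moreover have "m = a \<or> R a m" using m C(1) by (auto simp: P_def)
  ultimately show ?thesis using m Cfacts by blast
qed


section \<open>Hierarchically hyperbolic spaces with a single constant\<close>

definition has_rho :: "('x, 'i, 'h) hhs_data \<Rightarrow> 'i \<Rightarrow> 'i \<Rightarrow> bool" where
  "has_rho H V W \<longleftrightarrow> snest H V W \<or> transverse H V W"

text \<open>The axioms with all constants merged into one and with infimal distances between bounded sets
  replaced by distances between arbitrary elements of these sets.\<close>

locale coarse_hhs =
  fixes H :: "('x, 'i, 'h) hhs_data" and C :: real
  assumes C_ge_1: "1 \<le> C"
    and quasigeodesic: "quasigeodesic_space C (ambient H)"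
    and hyperbolic: "W \<in> index H \<Longrightarrow> hyperbolic_space C (hyp H W)"
    and prj_nonempty: "W \<in> index H \<Longrightarrow> x \<in> points H \<Longrightarrow> prj H W x \<noteq> {}"
    and prj_subset: "W \<in> index H \<Longrightarrow> x \<in> points H \<Longrightarrow> prj H W x \<subseteq> mspace (hyp H W)"
    and prj_diam: "W \<in> index H \<Longrightarrow> x \<in> points H \<Longrightarrow> all_within (hyp H W) C (prj H W x) (prj H W x)"
    and prj_lipschitz: "W \<in> index H \<Longrightarrow> x \<in> points H \<Longrightarrow> y \<in> points H \<Longrightarrow>
      all_within (hyp H W) (C * mdist (ambient H) x y + C) (prj H W x) (prj H W y)"
    and nest_refl: "W \<in> index H \<Longrightarrow> nest H W W"
    and nest_antisym: "V \<in> index H \<Longrightarrow> W \<in> index H \<Longrightarrow> nest H V W \<Longrightarrow> nest H W V \<Longrightarrow> V = W"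
    and nest_trans: "U \<in> index H \<Longrightarrow> V \<in> index H \<Longrightarrow> W \<in> index H \<Longrightarrow>
      nest H U V \<Longrightarrow> nest H V W \<Longrightarrow> nest H U W"
    and top_index: "\<exists>S\<in>index H. \<forall>V\<in>index H. nest H V S"
    and rho_nonempty: "V \<in> index H \<Longrightarrow> W \<in> index H \<Longrightarrow> has_rho H V W \<Longrightarrow> rho_set H V W \<noteq> {}"
    and rho_subset: "V \<in> index H \<Longrightarrow> W \<in> index H \<Longrightarrow> has_rho H V W \<Longrightarrow> rho_set H V W \<subseteq> mspace (hyp H W)"
    and rho_diam: "V \<in> index H \<Longrightarrow> W \<in> index H \<Longrightarrow> has_rho H V W \<Longrightarrow>
      all_within (hyp H W) C (rho_set H V W) (rho_set H V W)"
    and rho_map_nonempty: "V \<in> index H \<Longrightarrow> W \<in> index H \<Longrightarrow> snest H V W \<Longrightarrow>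
      p \<in> mspace (hyp H W) \<Longrightarrow> rho_map H W V p \<noteq> {}"
    and rho_map_subset: "V \<in> index H \<Longrightarrow> W \<in> index H \<Longrightarrow> snest H V W \<Longrightarrow>
      p \<in> mspace (hyp H W) \<Longrightarrow> rho_map H W V p \<subseteq> mspace (hyp H V)"
    and orth_sym: "V \<in> index H \<Longrightarrow> W \<in> index H \<Longrightarrow> orth H V W \<Longrightarrow> orth H W V"
    and orth_irrefl: "V \<in> index H \<Longrightarrow> \<not> orth H V V"
    and orth_nest: "U \<in> index H \<Longrightarrow> V \<in> index H \<Longrightarrow> W \<in> index H \<Longrightarrow>
      nest H V W \<Longrightarrow> orth H W U \<Longrightarrow> orth H V U"
    and container: "Z \<in> index H \<Longrightarrow> U \<in> nested_in H Z \<Longrightarrow> V \<in> nested_in H Z \<Longrightarrow> orth H V U \<Longrightarrow>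
      \<exists>T\<in>nested_in H Z - {Z}. \<forall>V\<in>nested_in H Z. orth H V U \<longrightarrow> nest H V T"
    and nest_not_orth: "V \<in> index H \<Longrightarrow> W \<in> index H \<Longrightarrow> nest H V W \<Longrightarrow> \<not> orth H V W"
    and consistency_transverse: "V \<in> index H \<Longrightarrow> W \<in> index H \<Longrightarrow> x \<in> points H \<Longrightarrow> transverse H V W \<Longrightarrow>
      all_within (hyp H W) C (prj H W x) (rho_set H V W) \<or>
      all_within (hyp H V) C (prj H V x) (rho_set H W V)"
    and consistency_nested: "V \<in> index H \<Longrightarrow> W \<in> index H \<Longrightarrow> x \<in> points H \<Longrightarrow> snest H V W \<Longrightarrow>
      all_within (hyp H W) C (prj H W x) (rho_set H V W) \<or>
      all_within (hyp H V) C (prj H V x) (rho_image H W V (prj H W x))"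
    and rho_consistency: "U \<in> index H \<Longrightarrow> V \<in> index H \<Longrightarrow> W \<in> index H \<Longrightarrow>
      nest H V W \<Longrightarrow> snest H W U \<or> transverse H W U \<and> \<not> orth H U V \<Longrightarrow>
      all_within (hyp H U) C (rho_set H V U) (rho_set H W U)"
    and finite_complexity: "hhs_finite_complexity H"
    and large_links: "W \<in> index H \<Longrightarrow> x \<in> points H \<Longrightarrow> y \<in> points H \<Longrightarrow>
      u \<in> prj H W x \<Longrightarrow> v \<in> prj H W y \<Longrightarrow>
      \<exists>\<T> \<subseteq> nested_in H W - {W}. finite \<T> \<and> real (card \<T>) \<le> C * mdist (hyp H W) u v + C \<and>
        (\<forall>T\<in>nested_in H W - {W}. (\<exists>T'\<in>\<T>. nest H T T') \<or>
           all_within (hyp H T) C (prj H T x) (prj H T y)) \<and>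
        (\<forall>T'\<in>\<T>. all_within (hyp H W) (C * mdist (hyp H W) u v + C) (prj H W x) (rho_set H T' W))"
    and bounded_geodesic_image: "V \<in> index H \<Longrightarrow> W \<in> index H \<Longrightarrow> snest H V W \<Longrightarrow>
      geodesic_segment (hyp H W) u v G \<Longrightarrow>
      all_within (hyp H V) C (rho_image H W V G) (rho_image H W V G) \<or>
      (\<exists>g\<in>G. all_within (hyp H W) C {g} (rho_set H V W))"
    and partial_realization: "\<V> \<subseteq> index H \<Longrightarrow>
      (\<And>V W. V \<in> \<V> \<Longrightarrow> W \<in> \<V> \<Longrightarrow> V \<noteq> W \<Longrightarrow> orth H V W) \<Longrightarrow>
      (\<And>V. V \<in> \<V> \<Longrightarrow> c V \<in> mspace (hyp H V)) \<Longrightarrow>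
      \<exists>x\<in>points H. \<forall>V\<in>\<V>. all_within (hyp H V) C (prj H V x) {c V} \<and>
        (\<forall>U\<in>index H. has_rho H V U \<longrightarrow> all_within (hyp H U) C (prj H U x) (rho_set H V U))"
    and uniqueness: "\<exists>t. \<forall>x\<in>points H. \<forall>y\<in>points H.
      (\<forall>V\<in>index H. \<exists>u\<in>prj H V x. \<exists>v\<in>prj H V y. mdist (hyp H V) u v \<le> k) \<longrightarrow>
      mdist (ambient H) x y \<le> t"
    and coarsely_surjective: "W \<in> index H \<Longrightarrow> u \<in> mspace (hyp H W) \<Longrightarrow>
      \<exists>x\<in>points H. all_within (hyp H W) C {u} (prj H W x)"

lemma transverse_sym:
  assumes "symp_on (index H) (orth H)" "V \<in> index H" "W \<in> index H" "transverse H V W"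
  shows "transverse H W V"
  using assms unfolding transverse_def symp_on_def by blast

lemma exists_nest_maximal_above:
  assumes "hhs_finite_complexity H" "V \<in> A" "A \<subseteq> index H"
    and "transp_on (index H) (nest H)" "antisymp_on (index H) (nest H)" "reflp_on (index H) (nest H)"
  shows "\<exists>m\<in>A. nest H V m \<and> (\<forall>z\<in>A. \<not> snest H m z)"
proof -
  obtain n where n0: "\<forall>\<C>. \<C> \<subseteq> index H \<and> (\<forall>V\<in>\<C>. \<forall>W\<in>\<C>. nest H V W \<or> nest H W V) \<longrightarrow>
      finite \<C> \<and> card \<C> \<le> n"
    using assms(1) unfolding hhs_finite_complexity_def ..
  have n: "card \<C> \<le> n" if "\<C> \<subseteq> index H" "\<forall>V\<in>\<C>. \<forall>W\<in>\<C>. nest H V W \<or> nest H W V" for \<C>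
    using n0[rule_format, of \<C>] that by simp
  have "\<exists>m\<in>A. (m = V \<or> snest H V m) \<and> (\<forall>z\<in>A. \<not> snest H m z)"
  proof (rule bounded_chains_maximal_above)
    show "V \<in> A" by fact
    show "\<not> snest H x x" for x by (simp add: snest_def)
    show "snest H x z" if "x \<in> A" "y \<in> A" "z \<in> A" "snest H x y" "snest H y z" for x y z
    proof -
      have "x \<in> index H" "y \<in> index H" "z \<in> index H" using that assms(3) by auto
      then show ?thesis
        using that assms(4,5) unfolding snest_def transp_on_def antisymp_on_def by blast
    qed
    show "card \<C> \<le> n" if "\<C> \<subseteq> A"
      "\<And>x y. x \<in> \<C> \<Longrightarrow> y \<in> \<C> \<Longrightarrow> x \<noteq> y \<Longrightarrow> snest H x y \<or> snest H y x" for \<C>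
    proof (rule n)
      show "\<C> \<subseteq> index H" using that assms(3) by auto
      show "\<forall>V\<in>\<C>. \<forall>W\<in>\<C>. nest H V W \<or> nest H W V"
      proof (intro ballI)
        fix x y assume "x \<in> \<C>" "y \<in> \<C>"
        then show "nest H x y \<or> nest H y x"
          using that assms(3,6) unfolding snest_def reflp_on_def by (cases "x = y") blast+
      qed
    qed
  qed
  then obtain m where "m \<in> A" "m = V \<or> snest H V m" "\<forall>z\<in>A. \<not> snest H m z" by blast
  moreover have "nest H V V" using assms by (auto simp: reflp_on_def)
  ultimately show ?thesis by (auto simp: snest_def)
qed

text \<open>The index set is nonempty because \<open>coarse_hhs\<close> asks for a greatest
  domain.\<close>

lemma hhs_imp_coarse_hhs:
  assumes "hhs H" "index H \<noteq> {}"
  shows "\<exists>C. coarse_hhs H C"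
proof -
  obtain q where q: "1 \<le> q" "quasigeodesic_space q (ambient H)"
    using assms(1) unfolding hhs_def by meson
  obtain \<delta> where \<delta>: "0 \<le> \<delta>" "\<And>W. W \<in> index H \<Longrightarrow> hyperbolic_space \<delta> (hyp H W)"
    using assms(1) unfolding hhs_def by meson
  obtain \<xi> K \<kappa>0 l E where pos: "0 \<le> \<xi>" "0 \<le> K" "0 \<le> \<kappa>0" "1 \<le> l" "\<xi> \<le> E" "\<kappa>0 \<le> E"
    and prj: "hhs_projections H \<xi> K" and nes: "hhs_nesting H \<xi>"
    and con: "hhs_consistency H \<xi> \<kappa>0" and ll: "hhs_large_links H l E" and bgi: "hhs_bounded_geodesic_image H E"
    using assms(1) unfolding hhs_def max.bounded_iff by meson
  have ort: "hhs_orthogonality H" and fc: "hhs_finite_complexity H" and un: "hhs_uniqueness H"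
    using assms(1) unfolding hhs_def by meson+
  obtain \<alpha> where \<alpha>: "0 \<le> \<alpha>" "hhs_partial_realization H \<alpha>"
    using assms(1) unfolding hhs_def by meson
  obtain s where s: "\<And>W. W \<in> index H \<Longrightarrow> mspace (hyp H W) \<subseteq> mneighbourhood (hyp H W) s (prj_image H W (points H))"
    using assms(1) unfolding hhs_def hhs_coarsely_surjective_def by meson
  \<comment> \<open>The summand \<open>2 * \<xi> + 1\<close> below is the price of
    \<open>all_within_of_msetdist\<close> between sets of diameter at most \<open>\<xi>\<close>; the
    factor 10 makes room for all the listed sums.\<close>
  define C where "C = 10 * (1 + q + \<delta> + \<xi> + K + \<kappa>0 + l + E + \<alpha> + \<bar>s\<bar>)"
  have C: "1 \<le> C" "q \<le> C" "\<delta> \<le> C" "\<xi> \<le> C" "K \<le> C" "l \<le> C"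
    "\<kappa>0 + 2 * \<xi> + 1 \<le> C" "K + 2 * \<xi> + 1 \<le> C" "E + 2 * \<xi> + 1 \<le> C" "l + 2 * \<xi> + 1 \<le> C"
    "\<alpha> + 2 * \<xi> + 1 \<le> C" "\<alpha> + 2 * \<xi> + \<bar>s\<bar> + 2 \<le> C"
    using pos q \<delta> \<alpha> unfolding C_def by simp_all

  have pb: "bounded_piece H \<xi> W (prj H W x)" if "W \<in> index H" "x \<in> points H" for W x
    using prj that unfolding hhs_projections_def by blast
  note pne = bounded_pieceD(1)[OF pb pos(1)]
    and psub = bounded_pieceD(2)[OF pb pos(1)] and pdi = bounded_pieceD(3)[OF pb pos(1)]
  have order: "reflp_on (index H) (nest H)" "antisymp_on (index H) (nest H)" "transp_on (index H) (nest H)"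
    using nes unfolding hhs_nesting_def by blast+
  have sy: "symp_on (index H) (orth H)" using ort unfolding hhs_orthogonality_def by blast
  have orthn: "orth H V U" if "U \<in> index H" "V \<in> index H" "W \<in> index H" "nest H V W" "orth H W U" for U V W
    using ort that unfolding hhs_orthogonality_def by blast
  have nno: "\<not> (nest H V W \<and> orth H V W)" if "V \<in> index H" "W \<in> index H" for V W
    using con that unfolding hhs_consistency_def by blast
  have rb: "bounded_piece H \<xi> W (rho_set H V W)" if "V \<in> index H" "W \<in> index H" "has_rho H V W" for V W
    using nes con that unfolding hhs_nesting_def hhs_consistency_def has_rho_def by blast
  note rne = bounded_pieceD(1)[OF rb pos(1)]
    and rsub = bounded_pieceD(2)[OF rb pos(1)] and rdi = bounded_pieceD(3)[OF rb pos(1)]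
  have rm: "rho_map H W V p \<noteq> {}" "rho_map H W V p \<subseteq> mspace (hyp H V)"
    if "V \<in> index H" "W \<in> index H" "snest H V W" "p \<in> mspace (hyp H W)" for V W p
    using nes that unfolding hhs_nesting_def by blast+
  have pr_aw: "all_within (hyp H W) C (prj H W x) (rho_set H V W)"
    if "V \<in> index H" "W \<in> index H" "x \<in> points H" "has_rho H V W"
      "hdist H W (prj H W x) (rho_set H V W) \<le> ennreal r" "0 \<le> r" "r + 2 * \<xi> + 1 \<le> C" for V W x r
    by (rule all_within_mono[OF all_within_of_msetdist[OF that(5,6) psub[OF that(2,3)] rsub[OF that(1,2,4)]
          pdi[OF that(2,3)] rdi[OF that(1,2,4)]]]) (use that in auto)
  have pp_aw: "all_within (hyp H W) c (prj H W x) (prj H W y)"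
    if "W \<in> index H" "x \<in> points H" "y \<in> points H"
      "hdist H W (prj H W x) (prj H W y) \<le> ennreal r" "0 \<le> r" "r + 2 * \<xi> + 1 \<le> c" for W x y r c
    by (rule all_within_mono[OF all_within_of_msetdist[OF that(4,5) psub[OF that(1,2)] psub[OF that(1,3)]
          pdi[OF that(1,2)] pdi[OF that(1,3)]]]) (use that in auto)
  have tr: "has_rho H V W \<and> has_rho H W V" if "transverse H V W" "V \<in> index H" "W \<in> index H" for V W
    using transverse_sym[OF sy that(2,3,1)] that(1) by (simp add: has_rho_def)
  have "coarse_hhs H C"
  proof unfold_locales
    show "1 \<le> C" by fact
    show "quasigeodesic_space C (ambient H)" using quasigeodesic_space_mono q C by blast
    show "hyperbolic_space C (hyp H W)" if "W \<in> index H" for W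
      using hyperbolic_space_mono \<delta>(2)[OF that] C by blast
    show "prj H W x \<noteq> {}" "prj H W x \<subseteq> mspace (hyp H W)" if "W \<in> index H" "x \<in> points H" for W x
      using pne psub that by blast+
    show "all_within (hyp H W) C (prj H W x) (prj H W x)" if "W \<in> index H" "x \<in> points H" for W x
      using pdi[OF that] C(4) by (meson all_withinI order_trans)
    show "all_within (hyp H W) (C * mdist (ambient H) x y + C) (prj H W x) (prj H W y)"
      if "W \<in> index H" "x \<in> points H" "y \<in> points H" for W x y
    proof (rule pp_aw[OF that])
      show "hdist H W (prj H W x) (prj H W y) \<le> ennreal (K * mdist (ambient H) x y + K)"
        using prj that unfolding hhs_projections_def by blast
      have "K * mdist (ambient H) x y \<le> C * mdist (ambient H) x y"
        using C by (intro mult_right_mono) auto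
      then show "K * mdist (ambient H) x y + K + 2 * \<xi> + 1 \<le> C * mdist (ambient H) x y + C"
        using C by linarith
    qed (use pos in simp)
    show "nest H W W" if "W \<in> index H" for W using order that by (auto simp: reflp_on_def)
    show "V = W" if "V \<in> index H" "W \<in> index H" "nest H V W" "nest H W V" for V W
      using order that unfolding antisymp_on_def by blast
    show "nest H U W" if "U \<in> index H" "V \<in> index H" "W \<in> index H" "nest H U V" "nest H V W" for U V W
      using order that unfolding transp_on_def by blast
    \<comment> \<open>A unique maximal domain is greatest: by finite complexity each
      \<open>V\<close> lies below some maximal domain.\<close>
    show "\<exists>S\<in>index H. \<forall>V\<in>index H. nest H V S"
    proof -
      obtain S where S: "maximal_index H S" "\<And>S'. maximal_index H S' \<Longrightarrow> S' = S"
        using nes assms(2) unfolding hhs_nesting_def by blast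
      have "nest H V S" if "V \<in> index H" for V
      proof -
        obtain m where "m \<in> index H" "nest H V m" "\<forall>z\<in>index H. \<not> snest H m z"
          using exists_nest_maximal_above[OF fc \<open>V \<in> index H\<close> subset_refl order(3,2,1)] by blast
        moreover from this have "m = S" by (intro S(2)) (auto simp: maximal_index_def snest_def)
        ultimately show ?thesis by simp
      qed
      then show ?thesis using S(1) by (auto simp: maximal_index_def)
    qed
    show "rho_set H V W \<noteq> {}" "rho_set H V W \<subseteq> mspace (hyp H W)"
      if "V \<in> index H" "W \<in> index H" "has_rho H V W" for V W
      using rne rsub that by blast+
    show "all_within (hyp H W) C (rho_set H V W) (rho_set H V W)"
      if "V \<in> index H" "W \<in> index H" "has_rho H V W" for V W
      using rdi[OF that] C(4) by (meson all_withinI order_trans)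
    show "rho_map H W V p \<noteq> {}" "rho_map H W V p \<subseteq> mspace (hyp H V)"
      if "V \<in> index H" "W \<in> index H" "snest H V W" "p \<in> mspace (hyp H W)" for V W p
      using rm that by blast+
    show "orth H W V" if "V \<in> index H" "W \<in> index H" "orth H V W" for V W
      using sy that unfolding symp_on_def by blast
    show "\<not> orth H V V" if "V \<in> index H" for V
      using ort that unfolding hhs_orthogonality_def irreflp_on_def by blast
    show "orth H V U" if "U \<in> index H" "V \<in> index H" "W \<in> index H" "nest H V W" "orth H W U" for U V W
      using orthn that by blast
    show "\<exists>T\<in>nested_in H Z - {Z}. \<forall>V\<in>nested_in H Z. orth H V U \<longrightarrow> nest H V T"
      if "Z \<in> index H" "U \<in> nested_in H Z" "V \<in> nested_in H Z" "orth H V U" for Z U V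
      using ort that unfolding hhs_orthogonality_def by blast
    show "\<not> orth H V W" if "V \<in> index H" "W \<in> index H" "nest H V W" for V W
      using nno that by blast
    show "all_within (hyp H W) C (prj H W x) (rho_set H V W) \<or>
      all_within (hyp H V) C (prj H V x) (rho_set H W V)"
      if VW: "V \<in> index H" "W \<in> index H" "x \<in> points H" "transverse H V W" for V W x
    proof -
      have "min (hdist H W (prj H W x) (rho_set H V W)) (hdist H V (prj H V x) (rho_set H W V)) \<le> ennreal \<kappa>0"
        using con VW unfolding hhs_consistency_def by blast
      then show ?thesis
        using pr_aw[of V W x \<kappa>0] pr_aw[of W V x \<kappa>0] VW tr C pos by (auto simp: min_le_iff_disj)
    qed
    show "all_within (hyp H W) C (prj H W x) (rho_set H V W) \<or>
      all_within (hyp H V) C (prj H V x) (rho_image H W V (prj H W x))"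
      if VW: "V \<in> index H" "W \<in> index H" "x \<in> points H" "snest H V W" for V W x
    proof -
      have "min (hdist H W (prj H W x) (rho_set H V W))
        (hdiam H V (prj H V x \<union> rho_image H W V (prj H W x))) \<le> ennreal \<kappa>0"
        using con VW unfolding hhs_consistency_def by blast
      moreover have "all_within (hyp H V) C (prj H V x) (rho_image H W V (prj H W x))"
        if "hdiam H V (prj H V x \<union> rho_image H W V (prj H W x)) \<le> ennreal \<kappa>0"
        using mdiam_leD[OF that _ _ pos(3)] C(7) pos by (intro all_withinI) (smt (verit) UnI1 UnI2)
      ultimately show ?thesis
        using pr_aw[of V W x \<kappa>0] VW C pos by (auto simp: min_le_iff_disj has_rho_def)
    qed
    show "all_within (hyp H U) C (rho_set H V U) (rho_set H W U)"
      if UVW: "U \<in> index H" "V \<in> index H" "W \<in> index H" "nest H V W"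
        "snest H W U \<or> transverse H W U \<and> \<not> orth H U V" for U V W
    proof -
      have d: "hdist H U (rho_set H V U) (rho_set H W U) \<le> ennreal \<kappa>0"
        using con UVW unfolding hhs_consistency_def by blast
      have 1: "has_rho H W U" using UVW by (auto simp: has_rho_def)
      \<comment> \<open>A bound on all pairs requires that both rho sets are bounded pieces; for
        \<open>V\<close> this means excluding \<open>orth H V U\<close> and
        \<open>nest H U V\<close>.\<close>
      have VU: "\<not> orth H V U" using UVW(5)
      proof
        assume "snest H W U"
        then have "nest H V U"
          using order(3) UVW unfolding snest_def transp_on_def by blast
        then show ?thesis using nno UVW by blast
      next
        assume "transverse H W U \<and> \<not> orth H U V"
        then show ?thesis using sy UVW unfolding symp_on_def by blast
      qed
      have UV: "\<not> nest H U V"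
      proof
        assume "nest H U V"
        then have "nest H U W" using order(3) UVW unfolding transp_on_def by blast
        then show False using UVW order(2) unfolding snest_def transverse_def antisymp_on_def by blast
      qed
      have "V \<noteq> U" using UV order(1) UVW by (auto simp: reflp_on_def)
      with VU UV have 2: "has_rho H V U" by (auto simp: has_rho_def snest_def transverse_def)
      show ?thesis
        by (rule all_within_mono[OF all_within_of_msetdist[OF d pos(3) rsub[OF UVW(2,1) 2] rsub[OF UVW(3,1) 1]
          rdi[OF UVW(2,1) 2] rdi[OF UVW(3,1) 1]]]) (use C in auto)
    qed
    show "hhs_finite_complexity H" by fact
    show "\<exists>\<T> \<subseteq> nested_in H W - {W}. finite \<T> \<and> real (card \<T>) \<le> C * mdist (hyp H W) u v + C \<and>
        (\<forall>T\<in>nested_in H W - {W}. (\<exists>T'\<in>\<T>. nest H T T') \<or>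
           all_within (hyp H T) C (prj H T x) (prj H T y)) \<and>
        (\<forall>T'\<in>\<T>. all_within (hyp H W) (C * mdist (hyp H W) u v + C) (prj H W x) (rho_set H T' W))"
      if W: "W \<in> index H" "x \<in> points H" "y \<in> points H" "u \<in> prj H W x" "v \<in> prj H W y" for W x y u v
    proof -
      define N where "N = l * enn2real (hdist H W (prj H W x) (prj H W y)) + l"
      obtain \<T> where T: "\<T> \<subseteq> nested_in H W - {W}" "finite \<T>" "int (card \<T>) \<le> \<lfloor>N\<rfloor>"
         "\<And>T. T \<in> nested_in H W - {W} \<Longrightarrow> (\<exists>T'\<in>\<T>. T \<in> nested_in H T') \<or>
           hdist H T (prj H T x) (prj H T y) < ennreal E"
        "\<And>T'. T' \<in> \<T> \<Longrightarrow> hdist H W (prj H W x) (rho_set H T' W) \<le> ennreal N"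
        using ll W(1-3) N_def unfolding hhs_large_links_def by metis
      have "l * enn2real (hdist H W (prj H W x) (prj H W y)) \<le> l * mdist (hyp H W) u v"
        using enn2real_msetdist_le[OF W(4,5)] pos by (intro mult_left_mono) auto
      moreover have "l * mdist (hyp H W) u v \<le> C * mdist (hyp H W) u v"
        using C by (intro mult_right_mono) auto
      ultimately have N: "N + 2 * \<xi> + 1 \<le> C * mdist (hyp H W) u v + C" unfolding N_def using C by linarith
      have N0: "0 \<le> N" unfolding N_def using pos by simp
      show ?thesis
      proof (intro exI[of _ \<T>] conjI ballI)
        show "real (card \<T>) \<le> C * mdist (hyp H W) u v + C"
          using T(3) N pos by linarith
        fix T assume T': "T \<in> nested_in H W - {W}"
        have "T \<in> index H" using T' by (auto simp: nested_in_def)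
        have "E + 2 * \<xi> + 1 \<le> C" by fact
        with T(4)[OF T'] pp_aw[OF \<open>T \<in> index H\<close> W(2,3), of E C]
        show "(\<exists>T'\<in>\<T>. nest H T T') \<or> all_within (hyp H T) C (prj H T x) (prj H T y)"
          using pos by (auto simp: nested_in_def intro: less_imp_le)
      next
        fix T' assume T': "T' \<in> \<T>"
        then have "has_rho H T' W" "T' \<in> index H" using T(1) by (auto simp: has_rho_def snest_def nested_in_def)
        then show "all_within (hyp H W) (C * mdist (hyp H W) u v + C) (prj H W x) (rho_set H T' W)"
          using N
          by (intro all_within_mono[OF all_within_of_msetdist[OF T(5)[OF T'] N0 psub[OF W(1,2)] rsub[of T' W]
                pdi[OF W(1,2)] rdi[of T' W]]]) (use W in auto)
      qed (use T in auto)
    qed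
    show "all_within (hyp H V) C (rho_image H W V G) (rho_image H W V G) \<or>
      (\<exists>g\<in>G. all_within (hyp H W) C {g} (rho_set H V W))"
      if VW: "V \<in> index H" "W \<in> index H" "snest H V W" "geodesic_segment (hyp H W) p q' G" for V W p q' G
    proof -
      have E0: "0 \<le> E" using pos by linarith
      have hr: "has_rho H V W" using VW by (auto simp: has_rho_def)
      consider "hdiam H V (rho_image H W V G) \<le> ennreal E"
        | g where "g \<in> G" "g \<in> mneighbourhood (hyp H W) E (rho_set H V W)"
        using bgi VW unfolding hhs_bounded_geodesic_image_def by blast
      then show ?thesis
      proof cases
        case 1
        have "all_within (hyp H V) C (rho_image H W V G) (rho_image H W V G)"
          using mdiam_leD[OF 1 _ _ E0] C(9) pos by (intro all_withinI) (smt (verit))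
        then show ?thesis by blast
      next
        case 2
        obtain r where r: "g \<in> mspace (hyp H W)" "r \<in> rho_set H V W" "mdist (hyp H W) g r \<le> \<bar>E\<bar> + 1"
          using mneighbourhoodD[OF 2(2)] by blast
        have "all_within (hyp H W) C {g} (rho_set H V W)"
        proof (rule all_withinI)
          fix a b assume "a \<in> {g}" "b \<in> rho_set H V W"
          moreover have "mdist (hyp H W) g b \<le> mdist (hyp H W) g r + mdist (hyp H W) r b"
            using r rsub[OF VW(1,2) hr] calculation by (intro mdist_triangle) auto
          ultimately show "mdist (hyp H W) a b \<le> C"
            using rdi[OF VW(1,2) hr r(2), of b] r(3) E0 C(9) pos(1) by auto
        qed
        then show ?thesis using 2 by blast
      qed
    qed
    show "\<exists>x\<in>points H. \<forall>V\<in>\<V>. all_within (hyp H V) C (prj H V x) {p V} \<and>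
        (\<forall>U\<in>index H. has_rho H V U \<longrightarrow> all_within (hyp H U) C (prj H U x) (rho_set H V U))"
      if V: "\<V> \<subseteq> index H" "\<And>V W. V \<in> \<V> \<Longrightarrow> W \<in> \<V> \<Longrightarrow> V \<noteq> W \<Longrightarrow> orth H V W"
        "\<And>V. V \<in> \<V> \<Longrightarrow> p V \<in> mspace (hyp H V)" for \<V> p
    proof -
      \<comment> \<open>The axiom accepts only targets in the projected image; coarse surjectivity
        replaces the arbitrary \<open>p V\<close> by a nearby point of that kind.\<close>
      have "\<exists>p'. p' \<in> prj_image H V (points H) \<and> mdist (hyp H V) (p V) p' \<le> \<bar>s\<bar> + 1" if "V \<in> \<V>" for V
      proof -
        have "p V \<in> mneighbourhood (hyp H V) s (prj_image H V (points H))" using s V that by blast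
        then show ?thesis by (rule mneighbourhoodD) blast
      qed
      then obtain p' where p': "\<And>V. V \<in> \<V> \<Longrightarrow> p' V \<in> prj_image H V (points H)"
        "\<And>V. V \<in> \<V> \<Longrightarrow> mdist (hyp H V) (p V) (p' V) \<le> \<bar>s\<bar> + 1" by metis
      have p'_in: "p' V \<in> mspace (hyp H V)" if "V \<in> \<V>" for V
        using p'(1)[OF that] psub V that unfolding prj_image_def by blast
      have "\<exists>x\<in>points H. \<forall>V\<in>\<V>. hdist H V (prj H V x) {p' V} \<le> ennreal \<alpha> \<and>
        (\<forall>U\<in>index H. snest H V U \<or> transverse H U V \<longrightarrow> hdist H U (prj H U x) (rho_set H V U) \<le> ennreal \<alpha>)"
      proof (rule \<alpha>(2)[unfolded hhs_partial_realization_def, rule_format], intro conjI ballI impI)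
        show "\<V> \<subseteq> index H" by (rule V)
        show "orth H V W" if "V \<in> \<V>" "W \<in> \<V>" "V \<noteq> W" for V W using V(2) that .
      qed (rule p')
      then obtain x where x: "x \<in> points H" "\<And>V. V \<in> \<V> \<Longrightarrow> hdist H V (prj H V x) {p' V} \<le> ennreal \<alpha>"
        "\<And>V U. V \<in> \<V> \<Longrightarrow> U \<in> index H \<Longrightarrow> snest H V U \<or> transverse H U V \<Longrightarrow>
           hdist H U (prj H U x) (rho_set H V U) \<le> ennreal \<alpha>"
        by blast
      show ?thesis
      proof (intro bexI[of _ x] ballI conjI impI)
        fix V assume VV: "V \<in> \<V>"
        have Vi: "V \<in> index H" using V VV by blast
        have "all_within (hyp H V) (\<alpha> + \<xi> + 0 + 1) (prj H V x) {p' V}"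
          using x(1) x(2)[OF VV] \<alpha> psub pdi Vi p'_in[OF VV] by (intro all_within_of_msetdist) auto
        moreover have "all_within (hyp H V) (\<bar>s\<bar> + 1) {p' V} {p V}"
          using p'(2)[OF VV] by (simp add: all_within_def mdist_commute)
        ultimately have "all_within (hyp H V) (\<alpha> + \<xi> + 0 + 1 + (\<bar>s\<bar> + 1)) (prj H V x) {p V}"
          by (rule all_within_trans) (use psub x Vi p'_in[OF VV] V(3)[OF VV] in auto)
        then show "all_within (hyp H V) C (prj H V x) {p V}"
          using C pos by (elim all_within_mono) linarith
        fix U assume U: "U \<in> index H" "has_rho H V U"
        then have "hdist H U (prj H U x) (rho_set H V U) \<le> ennreal \<alpha>"
          using x(3)[OF VV U(1)] transverse_sym[OF sy Vi U(1)] by (auto simp: has_rho_def)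
        then show "all_within (hyp H U) C (prj H U x) (rho_set H V U)"
          using pr_aw[of V U x \<alpha>] U Vi x(1) \<alpha> C by blast
      qed (use x in auto)
    qed
    show "\<exists>t. \<forall>x\<in>points H. \<forall>y\<in>points H.
      (\<forall>V\<in>index H. \<exists>u\<in>prj H V x. \<exists>v\<in>prj H V y. mdist (hyp H V) u v \<le> k) \<longrightarrow>
      mdist (ambient H) x y \<le> t" for k
    proof -
      obtain \<theta> where \<theta>: "\<And>\<kappa> x y. 0 \<le> \<kappa> \<Longrightarrow> x \<in> points H \<Longrightarrow> y \<in> points H \<Longrightarrow> mdist (ambient H) x y \<ge> \<theta> \<kappa> \<Longrightarrow>
          \<exists>V\<in>index H. hdist H V (prj H V x) (prj H V y) \<ge> ennreal \<kappa>"
        using un unfolding hhs_uniqueness_def by meson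
      \<comment> \<open>Uniqueness is applied at a nonnegative threshold strictly above
        \<open>k\<close>.\<close>
      define k' where "k' = \<bar>k\<bar> + 1"
      have "mdist (ambient H) x y \<le> \<theta> k'"
        if xy: "x \<in> points H" "y \<in> points H"
          "\<forall>V\<in>index H. \<exists>u\<in>prj H V x. \<exists>v\<in>prj H V y. mdist (hyp H V) u v \<le> k" for x y
      proof (rule ccontr)
        assume "\<not> mdist (ambient H) x y \<le> \<theta> k'"
        then obtain V where V: "V \<in> index H" "hdist H V (prj H V x) (prj H V y) \<ge> ennreal k'"
          using \<theta>[of k' x y] xy by (auto simp: k'_def)
        obtain u v where uv: "u \<in> prj H V x" "v \<in> prj H V y" "mdist (hyp H V) u v \<le> k"
          using xy(3) V(1) by blast
        have "ennreal k' \<le> ennreal (mdist (hyp H V) u v)"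
          using V(2) msetdist_le[OF uv(1,2) order_refl] by (meson order_trans)
        then have "k' \<le> mdist (hyp H V) u v" using ennreal_le_iff[of "mdist (hyp H V) u v" k'] by simp
        then show False using uv by (simp add: k'_def)
      qed
      then show ?thesis by blast
    qed
    show "\<exists>x\<in>points H. all_within (hyp H W) C {u} (prj H W x)"
      if W: "W \<in> index H" "u \<in> mspace (hyp H W)" for W u
    proof -
      have "u \<in> mneighbourhood (hyp H W) s (prj_image H W (points H))" using s W by blast
      then obtain v where v: "v \<in> prj_image H W (points H)" "mdist (hyp H W) u v \<le> \<bar>s\<bar> + 1"
        by (rule mneighbourhoodD)
      then obtain x where x: "x \<in> points H" "v \<in> prj H W x" by (auto simp: prj_image_def)
      have "mdist (hyp H W) u v' \<le> C" if "v' \<in> prj H W x" for v'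
      proof -
        have "mdist (hyp H W) u v' \<le> mdist (hyp H W) u v + mdist (hyp H W) v v'"
          using W x that psub by (intro mdist_triangle) auto
        then show ?thesis using v pdi[OF W(1) x that] C pos \<alpha> by linarith
      qed
      then show ?thesis using x by (auto simp: all_within_def)
    qed
  qed
  then show ?thesis by blast
qed

text \<open>This direction lets the transported structure be verified in pointwise form. Some
  constants grow: the diameter of a union is bounded through a common point, and large links must
  undo the difference between an infimum and a chosen pair.\<close>

lemma coarse_hhs_imp_hhs:
  assumes "coarse_hhs H C"
  shows "hhs H"
proof -
  interpret coarse_hhs H C by fact
  have bp: "bounded_piece H C W (prj H W x)" if "W \<in> index H" "x \<in> points H" for W x
    using prj_nonempty prj_subset prj_diam that by (intro bounded_pieceI) (auto simp: all_within_def)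
  have br: "bounded_piece H C W (rho_set H V W)" if "V \<in> index H" "W \<in> index H" "has_rho H V W" for V W
    using rho_nonempty rho_subset rho_diam that by (intro bounded_pieceI) (auto simp: all_within_def)
  have aw: "msetdist m A B \<le> ennreal r" if "all_within m r A B" "A \<noteq> {}" "B \<noteq> {}" for m :: "'c metric" and r A B
    using that unfolding all_within_def by (meson ex_in_conv msetdist_le)
  have tr: "transverse H W V" if "transverse H V W" "V \<in> index H" "W \<in> index H" for V W
    using that orth_sym unfolding transverse_def by blast
  have "hhs_projections H C C"
    unfolding hhs_projections_def quasiconvex_def
  proof (intro ballI conjI allI impI subsetI)
    fix W x assume W: "W \<in> index H" and x: "x \<in> points H"
    show "bounded_piece H C W (prj H W x)" using bp W x .
    fix y assume y: "y \<in> points H"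
    show "hdist H W (prj H W x) (prj H W y) \<le> ennreal (C * mdist (ambient H) x y + C)"
      using aw[OF prj_lipschitz[OF W x y]] prj_nonempty W x y by auto
  next
    fix W x assume "W \<in> index H" "x \<in> prj_image H W (points H)"
    then show "x \<in> mspace (hyp H W)" using prj_subset by (auto simp: prj_image_def)
  next
    fix W x y G g
    assume W: "W \<in> index H" and G: "geodesic_segment (hyp H W) x y G" "g \<in> G"
    have g: "g \<in> mspace (hyp H W)" using G unfolding geodesic_segment_def by auto
    \<comment> \<open>Coarse surjectivity puts every point of the hyperbolic space near the image,
      so quasiconvexity of the image is immediate.\<close>
    obtain z where z: "z \<in> points H" "all_within (hyp H W) C {g} (prj H W z)"
      using coarsely_surjective[OF W g] by blast
    obtain v where v: "v \<in> prj H W z" using prj_nonempty[OF W z(1)] by blast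
    show "g \<in> mneighbourhood (hyp H W) C (prj_image H W (points H))"
      using g v z by (intro mneighbourhoodI[of _ _ v]) (auto simp: prj_image_def all_within_def)
  qed
  moreover have "hhs_nesting H C"
  proof -
    obtain S where S: "S \<in> index H" "\<And>V. V \<in> index H \<Longrightarrow> nest H V S" using top_index by blast
    have "\<exists>!S. maximal_index H S"
      using S nest_antisym unfolding maximal_index_def by metis
    moreover have "reflp_on (index H) (nest H)" using nest_refl by (auto simp: reflp_on_def)
    moreover have "antisymp_on (index H) (nest H)" using nest_antisym by (auto simp: antisymp_on_def)
    moreover have "transp_on (index H) (nest H)" using nest_trans unfolding transp_on_def by blast
    ultimately show ?thesis unfolding hhs_nesting_def
      using br rho_map_nonempty rho_map_subset by (auto simp: has_rho_def)
  qed
  moreover have "hhs_orthogonality H"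
    unfolding hhs_orthogonality_def
  proof (intro conjI ballI impI)
    show "symp_on (index H) (orth H)" using orth_sym by (auto simp: symp_on_def)
    show "irreflp_on (index H) (orth H)" using orth_irrefl by (auto simp: irreflp_on_def)
    show "orth H V U" if "U \<in> index H" "V \<in> index H" "W \<in> index H" "nest H V W \<and> orth H W U" for U V W
      using orth_nest that by blast
    show "\<exists>T\<in>nested_in H Z - {Z}. \<forall>V\<in>nested_in H Z. orth H V U \<longrightarrow> nest H V T"
      if "Z \<in> index H" "U \<in> nested_in H Z" "\<exists>V\<in>nested_in H Z. orth H V U" for Z U
      using container that by blast
  qed
  moreover have "hhs_consistency H C (3 * C)"
    unfolding hhs_consistency_def
  proof (intro conjI ballI impI)
    fix V W assume VW: "V \<in> index H" "W \<in> index H"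
    show "\<not> (nest H V W \<and> orth H V W)" using nest_not_orth VW by blast
    show "bounded_piece H C W (rho_set H V W)" if "transverse H V W" using br VW that by (auto simp: has_rho_def)
    show "bounded_piece H C V (rho_set H W V)" if "transverse H V W" using br VW that tr by (auto simp: has_rho_def)
    fix x assume x: "x \<in> points H"
    have mono: "all_within (hyp H W) (3 * C) A B" if "all_within (hyp H W) C A B" for W A B
      using all_within_mono[OF that] C_ge_1 by simp
    show "min (hdist H W (prj H W x) (rho_set H V W)) (hdist H V (prj H V x) (rho_set H W V)) \<le> ennreal (3 * C)"
      if t: "transverse H V W"
    proof -
      have "rho_set H V W \<noteq> {}" "rho_set H W V \<noteq> {}"
        using rho_nonempty VW t tr by (auto simp: has_rho_def)
      with consistency_transverse[OF VW x t] show ?thesis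
        using aw[OF mono, of W "prj H W x" "rho_set H V W"] aw[OF mono, of V "prj H V x" "rho_set H W V"]
          prj_nonempty[OF _ x] VW unfolding min_le_iff_disj by blast
    qed
    show "min (hdist H W (prj H W x) (rho_set H V W))
              (hdiam H V (prj H V x \<union> rho_image H W V (prj H W x))) \<le> ennreal (3 * C)"
      if s: "snest H V W"
    proof -
      have ne: "rho_set H V W \<noteq> {}" using rho_nonempty VW s by (auto simp: has_rho_def)
      have im: "rho_image H W V (prj H W x) \<subseteq> mspace (hyp H V)"
        using rho_map_subset[OF VW s] prj_subset[OF VW(2) x] unfolding rho_image_def by blast
      have "hdiam H V (prj H V x \<union> rho_image H W V (prj H W x)) \<le> ennreal (3 * C)"
        if c: "all_within (hyp H V) C (prj H V x) (rho_image H W V (prj H W x))"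
      proof (rule mdiam_leI)
        fix a b assume ab: "a \<in> prj H V x \<union> rho_image H W V (prj H W x)" "b \<in> prj H V x \<union> rho_image H W V (prj H W x)"
        obtain p where p: "p \<in> prj H V x" using prj_nonempty VW x by blast
        have pc: "mdist (hyp H V) p c \<le> C" if "c \<in> prj H V x \<union> rho_image H W V (prj H W x)" for c
          using p that c prj_diam[OF VW(1) x] unfolding all_within_def by blast
        have "mdist (hyp H V) a b \<le> mdist (hyp H V) a p + mdist (hyp H V) p b"
          using ab p im prj_subset[OF VW(1) x] by (intro mdist_triangle) auto
        then show "mdist (hyp H V) a b \<le> 3 * C"
          using pc[OF ab(1)] pc[OF ab(2)] mdist_commute[of "hyp H V" a p] C_ge_1 by linarith
      qed
      with consistency_nested[OF VW x s] show ?thesis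
        using aw[OF mono, of W "prj H W x" "rho_set H V W"] ne prj_nonempty[OF VW(2) x]
        unfolding min_le_iff_disj by blast
    qed
  next
    fix U V W assume UVW: "U \<in> index H" "V \<in> index H" "W \<in> index H"
      and n: "nest H V W \<and> (snest H W U \<or> transverse H W U \<and> \<not> orth H U V)"
    have 1: "all_within (hyp H U) (3 * C) (rho_set H V U) (rho_set H W U)"
      using all_within_mono[OF rho_consistency[OF UVW], of "3 * C"] n C_ge_1 by auto
    have "nest H V U" if "snest H W U" using nest_trans UVW n that unfolding snest_def by blast
    moreover have "\<not> nest H U V"
      using nest_trans[OF UVW] nest_antisym[OF UVW(3,1)] n unfolding snest_def transverse_def by blast
    moreover have "V \<noteq> U" using calculation nest_refl UVW by blast
    moreover have "\<not> orth H V U"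
      using n calculation(1) nest_not_orth[OF UVW(2,1)] orth_sym[OF UVW(2,1)] by blast
    ultimately have "has_rho H V U" by (auto simp: has_rho_def snest_def transverse_def)
    moreover have "has_rho H W U" using n by (auto simp: has_rho_def)
    ultimately show "hdist H U (rho_set H V U) (rho_set H W U) \<le> ennreal (3 * C)"
      using aw[OF 1] rho_nonempty UVW by blast
  qed
  \<comment> \<open>A chosen pair exceeds the infimal distance \<open>h\<close> by at most
    \<open>2 * C\<close>, and \<open>C * (h + 2 * C) + C\<close> is at most
    \<open>C * (2 * C + 2) * (h + 1)\<close>. The strict inequality in the axiom forces the second
    constant above \<open>C\<close>.\<close>
  moreover have "hhs_large_links H (C * (2 * C + 2)) (3 * C)"
    unfolding hhs_large_links_def
  proof (intro ballI allI impI)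
    fix W x y N assume W: "W \<in> index H" and x: "x \<in> points H" and y: "y \<in> points H"
      and N: "N = C * (2 * C + 2) * enn2real (hdist H W (prj H W x) (prj H W y)) + C * (2 * C + 2)"
    define h where "h = enn2real (hdist H W (prj H W x) (prj H W y))"
    obtain u v where uv: "u \<in> prj H W x" "v \<in> prj H W y" using prj_nonempty[OF W] x y by blast
    have "mdist (hyp H W) u v - 2 * C \<le> mdist (hyp H W) a b" if ab: "a \<in> prj H W x" "b \<in> prj H W y" for a b
    proof -
      have "mdist (hyp H W) u v \<le> mdist (hyp H W) u a + mdist (hyp H W) a b + mdist (hyp H W) b v"
        using uv ab prj_subset[OF W] x y by (intro mdist_triangle3) auto
      moreover have "mdist (hyp H W) u a \<le> C" "mdist (hyp H W) b v \<le> C"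
        using prj_diam[OF W] x y uv ab unfolding all_within_def by blast+
      ultimately show ?thesis by linarith
    qed
    then have "mdist (hyp H W) u v - 2 * C \<le> h"
      unfolding h_def using prj_nonempty[OF W] x y by (intro enn2real_msetdist_ge) auto
    then have "C * mdist (hyp H W) u v \<le> C * (h + 2 * C)" using C_ge_1 by (intro mult_left_mono) auto
    moreover have "C * (h + 2 * C) + C \<le> C * (2 * C + 2) * h + C * (2 * C + 2)"
    proof -
      have "0 \<le> h" by (simp add: h_def)
      then have "C * h * 1 \<le> C * h * (2 * C + 2)" using C_ge_1 by (intro mult_left_mono) auto
      then show ?thesis using C_ge_1 by (simp add: algebra_simps)
    qed
    ultimately have le: "C * mdist (hyp H W) u v + C \<le> N" unfolding N h_def by linarith
    obtain \<T> where T: "\<T> \<subseteq> nested_in H W - {W}" "finite \<T>" "real (card \<T>) \<le> C * mdist (hyp H W) u v + C"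
        "\<And>T. T\<in>nested_in H W - {W} \<Longrightarrow> (\<exists>T'\<in>\<T>. nest H T T') \<or>
           all_within (hyp H T) C (prj H T x) (prj H T y)"
        "\<And>T'. T'\<in>\<T> \<Longrightarrow> all_within (hyp H W) (C * mdist (hyp H W) u v + C) (prj H W x) (rho_set H T' W)"
      using large_links[OF W x y uv] by blast
    show "\<exists>\<T> \<subseteq> nested_in H W - {W}. finite \<T> \<and> int (card \<T>) \<le> \<lfloor>N\<rfloor> \<and>
        (\<forall>T\<in>nested_in H W - {W}. (\<exists>T'\<in>\<T>. T \<in> nested_in H T') \<or>
           hdist H T (prj H T x) (prj H T y) < ennreal (3 * C)) \<and>
        (\<forall>T'\<in>\<T>. hdist H W (prj H W x) (rho_set H T' W) \<le> ennreal N)"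
    proof (intro exI[of _ \<T>] conjI ballI)
      show "int (card \<T>) \<le> \<lfloor>N\<rfloor>" using T(3) le by (simp add: le_floor_iff)
      fix T assume T': "T \<in> nested_in H W - {W}"
      then have Ti: "T \<in> index H" by (auto simp: nested_in_def)
      have "hdist H T (prj H T x) (prj H T y) < ennreal (3 * C)"
        if "all_within (hyp H T) C (prj H T x) (prj H T y)"
      proof -
        have "hdist H T (prj H T x) (prj H T y) \<le> ennreal C"
          using aw[OF that] prj_nonempty[OF Ti] x y by blast
        also have "\<dots> < ennreal (3 * C)" using C_ge_1 by (intro ennreal_lessI) auto
        finally show ?thesis .
      qed
      then show "(\<exists>T'\<in>\<T>. T \<in> nested_in H T') \<or> hdist H T (prj H T x) (prj H T y) < ennreal (3 * C)"
        using T(4)[OF T'] Ti by (auto simp: nested_in_def)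
    next
      fix T' assume T': "T' \<in> \<T>"
      then have "has_rho H T' W" "T' \<in> index H" using T(1) by (auto simp: has_rho_def snest_def nested_in_def)
      then have "rho_set H T' W \<noteq> {}" using rho_nonempty W by blast
      then show "hdist H W (prj H W x) (rho_set H T' W) \<le> ennreal N"
        using aw[OF all_within_mono[OF T(5)[OF T'] le]] prj_nonempty[OF W x] by blast
    qed (use T in auto)
  qed
  moreover have "hhs_bounded_geodesic_image H (3 * C)"
    unfolding hhs_bounded_geodesic_image_def
  proof (intro ballI allI impI)
    fix V W p q G assume VW: "V \<in> index H" "W \<in> index H" "snest H V W" and G: "geodesic_segment (hyp H W) p q G"
    have C3: "C \<le> 3 * C" using C_ge_1 by simp
    from bounded_geodesic_image[OF VW G]
    show "hdiam H V (rho_image H W V G) \<le> ennreal (3 * C) \<or>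
        G \<inter> mneighbourhood (hyp H W) (3 * C) (rho_set H V W) \<noteq> {}"
    proof
      assume "all_within (hyp H V) C (rho_image H W V G) (rho_image H W V G)"
      then have "hdiam H V (rho_image H W V G) \<le> ennreal (3 * C)"
        using C3 by (intro mdiam_leI) (meson all_withinD order_trans)
      then show ?thesis ..
    next
      assume "\<exists>g\<in>G. all_within (hyp H W) C {g} (rho_set H V W)"
      then obtain g where g: "g \<in> G" "all_within (hyp H W) C {g} (rho_set H V W)" by blast
      obtain r where r: "r \<in> rho_set H V W" using rho_nonempty VW by (auto simp: has_rho_def)
      have "mdist (hyp H W) g r \<le> 3 * C" using g r C3 by (meson all_withinD order_trans singletonI)
      moreover have "g \<in> mspace (hyp H W)" using G g unfolding geodesic_segment_def by auto
      ultimately have "g \<in> mneighbourhood (hyp H W) (3 * C) (rho_set H V W)"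
        using r by (intro mneighbourhoodI) auto
      then show ?thesis using g by blast
    qed
  qed
  moreover have "hhs_partial_realization H C"
    unfolding hhs_partial_realization_def
  proof (intro allI impI)
    fix \<V> p
    assume V: "\<V> \<subseteq> index H \<and> (\<forall>V\<in>\<V>. \<forall>W\<in>\<V>. V \<noteq> W \<longrightarrow> orth H V W) \<and>
      (\<forall>V\<in>\<V>. p V \<in> prj_image H V (points H))"
    have p: "p V \<in> mspace (hyp H V)" if "V \<in> \<V>" for V
      using V that prj_subset[of V] unfolding prj_image_def by blast
    have "\<exists>x\<in>points H. \<forall>V\<in>\<V>. all_within (hyp H V) C (prj H V x) {p V} \<and>
        (\<forall>U\<in>index H. has_rho H V U \<longrightarrow> all_within (hyp H U) C (prj H U x) (rho_set H V U))"
    proof (rule partial_realization)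
      show "\<V> \<subseteq> index H" using V by simp
      show "orth H V W" if "V \<in> \<V>" "W \<in> \<V>" "V \<noteq> W" for V W using V that by simp
    qed (rule p)
    then obtain x where x: "x \<in> points H" "\<And>V. V \<in> \<V> \<Longrightarrow> all_within (hyp H V) C (prj H V x) {p V}"
      "\<And>V U. V \<in> \<V> \<Longrightarrow> U \<in> index H \<Longrightarrow> has_rho H V U \<Longrightarrow> all_within (hyp H U) C (prj H U x) (rho_set H V U)"
      by blast
    show "\<exists>x\<in>points H. \<forall>V\<in>\<V>. hdist H V (prj H V x) {p V} \<le> ennreal C \<and>
        (\<forall>U\<in>index H. snest H V U \<or> transverse H U V \<longrightarrow>
           hdist H U (prj H U x) (rho_set H V U) \<le> ennreal C)"
    proof (intro bexI[of _ x] ballI conjI impI)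
      fix V assume VV: "V \<in> \<V>"
      then have Vi: "V \<in> index H" using V by blast
      show "hdist H V (prj H V x) {p V} \<le> ennreal C"
        using aw[OF x(2)[OF VV]] prj_nonempty Vi x(1) by blast
      fix U assume U: "U \<in> index H" "snest H V U \<or> transverse H U V"
      then have "has_rho H V U" using tr Vi by (auto simp: has_rho_def)
      then show "hdist H U (prj H U x) (rho_set H V U) \<le> ennreal C"
        using aw[OF x(3)[OF VV]] prj_nonempty rho_nonempty Vi U x(1) by blast
    qed (use x in auto)
  qed
  moreover have "hhs_uniqueness H"
  proof -
    obtain t where t: "\<And>k x y. x \<in> points H \<Longrightarrow> y \<in> points H \<Longrightarrow>
      (\<forall>V\<in>index H. \<exists>u\<in>prj H V x. \<exists>v\<in>prj H V y. mdist (hyp H V) u v \<le> k) \<Longrightarrow>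
      mdist (ambient H) x y \<le> t k" using uniqueness by metis
    show ?thesis unfolding hhs_uniqueness_def
    proof (intro exI[of _ "\<lambda>k. t k + 1"] allI impI ballI)
      fix k :: real and x y assume k: "0 \<le> k" and xy: "x \<in> points H" "y \<in> points H" "t k + 1 \<le> mdist (ambient H) x y"
      show "\<exists>V\<in>index H. ennreal k \<le> hdist H V (prj H V x) (prj H V y)"
      proof (rule ccontr)
        assume "\<not> ?thesis"
        then have less: "hdist H V (prj H V x) (prj H V y) < ennreal k" if "V \<in> index H" for V
          using that by auto
        have "\<exists>u\<in>prj H V x. \<exists>v\<in>prj H V y. mdist (hyp H V) u v \<le> k" if V: "V \<in> index H" for V
          by (rule msetdist_less_obtain[OF less[OF V]]) (auto intro: less_imp_le)
        then show False using t[OF xy(1,2), of k] xy(3) by auto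
      qed
    qed
  qed
  moreover have "hhs_coarsely_surjective H"
    unfolding hhs_coarsely_surjective_def
  proof (intro exI[of _ C] ballI subsetI)
    fix W u assume W: "W \<in> index H" "u \<in> mspace (hyp H W)"
    obtain x where x: "x \<in> points H" "all_within (hyp H W) C {u} (prj H W x)"
      using coarsely_surjective[OF W] by blast
    obtain v where v: "v \<in> prj H W x" using prj_nonempty W x by blast
    show "u \<in> mneighbourhood (hyp H W) C (prj_image H W (points H))"
      using x v W by (intro mneighbourhoodI[of _ _ v]) (auto simp: all_within_def prj_image_def)
  qed
  moreover have "1 \<le> C * (2 * C + 2)" "max C (3 * C) \<le> 3 * C" "0 \<le> C" "0 \<le> 3 * C"
    using C_ge_1 by (auto simp: mult_ge1_I)
  ultimately have
    "\<exists>\<xi> K \<kappa>0 l E. 0 \<le> \<xi> \<and> 0 \<le> K \<and> 0 \<le> \<kappa>0 \<and> 1 \<le> l \<and> max \<xi> \<kappa>0 \<le> E \<and>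
        hhs_projections H \<xi> K \<and> hhs_nesting H \<xi> \<and> hhs_orthogonality H \<and>
        hhs_consistency H \<xi> \<kappa>0 \<and> hhs_large_links H l E \<and> hhs_bounded_geodesic_image H E"
    by (intro exI[of _ C] exI[of _ C] exI[of _ "3 * C"] exI[of _ "C * (2 * C + 2)"] conjI) simp_all
  moreover have "\<exists>q\<ge>1. quasigeodesic_space q (ambient H)"
    "\<exists>\<delta>\<ge>0. \<forall>W\<in>index H. hyperbolic_space \<delta> (hyp H W)"
    "\<exists>\<alpha>\<ge>0. hhs_partial_realization H \<alpha>"
    using C_ge_1 \<open>0 \<le> C\<close> quasigeodesic hyperbolic \<open>hhs_partial_realization H C\<close> by blast+
  ultimately show ?thesis
    unfolding hhs_def using finite_complexity \<open>hhs_uniqueness H\<close> \<open>hhs_coarsely_surjective H\<close> by simp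
qed

section \<open>Realization of consistent tuples\<close>

text \<open>Fixed choices turn projections, rho sets and rho maps into ordinary points and maps, so
  later estimates compare points only. For \<open>pt\<close> and \<open>rp\<close> the choice
  matters by at most the diameter \<open>C\<close>; for \<open>mp\<close> there is no such
  bound.\<close>

definition pt :: "('x, 'i, 'h) hhs_data \<Rightarrow> 'i \<Rightarrow> 'x \<Rightarrow> 'h" where
  "pt H W x = (SOME u. u \<in> prj H W x)"

definition rp :: "('x, 'i, 'h) hhs_data \<Rightarrow> 'i \<Rightarrow> 'i \<Rightarrow> 'h" where
  "rp H V W = (SOME u. u \<in> rho_set H V W)"

definition mp :: "('x, 'i, 'h) hhs_data \<Rightarrow> 'i \<Rightarrow> 'i \<Rightarrow> 'h \<Rightarrow> 'h" where
  "mp H W V u = (SOME v. v \<in> rho_map H W V u)"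

context coarse_hhs
begin

abbreviation I where "I \<equiv> index H"
abbreviation X where "X \<equiv> points H"
abbreviation M where "M W \<equiv> mspace (hyp H W)"
abbreviation d where "d W \<equiv> mdist (hyp H W)"

lemma d_triangle: "u \<in> M W \<Longrightarrow> v \<in> M W \<Longrightarrow> w \<in> M W \<Longrightarrow> d W u w \<le> d W u v + d W v w"
  by (rule mdist_triangle)

lemma pt_in_prj: "W \<in> I \<Longrightarrow> x \<in> X \<Longrightarrow> pt H W x \<in> prj H W x"
  unfolding pt_def using prj_nonempty some_in_eq by blast

lemma pt_in [simp]: "W \<in> I \<Longrightarrow> x \<in> X \<Longrightarrow> pt H W x \<in> M W"
  using pt_in_prj prj_subset by blast

lemma rp_in_rho: "V \<in> I \<Longrightarrow> W \<in> I \<Longrightarrow> has_rho H V W \<Longrightarrow> rp H V W \<in> rho_set H V W"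
  unfolding rp_def using rho_nonempty some_in_eq by blast

lemma rp_in [simp]: "V \<in> I \<Longrightarrow> W \<in> I \<Longrightarrow> has_rho H V W \<Longrightarrow> rp H V W \<in> M W"
  using rp_in_rho rho_subset by blast

lemma mp_in_rho: "V \<in> I \<Longrightarrow> W \<in> I \<Longrightarrow> snest H V W \<Longrightarrow> u \<in> M W \<Longrightarrow> mp H W V u \<in> rho_map H W V u"
  unfolding mp_def using rho_map_nonempty some_in_eq by blast

lemma mp_in [simp]: "V \<in> I \<Longrightarrow> W \<in> I \<Longrightarrow> snest H V W \<Longrightarrow> u \<in> M W \<Longrightarrow> mp H W V u \<in> M V"
  using mp_in_rho rho_map_subset by blast

lemma pt_prj_close: "W \<in> I \<Longrightarrow> x \<in> X \<Longrightarrow> u \<in> prj H W x \<Longrightarrow> d W (pt H W x) u \<le> C"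
  using prj_diam pt_in_prj by (auto simp: all_within_def)

lemma pt_lipschitz: "W \<in> I \<Longrightarrow> x \<in> X \<Longrightarrow> y \<in> X \<Longrightarrow> d W (pt H W x) (pt H W y) \<le> C * mdist (ambient H) x y + C"
  using prj_lipschitz pt_in_prj by (auto simp: all_within_def)

lemma transverse_commute: "V \<in> I \<Longrightarrow> W \<in> I \<Longrightarrow> transverse H V W \<Longrightarrow> transverse H W V"
  using orth_sym unfolding transverse_def by blast

lemma has_rho_iff: "V \<in> I \<Longrightarrow> W \<in> I \<Longrightarrow> has_rho H V W \<longleftrightarrow> \<not> orth H V W \<and> \<not> nest H W V"
  unfolding has_rho_def snest_def transverse_def
  using nest_antisym nest_not_orth nest_refl by blast

lemma snest_has_rho: "snest H V W \<Longrightarrow> has_rho H V W"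
  by (simp add: has_rho_def)

lemma transverse_has_rho: "transverse H V W \<Longrightarrow> has_rho H V W"
  by (simp add: has_rho_def)

lemma cons_transverse:
  assumes "V \<in> I" "W \<in> I" "x \<in> X" "transverse H V W"
  shows "d W (pt H W x) (rp H V W) \<le> C \<or> d V (pt H V x) (rp H W V) \<le> C"
  using consistency_transverse[OF assms] pt_in_prj[of _ x] assms
    rp_in_rho[OF assms(1,2)] rp_in_rho[OF assms(2,1)] transverse_commute transverse_has_rho
  unfolding all_within_def by blast

lemma cons_nested:
  assumes "V \<in> I" "W \<in> I" "x \<in> X" "snest H V W"
  shows "d W (pt H W x) (rp H V W) \<le> C \<or> d V (pt H V x) (mp H W V (pt H W x)) \<le> C"
proof -
  have "mp H W V (pt H W x) \<in> rho_image H W V (prj H W x)"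
    using assms mp_in_rho pt_in_prj[of W x] pt_in unfolding rho_image_def by blast
  then show ?thesis
    using consistency_nested[OF assms] pt_in_prj[of _ x] assms rp_in_rho[OF assms(1,2)] snest_has_rho
    unfolding all_within_def by blast
qed

text \<open>If \<open>U\<close> were nested in \<open>V\<close> it would be nested in
  \<open>W\<close>, contrary to \<open>has_rho H W U\<close>; so passing to a smaller domain loses
  the rho set only through orthogonality.\<close>

lemma has_rho_down:
  assumes "U \<in> I" "V \<in> I" "W \<in> I" "nest H V W" "has_rho H W U" "\<not> orth H V U"
  shows "has_rho H V U" "d U (rp H V U) (rp H W U) \<le> C"
proof -
  show *: "has_rho H V U" using assms nest_trans[of U V W] by (simp add: has_rho_iff) blast
  have "snest H W U \<or> transverse H W U \<and> \<not> orth H U V"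
    using assms orth_sym unfolding has_rho_def by blast
  from rho_consistency[OF assms(1-4) this]
  show "d U (rp H V U) (rp H W U) \<le> C"
    using rp_in_rho assms * by (auto simp: all_within_def)
qed

lemma bgi_geodesic:
  assumes "V \<in> I" "W \<in> I" "snest H V W" and G: "geodesic_segment (hyp H W) p q G"
    and uv: "u \<in> G" "v \<in> G"
  shows "d V (mp H W V u) (mp H W V v) \<le> C \<or> (\<exists>g\<in>G. d W g (rp H V W) \<le> C)"
proof -
  have "G \<subseteq> M W" using G unfolding geodesic_segment_def by blast
  then have "mp H W V w \<in> rho_image H W V G" if "w \<in> G" for w
    using mp_in_rho[OF assms(1-3)] that unfolding rho_image_def by blast
  then show ?thesis
    using bounded_geodesic_image[OF assms(1-4)] uv rp_in_rho[OF assms(1,2)] snest_has_rho[OF assms(3)]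
    unfolding all_within_def by blast
qed

lemma geodesic_exists:
  assumes "W \<in> I" "u \<in> M W" "v \<in> M W"
  obtains G where "geodesic_segment (hyp H W) u v G" "u \<in> G" "v \<in> G" "G \<subseteq> M W"
    "\<And>g. g \<in> G \<Longrightarrow> d W u g + d W g v = d W u v"
proof -
  obtain G where G: "geodesic_segment (hyp H W) u v G"
    using hyperbolic assms unfolding hyperbolic_space_def by blast
  then obtain c L where c: "0 \<le> L" "c ` {0..L} \<subseteq> M W"
    "\<And>s t. s \<in> {0..L} \<Longrightarrow> t \<in> {0..L} \<Longrightarrow> d W (c s) (c t) = \<bar>s - t\<bar>" "c 0 = u" "c L = v" "G = c ` {0..L}"
    unfolding geodesic_segment_def by blast
  have "d W u g + d W g v = d W u v" if g: "g \<in> G" for g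
  proof -
    obtain t where t: "t \<in> {0..L}" "g = c t" using g c by blast
    then show ?thesis using c(3)[of 0 t] c(3)[of t L] c(3)[of 0 L] c by simp
  qed
  moreover have "u \<in> G" "v \<in> G" using c by (auto simp: image_iff intro: bexI[of _ 0] bexI[of _ L])
  ultimately show ?thesis using that G c by blast
qed

lemma bgi:
  assumes "V \<in> I" "W \<in> I" "snest H V W" "u \<in> M W" "v \<in> M W"
  shows "d V (mp H W V u) (mp H W V v) \<le> C \<or>
    (\<exists>g\<in>M W. d W u g + d W g v = d W u v \<and> d W g (rp H V W) \<le> C)"
proof -
  obtain G where G: "geodesic_segment (hyp H W) u v G" "u \<in> G" "v \<in> G" "G \<subseteq> M W"
    "\<And>g. g \<in> G \<Longrightarrow> d W u g + d W g v = d W u v" using geodesic_exists[OF assms(2,4,5)] by blast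
  show ?thesis using bgi_geodesic[OF assms(1-3) G(1-3)] G(4,5) by blast
qed

text \<open>A point on a geodesic from \<open>u\<close> to \<open>v\<close> is within
  \<open>d W u v\<close> of \<open>v\<close>, so the hypothesis keeps the whole geodesic away from
  the rho point and leaves only the bounded alternative.\<close>

lemma bgi_far_all:
  assumes "V \<in> I" "W \<in> I" "snest H V W" "u \<in> M W" "v \<in> M W" "C + d W u v < d W v (rp H V W)"
  shows "all_within (hyp H V) C (rho_map H W V u) (rho_map H W V v)"
proof -
  obtain G where G: "geodesic_segment (hyp H W) u v G" "u \<in> G" "v \<in> G" "G \<subseteq> M W"
    "\<And>g. g \<in> G \<Longrightarrow> d W u g + d W g v = d W u v" using geodesic_exists[OF assms(2,4,5)] by blast
  have h: "has_rho H V W" using assms snest_has_rho by blast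
  have "\<not> d W g (rp H V W) \<le> C" if g: "g \<in> G" for g
  proof
    assume "d W g (rp H V W) \<le> C"
    moreover have "d W v (rp H V W) \<le> d W v g + d W g (rp H V W)"
      using assms h g G(4) by (intro d_triangle) auto
    ultimately show False
      using G(5)[OF g] assms(6) mdist_nonneg[of "hyp H W" u g] mdist_commute[of "hyp H W" v g] by linarith
  qed
  then have "all_within (hyp H V) C (rho_image H W V G) (rho_image H W V G)"
    using bounded_geodesic_image[OF assms(1-3) G(1)] rp_in_rho[OF assms(1,2) h]
    unfolding all_within_def by blast
  then show ?thesis using G(2,3) unfolding all_within_def rho_image_def by blast
qed

lemma bgi_far:
  assumes "V \<in> I" "W \<in> I" "snest H V W" "u \<in> M W" "v \<in> M W" "C + d W u v < d W v (rp H V W)"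
  shows "d V (mp H W V u) (mp H W V v) \<le> C"
  using bgi_far_all[OF assms] mp_in_rho[OF assms(1-3)] assms(4,5) by (simp add: all_within_def)

lemma partial_realization_pt:
  assumes "\<V> \<subseteq> I" "\<And>V W. V \<in> \<V> \<Longrightarrow> W \<in> \<V> \<Longrightarrow> V \<noteq> W \<Longrightarrow> orth H V W"
    "\<And>V. V \<in> \<V> \<Longrightarrow> c V \<in> M V"
  obtains x where "x \<in> X" "\<And>V. V \<in> \<V> \<Longrightarrow> d V (pt H V x) (c V) \<le> C"
    "\<And>V U. V \<in> \<V> \<Longrightarrow> U \<in> I \<Longrightarrow> has_rho H V U \<Longrightarrow> d U (pt H U x) (rp H V U) \<le> C"
proof -
  have "\<exists>x\<in>X. \<forall>V\<in>\<V>. all_within (hyp H V) C (prj H V x) {c V} \<and>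
        (\<forall>U\<in>index H. has_rho H V U \<longrightarrow> all_within (hyp H U) C (prj H U x) (rho_set H V U))"
    using assms by (rule partial_realization)
  then obtain x where x: "x \<in> X" and 1: "\<And>V. V \<in> \<V> \<Longrightarrow> all_within (hyp H V) C (prj H V x) {c V}"
    and 2: "\<And>V U. V \<in> \<V> \<Longrightarrow> U \<in> I \<Longrightarrow> has_rho H V U \<Longrightarrow> all_within (hyp H U) C (prj H U x) (rho_set H V U)"
    by blast
  show ?thesis
  proof (rule that[OF x])
    show "d V (pt H V x) (c V) \<le> C" if "V \<in> \<V>" for V
      using 1[OF that] pt_in_prj[of V x] x that assms(1) by (auto simp: all_within_def)
    show "d U (pt H U x) (rp H V U) \<le> C" if "V \<in> \<V>" "U \<in> I" "has_rho H V U" for V U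
      using 2[OF that] pt_in_prj[of U x] rp_in_rho[of V U] x that assms(1) unfolding all_within_def by blast
  qed
qed

lemma partial_realization_single:
  assumes "V \<in> I" "c \<in> M V"
  obtains x where "x \<in> X" "d V (pt H V x) c \<le> C"
    "\<And>U. U \<in> I \<Longrightarrow> has_rho H V U \<Longrightarrow> d U (pt H U x) (rp H V U) \<le> C"
proof -
  show ?thesis
    by (rule partial_realization_pt[of "{V}" "\<lambda>_. c"]) (use assms that in auto)
qed

lemma points_nonempty: "X \<noteq> {}"
  using partial_realization[of "{}"] by auto

lemma M_nonempty: "V \<in> I \<Longrightarrow> M V \<noteq> {}"
  using points_nonempty pt_in by blast

text \<open>One partial realization serves both orthogonal domains, and its coordinate at
  \<open>Z\<close> is close to both rho points.\<close>

lemma rp_orth_close: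
  assumes "U \<in> I" "V \<in> I" "Z \<in> I" "orth H U V" "has_rho H U Z" "has_rho H V Z"
  shows "d Z (rp H U Z) (rp H V Z) \<le> 2 * C"
proof -
  define c where "c Z = (SOME u. u \<in> M Z)" for Z
  have c: "c U \<in> M U" "c V \<in> M V"
    unfolding c_def using M_nonempty assms by (simp_all add: some_in_eq)
  have "orth H V U" using orth_sym assms by blast
  then obtain x where x: "x \<in> X"
    "\<And>V' U'. V' \<in> {U, V} \<Longrightarrow> U' \<in> I \<Longrightarrow> has_rho H V' U' \<Longrightarrow> d U' (pt H U' x) (rp H V' U') \<le> C"
    by (rule_tac partial_realization_pt[of "{U, V}" c]) (use assms c in auto)
  have "d Z (rp H U Z) (rp H V Z) \<le> d Z (rp H U Z) (pt H Z x) + d Z (pt H Z x) (rp H V Z)"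
    using assms x by (intro d_triangle) simp_all
  then show ?thesis using x(2)[of U Z] x(2)[of V Z] assms mdist_commute[of "hyp H Z" "rp H U Z"] by simp
qed

text \<open>The maximal size of a nesting chain below a domain is a rank, bounded by finite
  complexity.\<close>

lemma level_function:
  obtains lev :: "'i \<Rightarrow> nat" and n where "\<And>W. W \<in> I \<Longrightarrow> lev W \<le> n"
    "\<And>V W. V \<in> I \<Longrightarrow> W \<in> I \<Longrightarrow> snest H V W \<Longrightarrow> lev V < lev W"
proof -
  define Ch where "Ch W = {\<C>. \<C> \<subseteq> nested_in H W \<and> (\<forall>V\<in>\<C>. \<forall>V'\<in>\<C>. nest H V V' \<or> nest H V' V)}" for W
  obtain n where n0: "\<forall>\<C>. \<C> \<subseteq> I \<and> (\<forall>V\<in>\<C>. \<forall>W\<in>\<C>. nest H V W \<or> nest H W V) \<longrightarrow>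
      finite \<C> \<and> card \<C> \<le> n"
    using finite_complexity unfolding hhs_finite_complexity_def ..
  have n: "finite \<C>" "card \<C> \<le> n" if "\<C> \<in> Ch W" for \<C> W
    using n0[rule_format, of \<C>] that by (auto simp: Ch_def nested_in_def)
  define lev where "lev W = Max (card ` Ch W)" for W
  have fin: "finite (card ` Ch W)" for W
  proof (rule finite_subset)
    show "card ` Ch W \<subseteq> {..n}" using n(2)[of _ W] by blast
  qed simp
  have ne: "card ` Ch W \<noteq> {}" for W by (auto simp: Ch_def intro!: exI[of _ "{}"])
  show ?thesis
  proof (rule that)
    show "lev W \<le> n" for W
      unfolding lev_def using fin ne n(2) by (subst Max_le_iff) auto
    fix V W assume V: "V \<in> I" and W: "W \<in> I" and VW: "snest H V W"
    obtain \<C> where \<C>: "\<C> \<in> Ch V" "lev V = card \<C>"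
      using Max_in[OF fin ne, of V] unfolding lev_def by auto
    have sub: "Z \<in> I" "nest H Z V" if "Z \<in> \<C>" for Z using \<C> that by (auto simp: Ch_def nested_in_def)
    have sub': "nest H Z W" if "Z \<in> \<C>" for Z
      using nest_trans[OF sub(1)[OF that] V W] sub(2)[OF that] VW by (simp add: snest_def)
    have "W \<notin> \<C>" using sub nest_antisym[OF V W] VW by (auto simp: snest_def)
    moreover have "insert W \<C> \<in> Ch W"
      using \<C>(1) sub sub' W nest_refl[OF W] by (auto simp: Ch_def nested_in_def)
    moreover have "card (insert W \<C>) \<le> lev W"
      unfolding lev_def using fin calculation(2) by (intro Max_ge) auto
    ultimately show "lev V < lev W" using \<C> n(1)[OF \<C>(1)] by simp
  qed
qed

text \<open>An orthogonal family minus one member lies in a container, hence in a strictly lower level.\<close>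

lemma orthogonal_family_bound:
  "\<exists>N. \<forall>\<V>. finite \<V> \<longrightarrow> \<V> \<subseteq> I \<longrightarrow> (\<forall>V\<in>\<V>. \<forall>W\<in>\<V>. V \<noteq> W \<longrightarrow> orth H V W) \<longrightarrow> card \<V> \<le> N"
proof -
  obtain lev :: "'i \<Rightarrow> nat" and n where lev: "\<And>W. W \<in> I \<Longrightarrow> lev W \<le> n"
    "\<And>V W. V \<in> I \<Longrightarrow> W \<in> I \<Longrightarrow> snest H V W \<Longrightarrow> lev V < lev W" using level_function by blast
  have main: "card \<V> \<le> lev W + 1" if "finite \<V>" "W \<in> I" "\<V> \<subseteq> nested_in H W"
    "\<forall>V\<in>\<V>. \<forall>W\<in>\<V>. V \<noteq> W \<longrightarrow> orth H V W" for \<V> W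
    using that
  proof (induction "lev W" arbitrary: \<V> W rule: less_induct)
    case less
    show ?case
    proof (cases "\<exists>V V'. V \<in> \<V> \<and> V' \<in> \<V> \<and> V \<noteq> V'")
      case False
      then have "\<V> = {} \<or> (\<exists>V. \<V> = {V})" by blast
      then show ?thesis by auto
    next
      case True
      then obtain V V' where V: "V \<in> \<V>" "V' \<in> \<V>" "V \<noteq> V'" by blast
      have "V \<in> nested_in H W" "V' \<in> nested_in H W" "orth H V' V"
        using less.prems(3,4) V by auto
      then have "\<exists>T\<in>nested_in H W - {W}. \<forall>V'\<in>nested_in H W. orth H V' V \<longrightarrow> nest H V' T"
        by (rule container[OF less.prems(2)])
      then obtain T where T: "T \<in> nested_in H W - {W}" "\<And>V'. V'\<in>nested_in H W \<Longrightarrow> orth H V' V \<Longrightarrow> nest H V' T"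
        by blast
      have Ti: "T \<in> I" and TW: "snest H T W" using T by (auto simp: nested_in_def snest_def)
      have "\<V> - {V} \<subseteq> nested_in H T"
      proof
        fix Z assume Z: "Z \<in> \<V> - {V}"
        then have "orth H Z V" using less.prems V by blast
        then show "Z \<in> nested_in H T" using T(2)[of Z] Z less.prems by (auto simp: nested_in_def)
      qed
      then have "card (\<V> - {V}) \<le> lev T + 1"
        using less.hyps[OF lev(2)[OF Ti less.prems(2) TW], of "\<V> - {V}"] less.prems Ti by auto
      then show ?thesis using lev(2)[OF Ti less.prems(2) TW] V less.prems(1) by simp
    qed
  qed
  obtain S where S: "S \<in> I" "\<And>V. V \<in> I \<Longrightarrow> nest H V S" using top_index by blast
  show ?thesis
  proof (intro exI[of _ "lev S + 1"] allI impI)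
    fix \<V> assume V: "finite \<V>" "\<V> \<subseteq> I"
      "\<forall>V\<in>\<V>. \<forall>W\<in>\<V>. V \<noteq> W \<longrightarrow> orth H V W"
    have "\<V> \<subseteq> nested_in H S" using V(2) S by (auto simp: nested_in_def)
    then show "card \<V> \<le> lev S + 1" by (rule main[OF V(1) S(1) _ V(3)])
  qed
qed

section \<open>Consistent tuples of points and the order on badly realized domains\<close>

definition consistent_on :: "'i set \<Rightarrow> real \<Rightarrow> ('i \<Rightarrow> 'h) \<Rightarrow> bool" where
  "consistent_on J K b \<longleftrightarrow> (\<forall>V\<in>J. b V \<in> M V) \<and>
     (\<forall>V\<in>J. \<forall>W\<in>J. transverse H V W \<longrightarrow>
        d W (b W) (rp H V W) \<le> K \<or> d V (b V) (rp H W V) \<le> K) \<and>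
     (\<forall>V\<in>J. \<forall>W\<in>J. snest H V W \<longrightarrow>
        d W (b W) (rp H V W) \<le> K \<or> d V (b V) (mp H W V (b W)) \<le> K)"

abbreviation consistent_pts :: "real \<Rightarrow> ('i \<Rightarrow> 'h) \<Rightarrow> bool" where
  "consistent_pts \<equiv> consistent_on I"

end

locale coarse_tuple = coarse_hhs H C for H :: "('x, 'i, 'h) hhs_data" and C +
  fixes K :: real and b :: "'i \<Rightarrow> 'h"
  assumes C_le_K: "C \<le> K" and consistent: "consistent_pts K b"
begin

lemma b_in [simp]: "V \<in> I \<Longrightarrow> b V \<in> M V"
  using consistent by (simp add: consistent_on_def)

lemma b_transverse: "V \<in> I \<Longrightarrow> W \<in> I \<Longrightarrow> transverse H V W \<Longrightarrow>
    d W (b W) (rp H V W) \<le> K \<or> d V (b V) (rp H W V) \<le> K"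
  using consistent by (simp add: consistent_on_def)

lemma b_nested: "V \<in> I \<Longrightarrow> W \<in> I \<Longrightarrow> snest H V W \<Longrightarrow>
    d W (b W) (rp H V W) \<le> K \<or> d V (b V) (mp H W V (b W)) \<le> K"
  using consistent by (simp add: consistent_on_def)

text \<open>Suppose \<open>b W\<close> is far from the rho point. Then so is the nearby coordinate
  of \<open>q\<close>, both coordinates at \<open>T\<close> are read off through \<open>mp\<close>,
  and bounded geodesic image makes the two values agree, so \<open>T\<close> cannot be bad.\<close>

lemma bad_nested_close:
  assumes "T \<in> I" "W \<in> I" "snest H T W" "q \<in> X" "d W (pt H W q) (b W) \<le> s" "3 * K < d T (pt H T q) (b T)"
  shows "d W (b W) (rp H T W) \<le> s + 2 * K"
proof (rule ccontr)
  assume far: "\<not> ?thesis"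
  have hr: "has_rho H T W" using assms snest_has_rho by blast
  have K1: "1 \<le> K" using C_ge_1 C_le_K by linarith
  have "0 \<le> s" using order_trans[OF mdist_nonneg assms(5)] .
  have "d W (b W) (rp H T W) \<le> d W (b W) (pt H W q) + d W (pt H W q) (rp H T W)"
    using assms hr by (intro d_triangle) simp_all
  then have "\<not> d W (pt H W q) (rp H T W) \<le> C"
    using far assms(5) C_le_K K1 mdist_commute[of "hyp H W" "b W"] by force
  then have 1: "d T (pt H T q) (mp H W T (pt H W q)) \<le> C"
    using cons_nested[OF assms(1,2,4,3)] by blast
  have 2: "d T (b T) (mp H W T (b W)) \<le> K"
    using b_nested[OF assms(1-3)] far \<open>0 \<le> s\<close> K1 by force
  have 3: "d T (mp H W T (pt H W q)) (mp H W T (b W)) \<le> C"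
    using assms far C_le_K K1 by (intro bgi_far) auto
  have "d T (pt H T q) (b T) \<le> d T (pt H T q) (mp H W T (pt H W q))
      + d T (mp H W T (pt H W q)) (mp H W T (b W)) + d T (mp H W T (b W)) (b T)"
    using assms by (intro mdist_triangle3) simp_all
  then show False
    using 1 2 3 assms(6) C_le_K mdist_commute[of "hyp H T" "b T"] by force
qed

text \<open>\<open>near c Y\<close> says that the tuple is close to the product region of \<open>Y\<close>.\<close>

definition near :: "real \<Rightarrow> 'i \<Rightarrow> bool" where
  "near c Y \<longleftrightarrow> (\<forall>Z\<in>I. has_rho H Y Z \<longrightarrow> d Z (b Z) (rp H Y Z) \<le> c)"

lemma nearD: "near c Y \<Longrightarrow> Z \<in> I \<Longrightarrow> has_rho H Y Z \<Longrightarrow> d Z (b Z) (rp H Y Z) \<le> c"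
  by (simp add: near_def)

definition lt :: "'i \<Rightarrow> 'i \<Rightarrow> bool" where
  "lt Y Z \<longleftrightarrow> transverse H Y Z \<and> d Y (b Y) (rp H Z Y) \<le> K"

end

text \<open>On the set \<open>B\<close> of domains badly realized by \<open>q\<close>, the relation \<open>lt\<close> is the order in which a path
  from \<open>q\<close> towards the tuple would traverse them.\<close>

locale bad_domains = coarse_tuple H C K b
  for H :: "('x, 'i, 'h) hhs_data" and C K and b :: "'i \<Rightarrow> 'h" +
  fixes q :: 'x and c :: real and B :: "'i set" and W0 :: 'i
  assumes q_in [simp]: "q \<in> X" and c_ge: "5 * K \<le> c" and W0_in [simp]: "W0 \<in> I"
    and B_in [simp]: "Y \<in> B \<Longrightarrow> Y \<in> I"
    and B_nest: "Y \<in> B \<Longrightarrow> snest H Y W0"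
    and B_bad: "Y \<in> B \<Longrightarrow> c < d Y (pt H Y q) (b Y)"
    and above_good: "Y \<in> B \<Longrightarrow> T \<in> I \<Longrightarrow> nest H T W0 \<Longrightarrow> snest H Y T \<Longrightarrow> T \<notin> B \<Longrightarrow>
      d T (pt H T q) (b T) \<le> c"
begin

lemma K_pos: "1 \<le> K"
  using C_ge_1 C_le_K by linarith

lemma bad_apart:
  assumes "Y \<in> B" "u \<in> M Y"
  shows "c < d Y (pt H Y q) u + d Y (b Y) u"
  using B_bad[OF assms(1)] d_triangle[of "pt H Y q" Y u "b Y"] assms mdist_commute[of "hyp H Y" u "b Y"] by simp

text \<open>A self-improving estimate. If \<open>b Y\<close> is merely \<open>c - 2 * K\<close>
  close to the rho point of \<open>Z\<close>, then \<open>q\<close> is away from it because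
  \<open>Y\<close> is bad. Consistency puts \<open>q\<close> near the rho point in \<open>Z\<close>,
  badness of \<open>Z\<close> keeps \<open>b Z\<close> away from that point, and consistency of the
  tuple sharpens the bound at \<open>Y\<close> to \<open>K\<close>.\<close>

lemma lt_facts:
  assumes "Y \<in> B" "Z \<in> B" "transverse H Y Z" "d Y (b Y) (rp H Z Y) \<le> c - 2 * K"
  shows "lt Y Z" "d Z (pt H Z q) (rp H Y Z) \<le> C" "c - C < d Z (b Z) (rp H Y Z)"
proof -
  have ZY: "transverse H Z Y" using transverse_commute assms by simp
  have "c < d Y (pt H Y q) (rp H Z Y) + d Y (b Y) (rp H Z Y)"
    using bad_apart[OF assms(1)] assms ZY transverse_has_rho by simp
  then have "\<not> d Y (pt H Y q) (rp H Z Y) \<le> C" using assms(4) C_le_K K_pos by linarith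
  then show 1: "d Z (pt H Z q) (rp H Y Z) \<le> C"
    using cons_transverse[of Y Z q] assms by auto
  show 2: "c - C < d Z (b Z) (rp H Y Z)"
    using bad_apart[OF assms(2), of "rp H Y Z"] 1 assms transverse_has_rho by simp
  then show "lt Y Z"
    using b_transverse[of Y Z] assms c_ge C_le_K K_pos unfolding lt_def by force
qed

lemma lt_asym:
  assumes "Y \<in> B" "Z \<in> B" "lt Y Z"
  shows "\<not> lt Z Y"
proof
  assume "lt Z Y"
  moreover have "c - C < d Z (b Z) (rp H Y Z)"
    using lt_facts(3)[of Y Z] assms c_ge K_pos unfolding lt_def by force
  ultimately show False using c_ge K_pos C_le_K unfolding lt_def by linarith
qed

text \<open>Distinct maximal bad domains are never nested, so they are orthogonal or transverse;
  transitivity of \<open>lt\<close> then only has to rule out orthogonality.\<close>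

definition Bmax where "Bmax = {Y \<in> B. \<forall>Z\<in>B. \<not> snest H Y Z}"

lemma BmaxD: "Y \<in> Bmax \<Longrightarrow> Y \<in> B" "Y \<in> Bmax \<Longrightarrow> Z \<in> B \<Longrightarrow> \<not> snest H Y Z"
  by (auto simp: Bmax_def)

lemma lt_trans:
  assumes "Y1 \<in> Bmax" "Y2 \<in> Bmax" "Y3 \<in> Bmax" "lt Y1 Y2" "lt Y2 Y3"
  shows "lt Y1 Y3"
proof -
  note inB = assms(1-3)[THEN BmaxD(1)]
  note inI [simp] = inB[THEN B_in]
  have t12: "transverse H Y1 Y2" and t23: "transverse H Y2 Y3" using assms unfolding lt_def by auto
  have t21: "transverse H Y2 Y1" and t32: "transverse H Y3 Y2" using t12 t23 transverse_commute by auto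
  note hr [simp] = transverse_has_rho[OF t12] transverse_has_rho[OF t21] transverse_has_rho[OF t23] transverse_has_rho[OF t32]
  have cK: "K \<le> c - 2 * K" using c_ge K_pos by linarith
  have f12: "d Y2 (pt H Y2 q) (rp H Y1 Y2) \<le> C" "c - C < d Y2 (b Y2) (rp H Y1 Y2)"
    using lt_facts(2,3)[OF inB(1,2) t12] assms(4) cK unfolding lt_def by linarith+
  have b2: "d Y2 (b Y2) (rp H Y3 Y2) \<le> K" using assms(5) unfolding lt_def by simp
  have "Y1 \<noteq> Y3" using lt_asym[OF inB(1,2) assms(4)] assms(5) by auto
  \<comment> \<open>Orthogonal domains would have close rho points in \<open>Y2\<close>, but
    \<open>b Y2\<close> is close to one of them and far from the other.\<close>
  moreover have "\<not> orth H Y1 Y3"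
  proof
    assume "orth H Y1 Y3"
    then have "d Y2 (rp H Y1 Y2) (rp H Y3 Y2) \<le> 2 * C" by (intro rp_orth_close) auto
    moreover have "d Y2 (b Y2) (rp H Y1 Y2) \<le> d Y2 (b Y2) (rp H Y3 Y2) + d Y2 (rp H Y3 Y2) (rp H Y1 Y2)"
      by (intro d_triangle) simp_all
    ultimately show False
      using f12(2) b2 c_ge C_le_K K_pos mdist_commute[of "hyp H Y2" "rp H Y1 Y2"] by force
  qed
  moreover have "\<not> nest H Y1 Y3" "\<not> nest H Y3 Y1"
    using BmaxD(2)[OF assms(1) inB(3)] BmaxD(2)[OF assms(3) inB(1)] calculation(1) by (auto simp: snest_def)
  ultimately have t13: "transverse H Y1 Y3" by (simp add: transverse_def)
  then have t31: "transverse H Y3 Y1" using transverse_commute by auto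
  note hr2 [simp] = transverse_has_rho[OF t13] transverse_has_rho[OF t31]
  \<comment> \<open>Realizing \<open>Y3\<close> compares two rho points in \<open>Y1\<close>. At
    \<open>Y2\<close> the point \<open>x\<close> is near the rho point of \<open>Y3\<close>, hence
    away from that of \<open>Y1\<close>; consistency puts it near the rho point of \<open>Y2\<close>
    in \<open>Y1\<close>, and by realization it is near that of \<open>Y3\<close> too.\<close>
  obtain x where x [simp]: "x \<in> X" and "d Y3 (pt H Y3 x) (b Y3) \<le> C"
    and xr: "\<And>U. U \<in> I \<Longrightarrow> has_rho H Y3 U \<Longrightarrow> d U (pt H U x) (rp H Y3 U) \<le> C"
    using partial_realization_single[of Y3 "b Y3"] by auto
  have "d Y2 (b Y2) (rp H Y1 Y2) \<le> d Y2 (b Y2) (rp H Y3 Y2) + d Y2 (rp H Y3 Y2) (pt H Y2 x) + d Y2 (pt H Y2 x) (rp H Y1 Y2)"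
    by (intro mdist_triangle3) simp_all
  then have "\<not> d Y2 (pt H Y2 x) (rp H Y1 Y2) \<le> C"
    using xr[of Y2] b2 f12(2) c_ge C_le_K K_pos mdist_commute[of "hyp H Y2" "rp H Y3 Y2"] by force
  then have "d Y1 (pt H Y1 x) (rp H Y2 Y1) \<le> C" using cons_transverse[of Y1 Y2 x] t12 by auto
  moreover have "d Y1 (b Y1) (rp H Y3 Y1) \<le> d Y1 (b Y1) (rp H Y2 Y1) + d Y1 (rp H Y2 Y1) (pt H Y1 x) + d Y1 (pt H Y1 x) (rp H Y3 Y1)"
    by (intro mdist_triangle3) simp_all
  moreover have "d Y1 (b Y1) (rp H Y2 Y1) \<le> K" using assms(4) unfolding lt_def by simp
  ultimately have "d Y1 (b Y1) (rp H Y3 Y1) \<le> c - 2 * K"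
    using xr[of Y1] c_ge C_le_K K_pos mdist_commute[of "hyp H Y1" "rp H Y2 Y1"] by force
  then show ?thesis using lt_facts(1)[OF inB(1,3) t13] by blast
qed

definition chain where
  "chain \<C> \<longleftrightarrow> finite \<C> \<and> \<C> \<subseteq> Bmax \<and> (\<forall>Y\<in>\<C>. \<forall>Z\<in>\<C>. Y \<noteq> Z \<longrightarrow> lt Y Z \<or> lt Z Y)"

text \<open>Compare \<open>q\<close> with the partial realization at the last domain of the chain: all members of the
  chain are large for this pair, so large links distributes them over boundedly many smaller domains.\<close>

lemma chain_bound:
  assumes lev: "\<And>V W. V \<in> I \<Longrightarrow> W \<in> I \<Longrightarrow> snest H V W \<Longrightarrow> lev V < lev W"
  shows "\<exists>N::nat. \<forall>T \<C>. T \<in> I \<longrightarrow> lev T < (l::nat) \<longrightarrow> nest H T W0 \<longrightarrow> T \<notin> B \<longrightarrow> chain \<C> \<longrightarrow>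
    (\<forall>Y\<in>\<C>. snest H Y T) \<longrightarrow> card \<C> \<le> N"
proof (induction l)
  case 0
  show ?case by simp
next
  case (Suc l)
  then obtain N where N: "\<And>T \<C>. T \<in> I \<Longrightarrow> lev T < l \<Longrightarrow> nest H T W0 \<Longrightarrow> T \<notin> B \<Longrightarrow> chain \<C> \<Longrightarrow>
    (\<And>Y. Y\<in>\<C> \<Longrightarrow> snest H Y T) \<Longrightarrow> card \<C> \<le> N" by blast
  define R where "R = nat \<lfloor>C * (2 * c + 3 * K) + C\<rfloor>"
  have "card \<C> \<le> R * max 1 N"
    if T [simp]: "T \<in> I" and "lev T < Suc l" and T0: "nest H T W0" and TB: "T \<notin> B" and ch: "chain \<C>"
      and below: "\<And>Y. Y \<in> \<C> \<Longrightarrow> snest H Y T" for T \<C>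
  proof (cases "\<C> = {}")
    case False
    have fin: "finite \<C>" and sub: "\<And>Y. Y \<in> \<C> \<Longrightarrow> Y \<in> Bmax"
      and tot: "\<And>Y Z. Y \<in> \<C> \<Longrightarrow> Z \<in> \<C> \<Longrightarrow> Y \<noteq> Z \<Longrightarrow> lt Y Z \<or> lt Z Y"
      using ch unfolding chain_def by auto
    have subI [simp]: "Y \<in> \<C> \<Longrightarrow> Y \<in> I" for Y using sub BmaxD by simp
    have "\<exists>Y\<in>\<C>. \<forall>Z\<in>\<C>. Z \<noteq> Y \<longrightarrow> lt Z Y"
      by (rule finite_chain_greatest[OF fin False tot]) (use lt_trans sub in blast)+
    then obtain L where L [simp]: "L \<in> \<C>" and last: "\<And>Z. Z \<in> \<C> \<Longrightarrow> Z \<noteq> L \<Longrightarrow> lt Z L" by blast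
    obtain x where x [simp]: "x \<in> X" and xL: "d L (pt H L x) (b L) \<le> C"
      and xr: "\<And>U. U \<in> I \<Longrightarrow> has_rho H L U \<Longrightarrow> d U (pt H U x) (rp H L U) \<le> C"
      using partial_realization_single[of L "b L"] by auto
    have LB: "L \<in> B" using sub BmaxD by simp
    \<comment> \<open>The point \<open>x\<close> nearly has the tuple's coordinate at every
      \<open>Y\<close>: at \<open>L\<close> by choice, and at the other members because both lie
      near the rho point of \<open>L\<close>. Badness then separates \<open>x\<close> from
      \<open>q\<close>.\<close>
    have big: "C < d Y (pt H Y q) (pt H Y x)" if Y: "Y \<in> \<C>" for Y
    proof -
      have "d Y (pt H Y x) (b Y) \<le> C + K"
      proof (cases "Y = L")
        case True
        then show ?thesis using xL K_pos by simp
      next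
        case False
        then have l: "lt Y L" using last Y by blast
        then have hr: "has_rho H L Y" using transverse_commute[of Y L] transverse_has_rho Y unfolding lt_def by simp
        have "d Y (pt H Y x) (b Y) \<le> d Y (pt H Y x) (rp H L Y) + d Y (rp H L Y) (b Y)"
          using Y hr by (intro d_triangle) simp_all
        then show ?thesis using xr[OF _ hr] l Y mdist_commute[of "hyp H Y" "b Y"] unfolding lt_def by simp
      qed
      then show ?thesis
        using B_bad[OF BmaxD(1)[OF sub[OF Y]]] Y c_ge K_pos C_le_K d_triangle[of "pt H Y q" Y "pt H Y x" "b Y"] by simp
    qed
    have hLT: "has_rho H L T" using below snest_has_rho by simp
    have Tq: "d T (pt H T q) (b T) \<le> c" using above_good[OF LB T T0 below[OF L] TB] .
    \<comment> \<open>As \<open>T\<close> is not bad, \<open>q\<close> is near \<open>b T\<close>;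
      as \<open>L\<close> is bad, \<open>b T\<close> is near the rho point of \<open>L\<close>,
      hence near \<open>x\<close>. This makes the number of large links independent of the
      chain.\<close>
    have "d T (b T) (rp H L T) \<le> c + 2 * K"
      using bad_nested_close[of L T q c] B_bad[OF LB] Tq below c_ge K_pos by simp
    moreover have "d T (pt H T q) (pt H T x) \<le> d T (pt H T q) (b T) + d T (b T) (rp H L T) + d T (rp H L T) (pt H T x)"
      using hLT by (intro mdist_triangle3) simp_all
    ultimately have dist: "d T (pt H T q) (pt H T x) \<le> 2 * c + 3 * K"
      using Tq xr[OF T hLT] C_le_K mdist_commute[of "hyp H T" "rp H L T"] by simp
    obtain \<T> where \<T>: "\<T> \<subseteq> nested_in H T - {T}" "finite \<T>"
      and card\<T>: "real (card \<T>) \<le> C * d T (pt H T q) (pt H T x) + C"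
      and cover: "\<And>Y. Y\<in>nested_in H T - {T} \<Longrightarrow> (\<exists>T'\<in>\<T>. nest H Y T') \<or>
           all_within (hyp H Y) C (prj H Y q) (prj H Y x)"
      using large_links[OF T q_in x pt_in_prj[OF T q_in] pt_in_prj[OF T x]] by blast
    have "C * d T (pt H T q) (pt H T x) \<le> C * (2 * c + 3 * K)" using dist C_ge_1 by (intro mult_left_mono) auto
    with card\<T> have R: "card \<T> \<le> R" unfolding R_def by linarith
    define part where "part T' = {Y \<in> \<C>. nest H Y T'}" for T'
    have covers: "\<C> \<subseteq> (\<Union>T'\<in>\<T>. part T')"
    proof
      fix Y assume Y: "Y \<in> \<C>"
      then have "Y \<in> nested_in H T - {T}" using below by (auto simp: nested_in_def snest_def)
      moreover have "\<not> all_within (hyp H Y) C (prj H Y q) (prj H Y x)"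
        using big[OF Y] Y pt_in_prj[of Y q] pt_in_prj[of Y x] unfolding all_within_def by force
      ultimately show "Y \<in> (\<Union>T'\<in>\<T>. part T')" using cover Y unfolding part_def by blast
    qed
    \<comment> \<open>Under a bad \<open>T'\<close> the members of the chain, being maximal, can
      only be \<open>T'\<close> itself; otherwise \<open>T'\<close> has smaller level and the
      induction applies. Hence \<open>max 1 N\<close>.\<close>
    have part: "card (part T') \<le> max 1 N" if T': "T' \<in> \<T>" for T'
    proof (cases "T' \<in> B")
      case True
      have "Y = T'" if "Y \<in> part T'" for Y
        using that BmaxD(2)[OF sub True] by (auto simp: part_def snest_def)
      then have "part T' \<subseteq> {T'}" by blast
      then have "card (part T') \<le> 1" using card_mono[of "{T'}"] by simp
      then show ?thesis by simp
    next
      case False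
      have T'I: "T' \<in> I" and T'T: "snest H T' T" using T' \<T>(1) by (auto simp: nested_in_def snest_def)
      have "card (part T') \<le> N"
      proof (rule N[OF T'I])
        show "lev T' < l" using lev[OF T'I T T'T] \<open>lev T < Suc l\<close> by simp
        show "nest H T' W0" using nest_trans[OF T'I T W0_in] T'T T0 by (simp add: snest_def)
        show "chain (part T')" using ch unfolding chain_def part_def by auto
        show "snest H Y T'" if "Y \<in> part T'" for Y
          using that False sub BmaxD(1) by (auto simp: part_def snest_def)
      qed (rule False)
      then show ?thesis by simp
    qed
    have "card \<C> \<le> card (\<Union>T'\<in>\<T>. part T')"
      using covers fin \<T>(2) by (intro card_mono) (auto simp: part_def)
    also have "\<dots> \<le> (\<Sum>T'\<in>\<T>. card (part T'))" using \<T>(2) by (rule card_UN_le)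
    also have "\<dots> \<le> card \<T> * max 1 N" using sum_bounded_above[of \<T> "\<lambda>T'. card (part T')" "max 1 N"] part by simp
    also have "\<dots> \<le> R * max 1 N" using R by (rule mult_le_mono1)
    finally show ?thesis .
  qed simp
  then show ?case by blast
qed

text \<open>Extremality among maximal bad domains extends to all of \<open>B\<close>: a bad
  \<open>Z\<close> after \<open>Y\<close> is replaced by a maximal \<open>Z'\<close> above it, whose
  rho point in \<open>Y\<close> is \<open>C\<close>-close, and \<open>lt_facts\<close> absorbs this
  loss.\<close>

lemma extremal_bad_exists:
  assumes "B \<noteq> {}"
  shows "\<exists>Y\<in>Bmax. \<forall>Z\<in>B. \<not> lt Y Z"
proof -
  have Bmax_above: "\<exists>Z'\<in>Bmax. nest H Z Z'" if Z: "Z \<in> B" for Z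
  proof -
    have "\<exists>m\<in>B. nest H Z m \<and> (\<forall>z\<in>B. \<not> snest H m z)"
    proof (rule exists_nest_maximal_above[OF finite_complexity Z])
      show "B \<subseteq> I" using B_in by blast
      show "transp_on I (nest H)" using nest_trans unfolding transp_on_def by blast
      show "antisymp_on I (nest H)" using nest_antisym unfolding antisymp_on_def by blast
      show "reflp_on I (nest H)" using nest_refl unfolding reflp_on_def by blast
    qed
    then show ?thesis by (auto simp: Bmax_def)
  qed
  obtain lev :: "'i \<Rightarrow> nat" and n where lev: "\<And>W. W \<in> I \<Longrightarrow> lev W \<le> n"
    "\<And>V W. V \<in> I \<Longrightarrow> W \<in> I \<Longrightarrow> snest H V W \<Longrightarrow> lev V < lev W" using level_function by blast
  obtain N where N: "\<And>T \<C>. T \<in> I \<Longrightarrow> lev T < Suc n \<Longrightarrow> nest H T W0 \<Longrightarrow> T \<notin> B \<Longrightarrow> chain \<C> \<Longrightarrow>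
    (\<forall>Y\<in>\<C>. snest H Y T) \<Longrightarrow> card \<C> \<le> N" using chain_bound[where lev=lev and l="Suc n", OF lev(2)] by blast
  obtain Y0 where Y0: "Y0 \<in> Bmax" using assms Bmax_above by blast
  have "\<exists>m\<in>Bmax. (m = Y0 \<or> lt Y0 m) \<and> (\<forall>z\<in>Bmax. \<not> lt m z)"
  proof (rule bounded_chains_maximal_above[OF Y0, where n=N])
    show "\<not> lt x x" if "x \<in> Bmax" for x using lt_asym[of x x] BmaxD(1)[OF that] by blast
    show "lt x z" if "x \<in> Bmax" "y \<in> Bmax" "z \<in> Bmax" "lt x y" "lt y z" for x y z
      using lt_trans that by blast
    show "card \<C> \<le> N" if "finite \<C>" "\<C> \<subseteq> Bmax"
      "\<And>x y. x \<in> \<C> \<Longrightarrow> y \<in> \<C> \<Longrightarrow> x \<noteq> y \<Longrightarrow> lt x y \<or> lt y x" for \<C>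
    proof (rule N[OF W0_in])
      show "lev W0 < Suc n" using lev(1)[OF W0_in] by simp
      show "nest H W0 W0" by (rule nest_refl) simp
      show "W0 \<notin> B" using B_nest by (auto simp: snest_def)
      show "chain \<C>" using that by (simp add: chain_def)
      show "\<forall>Y\<in>\<C>. snest H Y W0" using that(2) BmaxD(1) B_nest by blast
    qed
  qed
  then obtain Y where Y: "Y \<in> Bmax" "\<And>Z. Z \<in> Bmax \<Longrightarrow> \<not> lt Y Z" by blast
  have YB: "Y \<in> B" using Y BmaxD by blast
  have "\<not> lt Y Z" if Z: "Z \<in> B" for Z
  proof
    assume l: "lt Y Z"
    then have t: "transverse H Y Z" by (simp add: lt_def)
    obtain Z' where Z': "Z' \<in> Bmax" "nest H Z Z'" using Bmax_above[OF Z] by blast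
    have Z'B: "Z' \<in> B" using Z' BmaxD by blast
    have inI [simp]: "Y \<in> I" "Z \<in> I" "Z' \<in> I" using YB Z Z'B by auto
    have no: "\<not> orth H Z Y" using t orth_sym[of Z Y] by (auto simp: transverse_def)
    have "\<not> orth H Z' Y" using no orth_nest[of Y Z Z'] Z' by auto
    moreover have "\<not> nest H Z' Y" using nest_trans[of Z Z' Y] Z' t by (auto simp: transverse_def)
    moreover have "\<not> nest H Y Z'"
      using BmaxD(2)[OF Y(1) Z'B] calculation(2) nest_refl[of Y] by (auto simp: snest_def)
    ultimately have t': "transverse H Z' Y" by (simp add: transverse_def)
    have "d Y (rp H Z Y) (rp H Z' Y) \<le> C"
      using has_rho_down(2)[of Y Z Z'] Z' t' no transverse_has_rho by simp
    moreover have "d Y (b Y) (rp H Z' Y) \<le> d Y (b Y) (rp H Z Y) + d Y (rp H Z Y) (rp H Z' Y)"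
      using t' transverse_commute[OF _ _ t] transverse_has_rho by (intro d_triangle) simp_all
    ultimately have "d Y (b Y) (rp H Z' Y) \<le> c - 2 * K"
      using l c_ge K_pos C_le_K unfolding lt_def by linarith
    then have "lt Y Z'" using lt_facts(1)[OF YB Z'B] transverse_commute[OF _ _ t'] by simp
    then show False using Y Z' by blast
  qed
  then show ?thesis using Y by blast
qed

text \<open>For \<open>Y\<close> nested in \<open>Z\<close>, badness of \<open>Y\<close> suffices.
  For transverse \<open>Z\<close> with \<open>b Z\<close> away from the rho point of
  \<open>Y\<close>, consistency puts \<open>b Y\<close> near the rho point of \<open>Z\<close>. So
  \<open>Z\<close> is not bad by extremality, and \<open>q\<close> is away from that rho point;
  hence \<open>q\<close>, and with it \<open>b Z\<close>, is near the rho point of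
  \<open>Y\<close>.\<close>

lemma extremal_bad_near:
  assumes "Y \<in> Bmax" "\<forall>Z\<in>B. \<not> lt Y Z" and Z: "Z \<in> I" "has_rho H Y Z"
    and good: "Z \<notin> B \<Longrightarrow> d Z (pt H Z q) (b Z) \<le> c" 
  shows "d Z (b Z) (rp H Y Z) \<le> c + 2 * K"
proof -
  have YB: "Y \<in> B" using assms BmaxD by blast
  have [simp]: "Y \<in> I" using YB by simp
  have c3: "3 * K < d Y (pt H Y q) (b Y)" using B_bad[OF YB] c_ge K_pos by linarith
  show ?thesis
  proof (cases "snest H Y Z")
    case True
    then have "Z \<notin> B" using BmaxD(2)[OF assms(1)] by blast
    then show ?thesis using bad_nested_close[OF _ Z(1) True q_in good c3] by simp
  next
    case False
    then have t: "transverse H Y Z" using Z by (simp add: has_rho_def)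
    have t': "transverse H Z Y" using transverse_commute t Z by simp
    show ?thesis
    proof (cases "d Z (b Z) (rp H Y Z) \<le> K")
      case True
      then show ?thesis using c_ge K_pos by linarith
    next
      case nb: False
      then have bY: "d Y (b Y) (rp H Z Y) \<le> K" using b_transverse[of Y Z] t Z by simp
      then have ZB: "Z \<notin> B" using assms(2) t by (auto simp: lt_def)
      have "c < d Y (pt H Y q) (rp H Z Y) + d Y (b Y) (rp H Z Y)"
        using bad_apart[OF YB] t' transverse_has_rho Z by simp
      then have "\<not> d Y (pt H Y q) (rp H Z Y) \<le> C" using bY c_ge K_pos C_le_K by linarith
      then have "d Z (pt H Z q) (rp H Y Z) \<le> C" using cons_transverse[of Y Z q] t Z by auto
      moreover have "d Z (b Z) (rp H Y Z) \<le> d Z (b Z) (pt H Z q) + d Z (pt H Z q) (rp H Y Z)"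
        using Z by (intro d_triangle) simp_all
      ultimately show ?thesis
        using good[OF ZB] C_le_K K_pos mdist_commute[of "hyp H Z" "b Z"] by simp
    qed
  qed
qed

end

section \<open>Refinement of orthogonal families and realization\<close>

context coarse_tuple
begin

lemma K_ge_1: "1 \<le> K"
  using C_ge_1 C_le_K by linarith

lemma near_mono: "near c Y \<Longrightarrow> c \<le> c' \<Longrightarrow> near c' Y"
  unfolding near_def by (meson order_trans)

text \<open>A partial realization \<open>q\<close> at \<open>V\<close> is compared with the tuple
  below \<open>U\<close>: if nothing is bad, \<open>V\<close> itself works, otherwise an extremal
  bad domain does. For domains not nested in \<open>U\<close>, the rho points of \<open>U\<close>
  and of the smaller domain are close, so \<open>near c U\<close> takes over.\<close>

lemma near_below_exists:
  assumes U [simp]: "U \<in> I" and near: "near c U" and c0: "0 \<le> c"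
    and V [simp]: "V \<in> I" and VU: "snest H V U" "d U (b U) (rp H V U) \<le> 3 * K"
  shows "\<exists>Y\<in>I. snest H Y U \<and> near (c + 10 * K) Y"
proof -
  note K1 = K_ge_1
  obtain q where q [simp]: "q \<in> X" and qV: "d V (pt H V q) (b V) \<le> C"
    and qr: "\<And>Z. Z \<in> I \<Longrightarrow> has_rho H V Z \<Longrightarrow> d Z (pt H Z q) (rp H V Z) \<le> C"
    using partial_realization_single[of V "b V"] by auto
  define B where "B = {Y \<in> I. snest H Y U \<and> 5 * K < d Y (pt H Y q) (b Y)}"
  have hVU: "has_rho H V U" using VU snest_has_rho by blast
  \<comment> \<open>The hypothesis on \<open>b U\<close> makes \<open>U\<close> itself good, as
    \<open>bad_domains\<close> requires of non-bad domains above bad ones.\<close>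
  have "d U (pt H U q) (b U) \<le> d U (pt H U q) (rp H V U) + d U (rp H V U) (b U)"
    using hVU by (intro d_triangle) simp_all
  then have qU: "d U (pt H U q) (b U) \<le> 5 * K"
    using qr[OF U hVU] VU(2) C_le_K K1 mdist_commute[of "hyp H U" "b U"] by simp
  have good: "d Z (pt H Z q) (b Z) \<le> 5 * K" if "Z \<in> I" "nest H Z U" "Z \<notin> B" for Z
    using that qU by (cases "Z = U") (auto simp: B_def snest_def)
  have outside: "d Z (b Z) (rp H Y Z) \<le> c + C"
    if YZ: "Y \<in> I" "snest H Y U" "Z \<in> I" "has_rho H Y Z" "\<not> nest H Z U" for Y Z
  proof -
    have no: "\<not> orth H Y Z" using YZ has_rho_iff by blast
    then have "\<not> orth H U Z" using orth_nest[of Z Y U] YZ by (auto simp: snest_def)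
    then have h: "has_rho H U Z" using YZ by (simp add: has_rho_iff)
    have "d Z (rp H Y Z) (rp H U Z) \<le> C"
      using has_rho_down(2)[of Z Y U] YZ h no by (simp add: snest_def)
    moreover have "d Z (b Z) (rp H Y Z) \<le> d Z (b Z) (rp H U Z) + d Z (rp H U Z) (rp H Y Z)"
      using YZ h by (intro d_triangle) simp_all
    ultimately show ?thesis using nearD[OF near YZ(3) h] mdist_commute[of "hyp H Z" "rp H Y Z"] by simp
  qed
  interpret bad_domains H C K b q "5 * K" B U
  proof unfold_locales
    show "d T (pt H T q) (b T) \<le> 5 * K" if "T \<in> I" "nest H T U" "T \<notin> B" for T
      using good that .
  qed (auto simp: B_def)
  show ?thesis
  proof (cases "B = {}")
    case True
    have "d Z (b Z) (rp H V Z) \<le> c + 10 * K" if Z: "Z \<in> I" "has_rho H V Z" for Z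
    proof (cases "nest H Z U")
      case nZ: True
      have "d Z (b Z) (rp H V Z) \<le> d Z (b Z) (pt H Z q) + d Z (pt H Z q) (rp H V Z)"
        using Z by (intro d_triangle) simp_all
      then show ?thesis
        using good[OF Z(1) nZ] True qr[OF Z] C_le_K K1 c0 mdist_commute[of "hyp H Z" "b Z"] by simp
    next
      case False
      then show ?thesis using outside[OF V VU(1) Z False] C_le_K K1 by linarith
    qed
    then show ?thesis using VU by (auto simp: near_def)
  next
    case False
    obtain Y where Y: "Y \<in> Bmax" "\<forall>Z\<in>B. \<not> lt Y Z" using extremal_bad_exists[OF False] by blast
    have YB: "Y \<in> I" "snest H Y U" using BmaxD(1)[OF Y(1)] unfolding B_def by auto
    have "d Z (b Z) (rp H Y Z) \<le> c + 10 * K" if Z: "Z \<in> I" "has_rho H Y Z" for Z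
    proof (cases "nest H Z U")
      case True
      show ?thesis using extremal_bad_near[OF Y Z] good[OF Z(1) True] K1 c0 by fastforce
    next
      case False
      then show ?thesis using outside[OF YB Z False] C_le_K K1 by linarith
    qed
    then show ?thesis using YB by (auto simp: near_def)
  qed
qed

text \<open>The same comparison inside the common orthogonal complement of \<open>\<U>\<close>, with
  \<open>q\<close> realizing \<open>V\<close> and \<open>\<U>\<close> together. A domain above a bad
  one may leave the complement; it is then good only up to \<open>C + c\<close>, through a member of
  \<open>\<U>\<close>, which explains the threshold \<open>5 * K + c\<close>.\<close>

lemma near_orthogonal_exists:
  assumes \<U>: "\<U> \<subseteq> I" "\<U> \<noteq> {}" and orthU: "\<And>U U'. U \<in> \<U> \<Longrightarrow> U' \<in> \<U> \<Longrightarrow> U \<noteq> U' \<Longrightarrow> orth H U U'"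
    and near: "\<And>U. U \<in> \<U> \<Longrightarrow> near c U" and c0: "0 \<le> c"
    and V [simp]: "V \<in> I" and VU: "\<And>U. U \<in> \<U> \<Longrightarrow> orth H V U"
  shows "\<exists>Y\<in>I. (\<forall>U\<in>\<U>. orth H Y U) \<and> near (c + 10 * K) Y"
proof -
  note K1 = K_ge_1
  have [simp]: "U \<in> \<U> \<Longrightarrow> U \<in> I" for U using \<U> by blast
  have UV: "orth H U V" if "U \<in> \<U>" for U using orth_sym[of V U] VU that by simp
  have "\<exists>q\<in>X. (\<forall>U\<in>insert V \<U>. \<forall>Z\<in>I. has_rho H U Z \<longrightarrow> d Z (pt H Z q) (rp H U Z) \<le> C)"
  proof (rule partial_realization_pt[of "insert V \<U>" b])
    show "orth H U U'" if "U \<in> insert V \<U>" "U' \<in> insert V \<U>" "U \<noteq> U'" for U U'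
      using that orthU VU UV by blast
  qed auto
  then obtain q where q [simp]: "q \<in> X"
    and qr: "\<And>U Z. U \<in> insert V \<U> \<Longrightarrow> Z \<in> I \<Longrightarrow> has_rho H U Z \<Longrightarrow> d Z (pt H Z q) (rp H U Z) \<le> C" by blast
  obtain S where S [simp]: "S \<in> I" and top: "\<And>V. V \<in> I \<Longrightarrow> nest H V S" using top_index by blast
  define B where "B = {Y \<in> I. (\<forall>U\<in>\<U>. orth H Y U) \<and> 5 * K + c < d Y (pt H Y q) (b Y)}"
  have outside: "d Z (b Z) (rp H Y Z) \<le> c + 2 * C" "d Z (pt H Z q) (b Z) \<le> C + c"
    if Y: "Y \<in> I" "\<forall>U\<in>\<U>. orth H Y U" and Z: "Z \<in> I" "has_rho H Y Z" "\<not> (\<forall>U\<in>\<U>. orth H Z U)" for Y Z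
  proof -
    obtain U where U: "U \<in> \<U>" "\<not> orth H Z U" using Z by blast
    have [simp]: "U \<in> I" using U by simp
    have UY: "orth H U Y" using orth_sym[of Y U] U Y by simp
    have "\<not> orth H Y Z" "\<not> orth H Z Y" using Y Z has_rho_iff orth_sym by blast+
    then have "\<not> nest H Z U" using orth_nest[of Y Z U] Y Z UY by auto
    moreover have "\<not> orth H U Z" using U orth_sym[of U Z] Z by auto
    ultimately have h: "has_rho H U Z" using Z by (simp add: has_rho_iff)
    have "d Z (rp H U Z) (rp H Y Z) \<le> 2 * C" using UY h Y Z by (intro rp_orth_close) auto
    moreover have "d Z (b Z) (rp H Y Z) \<le> d Z (b Z) (rp H U Z) + d Z (rp H U Z) (rp H Y Z)"
      using Y Z h by (intro d_triangle) simp_all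
    moreover have n: "d Z (b Z) (rp H U Z) \<le> c" using nearD[OF near[OF U(1)] Z(1) h] .
    ultimately show "d Z (b Z) (rp H Y Z) \<le> c + 2 * C" by linarith
    have "d Z (pt H Z q) (b Z) \<le> d Z (pt H Z q) (rp H U Z) + d Z (rp H U Z) (b Z)"
      using Z h by (intro d_triangle) simp_all
    then show "d Z (pt H Z q) (b Z) \<le> C + c"
      using n qr[of U Z] U Z h mdist_commute[of "hyp H Z" "b Z"] by simp
  qed
  interpret bad_domains H C K b q "5 * K + c" B S
  proof unfold_locales
    show "snest H Y S" if "Y \<in> B" for Y
    proof -
      have Y: "Y \<in> I" "\<forall>U\<in>\<U>. orth H Y U" using that by (auto simp: B_def)
      obtain U where U: "U \<in> \<U>" using \<U> by blast
      then have "Y \<noteq> S" using Y nest_not_orth[of U S] top[of U] orth_sym[of S U] by auto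
      then show ?thesis using top[OF Y(1)] by (simp add: snest_def)
    qed
    show "d T (pt H T q) (b T) \<le> 5 * K + c" if "Y \<in> B" "T \<in> I" "snest H Y T" "T \<notin> B" for Y T
    proof (cases "\<forall>U\<in>\<U>. orth H T U")
      case True
      then show ?thesis using that by (auto simp: B_def)
    next
      case False
      have "d T (pt H T q) (b T) \<le> C + c"
        using that False by (intro outside(2)[of Y T]) (auto simp: B_def snest_has_rho)
      then show ?thesis using C_le_K K1 by linarith
    qed
  qed (use c0 in \<open>auto simp: B_def\<close>)
  show ?thesis
  proof (cases "B = {}")
    case True
    have "d Z (b Z) (rp H V Z) \<le> c + 10 * K" if Z: "Z \<in> I" "has_rho H V Z" for Z
    proof (cases "\<forall>U\<in>\<U>. orth H Z U")
      case oZ: True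
      then have "d Z (pt H Z q) (b Z) \<le> 5 * K + c" using True Z unfolding B_def by auto
      moreover have "d Z (b Z) (rp H V Z) \<le> d Z (b Z) (pt H Z q) + d Z (pt H Z q) (rp H V Z)"
        using Z by (intro d_triangle) simp_all
      ultimately show ?thesis
        using qr[of V Z] Z C_le_K K1 c0 mdist_commute[of "hyp H Z" "b Z"] by simp
    next
      case False
      then show ?thesis using outside(1)[of V Z] VU Z C_le_K K1 by fastforce
    qed
    then show ?thesis using V VU unfolding near_def by blast
  next
    case False
    obtain Y where Y: "Y \<in> Bmax" "\<forall>Z\<in>B. \<not> lt Y Z" using extremal_bad_exists[OF False] by blast
    have YB: "Y \<in> I" "\<forall>U\<in>\<U>. orth H Y U" using BmaxD(1)[OF Y(1)] unfolding B_def by auto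
    have "d Z (b Z) (rp H Y Z) \<le> c + 10 * K" if Z: "Z \<in> I" "has_rho H Y Z" for Z
    proof (cases "\<forall>U\<in>\<U>. orth H Z U")
      case True
      then have "d Z (pt H Z q) (b Z) \<le> 5 * K + c" if "Z \<notin> B" using that Z unfolding B_def by auto
      then show ?thesis using extremal_bad_near[OF Y Z] K1 c0 by fastforce
    next
      case False
      then show ?thesis using outside(1)[OF YB Z False] C_le_K K1 by linarith
    qed
    then show ?thesis using YB by (auto simp: near_def)
  qed
qed

definition family :: "real \<Rightarrow> 'i set \<Rightarrow> bool" where
  "family c \<U> \<longleftrightarrow> finite \<U> \<and> \<U> \<subseteq> I \<and> \<U> \<noteq> {} \<and>
     (\<forall>U\<in>\<U>. \<forall>U'\<in>\<U>. U \<noteq> U' \<longrightarrow> orth H U U') \<and> (\<forall>U\<in>\<U>. near c U)"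

text \<open>Neither refinement applies. The bound \<open>3 * K\<close> is what
  \<open>bad_nested_close\<close> gives for \<open>s = C\<close>, so domains below a member of the
  family are well realized.\<close>

definition complete :: "'i set \<Rightarrow> bool" where
  "complete \<U> \<longleftrightarrow> (\<forall>V\<in>I. \<exists>U\<in>\<U>. \<not> orth H V U) \<and>
     (\<forall>U\<in>\<U>. \<forall>V\<in>I. snest H V U \<longrightarrow> 3 * K < d U (b U) (rp H V U))"

text \<open>Each member counts \<open>n + 1\<close> minus its level: a new orthogonal member adds at
  least 1, and replacing a member by a properly nested one raises its summand. Orthogonality passes
  to nested domains, so the replacement stays orthogonal to the other members.\<close>

lemma family_progress:
  assumes fam: "family c \<U>" and "\<not> complete \<U>" "0 \<le> c"
    and lev: "\<And>W. W \<in> I \<Longrightarrow> lev W \<le> n" "\<And>V W. V \<in> I \<Longrightarrow> W \<in> I \<Longrightarrow> snest H V W \<Longrightarrow> lev V < lev W"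
  shows "\<exists>\<U>'. family (c + 10 * K) \<U>' \<and> (\<Sum>U\<in>\<U>. n + 1 - lev U) < (\<Sum>U\<in>\<U>'. n + 1 - lev U :: nat)"
proof -
  have fin: "finite \<U>" and sub: "\<U> \<subseteq> I" and ne: "\<U> \<noteq> {}"
    and ort: "\<And>U U'. U \<in> \<U> \<Longrightarrow> U' \<in> \<U> \<Longrightarrow> U \<noteq> U' \<Longrightarrow> orth H U U'"
    and nea: "\<And>U. U \<in> \<U> \<Longrightarrow> near c U"
    using fam unfolding family_def by auto
  have nea': "near (c + 10 * K) U" if "U \<in> \<U>" for U
    using nea[OF that] K_ge_1 by (elim near_mono) simp
  have add: "family (c + 10 * K) (insert Y \<U>0)"
    if "\<U>0 \<subseteq> \<U>" "Y \<in> I" "near (c + 10 * K) Y" "\<And>U. U \<in> \<U>0 \<Longrightarrow> orth H Y U" for Y \<U>0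
  proof -
    have "orth H U Y" if "U \<in> \<U>0" for U using \<open>\<U>0 \<subseteq> \<U>\<close> sub that orth_sym \<open>Y \<in> I\<close> \<open>U \<in> \<U>0 \<Longrightarrow> orth H Y U\<close> by blast
    then show ?thesis
      unfolding family_def using that(2-4) subsetD[OF that(1)] finite_subset[OF that(1) fin] sub ort nea'
      by auto
  qed
  consider V where "V \<in> I" "\<And>U. U \<in> \<U> \<Longrightarrow> orth H V U"
    | U V where "U \<in> \<U>" "V \<in> I" "snest H V U" "d U (b U) (rp H V U) \<le> 3 * K"
    using assms(2) unfolding complete_def by (meson not_le)
  then show ?thesis
  proof cases
    case 1
    obtain Y where Y: "Y \<in> I" "\<forall>U\<in>\<U>. orth H Y U" "near (c + 10 * K) Y"
      using near_orthogonal_exists[OF sub ne ort nea assms(3) 1] by blast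
    have "Y \<notin> \<U>" using Y orth_irrefl by blast
    then have "(\<Sum>U\<in>\<U>. n + 1 - lev U) < (\<Sum>U\<in>insert Y \<U>. n + 1 - lev U)"
      using fin lev(1)[OF Y(1)] by simp
    then show ?thesis using add[of \<U> Y] Y by blast
  next
    case 2
    have Ui: "U \<in> I" using 2 sub by blast
    obtain Y where Y: "Y \<in> I" "snest H Y U" "near (c + 10 * K) Y"
      using near_below_exists[OF Ui nea[OF 2(1)] assms(3) 2(2-4)] by blast
    have oY: "orth H Y U'" if "U' \<in> \<U> - {U}" for U'
    proof -
      have "orth H U U'" "U' \<in> I" using ort[of U U'] that 2(1) sub by blast+
      then show ?thesis using orth_nest[of U' Y U] Y Ui by (auto simp: snest_def)
    qed
    then have YU: "Y \<notin> \<U> - {U}" using orth_irrefl Y(1) by blast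
    have "(\<Sum>U\<in>\<U>. n + 1 - lev U) = (n + 1 - lev U) + (\<Sum>U\<in>\<U> - {U}. n + 1 - lev U)"
      using fin 2(1) by (rule sum.remove)
    moreover have "(\<Sum>U\<in>insert Y (\<U> - {U}). n + 1 - lev U) = (n + 1 - lev Y) + (\<Sum>U\<in>\<U> - {U}. n + 1 - lev U)"
      using fin YU by (intro sum.insert) auto
    moreover have "n + 1 - lev U < n + 1 - lev Y" using lev(1)[OF Ui] lev(2)[OF Y(1) Ui Y(2)] by simp
    ultimately have "(\<Sum>U\<in>\<U>. n + 1 - lev U) < (\<Sum>U\<in>insert Y (\<U> - {U}). n + 1 - lev U)" by linarith
    moreover have "family (c + 10 * K) (insert Y (\<U> - {U}))" by (rule add) (use Y oY in auto)
    ultimately show ?thesis by blast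
  qed
qed

lemma family_exists:
  assumes lev: "\<And>W. W \<in> I \<Longrightarrow> lev W \<le> n" "\<And>V W. V \<in> I \<Longrightarrow> W \<in> I \<Longrightarrow> snest H V W \<Longrightarrow> lev V < lev W"
  shows "\<exists>\<U>. family (10 * K * real k) \<U> \<and> (complete \<U> \<or> k \<le> (\<Sum>U\<in>\<U>. n + 1 - lev U :: nat))"
proof (induction k)
  case 0
  obtain S where S: "S \<in> I" and top: "\<And>V. V \<in> I \<Longrightarrow> nest H V S" using top_index by blast
  \<comment> \<open>The greatest domain has no rho set in any other domain, so the condition is
    empty.\<close>
  have "near 0 S" using top S by (auto simp: near_def has_rho_iff)
  then have "family 0 {S}" using S by (simp add: family_def)
  then show ?case by auto
next
  case (Suc k)
  then obtain \<U> where \<U>: "family (10 * K * real k) \<U>" "complete \<U> \<or> k \<le> (\<Sum>U\<in>\<U>. n + 1 - lev U)" by blast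
  have eq: "10 * K * real (Suc k) = 10 * K * real k + 10 * K" by (simp add: algebra_simps)
  show ?case
  proof (cases "complete \<U>")
    case True
    have "family (10 * K * real (Suc k)) \<U>"
      using \<U>(1) near_mono[of "10 * K * real k" _ "10 * K * real k + 10 * K"] K_ge_1
      unfolding family_def eq by simp
    then show ?thesis using True by blast
  next
    case False
    have "0 \<le> 10 * K * real k" using K_ge_1 by simp
    from family_progress[where lev=lev and n=n, OF \<U>(1) False this lev]
    obtain \<U>' where "family (10 * K * real k + 10 * K) \<U>'"
      "(\<Sum>U\<in>\<U>. n + 1 - lev U) < (\<Sum>U\<in>\<U>'. n + 1 - lev U)" by blast
    then show ?thesis using \<U>(2) False unfolding eq by (metis Suc_leI order_le_less_trans)
  qed
qed

text \<open>Every domain is a member, lies properly below one, or receives a rho set from one; the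
  three cases are settled by partial realization, completeness and \<open>near\<close>.\<close>

lemma complete_family_realizes:
  assumes fam: "family c \<U>" and com: "complete \<U>" and c: "0 \<le> c"
  shows "\<exists>x\<in>X. \<forall>V\<in>I. d V (pt H V x) (b V) \<le> c + 3 * K"
proof -
  have sub: "\<U> \<subseteq> I" and ort: "\<And>U U'. U \<in> \<U> \<Longrightarrow> U' \<in> \<U> \<Longrightarrow> U \<noteq> U' \<Longrightarrow> orth H U U'"
    and nea: "\<And>U. U \<in> \<U> \<Longrightarrow> near c U"
    using fam unfolding family_def by auto
  have subI [simp]: "U \<in> \<U> \<Longrightarrow> U \<in> I" for U using sub by blast
  obtain x where x [simp]: "x \<in> X" and xU: "\<And>U. U \<in> \<U> \<Longrightarrow> d U (pt H U x) (b U) \<le> C"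
    and xr: "\<And>U V. U \<in> \<U> \<Longrightarrow> V \<in> I \<Longrightarrow> has_rho H U V \<Longrightarrow> d V (pt H V x) (rp H U V) \<le> C"
    by (rule partial_realization_pt[of \<U> b]) (use sub ort in auto)
  have "d V (pt H V x) (b V) \<le> c + 3 * K" if V [simp]: "V \<in> I" for V
  proof -
    obtain U where U: "U \<in> \<U>" "\<not> orth H V U" using com V unfolding complete_def by blast
    have [simp]: "U \<in> I" using U by simp
    consider "V = U" | "snest H V U" | "has_rho H U V"
      using U(2) orth_sym[of U V] by (auto simp: has_rho_iff snest_def)
    then show ?thesis
    proof cases
      case 1
      then show ?thesis using xU[OF U(1)] C_le_K K_ge_1 c by simp
    next
      case 2
      have "3 * K < d U (b U) (rp H V U)" using com U 2 unfolding complete_def by simp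
      then have "\<not> 3 * K < d V (pt H V x) (b V)"
        using bad_nested_close[OF _ _ 2 _ xU[OF U(1)]] C_le_K by force
      then show ?thesis using c by simp
    next
      case 3
      have "d V (pt H V x) (b V) \<le> d V (pt H V x) (rp H U V) + d V (rp H U V) (b V)"
        using 3 by (intro d_triangle) simp_all
      then show ?thesis
        using xr[OF U(1) V 3] nearD[OF nea[OF U(1)] V 3] C_le_K K_ge_1 mdist_commute[of "hyp H V" "b V"] by simp
    qed
  qed
  then show ?thesis using x by blast
qed

end

theorem (in coarse_hhs) realization:
  "\<exists>\<theta>\<ge>0. \<forall>b. consistent_pts K b \<longrightarrow> (\<exists>x\<in>X. \<forall>V\<in>I. d V (pt H V x) (b V) \<le> \<theta>)"
proof -
  define K' where "K' = max C K"
  obtain lev :: "'i \<Rightarrow> nat" and n where lev: "\<And>W. W \<in> I \<Longrightarrow> lev W \<le> n"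
    "\<And>V W. V \<in> I \<Longrightarrow> W \<in> I \<Longrightarrow> snest H V W \<Longrightarrow> lev V < lev W" using level_function by blast
  obtain N where N: "\<forall>\<V>. finite \<V> \<longrightarrow> \<V> \<subseteq> I \<longrightarrow>
      (\<forall>V\<in>\<V>. \<forall>W\<in>\<V>. V \<noteq> W \<longrightarrow> orth H V W) \<longrightarrow> card \<V> \<le> N"
    using orthogonal_family_bound ..
  \<comment> \<open>The measure of any family is at most \<open>N * (n + 1)\<close>, so a family
    obtained at stage \<open>k\<close> must be complete.\<close>
  define k where "k = Suc (N * (n + 1))"
  define \<theta> where "\<theta> = 10 * K' * real k + 3 * K'"
  have "\<exists>x\<in>X. \<forall>V\<in>I. d V (pt H V x) (b V) \<le> \<theta>" if b: "consistent_pts K b" for b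
  proof -
    have "consistent_pts K' b"
      using b unfolding consistent_on_def K'_def by (meson max.coboundedI2)
    then interpret coarse_tuple H C K' b
      by unfold_locales (simp_all add: K'_def)
    obtain \<U> where \<U>: "family (10 * K' * real k) \<U>" "complete \<U> \<or> k \<le> (\<Sum>U\<in>\<U>. n + 1 - lev U)"
      using family_exists[where lev=lev and n=n and k=k, OF lev] by blast
    have "(\<Sum>U\<in>\<U>. n + 1 - lev U) \<le> card \<U> * (n + 1)"
      using sum_bounded_above[of \<U> "\<lambda>U. n + 1 - lev U" "n + 1"] by simp
    also have "\<dots> \<le> N * (n + 1)"
      using \<U>(1) N[rule_format, of \<U>] unfolding family_def by (intro mult_le_mono1) simp
    finally have "complete \<U>" using \<U>(2) by (auto simp: k_def)
    then show ?thesis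
      unfolding \<theta>_def using K_ge_1 by (intro complete_family_realizes[OF \<U>(1)]) simp_all
  qed
  moreover have "0 \<le> \<theta>" using C_ge_1 by (simp add: \<theta>_def K'_def)
  ultimately show ?thesis by blast
qed

section \<open>Gate maps and standard product regions\<close>

context coarse_hhs
begin

lemma uniqueness_pt:
  "\<exists>t\<ge>0. \<forall>x\<in>X. \<forall>y\<in>X. (\<forall>V\<in>I. d V (pt H V x) (pt H V y) \<le> k) \<longrightarrow> mdist (ambient H) x y \<le> t"
proof -
  obtain t where t: "\<forall>x\<in>X. \<forall>y\<in>X.
      (\<forall>V\<in>I. \<exists>u\<in>prj H V x. \<exists>v\<in>prj H V y. d V u v \<le> k) \<longrightarrow> mdist (ambient H) x y \<le> t"
    using uniqueness by blast
  have "mdist (ambient H) x y \<le> max 0 t" if "x \<in> X" "y \<in> X" "\<forall>V\<in>I. d V (pt H V x) (pt H V y) \<le> k" for x y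
  proof -
    have "\<forall>V\<in>I. \<exists>u\<in>prj H V x. \<exists>v\<in>prj H V y. d V u v \<le> k"
      using that pt_in_prj by blast
    then show ?thesis using t that(1,2) by fastforce
  qed
  then show ?thesis by (intro exI[of _ "max 0 t"]) simp
qed

lemma coordinatewise_lipschitz:
  assumes "quasigeodesic_space q m" "1 \<le> q" "f \<in> mspace m \<rightarrow> X"
    and "\<And>x y V. x \<in> mspace m \<Longrightarrow> y \<in> mspace m \<Longrightarrow> mdist m x y \<le> 2 * q \<Longrightarrow> V \<in> I \<Longrightarrow>
      d V (pt H V (f x)) (pt H V (f y)) \<le> B"
  shows "\<exists>K K'. 0 \<le> K \<and> 0 \<le> K' \<and>
    (\<forall>x\<in>mspace m. \<forall>y\<in>mspace m. mdist (ambient H) (f x) (f y) \<le> K * mdist m x y + K')"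
proof -
  obtain t where "\<forall>x\<in>X. \<forall>y\<in>X. (\<forall>V\<in>I. d V (pt H V x) (pt H V y) \<le> B) \<longrightarrow> mdist (ambient H) x y \<le> t"
    using uniqueness_pt by blast
  then have born: "mdist (ambient H) (f x) (f y) \<le> t"
    if "x \<in> mspace m" "y \<in> mspace m" "mdist m x y \<le> 2 * q" for x y
    using assms(3,4) that by (simp add: Pi_iff)
  show ?thesis by (rule quasigeodesic_bornologous_lipschitz[OF assms(1-3) born])
qed

section \<open>Product regions and points with prescribed inner coordinates\<close>

definition product_tuple :: "'i \<Rightarrow> ('i \<Rightarrow> 'h) \<Rightarrow> ('i \<Rightarrow> 'h) \<Rightarrow> 'i \<Rightarrow> 'h" where
  "product_tuple U b e V = (if nest H V U then b V else if orth H V U then e V else rp H U V)"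

text \<open>Domains nested in \<open>U\<close> are orthogonal to domains orthogonal to
  \<open>U\<close>, so \<open>b\<close> and \<open>e\<close> never interact. Two rho coordinates are
  compared with a partial realization \<open>x\<close> of \<open>U\<close>. If only \<open>W\<close>
  carries one, the rho point of the other domain in \<open>W\<close> is close to that of
  \<open>U\<close>.\<close>

lemma product_tuple_consistent:
  assumes U [simp]: "U \<in> I" and b: "consistent_on (nested_in H U) K b" and e: "consistent_on (orth_to H U) K e"
    and K: "3 * C \<le> K"
  shows "consistent_pts K (product_tuple U b e)"
proof -
  let ?t = "product_tuple U b e"
  have C: "0 \<le> C" "C \<le> K" "2 * C \<le> K" using C_ge_1 K by auto
  have tb: "?t V = b V" if "nest H V U" for V using that by (simp add: product_tuple_def)
  have te: "?t V = e V" if "orth H V U" "V \<in> I" for V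
    using that nest_not_orth[of V U] by (auto simp: product_tuple_def)
  have tr: "?t V = rp H U V" if "has_rho H U V" "V \<in> I" for V
    using that orth_sym[of V U] by (auto simp: product_tuple_def has_rho_iff)
  have tri: "nest H V U \<or> orth H V U \<or> has_rho H U V" if "V \<in> I" for V
    using that orth_sym[of U V] by (auto simp: has_rho_iff)
  have no_mix: "orth H V W" if "nest H V U" "orth H W U" "V \<in> I" "W \<in> I" for V W
    using that orth_sym[of W U] orth_nest[of W V U] by auto
  have close: "d W (?t W) (rp H V W) \<le> K"
    if V: "V \<in> I" "nest H V U \<or> orth H V U" and W: "W \<in> I" "has_rho H U W" "has_rho H V W" for V W
    using V(2)
  proof
    assume "nest H V U"
    moreover have "\<not> orth H V W" using V W has_rho_iff by blast
    ultimately have "d W (rp H V W) (rp H U W) \<le> C" using has_rho_down(2)[of W V U] V W by simp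
    then show ?thesis using C W tr mdist_commute[of "hyp H W" "rp H U W"] by simp
  next
    assume "orth H V U"
    then have "d W (rp H V W) (rp H U W) \<le> 2 * C" using rp_orth_close V W by simp
    then show ?thesis using C W tr mdist_commute[of "hyp H W" "rp H U W"] by simp
  qed
  obtain u where "u \<in> M U" using M_nonempty[OF U] by blast
  then obtain x where x [simp]: "x \<in> X"
    and xr: "\<And>V. V \<in> I \<Longrightarrow> has_rho H U V \<Longrightarrow> d V (pt H V x) (rp H U V) \<le> C"
    using partial_realization_single[OF U] by metis
  have x_rp: "d W (?t W) (rp H V W) \<le> C + d W (pt H W x) (rp H V W)"
    if "V \<in> I" "W \<in> I" "has_rho H U W" "has_rho H V W" for V W
    using xr[of W] that tr d_triangle[of "rp H U W" W "pt H W x" "rp H V W"] mdist_commute[of "hyp H W" "rp H U W"] by simp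
  show ?thesis
    unfolding consistent_on_def
  proof (intro conjI ballI impI)
    fix V assume V: "V \<in> I"
    show "?t V \<in> M V"
      using tri[OF V] b e tb te tr V by (auto simp: consistent_on_def nested_in_def orth_to_def)
  next
    fix V W assume V: "V \<in> I" and W: "W \<in> I" and t: "transverse H V W"
    note h = transverse_has_rho[OF t] transverse_has_rho[OF transverse_commute[OF V W t]]
    have no: "\<not> orth H V W" "\<not> orth H W V" using h V W has_rho_iff by blast+
    consider "has_rho H U V" "has_rho H U W" | "has_rho H U W" "nest H V U \<or> orth H V U"
      | "has_rho H U V" "nest H W U \<or> orth H W U" | "nest H V U" "nest H W U" | "orth H V U" "orth H W U"
      using tri[OF V] tri[OF W] no no_mix V W by blast
    then show "d W (?t W) (rp H V W) \<le> K \<or> d V (?t V) (rp H W V) \<le> K"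
    proof cases
      case 1
      then show ?thesis using cons_transverse[OF V W x t] x_rp[of V W] x_rp[of W V] h V W C by force
    next
      case 2
      then show ?thesis using close[OF V _ W] h by blast
    next
      case 3
      then show ?thesis using close[OF W _ V] h by blast
    next
      case 4
      then show ?thesis using b t tb V W by (simp add: consistent_on_def nested_in_def)
    next
      case 5
      then show ?thesis using e t te V W by (simp add: consistent_on_def orth_to_def)
    qed
  next
    fix V W assume V: "V \<in> I" and W: "W \<in> I" and s: "snest H V W"
    note h = snest_has_rho[OF s]
    have n: "nest H V W" using s by (simp add: snest_def)
    have no: "\<not> orth H V W" using h V W has_rho_iff by blast
    \<comment> \<open>Below a \<open>W\<close> that is nested in or orthogonal to \<open>U\<close>,
      the domain \<open>V\<close> is so too; hence a rho coordinate at \<open>V\<close> forces one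
      at \<open>W\<close>.\<close>
    consider "has_rho H U V" "has_rho H U W" | "has_rho H U W" "nest H V U \<or> orth H V U"
      | "nest H V U" "nest H W U" | "orth H V U" "orth H W U"
      using tri[OF V] tri[OF W] nest_trans[OF V W U n] orth_nest[OF U V W n] V W by blast
    then show "d W (?t W) (rp H V W) \<le> K \<or> d V (?t V) (mp H W V (?t W)) \<le> K"
    proof cases
      case 1
      show ?thesis
      proof (cases "d W (pt H W x) (rp H V W) \<le> 2 * C")
        case True
        then show ?thesis using x_rp[OF V W 1(2) h] K by linarith
      next
        case False
        \<comment> \<open>Away from the rho point of \<open>V\<close>, bounded geodesic image makes
          \<open>mp\<close> nearly equal at \<open>rp H U W\<close> and at the coordinate of
          \<open>x\<close>, so consistency of \<open>x\<close> passes to the rho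
          coordinates.\<close>
        have far: "C + d W (rp H U W) (pt H W x) < d W (pt H W x) (rp H V W)"
          using False xr[OF W 1(2)] mdist_commute[of "hyp H W" "rp H U W"] by simp
        have 2: "d V (mp H W V (rp H U W)) (mp H W V (pt H W x)) \<le> C"
          using bgi_far[OF V W s _ _ far] W 1 by simp
        have 3: "d V (pt H V x) (mp H W V (pt H W x)) \<le> C"
          using cons_nested[OF V W x s] False C_ge_1 by auto
        have "d V (rp H U V) (mp H W V (rp H U W)) \<le> d V (rp H U V) (pt H V x)
            + d V (pt H V x) (mp H W V (pt H W x)) + d V (mp H W V (pt H W x)) (mp H W V (rp H U W))"
          using V W s 1 by (intro mdist_triangle3) simp_all
        then have "d V (rp H U V) (mp H W V (rp H U W)) \<le> K"
          using 2 3 xr[OF V 1(1)] K mdist_commute[of "hyp H V" "rp H U V"]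
            mdist_commute[of "hyp H V" "mp H W V (pt H W x)"] by simp
        then show ?thesis using tr V W 1 by simp
      qed
    next
      case 2
      then show ?thesis using close[OF V _ W] h by blast
    next
      case 3
      then show ?thesis using b s tb V W by (simp add: consistent_on_def nested_in_def)
    next
      case 4
      then show ?thesis using e s te V W by (simp add: consistent_on_def orth_to_def)
    qed
  qed
qed

definition choice :: "('i \<Rightarrow> 'h set) \<Rightarrow> 'i \<Rightarrow> 'h" where
  "choice e V = (SOME u. u \<in> e V)"

lemma choice_in: "bounded_piece H \<kappa> V (e V) \<Longrightarrow> choice e V \<in> e V"
  unfolding choice_def bounded_piece_def by (simp add: some_in_eq)

lemma consistent_tuple_choice:
  assumes ct: "consistent_tuple H \<kappa> J e" and \<kappa>: "0 \<le> \<kappa>" and J: "J \<subseteq> I"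
  shows "consistent_on J (2 * \<kappa> + C + 1) (choice e)"
proof -
  have bp: "bounded_piece H \<kappa> V (e V)" if "V \<in> J" for V
    using ct that unfolding consistent_tuple_def by blast
  have ci: "choice e V \<in> e V" if "V \<in> J" for V
    using bp[OF that] by (rule choice_in)
  have JI: "V \<in> I" if "V \<in> J" for V using J that by blast
  have cm: "choice e V \<in> M V" if "V \<in> J" for V
    using ci[OF that] bounded_pieceD(2)[OF bp[OF that] \<kappa>] by blast
  have rho: "d W (choice e W) (rp H V W) \<le> 2 * \<kappa> + C + 1"
    if "V \<in> J" "W \<in> J" "has_rho H V W" "hdist H W (e W) (rho_set H V W) \<le> ennreal \<kappa>" for V W
  proof -
    have "all_within (hyp H W) (\<kappa> + \<kappa> + C + 1) (e W) (rho_set H V W)"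
      using rho_diam[OF JI[OF that(1)] JI[OF that(2)] that(3)] rho_subset[OF JI[OF that(1)] JI[OF that(2)] that(3)]
        bounded_pieceD(2,3)[OF bp[OF that(2)] \<kappa>] \<kappa>
      by (intro all_within_of_msetdist[OF that(4)]) (auto simp: all_within_def)
    then show ?thesis
      using ci[OF that(2)] rp_in_rho[OF JI[OF that(1)] JI[OF that(2)] that(3)] by (auto simp: all_within_def)
  qed
  show ?thesis
    unfolding consistent_on_def
  proof (intro conjI ballI impI)
    fix V W assume VW: "V \<in> J" "W \<in> J"
    {
      assume t: "transverse H V W"
      have "min (hdist H W (e W) (rho_set H V W)) (hdist H V (e V) (rho_set H W V)) \<le> ennreal \<kappa>"
        using ct VW t unfolding consistent_tuple_def by blast
      then show "d W (choice e W) (rp H V W) \<le> 2 * \<kappa> + C + 1 \<or> d V (choice e V) (rp H W V) \<le> 2 * \<kappa> + C + 1"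
        using rho[OF VW transverse_has_rho[OF t]]
          rho[OF VW(2,1) transverse_has_rho[OF transverse_commute[OF JI[OF VW(1)] JI[OF VW(2)] t]]]
        unfolding min_le_iff_disj by blast
    next
      assume s: "snest H V W"
      have 1: "min (hdist H W (e W) (rho_set H V W)) (hdiam H V (e V \<union> rho_image H W V (e W))) \<le> ennreal \<kappa>"
        using ct VW s unfolding consistent_tuple_def by blast
      have "mp H W V (choice e W) \<in> rho_image H W V (e W)"
        using mp_in_rho[OF JI[OF VW(1)] JI[OF VW(2)] s cm[OF VW(2)]] ci[OF VW(2)] unfolding rho_image_def by blast
      then have "d V (choice e V) (mp H W V (choice e W)) \<le> \<kappa>"
        if "hdiam H V (e V \<union> rho_image H W V (e W)) \<le> ennreal \<kappa>"
        using mdiam_leD[OF that _ _ \<kappa>] ci[OF VW(1)] by blast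
      then show "d W (choice e W) (rp H V W) \<le> 2 * \<kappa> + C + 1 \<or> d V (choice e V) (mp H W V (choice e W)) \<le> 2 * \<kappa> + C + 1"
        using 1 rho[OF VW snest_has_rho[OF s]] \<kappa> C_ge_1 unfolding min_le_iff_disj by force
    }
  qed (rule cm)
qed

lemma F_copy_subset: "F_copy H \<kappa> \<theta> U e \<subseteq> X"
  by (auto simp: F_copy_def realizes_def)

lemma F_copy_outside:
  assumes U: "U \<in> I" and e: "e \<in> E_tuples H \<kappa> U" and pos: "0 \<le> \<kappa>" "0 \<le> \<theta>"
    and z: "z \<in> F_copy H \<kappa> \<theta> U e" and V: "V \<in> I" "\<not> nest H V U"
  shows "d V (pt H V z) (product_tuple U b (choice e) V) \<le> \<theta> + \<kappa> + 2 * C + 1"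
proof -
  have zX: "z \<in> X" using z F_copy_subset by blast
  define A where "A = (if orth H V U then e V else rho_set H U V)"
  have A: "hdist H V (prj H V z) A \<le> ennreal \<theta>"
    using z V unfolding F_copy_def realizes_def A_def by force
  have *: "A \<subseteq> M V \<and> (\<forall>u\<in>A. \<forall>v\<in>A. d V u v \<le> \<kappa> + C) \<and> product_tuple U b (choice e) V \<in> A"
  proof (cases "orth H V U")
    case True
    then have bp: "bounded_piece H \<kappa> V (e V)"
      using e V unfolding E_tuples_def consistent_tuple_def orth_to_def by blast
    show ?thesis
      using bounded_pieceD(2,3)[OF bp pos(1)] choice_in[of \<kappa> V e, OF bp] True V C_ge_1
      by (force simp: A_def product_tuple_def)
  next
    case False
    then have h: "has_rho H U V" using V orth_sym[OF U V(1)] U by (auto simp: has_rho_iff)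
    show ?thesis
      using rho_subset[OF U V(1) h] rho_diam[OF U V(1) h] rp_in_rho[OF U V(1) h] False V pos
      by (force simp: A_def product_tuple_def all_within_def)
  qed
  have "all_within (hyp H V) (\<theta> + C + (\<kappa> + C) + 1) (prj H V z) A"
    using * prj_subset[OF V(1) zX] prj_diam[OF V(1) zX] pos
    by (intro all_within_of_msetdist[OF A]) (auto simp: all_within_def)
  then have "d V (pt H V z) (product_tuple U b (choice e) V) \<le> \<theta> + C + (\<kappa> + C) + 1"
    using * pt_in_prj[OF V(1) zX] by (simp add: all_within_def)
  then show ?thesis by simp
qed

text \<open>Inner coordinates of \<open>x\<close> and outer ones of \<open>e\<close> form a
  consistent tuple, whose realization lies in the copy. The bound \<open>\<theta>0\<close> precedes
  \<open>\<theta>\<close>, \<open>U\<close>, \<open>e\<close> and \<open>x\<close>, so that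
  \<open>\<theta>\<close> can be chosen uniformly.\<close>

lemma F_copy_realization:
  assumes \<kappa>: "0 \<le> \<kappa>" and prj_consistent: "\<And>x J. x \<in> X \<Longrightarrow> J \<subseteq> I \<Longrightarrow> consistent_tuple H \<kappa> J (\<lambda>V. prj H V x)"
  shows "\<exists>\<theta>0\<ge>0. \<forall>\<theta>\<ge>\<theta>0. \<forall>U\<in>I. \<forall>e\<in>E_tuples H \<kappa> U. \<forall>x\<in>X.
    \<exists>z\<in>F_copy H \<kappa> \<theta> U e. \<forall>V\<in>I. nest H V U \<longrightarrow> d V (pt H V z) (pt H V x) \<le> \<theta>0"
proof -
  define K where "K = 2 * \<kappa> + 3 * C + 1"
  obtain \<theta>0 where \<theta>0: "0 \<le> \<theta>0"
    "\<And>b. consistent_pts K b \<Longrightarrow> \<exists>x\<in>X. \<forall>V\<in>I. d V (pt H V x) (b V) \<le> \<theta>0"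
    using realization[of K] by metis
  have "\<exists>z\<in>F_copy H \<kappa> \<theta> U e. \<forall>V\<in>I. nest H V U \<longrightarrow> d V (pt H V z) (pt H V x) \<le> \<theta>0 + C"
    if \<theta>: "\<theta>0 \<le> \<theta>" and U: "U \<in> I" and e: "e \<in> E_tuples H \<kappa> U" and x: "x \<in> X" for \<theta> U e x
  proof -
    have mono: "consistent_on J K c" if "consistent_on J (2 * \<kappa> + C + 1) c" for J c
    proof -
      have "2 * \<kappa> + C + 1 \<le> K" using C_ge_1 by (simp add: K_def)
      then show ?thesis using that unfolding consistent_on_def by (meson order_trans)
    qed
    have e': "consistent_tuple H \<kappa> (orth_to H U) e" using e by (simp add: E_tuples_def)
    have n: "nested_in H U \<subseteq> I" "orth_to H U \<subseteq> I" by (auto simp: nested_in_def orth_to_def)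
    define b where "b = choice (\<lambda>V. prj H V x)"
    have b_prj: "b V \<in> prj H V x" if "V \<in> I" for V
      unfolding b_def choice_def using prj_nonempty[OF that x] by (simp add: some_in_eq)
    have "consistent_pts K (product_tuple U b (choice e))"
    proof (rule product_tuple_consistent[OF U])
      show "consistent_on (nested_in H U) K b"
        unfolding b_def by (intro mono consistent_tuple_choice prj_consistent x n \<kappa>)
      show "consistent_on (orth_to H U) K (choice e)"
        by (intro mono consistent_tuple_choice e' n \<kappa>)
      show "3 * C \<le> K" using \<kappa> by (simp add: K_def)
    qed
    then obtain z where z: "z \<in> X" "\<And>V. V \<in> I \<Longrightarrow> d V (pt H V z) (product_tuple U b (choice e) V) \<le> \<theta>0"
      using \<theta>0(2) by metis
    have "realizes H \<theta> (\<lambda>V. if nest H V U then prj H V x else if orth H V U then e V else rho_set H U V) z"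
      unfolding realizes_def
    proof (intro conjI ballI z)
      fix V assume V: "V \<in> I"
      let ?A = "if nest H V U then prj H V x else if orth H V U then e V else rho_set H U V"
      have "product_tuple U b (choice e) V \<in> ?A"
      proof -
        have "choice e V \<in> e V" if "orth H V U"
          using e' that V choice_in unfolding consistent_tuple_def orth_to_def by blast
        moreover have "rp H U V \<in> rho_set H U V" if "\<not> nest H V U" "\<not> orth H V U"
          using that orth_sym[OF U V] rp_in_rho[OF U V] by (auto simp: has_rho_iff[OF U V])
        ultimately show ?thesis using b_prj[OF V] by (simp add: product_tuple_def)
      qed
      then show "hdist H V (prj H V z) ?A \<le> ennreal \<theta>"
        by (rule msetdist_le[OF pt_in_prj[OF V z(1)]]) (use z(2)[OF V] \<theta> in simp)
    qed
    then have "z \<in> F_copy H \<kappa> \<theta> U e"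
      unfolding F_copy_def using prj_consistent[OF x n(1)] by blast
    moreover have "d V (pt H V z) (pt H V x) \<le> \<theta>0 + C" if V: "V \<in> I" "nest H V U" for V
    proof -
      have "d V (pt H V z) (pt H V x) \<le> d V (pt H V z) (b V) + d V (b V) (pt H V x)"
        using z V x b_prj[OF V(1)] prj_subset[OF V(1) x] by (intro d_triangle) auto
      then show ?thesis
        using z(2)[OF V(1)] V pt_prj_close[OF V(1) x b_prj[OF V(1)]] mdist_commute[of "hyp H V" "b V"]
        by (simp add: product_tuple_def)
    qed
    ultimately show ?thesis by blast
  qed
  then show ?thesis using \<theta>0(1) C_ge_1 by (intro exI[of _ "\<theta>0 + C"]) auto
qed

text \<open>Near-closest points rather than closest ones, since minima need not be attained.\<close>

definition nearest :: "'x set \<Rightarrow> real \<Rightarrow> 'i \<Rightarrow> 'h \<Rightarrow> 'h \<Rightarrow> bool" where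
  "nearest Y s V p a \<longleftrightarrow> a \<in> prj_image H V Y \<and> (\<forall>a'\<in>prj_image H V Y. d V p a \<le> d V p a' + s)"

lemma prj_image_subset: "Y \<subseteq> X \<Longrightarrow> V \<in> I \<Longrightarrow> prj_image H V Y \<subseteq> M V"
  using prj_subset unfolding prj_image_def by blast

lemma pt_in_prj_image: "Y \<subseteq> X \<Longrightarrow> V \<in> I \<Longrightarrow> y \<in> Y \<Longrightarrow> pt H V y \<in> prj_image H V Y"
  using pt_in_prj unfolding prj_image_def by blast

lemma prj_image_point:
  assumes "Y \<subseteq> X" "V \<in> I" "a \<in> prj_image H V Y"
  obtains y where "y \<in> Y" "y \<in> X" "d V (pt H V y) a \<le> C"
  using assms pt_prj_close unfolding prj_image_def by blast

text \<open>The slack \<open>2 * C + 1\<close> comes from \<open>closest_point_projectionD\<close>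
  for a set of diameter \<open>C\<close>; it is the slack of \<open>nearest\<close> in all gate
  arguments.\<close>

lemma projection_nearest:
  assumes "Y \<subseteq> X" "V \<in> I" "x \<in> X"
    and "a \<in> closest_point_projection (hyp H V) (prj_image H V Y) (prj H V x)"
  shows "nearest Y (2 * C + 1) V (pt H V x) a"
proof -
  have diam: "d V u v \<le> C" if "u \<in> prj H V x" "v \<in> prj H V x" for u v
    using prj_diam[OF assms(2,3)] that by (simp add: all_within_def)
  note * = closest_point_projectionD[OF assms(4) prj_subset[OF assms(2,3)] prj_image_subset[OF assms(1,2)] diam
      pt_in_prj[OF assms(2,3)]]
  have "prj_image H V Y \<noteq> {}" using assms(4) unfolding closest_point_projection_def by blast
  then show ?thesis unfolding nearest_def using * by blast
qed

lemma projection_nonempty: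
  assumes "Y \<subseteq> X" "Y \<noteq> {}" "V \<in> I" "x \<in> X"
  shows "closest_point_projection (hyp H V) (prj_image H V Y) (prj H V x) \<noteq> {}"
  using pt_in_prj_image[OF assms(1,3)] assms prj_nonempty
  by (intro closest_point_projection_nonempty) auto

text \<open>A nearest point for \<open>p'\<close> is nearest for \<open>p\<close> with slack
  enlarged by \<open>2 * d V p p'\<close>, which reduces the claim to a single centre.\<close>

lemma nearest_close:
  assumes qc: "quasiconvex (hyp H V) k (prj_image H V Y)" and k: "0 \<le> k" and V: "V \<in> I"
    and p: "p \<in> M V" "p' \<in> M V" and a: "nearest Y s V p a" "nearest Y s V p' a'"
  shows "d V a a' \<le> 2 * s + 4 * d V p p' + 4 * C + 2 * k + 6"
proof -
  let ?A = "prj_image H V Y"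
  have A: "?A \<subseteq> M V" using qc by (simp add: quasiconvex_def)
  have aA: "a \<in> ?A" "a' \<in> ?A" using a by (auto simp: nearest_def)
  have "d V a a' \<le> 2 * (s + 2 * d V p p') + 4 * C + 2 * k + 6"
  proof (rule near_closest_points_close[OF hyperbolic[OF V] qc _ k p(1) aA])
    fix v assume v: "v \<in> ?A"
    show "d V p a \<le> d V p v + (s + 2 * d V p p')" 
    proof -
      have "d V p a \<le> d V p v + s" using a(1) v by (simp add: nearest_def)
      then show ?thesis using mdist_nonneg[of "hyp H V" p p'] by linarith
    qed
    have "d V p a' \<le> d V p p' + d V p' a'" using p aA A by (intro d_triangle) auto
    moreover have "d V p' v \<le> d V p' p + d V p v" using p v A by (intro d_triangle) auto
    moreover have "d V p' a' \<le> d V p' v + s" using a(2) v by (simp add: nearest_def)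
    ultimately show "d V p a' \<le> d V p v + (s + 2 * d V p p')" using mdist_commute[of "hyp H V" p p'] by linarith
  qed (use C_ge_1 in simp)
  then show ?thesis by simp
qed

text \<open>In the nested case, if the geodesic towards the projection passes close to the rho point, then by
  quasiconvexity geodesics joining points of the image avoid it, and the whole lower image is bounded.\<close>

lemma nearest_consistent:
  assumes Y: "Y \<subseteq> X" and k: "0 \<le> k" and qc: "\<And>V. V \<in> I \<Longrightarrow> quasiconvex (hyp H V) k (prj_image H V Y)"
    and x [simp]: "x \<in> X" and s: "0 \<le> s" and a: "\<And>V. V \<in> I \<Longrightarrow> nearest Y s V (pt H V x) (a V)"
  shows "consistent_pts (10 * C + s + k + 10) a"
proof -
  let ?K = "10 * C + s + k + 10"
  note C1 = C_ge_1
  have aA: "a V \<in> prj_image H V Y" if "V \<in> I" for V using a[OF that] by (simp add: nearest_def)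
  have aM [simp]: "a V \<in> M V" if "V \<in> I" for V using aA prj_image_subset Y that by blast
  have one_side: "\<not> d V (pt H V x) (rp H W V) \<le> C"
    if V [simp]: "V \<in> I" and W [simp]: "W \<in> I" and t: "transverse H V W"
      and far: "?K < d W (a W) (rp H V W)" "?K < d V (a V) (rp H W V)" for V W
  proof
    assume le: "d V (pt H V x) (rp H W V) \<le> C"
    note h [simp] = transverse_has_rho[OF t] transverse_has_rho[OF transverse_commute[OF V W t]]
    \<comment> \<open>\<open>y\<close> copies \<open>a W\<close>, so it is away from the rho point
      in \<open>W\<close> and therefore near the rho point in \<open>V\<close>, as \<open>x\<close>
      is. Thus the image comes close to \<open>x\<close> in \<open>V\<close>, and so does
      \<open>a V\<close>.\<close>
    obtain y where y: "y \<in> Y" and [simp]: "y \<in> X" and ya: "d W (pt H W y) (a W) \<le> C"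
      using prj_image_point[OF Y W aA[OF W]] by blast
    have "d W (a W) (rp H V W) \<le> d W (a W) (pt H W y) + d W (pt H W y) (rp H V W)"
      by (intro d_triangle) simp_all
    then have "\<not> d W (pt H W y) (rp H V W) \<le> C"
      using far(1) ya C1 s k mdist_commute[of "hyp H W" "a W"] by simp
    then have yV: "d V (pt H V y) (rp H W V) \<le> C" using cons_transverse[OF V W _ t, of y] by auto
    have "d V (pt H V x) (a V) \<le> d V (pt H V x) (pt H V y) + s"
      using a[OF V] pt_in_prj_image[OF Y V y] by (simp add: nearest_def)
    moreover have "d V (pt H V x) (pt H V y) \<le> d V (pt H V x) (rp H W V) + d V (rp H W V) (pt H V y)"
      by (intro d_triangle) simp_all
    moreover have "d V (a V) (rp H W V) \<le> d V (a V) (pt H V x) + d V (pt H V x) (rp H W V)"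
      by (intro d_triangle) simp_all
    ultimately show False
      using far(2) le yV C1 s k mdist_commute[of "hyp H V" "a V" "pt H V x"]
        mdist_commute[of "hyp H V" "rp H W V" "pt H V y"] by linarith
  qed
  show ?thesis
    unfolding consistent_on_def
  proof (intro conjI ballI impI)
    fix V W assume V: "V \<in> I" and W: "W \<in> I" and t: "transverse H V W"
    show "d W (a W) (rp H V W) \<le> ?K \<or> d V (a V) (rp H W V) \<le> ?K"
      using one_side[OF V W t] one_side[OF W V transverse_commute[OF V W t]] cons_transverse[OF V W x t]
      by linarith
  next
    fix V W assume V [simp]: "V \<in> I" and W [simp]: "W \<in> I" and sn: "snest H V W"
    note h [simp] = snest_has_rho[OF sn] and sn [simp]
    show "d W (a W) (rp H V W) \<le> ?K \<or> d V (a V) (mp H W V (a W)) \<le> ?K"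
    proof (rule disjCI)
      assume "\<not> d V (a V) (mp H W V (a W)) \<le> ?K"
      then have farV: "?K < d V (a V) (mp H W V (a W))" by simp
      show "d W (a W) (rp H V W) \<le> ?K"
      proof (rule ccontr)
        assume "\<not> d W (a W) (rp H V W) \<le> ?K"
        then have farW: "?K < d W (a W) (rp H V W)" by simp
        \<comment> \<open>If the geodesic from \<open>x\<close> to \<open>a W\<close> avoided the
          rho point, the coordinates at \<open>V\<close> of \<open>x\<close> and of some
          \<open>y\<close> lying over \<open>a W\<close> would both be near
          \<open>mp H W V (a W)\<close>. The nearest point \<open>a V\<close> would then be near it
          too.\<close>
        have close_g: "\<exists>g\<in>M W. d W (pt H W x) g + d W g (a W) = d W (pt H W x) (a W) \<and> d W g (rp H V W) \<le> C"
        proof (rule ccontr)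
          assume no: "\<not> ?thesis"
          obtain y where y: "y \<in> Y" and [simp]: "y \<in> X" and ya: "d W (pt H W y) (a W) \<le> C"
            using prj_image_point[OF Y W aA[OF W]] by blast
          have 1: "d V (mp H W V (pt H W x)) (mp H W V (a W)) \<le> C"
            using bgi[OF V W sn, of "pt H W x" "a W"] no by auto
          have "\<not> d W (pt H W x) (rp H V W) \<le> C" using no by (auto dest!: bspec[of _ _ "pt H W x"])
          then have 2: "d V (pt H V x) (mp H W V (pt H W x)) \<le> C" using cons_nested[OF V W x sn] by blast
          have 3: "d V (mp H W V (pt H W y)) (mp H W V (a W)) \<le> C"
            using ya farW C1 s k by (intro bgi_far) simp_all
          have "d W (a W) (rp H V W) \<le> d W (a W) (pt H W y) + d W (pt H W y) (rp H V W)"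
            by (intro d_triangle) simp_all
          then have "\<not> d W (pt H W y) (rp H V W) \<le> C"
            using farW ya C1 s k mdist_commute[of "hyp H W" "a W"] by simp
          then have 4: "d V (pt H V y) (mp H W V (pt H W y)) \<le> C" using cons_nested[OF V W _ sn, of y] by auto
          let ?m = "mp H W V (a W)"
          have "d V (pt H V x) ?m \<le> 2 * C"
            using 1 2 d_triangle[of "pt H V x" V "mp H W V (pt H W x)" ?m] by simp
          moreover have "d V (pt H V y) ?m \<le> 2 * C"
            using 3 4 d_triangle[of "pt H V y" V "mp H W V (pt H W y)" ?m] by simp
          moreover have "d V (pt H V x) (pt H V y) \<le> d V (pt H V x) ?m + d V ?m (pt H V y)"
            by (intro d_triangle) simp_all
          moreover have "d V (pt H V x) (a V) \<le> d V (pt H V x) (pt H V y) + s"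
            using a[OF V] pt_in_prj_image[OF Y V y] by (simp add: nearest_def)
          moreover have "d V (a V) ?m \<le> d V (a V) (pt H V x) + d V (pt H V x) ?m"
            by (intro d_triangle) simp_all
          ultimately show False
            using farV C1 s k mdist_commute[of "hyp H V" "a V" "pt H V x"]
              mdist_commute[of "hyp H V" ?m "pt H V y"] by linarith
        qed
        then obtain g where g [simp]: "g \<in> M W" and gx: "d W (pt H W x) g + d W g (a W) = d W (pt H W x) (a W)"
          and grp: "d W g (rp H V W) \<le> C" by blast
        \<comment> \<open>Since \<open>g\<close> is on a geodesic to \<open>a W\<close>, the point
          \<open>a W\<close> is almost nearest for \<open>g\<close> too. As \<open>g\<close> is near
          the rho point and \<open>a W\<close> is far, the whole image keeps away from the rho
          point.\<close>
        have g_near: "d W g (a W) \<le> d W g a' + s" if a': "a' \<in> prj_image H W Y" for a'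
        proof -
          have "d W (pt H W x) (a W) \<le> d W (pt H W x) a' + s" using a[OF W] a' by (simp add: nearest_def)
          moreover have "d W (pt H W x) a' \<le> d W (pt H W x) g + d W g a'"
            using a' prj_image_subset[OF Y W] by (intro d_triangle) auto
          ultimately show ?thesis using gx by linarith
        qed
        have "d W (a W) (rp H V W) \<le> d W (a W) g + d W g (rp H V W)" by (intro d_triangle) simp_all
        then have g_far: "?K - C < d W g (a W)" using farW grp mdist_commute[of "hyp H W" "a W"] by simp
        \<comment> \<open>This time \<open>y\<close> copies \<open>a V\<close> instead of
          \<open>a W\<close>. The geodesic from \<open>a W\<close> to its coordinate in
          \<open>W\<close> stays near the image by quasiconvexity, hence off the rho point.\<close>
        obtain y where y: "y \<in> Y" and yX [simp]: "y \<in> X" and ya: "d V (pt H V y) (a V) \<le> C"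
          using prj_image_point[OF Y V aA[OF V]] by blast
        obtain G where G: "geodesic_segment (hyp H W) (a W) (pt H W y) G" "a W \<in> G" "pt H W y \<in> G" "G \<subseteq> M W"
          by (rule geodesic_exists[of W "a W" "pt H W y"]) simp_all
        have G_far: "\<not> d W v (rp H V W) \<le> C" if v: "v \<in> G" for v
        proof
          assume le: "d W v (rp H V W) \<le> C"
          have vM: "v \<in> M W" using v G by blast
          have "v \<in> mneighbourhood (hyp H W) k (prj_image H W Y)"
            using qc[OF W] aA[OF W] pt_in_prj_image[OF Y W y] G(1) v unfolding quasiconvex_def by blast
          then obtain a' where a': "a' \<in> prj_image H W Y" "d W v a' \<le> \<bar>k\<bar> + 1" by (rule mneighbourhoodD)
          have "d W g a' \<le> d W g (rp H V W) + d W (rp H V W) v + d W v a'"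
            using vM a' prj_image_subset[OF Y W] by (intro mdist_triangle3) auto
          then show False
            using g_near[OF a'(1)] g_far grp le a'(2) k s C1 mdist_commute[of "hyp H W" v] by simp
        qed
        have 1: "d V (mp H W V (pt H W y)) (mp H W V (a W)) \<le> C"
          using bgi_geodesic[OF V W sn G(1) G(3,2)] G_far by blast
        have 2: "d V (pt H V y) (mp H W V (pt H W y)) \<le> C"
          using cons_nested[OF V W yX sn] G_far[OF G(3)] by blast
        have "d V (a V) (mp H W V (a W)) \<le> d V (a V) (pt H V y) + d V (pt H V y) (mp H W V (pt H W y))
            + d V (mp H W V (pt H W y)) (mp H W V (a W))"
          by (intro mdist_triangle3) simp_all
        then show False using 1 2 ya farV C1 s k mdist_commute[of "hyp H V" "a V"] by simp
      qed
    qed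
  qed (rule aM)
qed

text \<open>Nearest points form a consistent tuple; its realization \<open>z\<close> has coordinates
  near those of \<open>Y\<close>, so hierarchical quasiconvexity supplies \<open>y\<close> near
  \<open>z\<close>. The bound covers every nearest \<open>a\<close>, since any two are
  close.\<close>

lemma hierarchically_quasiconvex_gate_point:
  assumes hq: "hierarchically_quasiconvex H Y" and ne: "Y \<noteq> {}"
  shows "\<exists>B\<ge>0. \<forall>x\<in>X. \<exists>y\<in>Y. \<forall>V\<in>I. \<forall>a. nearest Y (2 * C + 1) V (pt H V x) a \<longrightarrow> d V (pt H V y) a \<le> B"
proof -
  let ?s = "2 * C + 1"
  have Y: "Y \<subseteq> X" using hq by (simp add: hierarchically_quasiconvex_def)
  obtain k :: "real \<Rightarrow> real" where kall: "(\<forall>\<kappa>\<ge>0. 0 \<le> k \<kappa>) \<and>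
        (\<forall>U\<in>I. quasiconvex (hyp H U) (k 0) (prj_image H U Y)) \<and>
        (\<forall>\<kappa>\<ge>0. \<forall>x\<in>X. (\<forall>U\<in>I. hdist H U (prj H U x) (prj_image H U Y) \<le> ennreal \<kappa>) \<longrightarrow>
           msetdist (ambient H) {x} Y \<le> ennreal (k \<kappa>))"
    using hq unfolding hierarchically_quasiconvex_def by (elim conjE exE) simp
  have k: "\<And>\<kappa>. 0 \<le> \<kappa> \<Longrightarrow> 0 \<le> k \<kappa>"
    "\<And>U. U \<in> I \<Longrightarrow> quasiconvex (hyp H U) (k 0) (prj_image H U Y)"
    "\<And>\<kappa> x. 0 \<le> \<kappa> \<Longrightarrow> x \<in> X \<Longrightarrow> (\<And>U. U \<in> I \<Longrightarrow> hdist H U (prj H U x) (prj_image H U Y) \<le> ennreal \<kappa>) \<Longrightarrow>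
      msetdist (ambient H) {x} Y \<le> ennreal (k \<kappa>)"
    using kall by simp_all
  have k0: "0 \<le> k 0" using k(1)[of 0] by simp
  obtain \<theta> where \<theta>: "0 \<le> \<theta>" "\<And>b. consistent_pts (10 * C + ?s + k 0 + 10) b \<Longrightarrow> \<exists>x\<in>X. \<forall>V\<in>I. d V (pt H V x) (b V) \<le> \<theta>"
    using realization[of "10 * C + ?s + k 0 + 10"] by metis
  define B where "B = (C * (k \<theta> + 1) + C) + \<theta> + (2 * ?s + 4 * C + 2 * k 0 + 6)"
  have "\<exists>y\<in>Y. \<forall>V\<in>I. \<forall>a. nearest Y ?s V (pt H V x) a \<longrightarrow> d V (pt H V y) a \<le> B" if x: "x \<in> X" for x
  proof -
    define a where "a V = (SOME v. v \<in> closest_point_projection (hyp H V) (prj_image H V Y) (prj H V x))" for V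
    have a: "nearest Y ?s V (pt H V x) (a V)" if "V \<in> I" for V
      unfolding a_def using projection_nonempty[OF Y ne that x]
      by (intro projection_nearest[OF Y that x]) (simp add: some_in_eq)
    have s: "0 \<le> ?s" using C_ge_1 by simp
    have aA: "a V \<in> prj_image H V Y" if "V \<in> I" for V using a[OF that] by (simp add: nearest_def)
    have aM: "a V \<in> M V" if "V \<in> I" for V using aA prj_image_subset Y that by blast
    obtain z where z: "z \<in> X" "\<And>V. V \<in> I \<Longrightarrow> d V (pt H V z) (a V) \<le> \<theta>"
      using \<theta>(2)[OF nearest_consistent[OF Y k0 k(2) x s a]] by blast
    have "msetdist (ambient H) {z} Y \<le> ennreal (k \<theta>)"
      by (rule k(3)[OF \<theta>(1) z(1)]) (use msetdist_le[OF pt_in_prj[OF _ z(1)] aA z(2)] in blast)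
    moreover have "k \<theta> < k \<theta> + 1" "0 < k \<theta> + 1" using k(1)[OF \<theta>(1)] by auto
    ultimately obtain z' y where "z' \<in> {z}" "y \<in> Y" "mdist (ambient H) z' y < k \<theta> + 1"
      by (rule msetdist_le_obtain)
    then have y: "y \<in> Y" "y \<in> X" "mdist (ambient H) y z \<le> k \<theta> + 1"
      using Y mdist_commute[of "ambient H" z y] by auto
    show ?thesis
    proof (intro bexI[of _ y] ballI allI impI)
      fix V a' assume V: "V \<in> I" and a': "nearest Y ?s V (pt H V x) a'"
      have a'M: "a' \<in> M V" using a' prj_image_subset Y V unfolding nearest_def by blast
      have "C * mdist (ambient H) y z \<le> C * (k \<theta> + 1)" using y C_ge_1 by (intro mult_left_mono) auto
      then have "d V (pt H V y) (pt H V z) \<le> C * (k \<theta> + 1) + C"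
        using pt_lipschitz[OF V y(2) z(1)] by linarith
      moreover have "d V (a V) a' \<le> 2 * ?s + 4 * C + 2 * k 0 + 6"
        using nearest_close[OF k(2)[OF V] k0 V _ _ a[OF V] a'] V x by simp
      moreover have "d V (pt H V y) a' \<le> d V (pt H V y) (pt H V z) + d V (pt H V z) (a V) + d V (a V) a'"
        using V y z aM a'M by (intro mdist_triangle3) auto
      ultimately show "d V (pt H V y) a' \<le> B" using z(2)[OF V] unfolding B_def by linarith
    qed (rule y)
  qed
  moreover have "0 \<le> B" using C_ge_1 \<theta>(1) k0 k(1)[OF \<theta>(1)] by (simp add: B_def)
  ultimately show ?thesis by blast
qed

lemma gate_map_nearest:
  assumes g: "gate_map H Y g" and Y: "Y \<subseteq> X"
  shows "\<exists>B. \<forall>x\<in>X. g x \<in> Y \<and> g x \<in> X \<and>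
    (\<forall>V\<in>I. \<exists>a. nearest Y (2 * C + 1) V (pt H V x) a \<and> d V (pt H V (g x)) a \<le> B)"
proof -
  obtain r where r: "\<And>x V. x \<in> X \<Longrightarrow> V \<in> I \<Longrightarrow> coarsely_equal (hyp H V) r (prj H V (g x))
        (closest_point_projection (hyp H V) (prj_image H V Y) (prj H V x))"
    using g unfolding gate_map_def by blast
  have gY: "g x \<in> Y \<and> g x \<in> X" if "x \<in> X" for x
    using g that unfolding gate_map_def coarsely_lipschitz_def by auto
  have "\<exists>a. nearest Y (2 * C + 1) V (pt H V x) a \<and> d V (pt H V (g x)) a \<le> \<bar>r\<bar> + 1" if x: "x \<in> X" and V: "V \<in> I" for x V
  proof -
    obtain a where "a \<in> closest_point_projection (hyp H V) (prj_image H V Y) (prj H V x)"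
      "d V (pt H V (g x)) a \<le> \<bar>r\<bar> + 1"
      using coarsely_equalD1[OF r[OF x V] pt_in_prj[OF V]] gY[OF x] by blast
    then show ?thesis using projection_nearest[OF Y V x] by blast
  qed
  then show ?thesis using gY by blast
qed

lemma gate_mapI:
  assumes Y: "Y \<subseteq> X" "Y \<noteq> {}" and g: "\<And>x. x \<in> X \<Longrightarrow> g x \<in> Y"
    and B: "\<And>x V a. x \<in> X \<Longrightarrow> V \<in> I \<Longrightarrow> nearest Y (2 * C + 1) V (pt H V x) a \<Longrightarrow> d V (pt H V (g x)) a \<le> B"
    and born: "\<And>x y V. x \<in> X \<Longrightarrow> y \<in> X \<Longrightarrow> mdist (ambient H) x y \<le> 2 * C \<Longrightarrow> V \<in> I \<Longrightarrow>
      d V (pt H V (g x)) (pt H V (g y)) \<le> B'"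
  shows "gate_map H Y g"
proof -
  have gX: "g \<in> X \<rightarrow> X" using g Y by blast
  obtain K K' where "\<forall>x\<in>X. \<forall>y\<in>X. mdist (ambient H) (g x) (g y) \<le> K * mdist (ambient H) x y + K'"
    using coordinatewise_lipschitz[OF quasigeodesic C_ge_1 gX born] by blast
  then have "coarsely_lipschitz (ambient H) (submetric (ambient H) Y) g"
    using g Y(1) unfolding coarsely_lipschitz_def by auto
  moreover have "coarsely_equal (hyp H V) (C + B) (prj H V (g x))
        (closest_point_projection (hyp H V) (prj_image H V Y) (prj H V x))" if x: "x \<in> X" and V: "V \<in> I" for x V
  proof -
    let ?P = "closest_point_projection (hyp H V) (prj_image H V Y) (prj H V x)"
    have gx: "g x \<in> X" using gX x by blast
    have PM: "?P \<subseteq> M V"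
      using prj_image_subset[OF Y(1) V] unfolding closest_point_projection_def by blast
    have le: "d V u a \<le> C + B" if u: "u \<in> prj H V (g x)" and a: "a \<in> ?P" for u a
    proof -
      have "d V u a \<le> d V u (pt H V (g x)) + d V (pt H V (g x)) a"
        using V gx u a PM prj_subset[OF V gx] by (intro d_triangle) auto
      then show ?thesis
        using B[OF x V projection_nearest[OF Y(1) V x a]] pt_prj_close[OF V gx u] mdist_commute[of "hyp H V" u] by simp
    qed
    show ?thesis
    proof (rule coarsely_equalI[OF prj_subset[OF V gx] PM])
      show "\<exists>b\<in>?P. d V u b \<le> C + B" if "u \<in> prj H V (g x)" for u
        using projection_nonempty[OF Y V x] le that by blast
      show "\<exists>u\<in>prj H V (g x). d V b u \<le> C + B" if "b \<in> ?P" for b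
      proof -
        obtain u where "u \<in> prj H V (g x)" using prj_nonempty[OF V gx] by blast
        then show ?thesis using le[OF _ that] by (subst mdist_commute) blast
      qed
    qed
  qed
  ultimately show ?thesis unfolding gate_map_def by blast
qed

lemma hierarchically_quasiconvex_gate_exists:
  assumes hq: "hierarchically_quasiconvex H Y" and ne: "Y \<noteq> {}"
  shows "\<exists>g. gate_map H Y g"
proof -
  have Y: "Y \<subseteq> X" using hq by (simp add: hierarchically_quasiconvex_def)
  obtain k where k: "0 \<le> k" "\<And>U. U \<in> I \<Longrightarrow> quasiconvex (hyp H U) k (prj_image H U Y)"
    using hq unfolding hierarchically_quasiconvex_def by blast
  obtain B where "\<forall>x\<in>X. \<exists>y\<in>Y. \<forall>V\<in>I. \<forall>a. nearest Y (2 * C + 1) V (pt H V x) a \<longrightarrow> d V (pt H V y) a \<le> B"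
    using hierarchically_quasiconvex_gate_point[OF assms] by blast
  then obtain g where g: "\<And>x. x \<in> X \<Longrightarrow> g x \<in> Y"
    "\<And>x V a. x \<in> X \<Longrightarrow> V \<in> I \<Longrightarrow> nearest Y (2 * C + 1) V (pt H V x) a \<Longrightarrow> d V (pt H V (g x)) a \<le> B"
    by metis
  have "gate_map H Y g"
  proof (rule gate_mapI[OF Y ne g])
    fix x y V assume x: "x \<in> X" and y: "y \<in> X" and xy: "mdist (ambient H) x y \<le> 2 * C" and V: "V \<in> I"
    obtain a where a: "nearest Y (2 * C + 1) V (pt H V x) a"
      using projection_nonempty[OF Y ne V x] projection_nearest[OF Y V x] by blast
    obtain b where b: "nearest Y (2 * C + 1) V (pt H V y) b"
      using projection_nonempty[OF Y ne V y] projection_nearest[OF Y V y] by blast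
    have abM: "a \<in> M V" "b \<in> M V" using a b prj_image_subset[OF Y V] by (auto simp: nearest_def)
    have "C * mdist (ambient H) x y \<le> C * (2 * C)" using xy C_ge_1 by (intro mult_left_mono) auto
    then have "d V (pt H V x) (pt H V y) \<le> C * (2 * C) + C" using pt_lipschitz[OF V x y] by linarith
    then have "d V a b \<le> 2 * (2 * C + 1) + 4 * (C * (2 * C) + C) + 4 * C + 2 * k + 6"
      using nearest_close[OF k(2)[OF V] k(1) V _ _ a b] V x y by simp
    moreover have "d V (pt H V (g x)) (pt H V (g y)) \<le> d V (pt H V (g x)) a + d V a b + d V b (pt H V (g y))"
      using V g(1)[OF x] g(1)[OF y] Y abM by (intro mdist_triangle3) auto
    ultimately show "d V (pt H V (g x)) (pt H V (g y)) \<le> 2 * B + (2 * (2 * C + 1) + 4 * (C * (2 * C) + C) + 4 * C + 2 * k + 6)"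
      using g(2)[OF x V a] g(2)[OF y V b] mdist_commute[of "hyp H V" b] by simp
  qed
  then show ?thesis by blast
qed

lemma F_copy_outside_close:
  assumes U: "U \<in> I" and e: "e \<in> E_tuples H \<kappa> U" and pos: "0 \<le> \<kappa>" "0 \<le> \<theta>"
    and z: "z \<in> F_copy H \<kappa> \<theta> U e" "z' \<in> F_copy H \<kappa> \<theta> U e" and V: "V \<in> I" "\<not> nest H V U"
  shows "d V (pt H V z) (pt H V z') \<le> 2 * (\<theta> + \<kappa> + 2 * C + 1)"
proof -
  \<comment> \<open>\<open>V\<close> is not nested in \<open>U\<close>, so the value
    \<open>undefined\<close> of the inner part is never selected.\<close>
  define t where "t = product_tuple U (\<lambda>_. undefined) (choice e) V"
  have t: "d V (pt H V w) t \<le> \<theta> + \<kappa> + 2 * C + 1" if "w \<in> F_copy H \<kappa> \<theta> U e" for w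
    using F_copy_outside[OF U e pos that V] unfolding t_def .
  have "t \<in> M V"
  proof (cases "orth H V U")
    case True
    then have bp: "bounded_piece H \<kappa> V (e V)"
      using e V unfolding E_tuples_def consistent_tuple_def orth_to_def by blast
    then show ?thesis using choice_in[of \<kappa> V e] bounded_pieceD(2)[OF bp pos(1)] V True
      by (auto simp: t_def product_tuple_def)
  next
    case False
    then have "has_rho H U V" using V orth_sym[OF U V(1)] has_rho_iff[OF U V(1)] by blast
    then show ?thesis using V U False by (simp add: t_def product_tuple_def)
  qed
  then have "d V (pt H V z) (pt H V z') \<le> d V (pt H V z) t + d V t (pt H V z')"
    using z V F_copy_subset[of \<kappa> \<theta> U e] by (intro d_triangle) auto
  then show ?thesis using t[OF z(1)] t[OF z(2)] mdist_commute[of "hyp H V" t] by simp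
qed

text \<open>A map into the copy that nearly keeps the coordinates nested in \<open>U\<close> is a
  gate: at those domains it moves points boundedly, and at the others the copy has bounded
  projection, so any of its points is nearest up to a constant.\<close>

lemma F_copy_gate_exists:
  assumes U: "U \<in> I" and e: "e \<in> E_tuples H \<kappa> U" and pos: "0 \<le> \<kappa>" "0 \<le> \<theta>" "0 \<le> \<theta>0"
    and real: "\<And>x. x \<in> X \<Longrightarrow> \<exists>z\<in>F_copy H \<kappa> \<theta> U e. \<forall>V\<in>I. nest H V U \<longrightarrow> d V (pt H V z) (pt H V x) \<le> \<theta>0"
  shows "\<exists>h. gate_map H (F_copy H \<kappa> \<theta> U e) h"
proof -
  let ?F = "F_copy H \<kappa> \<theta> U e"
  have F: "?F \<subseteq> X" by (rule F_copy_subset)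
  obtain h where h: "\<And>x. x \<in> X \<Longrightarrow> h x \<in> ?F"
    "\<And>x V. x \<in> X \<Longrightarrow> V \<in> I \<Longrightarrow> nest H V U \<Longrightarrow> d V (pt H V (h x)) (pt H V x) \<le> \<theta>0"
    using real by metis
  define r where "r = \<theta> + \<kappa> + 2 * C + 1"
  have r: "0 \<le> r" using pos C_ge_1 by (simp add: r_def)
  have out: "d V (pt H V z) (pt H V z') \<le> 2 * r"
    if "z \<in> ?F" "z' \<in> ?F" "V \<in> I" "\<not> nest H V U" for z z' V
    using F_copy_outside_close[OF U e pos(1,2) that] by (simp add: r_def)
  have "?F \<noteq> {}" using h(1) points_nonempty by blast
  then have "gate_map H ?F h"
  proof (rule gate_mapI[OF F _ h(1)])
    fix x V a assume x: "x \<in> X" and V: "V \<in> I" and a: "nearest ?F (2 * C + 1) V (pt H V x) a"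
    have hx: "h x \<in> X" using h(1)[OF x] F by blast
    have aA: "a \<in> prj_image H V ?F" using a by (simp add: nearest_def)
    have aM: "a \<in> M V" using aA prj_image_subset[OF F V] by blast
    show "d V (pt H V (h x)) a \<le> 2 * \<theta>0 + 2 * r + 3 * C + 1"
    proof (cases "nest H V U")
      case True
      have "d V (pt H V x) a \<le> d V (pt H V x) (pt H V (h x)) + (2 * C + 1)"
        using a pt_in_prj_image[OF F V h(1)[OF x]] by (simp add: nearest_def)
      moreover have "d V (pt H V (h x)) a \<le> d V (pt H V (h x)) (pt H V x) + d V (pt H V x) a"
        using V x hx aM by (intro d_triangle) auto
      ultimately show ?thesis
        using h(2)[OF x V True] mdist_commute[of "hyp H V" "pt H V x"] r C_ge_1 by simp
    next
      case False
      obtain z where z: "z \<in> ?F" "z \<in> X" "d V (pt H V z) a \<le> C" using prj_image_point[OF F V aA] .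
      have "d V (pt H V (h x)) a \<le> d V (pt H V (h x)) (pt H V z) + d V (pt H V z) a"
        using V z hx aM by (intro d_triangle) auto
      then show ?thesis using out[OF h(1)[OF x] z(1) V False] z(3) pos C_ge_1 by simp
    qed
  next
    fix x y V assume x: "x \<in> X" and y: "y \<in> X" and xy: "mdist (ambient H) x y \<le> 2 * C" and V: "V \<in> I"
    have hX: "h x \<in> X" "h y \<in> X" using h(1) x y F by blast+
    have "C * mdist (ambient H) x y \<le> C * (2 * C)" using xy C_ge_1 by (intro mult_left_mono) auto
    then have xy': "d V (pt H V x) (pt H V y) \<le> C * (2 * C) + C" using pt_lipschitz[OF V x y] by linarith
    have C2: "0 \<le> C * (2 * C) + C" using C_ge_1 by simp
    show "d V (pt H V (h x)) (pt H V (h y)) \<le> 2 * \<theta>0 + (C * (2 * C) + C) + 2 * r"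
    proof (cases "nest H V U")
      case True
      have "d V (pt H V (h x)) (pt H V (h y)) \<le> d V (pt H V (h x)) (pt H V x) + d V (pt H V x) (pt H V y)
          + d V (pt H V y) (pt H V (h y))"
        using V x y hX by (intro mdist_triangle3) auto
      then show ?thesis
        using h(2)[OF x V True] h(2)[OF y V True] xy' r mdist_commute[of "hyp H V" "pt H V y"] by simp
    next
      case False
      then show ?thesis using out[OF h(1)[OF x] h(1)[OF y] V False] pos(3) C2 by linarith
    qed
  qed
  then show ?thesis by blast
qed

end

text \<open>\<open>consistent_tuple\<close> uses infimal distances and diameters of unions, as the
  original axioms do; so they apply directly, with the larger of \<open>\<xi>\<close> and
  \<open>\<kappa>0\<close> as threshold.\<close>

lemma hhs_prj_consistent:
  assumes "hhs H"
  shows "\<exists>\<kappa>1\<ge>0. \<forall>\<kappa>\<ge>\<kappa>1. \<forall>x\<in>points H. \<forall>J\<subseteq>index H. consistent_tuple H \<kappa> J (\<lambda>V. prj H V x)"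
proof -
  obtain \<xi> K \<kappa>0 where pos: "0 \<le> \<xi>" "0 \<le> \<kappa>0" and prj: "hhs_projections H \<xi> K" and con: "hhs_consistency H \<xi> \<kappa>0"
    using assms unfolding hhs_def by meson
  have "consistent_tuple H \<kappa> J (\<lambda>V. prj H V x)"
    if \<kappa>: "max \<xi> \<kappa>0 \<le> \<kappa>" and x: "x \<in> points H" and J: "J \<subseteq> index H" for \<kappa> x J
  proof -
    have le: "ennreal \<xi> \<le> ennreal \<kappa>" "ennreal \<kappa>0 \<le> ennreal \<kappa>" using \<kappa> by (auto intro: ennreal_leI)
    show ?thesis
      unfolding consistent_tuple_def
    proof (intro conjI ballI impI)
      show "bounded_piece H \<kappa> V (prj H V x)" if "V \<in> J" for V
      proof -
        have "bounded_piece H \<xi> V (prj H V x)" using prj x J that unfolding hhs_projections_def by blast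
        then show ?thesis using le(1) unfolding bounded_piece_def by (meson order_trans)
      qed
      fix V W assume VW: "V \<in> J" "W \<in> J"
      then have VWi: "V \<in> index H" "W \<in> index H" using J by auto
      show "min (hdist H W (prj H W x) (rho_set H V W)) (hdist H V (prj H V x) (rho_set H W V)) \<le> ennreal \<kappa>"
        if "transverse H V W"
      proof (rule order_trans[OF _ le(2)])
        show "min (hdist H W (prj H W x) (rho_set H V W)) (hdist H V (prj H V x) (rho_set H W V)) \<le> ennreal \<kappa>0"
          using con VWi x that unfolding hhs_consistency_def by blast
      qed
      show "min (hdist H W (prj H W x) (rho_set H V W)) (hdiam H V (prj H V x \<union> rho_image H W V (prj H W x))) \<le> ennreal \<kappa>"
        if "snest H V W"
      proof (rule order_trans[OF _ le(2)])
        show "min (hdist H W (prj H W x) (rho_set H V W)) (hdiam H V (prj H V x \<union> rho_image H W V (prj H W x))) \<le> ennreal \<kappa>0"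
          using con VWi x that unfolding hhs_consistency_def by blast
      qed
    qed
  qed
  then show ?thesis using pos by (intro exI[of _ "max \<xi> \<kappa>0"]) auto
qed

section \<open>Full hieromorphisms\<close>

lemma quasi_isometry_of_quasi_inverses:
  assumes qi: "quasi_inverses c m1 m2 f g"
    and f: "\<And>x y. x \<in> mspace m1 \<Longrightarrow> y \<in> mspace m1 \<Longrightarrow> mdist m2 (f x) (f y) \<le> K1 * mdist m1 x y + C1"
    and g: "\<And>x y. x \<in> mspace m2 \<Longrightarrow> y \<in> mspace m2 \<Longrightarrow> mdist m1 (g x) (g y) \<le> K2 * mdist m2 x y + C2"
  shows "\<exists>K C. quasi_isometry K C m1 m2 f"
proof -
  define K where "K = 1 + \<bar>K1\<bar> + \<bar>K2\<bar>"
  define C where "C = \<bar>C1\<bar> + \<bar>C2\<bar> + 2 * \<bar>c\<bar>"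
  have K: "1 \<le> K" "K1 \<le> K" "K2 \<le> K" and C: "0 \<le> C" "C1 \<le> C" "C2 + 2 * c \<le> C" "c \<le> C"
    by (auto simp: K_def C_def)
  have fm: "f x \<in> mspace m2" if "x \<in> mspace m1" for x using qi that by (auto simp: quasi_inverses_def)
  have gm: "g x \<in> mspace m1" if "x \<in> mspace m2" for x using qi that by (auto simp: quasi_inverses_def)
  have gf: "mdist m1 (g (f x)) x \<le> c" if "x \<in> mspace m1" for x using qi that by (auto simp: quasi_inverses_def)
  have fg: "mdist m2 (f (g y)) y \<le> c" if "y \<in> mspace m2" for y using qi that by (auto simp: quasi_inverses_def)
  have "mdist m1 x y / K - C \<le> mdist m2 (f x) (f y) \<and> mdist m2 (f x) (f y) \<le> K * mdist m1 x y + C"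
    if xy: "x \<in> mspace m1" "y \<in> mspace m1" for x y
  proof
    have "K1 * mdist m1 x y \<le> K * mdist m1 x y" using K by (intro mult_right_mono) auto
    then show "mdist m2 (f x) (f y) \<le> K * mdist m1 x y + C" using f[OF xy] C by linarith
    have "mdist m1 x y \<le> mdist m1 x (g (f x)) + mdist m1 (g (f x)) (g (f y)) + mdist m1 (g (f y)) y"
      using xy fm gm by (intro mdist_triangle3) auto
    moreover have "K2 * mdist m2 (f x) (f y) \<le> K * mdist m2 (f x) (f y)" using K by (intro mult_right_mono) auto
    ultimately have "mdist m1 x y \<le> K * mdist m2 (f x) (f y) + C"
      using g[OF fm[OF xy(1)] fm[OF xy(2)]] gf[OF xy(1)] gf[OF xy(2)] C mdist_commute[of m1 x "g (f x)"] by linarith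
    moreover have "C \<le> K * C" using K C by (simp add: mult_le_cancel_right1)
    ultimately have "mdist m1 x y \<le> (mdist m2 (f x) (f y) + C) * K" by (simp add: algebra_simps)
    then have "mdist m1 x y / K \<le> mdist m2 (f x) (f y) + C" using K by (simp add: divide_le_eq)
    then show "mdist m1 x y / K - C \<le> mdist m2 (f x) (f y)" by simp
  qed
  moreover have "y \<in> mneighbourhood m2 C (f ` mspace m1)" if "y \<in> mspace m2" for y
    using that gm[OF that] fg[OF that] C mdist_commute[of m2 y "f (g y)"] by (intro mneighbourhoodI[of _ _ "f (g y)"]) auto
  ultimately show ?thesis
    unfolding quasi_isometry_def qi_embedding_def using K C fm by (intro exI[of _ K] exI[of _ C]) auto
qed

text \<open>\<open>full\<close> is an equality because nesting is preserved and \<open>S\<close> is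
  greatest. \<open>phis_rho_map\<close> keeps one inclusion of the coarse equality: values of
  \<open>rho_map\<close> have no diameter bound, so they cannot be compared pairwise.\<close>

locale full_hiero = src: coarse_hhs H C + tgt: coarse_hhs H' C'
  for H :: "('x, 'i, 'h) hhs_data" and C and H' :: "('y, 'j, 'k) hhs_data" and C' +
  fixes \<phi> :: "'x \<Rightarrow> 'y" and \<phi>d :: "'i \<Rightarrow> 'j" and \<phi>s :: "'i \<Rightarrow> 'h \<Rightarrow> 'k" and L :: real and S :: 'i
  assumes phi_in [simp]: "x \<in> points H \<Longrightarrow> \<phi> x \<in> points H'"
    and phid_in [simp]: "U \<in> index H \<Longrightarrow> \<phi>d U \<in> index H'"
    and phid_inj: "inj_on \<phi>d (index H)"
    and phid_nest: "U \<in> index H \<Longrightarrow> V \<in> index H \<Longrightarrow> nest H U V \<Longrightarrow> nest H' (\<phi>d U) (\<phi>d V)"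
    and phid_transverse: "U \<in> index H \<Longrightarrow> V \<in> index H \<Longrightarrow> transverse H U V \<Longrightarrow> transverse H' (\<phi>d U) (\<phi>d V)"
    and L_ge_1: "1 \<le> L"
    and phis_in [simp]: "U \<in> index H \<Longrightarrow> u \<in> mspace (hyp H U) \<Longrightarrow> \<phi>s U u \<in> mspace (hyp H' (\<phi>d U))"
    and phis_upper: "U \<in> index H \<Longrightarrow> u \<in> mspace (hyp H U) \<Longrightarrow> v \<in> mspace (hyp H U) \<Longrightarrow>
      mdist (hyp H' (\<phi>d U)) (\<phi>s U u) (\<phi>s U v) \<le> L * mdist (hyp H U) u v + L"
    and phis_lower: "U \<in> index H \<Longrightarrow> u \<in> mspace (hyp H U) \<Longrightarrow> v \<in> mspace (hyp H U) \<Longrightarrow>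
      mdist (hyp H U) u v \<le> L * mdist (hyp H' (\<phi>d U)) (\<phi>s U u) (\<phi>s U v) + L"
    and phis_surj: "U \<in> index H \<Longrightarrow> w \<in> mspace (hyp H' (\<phi>d U)) \<Longrightarrow>
      \<exists>u\<in>mspace (hyp H U). mdist (hyp H' (\<phi>d U)) (\<phi>s U u) w \<le> L"
    and phis_prj: "U \<in> index H \<Longrightarrow> x \<in> points H \<Longrightarrow>
      all_within (hyp H' (\<phi>d U)) L (prj H' (\<phi>d U) (\<phi> x)) (\<phi>s U ` prj H U x)"
    and phis_rho_set: "U \<in> index H \<Longrightarrow> V \<in> index H \<Longrightarrow> has_rho H U V \<Longrightarrow>
      all_within (hyp H' (\<phi>d V)) L (\<phi>s V ` rho_set H U V) (rho_set H' (\<phi>d U) (\<phi>d V))"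
    and phis_rho_map: "U \<in> index H \<Longrightarrow> V \<in> index H \<Longrightarrow> snest H V U \<Longrightarrow> p \<in> mspace (hyp H U) \<Longrightarrow>
      u \<in> rho_map H U V p \<Longrightarrow>
      \<exists>u'\<in>rho_map H' (\<phi>d U) (\<phi>d V) (\<phi>s U p). mdist (hyp H' (\<phi>d V)) (\<phi>s V u) u' \<le> L"
    and S_in [simp]: "S \<in> index H"
    and full: "nested_in H' (\<phi>d S) = \<phi>d ` index H"

lemma full_hieromorphism_imp_full_hiero:
  assumes "coarse_hhs H C" "coarse_hhs H' C'" and fh: "full_hieromorphism H H' \<phi> \<phi>d \<phi>s" and S: "maximal_index H S"
  shows "\<exists>L. full_hiero H C H' C' \<phi> \<phi>d \<phi>s L S"
proof -
  interpret src: coarse_hhs H C by fact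
  interpret tgt: coarse_hhs H' C' by fact
  have SI: "S \<in> index H" using S by (simp add: maximal_index_def)
  have S_top: "nest H V S" if "V \<in> index H" for V
    using src.top_index S that unfolding maximal_index_def by blast
  have h: "hieromorphism H H' \<phi> \<phi>d \<phi>s" using fh by (simp add: full_hieromorphism_def)
  obtain \<xi> where \<xi>: "\<And>U. U \<in> index H \<Longrightarrow> quasi_isometry \<xi> \<xi> (hyp H U) (hyp H' (\<phi>d U)) (\<phi>s U)"
    using fh unfolding full_hieromorphism_def by blast
  have pin: "\<phi> x \<in> points H'" if "x \<in> points H" for x using h that unfolding hieromorphism_def by blast
  have din: "\<phi>d U \<in> index H'" if "U \<in> index H" for U using h that unfolding hieromorphism_def by blast
  have inj: "inj_on \<phi>d (index H)" using h unfolding hieromorphism_def by blast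
  have pres: "nest H U V \<Longrightarrow> nest H' (\<phi>d U) (\<phi>d V)" "transverse H U V \<Longrightarrow> transverse H' (\<phi>d U) (\<phi>d V)"
    if "U \<in> index H" "V \<in> index H" for U V using h that unfolding hieromorphism_def by blast+
  obtain K where K: "(\<forall>U\<in>index H. qi_embedding K K (hyp H U) (hyp H' (\<phi>d U)) (\<phi>s U)) \<and>
        (\<forall>U\<in>index H. \<forall>x\<in>points H.
           coarsely_equal (hyp H' (\<phi>d U)) K (prj H' (\<phi>d U) (\<phi> x)) (\<phi>s U ` prj H U x)) \<and>
        (\<forall>U\<in>index H. \<forall>V\<in>index H. snest H U V \<or> transverse H U V \<longrightarrow>
           coarsely_equal (hyp H' (\<phi>d V)) K (\<phi>s V ` rho_set H U V) (rho_set H' (\<phi>d U) (\<phi>d V))) \<and>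
        (\<forall>U\<in>index H. \<forall>V\<in>index H. snest H V U \<longrightarrow> (\<forall>p\<in>mspace (hyp H U).
           coarsely_equal (hyp H' (\<phi>d V)) K
             (\<phi>s V ` rho_map H U V p) (rho_map H' (\<phi>d U) (\<phi>d V) (\<phi>s U p))))"
    using h unfolding hieromorphism_def by (elim conjE exE) simp
  have K1: "1 \<le> K" using K SI unfolding qi_embedding_def by blast
  have sin: "\<phi>s U u \<in> mspace (hyp H' (\<phi>d U))" if "U \<in> index H" "u \<in> mspace (hyp H U)" for U u
    using K that unfolding qi_embedding_def by blast
  have qi: "mdist (hyp H U) u v / K - K \<le> mdist (hyp H' (\<phi>d U)) (\<phi>s U u) (\<phi>s U v)"
     "mdist (hyp H' (\<phi>d U)) (\<phi>s U u) (\<phi>s U v) \<le> K * mdist (hyp H U) u v + K"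
    if "U \<in> index H" "u \<in> mspace (hyp H U)" "v \<in> mspace (hyp H U)" for U u v
    using K that unfolding qi_embedding_def by blast+
  \<comment> \<open>The terms pay for turning \<open>K\<close>-coarse equality into
    \<open>all_within\<close> (\<open>K + 1\<close> plus the spread \<open>K * C + K\<close>), for
    inverting the embedding estimate (\<open>K * K\<close>) and for coarse density of the image
    (\<open>\<bar>\<xi>\<bar> + 1\<close>).\<close>
  define L where "L = 10 + K * C + 3 * K + K * K + \<bar>\<xi>\<bar>"
  have KC: "0 \<le> K * C" "0 \<le> K * K" using K1 src.C_ge_1 by simp_all
  have L: "K \<le> L" "K * C + K + (K + 1) \<le> L" "K * K \<le> L" "\<bar>\<xi>\<bar> + 1 \<le> L" "1 \<le> L" "K + 1 \<le> L"
    using K1 KC unfolding L_def by linarith+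
  have absK: "\<bar>K\<bar> = K" using K1 by simp
  have spread: "mdist (hyp H' (\<phi>d V)) (\<phi>s V a) (\<phi>s V b) \<le> K * C + K"
    if "V \<in> index H" "a \<in> A" "b \<in> A" "A \<subseteq> mspace (hyp H V)" "all_within (hyp H V) C A A" for V A a b
  proof -
    have "mdist (hyp H V) a b \<le> C" using that by (simp add: all_within_def)
    then have "K * mdist (hyp H V) a b \<le> K * C" using K1 by (intro mult_left_mono) auto
    moreover have "a \<in> mspace (hyp H V)" "b \<in> mspace (hyp H V)" using that by auto
    ultimately show ?thesis using qi(2)[OF that(1), of a b] by linarith
  qed
  have aw: "all_within (hyp H' (\<phi>d V)) L B (\<phi>s V ` A)"
    if V: "V \<in> index H" and A: "A \<subseteq> mspace (hyp H V)" "all_within (hyp H V) C A A"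
      and B: "\<And>b. b \<in> B \<Longrightarrow> b \<in> mspace (hyp H' (\<phi>d V)) \<and> (\<exists>a\<in>A. mdist (hyp H' (\<phi>d V)) b (\<phi>s V a) \<le> K + 1)"
    for V A B
  proof (rule all_withinI)
    fix b w assume b: "b \<in> B" and "w \<in> \<phi>s V ` A"
    then obtain a where a: "a \<in> A" "w = \<phi>s V a" by blast
    obtain a' where a': "a' \<in> A" "mdist (hyp H' (\<phi>d V)) b (\<phi>s V a') \<le> K + 1" using B[OF b] by blast
    have "mdist (hyp H' (\<phi>d V)) b (\<phi>s V a) \<le> mdist (hyp H' (\<phi>d V)) b (\<phi>s V a') + mdist (hyp H' (\<phi>d V)) (\<phi>s V a') (\<phi>s V a)"
      using B[OF b] a a' A sin[OF V] by (intro mdist_triangle) auto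
    then show "mdist (hyp H' (\<phi>d V)) b w \<le> L" using a a'(2) spread[OF V a'(1) a(1) A] L(2) by simp
  qed
  have "full_hiero H C H' C' \<phi> \<phi>d \<phi>s L S"
  proof unfold_locales
    show "inj_on \<phi>d (index H)" "1 \<le> L" "S \<in> index H" by fact+
    show "\<phi> x \<in> points H'" if "x \<in> points H" for x using pin that .
    show "\<phi>d U \<in> index H'" if "U \<in> index H" for U using din that .
    show "nest H' (\<phi>d U) (\<phi>d V)" if "U \<in> index H" "V \<in> index H" "nest H U V" for U V using pres that by blast
    show "transverse H' (\<phi>d U) (\<phi>d V)" if "U \<in> index H" "V \<in> index H" "transverse H U V" for U V
      using pres that by blast
    show "\<phi>s U u \<in> mspace (hyp H' (\<phi>d U))" if "U \<in> index H" "u \<in> mspace (hyp H U)" for U u using sin that .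
    fix U assume U: "U \<in> index H"
    show "mdist (hyp H' (\<phi>d U)) (\<phi>s U u) (\<phi>s U v) \<le> L * mdist (hyp H U) u v + L"
      if "u \<in> mspace (hyp H U)" "v \<in> mspace (hyp H U)" for u v
    proof -
      have "K * mdist (hyp H U) u v \<le> L * mdist (hyp H U) u v" using L by (intro mult_right_mono) auto
      then show ?thesis using qi(2)[OF U that] L(1) by linarith
    qed
    show "mdist (hyp H U) u v \<le> L * mdist (hyp H' (\<phi>d U)) (\<phi>s U u) (\<phi>s U v) + L"
      if "u \<in> mspace (hyp H U)" "v \<in> mspace (hyp H U)" for u v
    proof -
      let ?d = "mdist (hyp H' (\<phi>d U)) (\<phi>s U u) (\<phi>s U v)"
      have "mdist (hyp H U) u v / K \<le> ?d + K" using qi(1)[OF U that] by simp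
      then have "mdist (hyp H U) u v \<le> (?d + K) * K" using K1 by (simp add: divide_le_eq)
      moreover have "K * ?d \<le> L * ?d" using L by (intro mult_right_mono) auto
      ultimately show ?thesis using L(3) by (simp add: algebra_simps)
    qed
    show "\<exists>u\<in>mspace (hyp H U). mdist (hyp H' (\<phi>d U)) (\<phi>s U u) v \<le> L" if v: "v \<in> mspace (hyp H' (\<phi>d U))" for v
    proof -
      have "v \<in> mneighbourhood (hyp H' (\<phi>d U)) \<xi> (\<phi>s U ` mspace (hyp H U))"
        using \<xi>[OF U] v unfolding quasi_isometry_def by blast
      then obtain w where w: "w \<in> \<phi>s U ` mspace (hyp H U)" "mdist (hyp H' (\<phi>d U)) v w \<le> \<bar>\<xi>\<bar> + 1"
        by (rule mneighbourhoodD)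
      then obtain u where "u \<in> mspace (hyp H U)" "w = \<phi>s U u" by blast
      then show ?thesis using w(2) L(4) mdist_commute[of "hyp H' (\<phi>d U)" v w] by (intro bexI[of _ u]) simp_all
    qed
    show "all_within (hyp H' (\<phi>d U)) L (prj H' (\<phi>d U) (\<phi> x)) (\<phi>s U ` prj H U x)" if x: "x \<in> points H" for x
    proof (rule aw[OF U src.prj_subset[OF U x] src.prj_diam[OF U x]])
      have ce: "coarsely_equal (hyp H' (\<phi>d U)) K (prj H' (\<phi>d U) (\<phi> x)) (\<phi>s U ` prj H U x)" using K U x by blast
      fix b assume "b \<in> prj H' (\<phi>d U) (\<phi> x)"
      from coarsely_equalD1[OF ce this]
      show "b \<in> mspace (hyp H' (\<phi>d U)) \<and> (\<exists>a\<in>prj H U x. mdist (hyp H' (\<phi>d U)) b (\<phi>s U a) \<le> K + 1)"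
        unfolding absK by blast
    qed
    fix V assume V: "V \<in> index H"
    show "all_within (hyp H' (\<phi>d V)) L (\<phi>s V ` rho_set H U V) (rho_set H' (\<phi>d U) (\<phi>d V))" if hr: "has_rho H U V"
    proof -
      have ce: "coarsely_equal (hyp H' (\<phi>d V)) K (\<phi>s V ` rho_set H U V) (rho_set H' (\<phi>d U) (\<phi>d V))"
        using K U V hr unfolding has_rho_def by blast
      have "all_within (hyp H' (\<phi>d V)) L (rho_set H' (\<phi>d U) (\<phi>d V)) (\<phi>s V ` rho_set H U V)"
      proof (rule aw[OF V src.rho_subset[OF U V hr] src.rho_diam[OF U V hr]])
        fix b assume "b \<in> rho_set H' (\<phi>d U) (\<phi>d V)"
        from coarsely_equalD2[OF ce this]
        show "b \<in> mspace (hyp H' (\<phi>d V)) \<and> (\<exists>a\<in>rho_set H U V. mdist (hyp H' (\<phi>d V)) b (\<phi>s V a) \<le> K + 1)"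
          unfolding absK by blast
      qed
      then show ?thesis unfolding all_within_def using mdist_commute by metis
    qed
    show "\<exists>u'\<in>rho_map H' (\<phi>d U) (\<phi>d V) (\<phi>s U p). mdist (hyp H' (\<phi>d V)) (\<phi>s V u) u' \<le> L"
      if VU: "snest H V U" and p: "p \<in> mspace (hyp H U)" and u: "u \<in> rho_map H U V p" for p u
    proof -
      have ce: "coarsely_equal (hyp H' (\<phi>d V)) K (\<phi>s V ` rho_map H U V p) (rho_map H' (\<phi>d U) (\<phi>d V) (\<phi>s U p))"
        using K U V VU p by blast
      from coarsely_equalD1[OF ce imageI[OF u]]
      show ?thesis using L(6) unfolding absK by (meson order_trans)
    qed
  next
    have "\<phi>d ` index H \<subseteq> nested_in H' (\<phi>d S)" using S_top pres(1) SI din by (auto simp: nested_in_def)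
    then show "nested_in H' (\<phi>d S) = \<phi>d ` index H"
      using fh S unfolding full_hieromorphism_def by blast
  qed
  then show ?thesis by blast
qed

section \<open>Lipschitz bounds, gates and coordinates outside the image of the index set\<close>

context full_hiero
begin

abbreviation Y where "Y \<equiv> \<phi> ` points H"

lemma nest_top_iff: "W \<in> tgt.I \<Longrightarrow> nest H' W (\<phi>d S) \<longleftrightarrow> W \<in> \<phi>d ` src.I"
  using full by (auto simp: nested_in_def)

lemma has_rho_image: "U \<in> src.I \<Longrightarrow> V \<in> src.I \<Longrightarrow> has_rho H U V \<Longrightarrow> has_rho H' (\<phi>d U) (\<phi>d V)"
  using phid_nest phid_transverse inj_onD[OF phid_inj, of U V] unfolding has_rho_def snest_def by blast

lemma Y_subset: "Y \<subseteq> tgt.X"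
  by auto

lemma Y_nonempty: "Y \<noteq> {}"
  using src.points_nonempty by simp

lemma pt_image_close:
  assumes "U \<in> src.I" "x \<in> src.X"
  shows "tgt.d (\<phi>d U) (pt H' (\<phi>d U) (\<phi> x)) (\<phi>s U (pt H U x)) \<le> L"
  using phis_prj[OF assms] src.pt_in_prj[OF assms] tgt.pt_in_prj assms by (auto simp: all_within_def)

lemma pt_image_upper:
  assumes U [simp]: "U \<in> src.I" and x [simp]: "x \<in> src.X" and y [simp]: "y \<in> src.X"
  shows "tgt.d (\<phi>d U) (pt H' (\<phi>d U) (\<phi> x)) (pt H' (\<phi>d U) (\<phi> y)) \<le> L * src.d U (pt H U x) (pt H U y) + 3 * L"
proof -
  have "tgt.d (\<phi>d U) (pt H' (\<phi>d U) (\<phi> x)) (pt H' (\<phi>d U) (\<phi> y))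
    \<le> tgt.d (\<phi>d U) (pt H' (\<phi>d U) (\<phi> x)) (\<phi>s U (pt H U x)) + tgt.d (\<phi>d U) (\<phi>s U (pt H U x)) (\<phi>s U (pt H U y))
      + tgt.d (\<phi>d U) (\<phi>s U (pt H U y)) (pt H' (\<phi>d U) (\<phi> y))"
    by (intro mdist_triangle3) simp_all
  then show ?thesis
    using pt_image_close[OF U x] pt_image_close[OF U y] phis_upper[OF U src.pt_in[OF U x] src.pt_in[OF U y]]
      mdist_commute[of "hyp H' (\<phi>d U)" "\<phi>s U (pt H U y)" "pt H' (\<phi>d U) (\<phi> y)"] by linarith
qed

lemma pt_image_lower:
  assumes U [simp]: "U \<in> src.I" and x [simp]: "x \<in> src.X" and y [simp]: "y \<in> src.X"
    and le: "tgt.d (\<phi>d U) (pt H' (\<phi>d U) (\<phi> x)) (pt H' (\<phi>d U) (\<phi> y)) \<le> r"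
  shows "src.d U (pt H U x) (pt H U y) \<le> L * (r + 2 * L) + L"
proof -
  have "tgt.d (\<phi>d U) (\<phi>s U (pt H U x)) (\<phi>s U (pt H U y))
    \<le> tgt.d (\<phi>d U) (\<phi>s U (pt H U x)) (pt H' (\<phi>d U) (\<phi> x)) + tgt.d (\<phi>d U) (pt H' (\<phi>d U) (\<phi> x)) (pt H' (\<phi>d U) (\<phi> y))
      + tgt.d (\<phi>d U) (pt H' (\<phi>d U) (\<phi> y)) (\<phi>s U (pt H U y))"
    by (intro mdist_triangle3) simp_all
  then have "tgt.d (\<phi>d U) (\<phi>s U (pt H U x)) (\<phi>s U (pt H U y)) \<le> r + 2 * L"
    using pt_image_close[OF U x] pt_image_close[OF U y] le
      mdist_commute[of "hyp H' (\<phi>d U)" "\<phi>s U (pt H U x)" "pt H' (\<phi>d U) (\<phi> x)"] by linarith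
  then have "L * tgt.d (\<phi>d U) (\<phi>s U (pt H U x)) (\<phi>s U (pt H U y)) \<le> L * (r + 2 * L)"
    using L_ge_1 by (intro mult_left_mono) auto
  then show ?thesis using phis_lower[OF U src.pt_in[OF U x] src.pt_in[OF U y]] by linarith
qed

lemma pt_image_dense:
  assumes V: "V \<in> \<phi>d ` src.I" and v: "v \<in> tgt.M V"
  shows "\<exists>x\<in>src.X. tgt.d V v (pt H' V (\<phi> x)) \<le> L * C + 3 * L"
proof -
  obtain U where U: "U \<in> src.I" "V = \<phi>d U" using V by blast
  obtain u where u: "u \<in> src.M U" "tgt.d V (\<phi>s U u) v \<le> L" using phis_surj U v by blast
  obtain x where x: "x \<in> src.X" "all_within (hyp H U) C {u} (prj H U x)" using src.coarsely_surjective U u by blast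
  have "src.d U u (pt H U x) \<le> C" using x src.pt_in_prj U by (simp add: all_within_def)
  then have "L * src.d U u (pt H U x) \<le> L * C" using L_ge_1 by (intro mult_left_mono) auto
  then have 1: "tgt.d V (\<phi>s U u) (\<phi>s U (pt H U x)) \<le> L * C + L"
    using phis_upper[OF U(1) u(1), of "pt H U x"] U x by simp
  have "tgt.d V v (pt H' V (\<phi> x)) \<le> tgt.d V v (\<phi>s U u) + tgt.d V (\<phi>s U u) (\<phi>s U (pt H U x))
      + tgt.d V (\<phi>s U (pt H U x)) (pt H' V (\<phi> x))"
    using U u x v by (intro mdist_triangle3) simp_all
  then have "tgt.d V v (pt H' V (\<phi> x)) \<le> L * C + 3 * L"
    using 1 u(2) pt_image_close[OF U(1) x(1)] mdist_commute[of "hyp H' V" v "\<phi>s U u"]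
      mdist_commute[of "hyp H' V" "\<phi>s U (pt H U x)" "pt H' V (\<phi> x)"] unfolding U(2) by linarith
  then show ?thesis using x(1) by blast
qed

text \<open>Uniqueness in the source, read through the embeddings \<open>\<phi>s\<close>: control at
  image domains already determines preimages, before any Lipschitz bound on \<open>\<phi>\<close> is
  known.\<close>

lemma image_points_close:
  "\<exists>t\<ge>0. \<forall>x\<in>src.X. \<forall>y\<in>src.X.
    (\<forall>V\<in>\<phi>d ` src.I. tgt.d V (pt H' V (\<phi> x)) (pt H' V (\<phi> y)) \<le> r) \<longrightarrow> mdist (ambient H) x y \<le> t"
proof -
  obtain t where t: "0 \<le> t" "\<forall>x\<in>src.X. \<forall>y\<in>src.X.
      (\<forall>V\<in>src.I. src.d V (pt H V x) (pt H V y) \<le> L * (r + 2 * L) + L) \<longrightarrow> mdist (ambient H) x y \<le> t"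
    using src.uniqueness_pt by blast
  have "mdist (ambient H) x y \<le> t"
    if "x \<in> src.X" "y \<in> src.X" "\<forall>V\<in>\<phi>d ` src.I. tgt.d V (pt H' V (\<phi> x)) (pt H' V (\<phi> y)) \<le> r" for x y
    using t(2) that pt_image_lower by blast
  then show ?thesis using t(1) by blast
qed

text \<open>The gate map followed by a choice of preimages.\<close>

lemma coarse_left_inverse:
  assumes hq: "hierarchically_quasiconvex H' Y"
  shows "\<exists>f K B. (\<forall>z\<in>tgt.X. f z \<in> src.X) \<and> 0 \<le> K \<and> 0 \<le> B \<and>
    (\<forall>z\<in>tgt.X. \<forall>w\<in>tgt.X. mdist (ambient H) (f z) (f w) \<le> K * mdist (ambient H') z w + B) \<and>
    (\<forall>x\<in>src.X. mdist (ambient H) (f (\<phi> x)) x \<le> B)"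
proof -
  obtain g where g: "gate_map H' Y g" using tgt.hierarchically_quasiconvex_gate_exists[OF hq Y_nonempty] by blast
  obtain B where gX: "\<And>z. z \<in> tgt.X \<Longrightarrow> g z \<in> Y \<and> g z \<in> tgt.X"
    and near: "\<And>z V. z \<in> tgt.X \<Longrightarrow> V \<in> tgt.I \<Longrightarrow>
      \<exists>a. tgt.nearest Y (2 * C' + 1) V (pt H' V z) a \<and> tgt.d V (pt H' V (g z)) a \<le> B"
    using tgt.gate_map_nearest[OF g Y_subset] by blast
  obtain K1 C1 where lip: "\<forall>z\<in>tgt.X. \<forall>w\<in>tgt.X. mdist (ambient H') (g z) (g w) \<le> K1 * mdist (ambient H') z w + C1"
    using g unfolding gate_map_def coarsely_lipschitz_def by auto
  define f where "f z = inv_into src.X \<phi> (g z)" for z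
  have fX: "f z \<in> src.X" and ff: "\<phi> (f z) = g z" if "z \<in> tgt.X" for z
    using gX[OF that] unfolding f_def by (auto intro: inv_into_into f_inv_into_f)
  define r where "r = C' * (\<bar>K1\<bar> * (2 * C') + C1) + C'"
  obtain K2 B2 where KB2: "0 \<le> K2" "0 \<le> B2"
    "\<forall>z\<in>tgt.X. \<forall>w\<in>tgt.X. mdist (ambient H) (f z) (f w) \<le> K2 * mdist (ambient H') z w + B2"
  proof -
    have "\<exists>K K'. 0 \<le> K \<and> 0 \<le> K' \<and> (\<forall>z\<in>tgt.X. \<forall>w\<in>tgt.X. mdist (ambient H) (f z) (f w) \<le> K * mdist (ambient H') z w + K')"
    proof (rule src.coordinatewise_lipschitz[OF tgt.quasigeodesic tgt.C_ge_1])
      show "f \<in> tgt.X \<rightarrow> src.X" using fX by blast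
      fix z w U assume z: "z \<in> tgt.X" and w: "w \<in> tgt.X" and zw: "mdist (ambient H') z w \<le> 2 * C'" and U: "U \<in> src.I"
      have "K1 * mdist (ambient H') z w \<le> \<bar>K1\<bar> * mdist (ambient H') z w" by (intro mult_right_mono) auto
      also have "\<dots> \<le> \<bar>K1\<bar> * (2 * C')" using zw by (intro mult_left_mono) auto
      finally have "mdist (ambient H') (g z) (g w) \<le> \<bar>K1\<bar> * (2 * C') + C1" using lip z w by fastforce
      then have "C' * mdist (ambient H') (g z) (g w) \<le> C' * (\<bar>K1\<bar> * (2 * C') + C1)"
        using tgt.C_ge_1 by (intro mult_left_mono) auto
      then have "tgt.d (\<phi>d U) (pt H' (\<phi>d U) (g z)) (pt H' (\<phi>d U) (g w)) \<le> r"
        using tgt.pt_lipschitz[of "\<phi>d U" "g z" "g w"] gX[OF z] gX[OF w] U by (simp add: r_def)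
      \<comment> \<open>As \<open>\<phi>\<close> maps \<open>f z\<close> to \<open>g z\<close>,
        source coordinates of \<open>f z\<close> are read off from target coordinates of
        \<open>g z\<close>, where the Lipschitz bound of the gate is available.\<close>
      then show "src.d U (pt H U (f z)) (pt H U (f w)) \<le> L * (r + 2 * L) + L"
        using pt_image_lower[OF U fX[OF z] fX[OF w]] ff z w by simp
    qed
    then show ?thesis using that by blast
  qed
  obtain t where t: "0 \<le> t" "\<forall>x\<in>src.X. \<forall>y\<in>src.X.
    (\<forall>V\<in>\<phi>d ` src.I. tgt.d V (pt H' V (\<phi> x)) (pt H' V (\<phi> y)) \<le> B + (2 * C' + 1)) \<longrightarrow> mdist (ambient H) x y \<le> t"
    using image_points_close by blast
  have "mdist (ambient H) (f (\<phi> x)) x \<le> t" if x: "x \<in> src.X" for x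
  proof -
    have "tgt.d V (pt H' V (\<phi> (f (\<phi> x)))) (pt H' V (\<phi> x)) \<le> B + (2 * C' + 1)" if V: "V \<in> \<phi>d ` src.I" for V
    proof -
      have VI: "V \<in> tgt.I" using V by auto
      obtain a where a: "tgt.nearest Y (2 * C' + 1) V (pt H' V (\<phi> x)) a" "tgt.d V (pt H' V (g (\<phi> x))) a \<le> B"
        using near[OF phi_in[OF x] VI] by blast
      have aM: "a \<in> tgt.M V" using a tgt.prj_image_subset[OF Y_subset VI] unfolding tgt.nearest_def by blast
      \<comment> \<open>\<open>\<phi> x\<close> belongs to \<open>Y\<close>, so a nearest point for
        it is within the slack.\<close>
      have "tgt.d V (pt H' V (\<phi> x)) a \<le> tgt.d V (pt H' V (\<phi> x)) (pt H' V (\<phi> x)) + (2 * C' + 1)"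
        using a(1) tgt.pt_in_prj_image[OF Y_subset VI] x unfolding tgt.nearest_def by blast
      moreover have "tgt.d V (pt H' V (g (\<phi> x))) (pt H' V (\<phi> x)) \<le> tgt.d V (pt H' V (g (\<phi> x))) a + tgt.d V a (pt H' V (\<phi> x))"
        using VI x gX aM by (intro tgt.d_triangle) auto
      ultimately show ?thesis
        using a(2) ff x VI mdist_commute[of "hyp H' V" a "pt H' V (\<phi> x)"] by simp
    qed
    then show ?thesis using t(2) fX x by simp
  qed
  then show ?thesis using KB2 t(1) fX by (intro exI[of _ f] exI[of _ K2] exI[of _ "B2 + t"]) (auto intro: add_increasing2 order_trans)
qed

lemma lipschitz_imp_qi_embedding:
  assumes hq: "hierarchically_quasiconvex H' Y" and lip: "coarsely_lipschitz (ambient H) (ambient H') \<phi>"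
  shows "\<exists>K C. qi_embedding K C (ambient H) (ambient H') \<phi>"
proof -
  obtain f K B where f: "\<And>z. z \<in> tgt.X \<Longrightarrow> f z \<in> src.X" "0 \<le> K" "0 \<le> B"
    "\<And>z w. z \<in> tgt.X \<Longrightarrow> w \<in> tgt.X \<Longrightarrow> mdist (ambient H) (f z) (f w) \<le> K * mdist (ambient H') z w + B"
    "\<And>x. x \<in> src.X \<Longrightarrow> mdist (ambient H) (f (\<phi> x)) x \<le> B"
    using coarse_left_inverse[OF hq] by blast
  obtain K1 C1 where lip1: "\<forall>x\<in>src.X. \<forall>y\<in>src.X. mdist (ambient H') (\<phi> x) (\<phi> y) \<le> K1 * mdist (ambient H) x y + C1"
    using lip unfolding coarsely_lipschitz_def by blast
  define Q where "Q = 1 + K + \<bar>K1\<bar>"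
  define R where "R = 3 * B + \<bar>C1\<bar>"
  have Q: "1 \<le> Q" "K \<le> Q" "K1 \<le> Q" "0 \<le> R" "C1 \<le> R" "3 * B \<le> R" using f by (auto simp: Q_def R_def)
  have "mdist (ambient H) x y / Q - R \<le> mdist (ambient H') (\<phi> x) (\<phi> y) \<and>
      mdist (ambient H') (\<phi> x) (\<phi> y) \<le> Q * mdist (ambient H) x y + R" if xy: "x \<in> src.X" "y \<in> src.X" for x y
  proof
    have "K1 * mdist (ambient H) x y \<le> Q * mdist (ambient H) x y" using Q by (intro mult_right_mono) auto
    then show "mdist (ambient H') (\<phi> x) (\<phi> y) \<le> Q * mdist (ambient H) x y + R" using lip1 xy Q(5) by fastforce
    have "mdist (ambient H) x y \<le> mdist (ambient H) x (f (\<phi> x)) + mdist (ambient H) (f (\<phi> x)) (f (\<phi> y)) + mdist (ambient H) (f (\<phi> y)) y"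
      using xy f(1) by (intro mdist_triangle3) auto
    moreover have "K * mdist (ambient H') (\<phi> x) (\<phi> y) \<le> Q * mdist (ambient H') (\<phi> x) (\<phi> y)"
      using Q by (intro mult_right_mono) auto
    ultimately have "mdist (ambient H) x y \<le> Q * mdist (ambient H') (\<phi> x) (\<phi> y) + R"
      using f(4)[of "\<phi> x" "\<phi> y"] f(5)[OF xy(1)] f(5)[OF xy(2)] xy Q(6)
        mdist_commute[of "ambient H" x "f (\<phi> x)"] by simp
    moreover have "R \<le> Q * R" using Q by (simp add: mult_le_cancel_right1)
    ultimately have "mdist (ambient H) x y \<le> (mdist (ambient H') (\<phi> x) (\<phi> y) + R) * Q" by (simp add: algebra_simps)
    then have "mdist (ambient H) x y / Q \<le> mdist (ambient H') (\<phi> x) (\<phi> y) + R" using Q by (simp add: divide_le_eq)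
    then show "mdist (ambient H) x y / Q - R \<le> mdist (ambient H') (\<phi> x) (\<phi> y)" by simp
  qed
  then show ?thesis unfolding qi_embedding_def using Q by (intro exI[of _ Q] exI[of _ R]) auto
qed

definition bounded_outside :: bool where
  "bounded_outside \<longleftrightarrow> (\<exists>\<mu>::real. \<forall>W\<in>index H' - \<phi>d ` index H.
     hdiam H' W (prj_image H' W (\<phi> ` points H)) \<le> ennreal \<mu>)"

lemma bounded_outsideI:
  assumes "\<And>W x y. W \<in> tgt.I \<Longrightarrow> W \<notin> \<phi>d ` src.I \<Longrightarrow> x \<in> src.X \<Longrightarrow> y \<in> src.X \<Longrightarrow>
    tgt.d W (pt H' W (\<phi> x)) (pt H' W (\<phi> y)) \<le> B"
  shows bounded_outside
proof -
  have "hdiam H' W (prj_image H' W Y) \<le> ennreal (2 * C' + B)" if W: "W \<in> index H' - \<phi>d ` index H" for W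
  proof (rule mdiam_leI)
    fix u v assume uv: "u \<in> prj_image H' W Y" "v \<in> prj_image H' W Y"
    have WI: "W \<in> tgt.I" using W by blast
    obtain x where x: "x \<in> src.X" "u \<in> prj H' W (\<phi> x)" using uv by (auto simp: prj_image_def)
    obtain y where y: "y \<in> src.X" "v \<in> prj H' W (\<phi> y)" using uv by (auto simp: prj_image_def)
    have "tgt.d W u v \<le> tgt.d W u (pt H' W (\<phi> x)) + tgt.d W (pt H' W (\<phi> x)) (pt H' W (\<phi> y)) + tgt.d W (pt H' W (\<phi> y)) v"
      using WI x y uv tgt.prj_image_subset[OF Y_subset WI] by (intro mdist_triangle3) auto
    then show "tgt.d W u v \<le> 2 * C' + B"
      using assms[OF WI _ x(1) y(1)] W tgt.pt_prj_close[OF WI phi_in[OF x(1)] x(2)]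
        tgt.pt_prj_close[OF WI phi_in[OF y(1)] y(2)] mdist_commute[of "hyp H' W" u "pt H' W (\<phi> x)"] by simp
  qed
  then show ?thesis unfolding bounded_outside_def by blast
qed

lemma bounded_outsideD:
  assumes bounded_outside
  shows "\<exists>B\<ge>0. \<forall>W\<in>tgt.I. W \<notin> \<phi>d ` src.I \<longrightarrow> (\<forall>x\<in>src.X. \<forall>y\<in>src.X.
    tgt.d W (pt H' W (\<phi> x)) (pt H' W (\<phi> y)) \<le> B)"
proof -
  obtain \<mu> :: real where \<mu>: "\<And>W. W \<in> index H' - \<phi>d ` index H \<Longrightarrow>
      hdiam H' W (prj_image H' W (\<phi> ` points H)) \<le> ennreal \<mu>"
    using assms unfolding bounded_outside_def by blast
  have "tgt.d W (pt H' W (\<phi> x)) (pt H' W (\<phi> y)) \<le> max 0 \<mu>"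
    if "W \<in> tgt.I" "W \<notin> \<phi>d ` src.I" "x \<in> src.X" "y \<in> src.X" for W x y
  proof (rule mdiam_leD)
    show "hdiam H' W (prj_image H' W Y) \<le> ennreal (max 0 \<mu>)"
      using \<mu>[of W] that ennreal_leI[of \<mu> "max 0 \<mu>"] by (auto intro: order_trans)
  qed (use that tgt.pt_in_prj_image[OF Y_subset] in auto)
  then show ?thesis by (intro exI[of _ "max 0 \<mu>"]) auto
qed

text \<open>Coordinates at image domains follow the source projections, which are coarsely
  Lipschitz; only the remaining ones could spoil the estimate, and they are bounded.\<close>

lemma bounded_outside_imp_lipschitz:
  assumes bounded_outside
  shows "coarsely_lipschitz (ambient H) (ambient H') \<phi>"
proof -
  obtain B where B: "0 \<le> B" "\<And>W x y. W \<in> tgt.I \<Longrightarrow> W \<notin> \<phi>d ` src.I \<Longrightarrow> x \<in> src.X \<Longrightarrow> y \<in> src.X \<Longrightarrow>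
    tgt.d W (pt H' W (\<phi> x)) (pt H' W (\<phi> y)) \<le> B"
    using bounded_outsideD[OF assms] by blast
  have "\<exists>K K'. 0 \<le> K \<and> 0 \<le> K' \<and> (\<forall>x\<in>src.X. \<forall>y\<in>src.X. mdist (ambient H') (\<phi> x) (\<phi> y) \<le> K * mdist (ambient H) x y + K')"
  proof (rule tgt.coordinatewise_lipschitz[OF src.quasigeodesic src.C_ge_1])
    show "\<phi> \<in> src.X \<rightarrow> tgt.X" by auto
    fix x y W assume x: "x \<in> src.X" and y: "y \<in> src.X" and xy: "mdist (ambient H) x y \<le> 2 * C" and W: "W \<in> tgt.I"
    show "tgt.d W (pt H' W (\<phi> x)) (pt H' W (\<phi> y)) \<le> B + (L * (C * (2 * C) + C) + 3 * L)"
    proof (cases "W \<in> \<phi>d ` src.I")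
      case True
      then obtain U where U: "U \<in> src.I" "W = \<phi>d U" by blast
      have "C * mdist (ambient H) x y \<le> C * (2 * C)" using xy src.C_ge_1 by (intro mult_left_mono) auto
      then have "src.d U (pt H U x) (pt H U y) \<le> C * (2 * C) + C" using src.pt_lipschitz[OF U(1) x y] by linarith
      then have "L * src.d U (pt H U x) (pt H U y) \<le> L * (C * (2 * C) + C)" using L_ge_1 by (intro mult_left_mono) auto
      then show ?thesis using pt_image_upper[OF U(1) x y] U(2) B(1) by simp
    next
      case False
      have "0 \<le> L * (C * (2 * C) + C) + 3 * L" using L_ge_1 src.C_ge_1 by simp
      then show ?thesis using B(2)[OF W False x y] by linarith
    qed
  qed
  then show ?thesis unfolding coarsely_lipschitz_def by auto
qed

text \<open>Points of a product region have bounded coordinates outside the image of the index set, and so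
  do their gates; hence so does the image as soon as it is covered by gates of the product region.\<close>

lemma gates_cover_imp_bounded_outside:
  assumes hq: "hierarchically_quasiconvex H' Y" and e: "e \<in> E_tuples H' \<kappa> (\<phi>d S)" and pos: "0 \<le> \<kappa>" "0 \<le> \<theta>"
    and g: "gate_map H' Y g"
    and cover: "\<And>y. y \<in> Y \<Longrightarrow> \<exists>z\<in>F_copy H' \<kappa> \<theta> (\<phi>d S) e. mdist (ambient H') (g z) y \<le> B"
  shows bounded_outside
proof -
  let ?F = "F_copy H' \<kappa> \<theta> (\<phi>d S) e"
  have F: "?F \<subseteq> tgt.X" by (rule tgt.F_copy_subset)
  obtain B1 where gX: "\<And>z. z \<in> tgt.X \<Longrightarrow> g z \<in> Y \<and> g z \<in> tgt.X"
    and near: "\<And>z V. z \<in> tgt.X \<Longrightarrow> V \<in> tgt.I \<Longrightarrow>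
      \<exists>a. tgt.nearest Y (2 * C' + 1) V (pt H' V z) a \<and> tgt.d V (pt H' V (g z)) a \<le> B1"
    using tgt.gate_map_nearest[OF g Y_subset] by blast
  obtain k where k: "0 \<le> k" "\<And>U. U \<in> tgt.I \<Longrightarrow> quasiconvex (hyp H' U) k (prj_image H' U Y)"
    using hq unfolding hierarchically_quasiconvex_def by blast
  define r where "r = 2 * (2 * C' + 1) + 4 * (2 * (\<theta> + \<kappa> + 2 * C' + 1)) + 4 * C' + 2 * k + 6"
  define s where "s = C' * B + C'"
  show ?thesis
  proof (rule bounded_outsideI)
    fix W x y assume W: "W \<in> tgt.I" "W \<notin> \<phi>d ` src.I" and x: "x \<in> src.X" and y: "y \<in> src.X"
    have nW: "\<not> nest H' W (\<phi>d S)" using nest_top_iff W by blast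
    obtain z where z: "z \<in> ?F" "mdist (ambient H') (g z) (\<phi> x) \<le> B" using cover x by blast
    obtain w where w: "w \<in> ?F" "mdist (ambient H') (g w) (\<phi> y) \<le> B" using cover y by blast
    have zw: "z \<in> tgt.X" "w \<in> tgt.X" using z w F by auto
    obtain a where a: "tgt.nearest Y (2 * C' + 1) W (pt H' W z) a" "tgt.d W (pt H' W (g z)) a \<le> B1"
      using near[OF zw(1) W(1)] by blast
    obtain b where b: "tgt.nearest Y (2 * C' + 1) W (pt H' W w) b" "tgt.d W (pt H' W (g w)) b \<le> B1"
      using near[OF zw(2) W(1)] by blast
    have abM: "a \<in> tgt.M W" "b \<in> tgt.M W"
      using a b tgt.prj_image_subset[OF Y_subset W(1)] unfolding tgt.nearest_def by blast+
    have "tgt.d W (pt H' W z) (pt H' W w) \<le> 2 * (\<theta> + \<kappa> + 2 * C' + 1)"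
      using tgt.F_copy_outside_close[OF _ e pos z(1) w(1) W(1) nW] by simp
    then have ab: "tgt.d W a b \<le> r"
      using tgt.nearest_close[OF k(2)[OF W(1)] k(1) W(1) _ _ a(1) b(1)] W zw by (simp add: r_def)
    have close: "tgt.d W (pt H' W (\<phi> x)) (pt H' W (g z)) \<le> s"
      if "x \<in> src.X" "z \<in> tgt.X" "mdist (ambient H') (g z) (\<phi> x) \<le> B" for x z
    proof -
      have "C' * mdist (ambient H') (\<phi> x) (g z) \<le> C' * B"
        using that tgt.C_ge_1 mdist_commute[of "ambient H'" "\<phi> x" "g z"] by (intro mult_left_mono) auto
      then show ?thesis using tgt.pt_lipschitz[OF W(1) phi_in[OF that(1)], of "g z"] gX[OF that(2)] unfolding s_def by linarith
    qed
    have "tgt.d W (pt H' W (\<phi> x)) b \<le> tgt.d W (pt H' W (\<phi> x)) (pt H' W (g z)) + tgt.d W (pt H' W (g z)) a + tgt.d W a b"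
      using W x gX[OF zw(1)] abM by (intro mdist_triangle3) auto
    moreover have "tgt.d W (pt H' W (\<phi> x)) (pt H' W (\<phi> y)) \<le> tgt.d W (pt H' W (\<phi> x)) b
        + tgt.d W b (pt H' W (g w)) + tgt.d W (pt H' W (g w)) (pt H' W (\<phi> y))"
      using W x y gX[OF zw(2)] abM by (intro mdist_triangle3) auto
    ultimately show "tgt.d W (pt H' W (\<phi> x)) (pt H' W (\<phi> y)) \<le> s + s + (B1 + B1) + r"
      using close[OF x zw(1) z(2)] close[OF y zw(2) w(2)] a(2) b(2) ab
        mdist_commute[of "hyp H' W" b "pt H' W (g w)"]
        mdist_commute[of "hyp H' W" "pt H' W (\<phi> y)" "pt H' W (g w)"] by linarith
  qed
qed

text \<open>Uniqueness in the target cannot compare \<open>g z\<close> with \<open>y\<close>, as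
  their outer coordinates are not yet controlled. Writing \<open>g z = \<phi> c\<close>, the inner
  coordinates of \<open>\<phi> c\<close> and \<open>\<phi> x\<close> are close, so \<open>c\<close>
  is near \<open>x\<close> by uniqueness in the source, and the Lipschitz bound leads back to the
  target.\<close>

lemma lipschitz_imp_bounded_outside:
  assumes hq: "hierarchically_quasiconvex H' Y" and e: "e \<in> E_tuples H' \<kappa> (\<phi>d S)" and pos: "0 \<le> \<kappa>" "0 \<le> \<theta>"
    and real: "\<And>x. x \<in> tgt.X \<Longrightarrow> \<exists>z\<in>F_copy H' \<kappa> \<theta> (\<phi>d S) e. \<forall>V\<in>tgt.I. nest H' V (\<phi>d S) \<longrightarrow>
      tgt.d V (pt H' V z) (pt H' V x) \<le> \<theta>0"
    and lip: "coarsely_lipschitz (ambient H) (ambient H') \<phi>"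
  shows bounded_outside
proof -
  let ?F = "F_copy H' \<kappa> \<theta> (\<phi>d S) e"
  have F: "?F \<subseteq> tgt.X" by (rule tgt.F_copy_subset)
  obtain g where g: "gate_map H' Y g" using tgt.hierarchically_quasiconvex_gate_exists[OF hq Y_nonempty] by blast
  obtain B1 where gX: "\<And>z. z \<in> tgt.X \<Longrightarrow> g z \<in> Y \<and> g z \<in> tgt.X"
    and near: "\<And>z V. z \<in> tgt.X \<Longrightarrow> V \<in> tgt.I \<Longrightarrow>
      \<exists>a. tgt.nearest Y (2 * C' + 1) V (pt H' V z) a \<and> tgt.d V (pt H' V (g z)) a \<le> B1"
    using tgt.gate_map_nearest[OF g Y_subset] by blast
  obtain K1 C1 where lip1: "\<forall>x\<in>src.X. \<forall>y\<in>src.X. mdist (ambient H') (\<phi> x) (\<phi> y) \<le> K1 * mdist (ambient H) x y + C1"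
    using lip unfolding coarsely_lipschitz_def by blast
  obtain t where t: "0 \<le> t" "\<forall>x\<in>src.X. \<forall>y\<in>src.X.
    (\<forall>V\<in>\<phi>d ` src.I. tgt.d V (pt H' V (\<phi> x)) (pt H' V (\<phi> y)) \<le> B1 + 2 * \<theta>0 + (2 * C' + 1)) \<longrightarrow> mdist (ambient H) x y \<le> t"
    using image_points_close by blast
  show ?thesis
  proof (rule gates_cover_imp_bounded_outside[OF hq e pos g])
    fix y assume "y \<in> Y"
    then obtain x where x: "x \<in> src.X" "y = \<phi> x" by blast
    obtain z where z: "z \<in> ?F" "\<And>V. V \<in> tgt.I \<Longrightarrow> nest H' V (\<phi>d S) \<Longrightarrow> tgt.d V (pt H' V z) (pt H' V (\<phi> x)) \<le> \<theta>0"
      using real[of "\<phi> x"] x by auto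
    have zX: "z \<in> tgt.X" using z F by blast
    obtain c where c: "c \<in> src.X" "g z = \<phi> c" using gX[OF zX] by blast
    have "tgt.d V (pt H' V (\<phi> c)) (pt H' V (\<phi> x)) \<le> B1 + 2 * \<theta>0 + (2 * C' + 1)" if V: "V \<in> \<phi>d ` src.I" for V
    proof -
      have VI: "V \<in> tgt.I" using V by auto
      have zx: "tgt.d V (pt H' V z) (pt H' V (\<phi> x)) \<le> \<theta>0" using z(2)[OF VI] nest_top_iff[OF VI] V by blast
      obtain a where a: "tgt.nearest Y (2 * C' + 1) V (pt H' V z) a" "tgt.d V (pt H' V (g z)) a \<le> B1"
        using near[OF zX VI] by blast
      have aM: "a \<in> tgt.M V" using a tgt.prj_image_subset[OF Y_subset VI] unfolding tgt.nearest_def by blast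
      have "tgt.d V (pt H' V z) a \<le> tgt.d V (pt H' V z) (pt H' V (\<phi> x)) + (2 * C' + 1)"
        using a(1) tgt.pt_in_prj_image[OF Y_subset VI] x unfolding tgt.nearest_def by blast
      moreover have "tgt.d V (pt H' V (g z)) (pt H' V (\<phi> x)) \<le> tgt.d V (pt H' V (g z)) a + tgt.d V a (pt H' V z) + tgt.d V (pt H' V z) (pt H' V (\<phi> x))"
        using VI x gX[OF zX] zX aM by (intro mdist_triangle3) auto
      ultimately show ?thesis
        using a(2) c(2) zx mdist_commute[of "hyp H' V" a "pt H' V z"] by simp
    qed
    then have "mdist (ambient H) c x \<le> t" using t(2) c x by blast
    then have "\<bar>K1\<bar> * mdist (ambient H) c x \<le> \<bar>K1\<bar> * t" by (intro mult_left_mono) auto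
    moreover have "K1 * mdist (ambient H) c x \<le> \<bar>K1\<bar> * mdist (ambient H) c x" by (intro mult_right_mono) auto
    ultimately have "mdist (ambient H') (g z) y \<le> \<bar>K1\<bar> * t + C1" using lip1 c x by fastforce
    then show "\<exists>z\<in>?F. mdist (ambient H') (g z) y \<le> \<bar>K1\<bar> * t + C1" using z(1) by blast
  qed
qed

text \<open>Both gates move inner coordinates boundedly: \<open>g\<close> because projections of the
  image are coarsely dense there, \<open>h\<close> because the copy contains points with prescribed
  inner coordinates. Outer coordinates are bounded on each set, so both composites are near the
  identity by uniqueness.\<close>

lemma bounded_outside_imp_gates:
  assumes hq: "hierarchically_quasiconvex H' Y" and e: "e \<in> E_tuples H' \<kappa> (\<phi>d S)" and pos: "0 \<le> \<kappa>" "0 \<le> \<theta>" "0 \<le> \<theta>0"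
    and real: "\<And>x. x \<in> tgt.X \<Longrightarrow> \<exists>z\<in>F_copy H' \<kappa> \<theta> (\<phi>d S) e. \<forall>V\<in>tgt.I. nest H' V (\<phi>d S) \<longrightarrow>
      tgt.d V (pt H' V z) (pt H' V x) \<le> \<theta>0"
    and bo: bounded_outside
  shows "gates_quasi_inverse H' Y (F_copy H' \<kappa> \<theta> (\<phi>d S) e)"
proof -
  let ?F = "F_copy H' \<kappa> \<theta> (\<phi>d S) e"
  have F: "?F \<subseteq> tgt.X" by (rule tgt.F_copy_subset)
  have SI: "\<phi>d S \<in> tgt.I" by simp
  obtain Bo where Bo: "0 \<le> Bo" "\<And>W x y. W \<in> tgt.I \<Longrightarrow> W \<notin> \<phi>d ` src.I \<Longrightarrow> x \<in> src.X \<Longrightarrow> y \<in> src.X \<Longrightarrow>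
    tgt.d W (pt H' W (\<phi> x)) (pt H' W (\<phi> y)) \<le> Bo"
    using bounded_outsideD[OF bo] by blast
  have mY: "mspace (submetric (ambient H') Y) = Y" and mF: "mspace (submetric (ambient H') ?F) = ?F"
    using Y_subset F by auto
  have main: "(\<exists>C. quasi_inverses C (submetric (ambient H') ?F) (submetric (ambient H') Y) g h) \<and>
        (\<exists>K C. quasi_isometry K C (submetric (ambient H') ?F) (submetric (ambient H') Y) g) \<and>
        (\<exists>K C. quasi_isometry K C (submetric (ambient H') Y) (submetric (ambient H') ?F) h)"
    if g: "gate_map H' Y g" and h: "gate_map H' ?F h" for g h
  proof -
    obtain B1 where gX: "\<And>z. z \<in> tgt.X \<Longrightarrow> g z \<in> Y \<and> g z \<in> tgt.X"
      and near_g: "\<And>z V. z \<in> tgt.X \<Longrightarrow> V \<in> tgt.I \<Longrightarrow>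
        \<exists>a. tgt.nearest Y (2 * C' + 1) V (pt H' V z) a \<and> tgt.d V (pt H' V (g z)) a \<le> B1"
      using tgt.gate_map_nearest[OF g Y_subset] by blast
    obtain B2 where hX: "\<And>z. z \<in> tgt.X \<Longrightarrow> h z \<in> ?F \<and> h z \<in> tgt.X"
      and near_h: "\<And>z V. z \<in> tgt.X \<Longrightarrow> V \<in> tgt.I \<Longrightarrow>
        \<exists>a. tgt.nearest ?F (2 * C' + 1) V (pt H' V z) a \<and> tgt.d V (pt H' V (h z)) a \<le> B2"
      using tgt.gate_map_nearest[OF h F] by blast
    have inside: "tgt.d V (pt H' V (g' z)) (pt H' V z) \<le> B + (2 * C' + 1) + r"
      if Z: "Z \<subseteq> tgt.X" and z: "z \<in> tgt.X" "g' z \<in> tgt.X" and V: "V \<in> tgt.I"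
        and a: "\<exists>a. tgt.nearest Z (2 * C' + 1) V (pt H' V z) a \<and> tgt.d V (pt H' V (g' z)) a \<le> B"
        and w: "w \<in> Z" "tgt.d V (pt H' V z) (pt H' V w) \<le> r" for Z z g' V B w r
    proof -
      obtain a where a: "tgt.nearest Z (2 * C' + 1) V (pt H' V z) a" "tgt.d V (pt H' V (g' z)) a \<le> B" using a by blast
      have aM: "a \<in> tgt.M V" using a tgt.prj_image_subset[OF Z V] unfolding tgt.nearest_def by blast
      have "tgt.d V (pt H' V z) a \<le> tgt.d V (pt H' V z) (pt H' V w) + (2 * C' + 1)"
        using a(1) tgt.pt_in_prj_image[OF Z V w(1)] unfolding tgt.nearest_def by blast
      moreover have "tgt.d V (pt H' V (g' z)) (pt H' V z) \<le> tgt.d V (pt H' V (g' z)) a + tgt.d V a (pt H' V z)"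
        using V z aM by (intro tgt.d_triangle) auto
      ultimately show ?thesis using a(2) w(2) mdist_commute[of "hyp H' V" a "pt H' V z"] by linarith
    qed
    have g_in: "tgt.d V (pt H' V (g z)) (pt H' V z) \<le> B1 + (2 * C' + 1) + (L * C + 3 * L)"
      if z: "z \<in> tgt.X" and V: "V \<in> \<phi>d ` src.I" for z V
    proof -
      have VI: "V \<in> tgt.I" using V by auto
      obtain x where "x \<in> src.X" "tgt.d V (pt H' V z) (pt H' V (\<phi> x)) \<le> L * C + 3 * L"
        using pt_image_dense[OF V tgt.pt_in[OF VI z]] by blast
      then show ?thesis using gX[OF z] by (intro inside[where g'=g and w="\<phi> x", OF Y_subset z _ VI near_g[OF z VI]]) auto
    qed
    have h_in: "tgt.d V (pt H' V (h z)) (pt H' V z) \<le> B2 + (2 * C' + 1) + \<theta>0"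
      if z: "z \<in> tgt.X" and V: "V \<in> \<phi>d ` src.I" for z V
    proof -
      have VI: "V \<in> tgt.I" using V by auto
      obtain w where w: "w \<in> ?F" "\<forall>V\<in>tgt.I. nest H' V (\<phi>d S) \<longrightarrow> tgt.d V (pt H' V w) (pt H' V z) \<le> \<theta>0"
        using real[OF z] by blast
      then have "tgt.d V (pt H' V z) (pt H' V w) \<le> \<theta>0"
        using nest_top_iff[OF VI] V VI mdist_commute[of "hyp H' V" "pt H' V z"] by simp
      then show ?thesis using hX[OF z] w by (intro inside[where g'=h and w=w, OF F z _ VI near_h[OF z VI]]) auto
    qed
    define rg where "rg = B1 + (2 * C' + 1) + (L * C + 3 * L)"
    define rh where "rh = B2 + (2 * C' + 1) + \<theta>0"
    define r where "r = \<bar>rg + rh\<bar> + Bo + 2 * (\<theta> + \<kappa> + 2 * C' + 1)"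
    have r: "rg + rh \<le> r" "Bo \<le> r" "2 * (\<theta> + \<kappa> + 2 * C' + 1) \<le> r"
      using Bo(1) pos tgt.C_ge_1 by (auto simp: r_def)
    obtain t where t: "0 \<le> t" "\<forall>x\<in>tgt.X. \<forall>y\<in>tgt.X.
        (\<forall>V\<in>tgt.I. tgt.d V (pt H' V x) (pt H' V y) \<le> r) \<longrightarrow> mdist (ambient H') x y \<le> t"
      using tgt.uniqueness_pt by blast
    have gh: "mdist (ambient H') (g (h y)) y \<le> t" if y: "y \<in> Y" for y
    proof -
      have yX: "y \<in> tgt.X" using y Y_subset by blast
      have hy: "h y \<in> tgt.X" "g (h y) \<in> Y" "g (h y) \<in> tgt.X" using hX[OF yX] gX by auto
      have "tgt.d V (pt H' V (g (h y))) (pt H' V y) \<le> r" if V: "V \<in> tgt.I" for V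
      proof (cases "V \<in> \<phi>d ` src.I")
        case True
        have "tgt.d V (pt H' V (g (h y))) (pt H' V y) \<le> tgt.d V (pt H' V (g (h y))) (pt H' V (h y)) + tgt.d V (pt H' V (h y)) (pt H' V y)"
          using V hy yX by (intro tgt.d_triangle) auto
        then show ?thesis using g_in[OF hy(1) True] h_in[OF yX True] r(1) unfolding rg_def rh_def by linarith
      next
        case False
        obtain c where c: "c \<in> src.X" "y = \<phi> c" using y by blast
        obtain c' where c': "c' \<in> src.X" "g (h y) = \<phi> c'" using hy(2) by blast
        show ?thesis using Bo(2)[OF V False c'(1) c(1)] r(2) by (simp add: c(2) c'(2)[unfolded c(2)])
      qed
      then show ?thesis using t(2) hy yX by blast
    qed
    have hg: "mdist (ambient H') (h (g z)) z \<le> t" if z: "z \<in> ?F" for z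
    proof -
      have zX: "z \<in> tgt.X" using z F by blast
      have gz: "g z \<in> tgt.X" "h (g z) \<in> ?F" "h (g z) \<in> tgt.X" using gX[OF zX] hX by auto
      have "tgt.d V (pt H' V (h (g z))) (pt H' V z) \<le> r" if V: "V \<in> tgt.I" for V
      proof (cases "V \<in> \<phi>d ` src.I")
        case True
        have "tgt.d V (pt H' V (h (g z))) (pt H' V z) \<le> tgt.d V (pt H' V (h (g z))) (pt H' V (g z)) + tgt.d V (pt H' V (g z)) (pt H' V z)"
          using V gz zX by (intro tgt.d_triangle) auto
        then show ?thesis using h_in[OF gz(1) True] g_in[OF zX True] r(1) unfolding rg_def rh_def by linarith
      next
        case False
        then have "\<not> nest H' V (\<phi>d S)" using nest_top_iff V by blast
        then show ?thesis using tgt.F_copy_outside_close[OF SI e pos(1,2) gz(2) z V] r(3) by linarith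
      qed
      then show ?thesis using t(2) gz zX by blast
    qed
    have qi: "quasi_inverses t (submetric (ambient H') ?F) (submetric (ambient H') Y) g h"
      and qi': "quasi_inverses t (submetric (ambient H') Y) (submetric (ambient H') ?F) h g"
      unfolding quasi_inverses_def mY mF mdist_submetric using gh hg gX hX Y_subset F by blast+
    obtain K1 C1 where lg: "\<forall>x\<in>tgt.X. \<forall>y\<in>tgt.X. mdist (ambient H') (g x) (g y) \<le> K1 * mdist (ambient H') x y + C1"
      using g unfolding gate_map_def coarsely_lipschitz_def by auto
    obtain K2 C2 where lh: "\<forall>x\<in>tgt.X. \<forall>y\<in>tgt.X. mdist (ambient H') (h x) (h y) \<le> K2 * mdist (ambient H') x y + C2"
      using h unfolding gate_map_def coarsely_lipschitz_def by auto
    have "\<exists>K C. quasi_isometry K C (submetric (ambient H') ?F) (submetric (ambient H') Y) g"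
      by (rule quasi_isometry_of_quasi_inverses[OF qi, of K1 C1 K2 C2]) (use lg lh Y_subset F in auto)
    moreover have "\<exists>K C. quasi_isometry K C (submetric (ambient H') Y) (submetric (ambient H') ?F) h"
      by (rule quasi_isometry_of_quasi_inverses[OF qi', of K2 C2 K1 C1]) (use lg lh Y_subset F in auto)
    ultimately show ?thesis using qi by blast
  qed
  have "\<exists>g. gate_map H' Y g" using tgt.hierarchically_quasiconvex_gate_exists[OF hq Y_nonempty] .
  moreover have "\<exists>h. gate_map H' ?F h" by (rule tgt.F_copy_gate_exists[OF SI e pos real])
  ultimately show ?thesis unfolding gates_quasi_inverse_def using main by blast
qed

lemma gates_imp_bounded_outside:
  assumes hq: "hierarchically_quasiconvex H' Y" and e: "e \<in> E_tuples H' \<kappa> (\<phi>d S)" and pos: "0 \<le> \<kappa>" "0 \<le> \<theta>"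
    and gates: "gates_quasi_inverse H' Y (F_copy H' \<kappa> \<theta> (\<phi>d S) e)"
  shows bounded_outside
proof -
  let ?F = "F_copy H' \<kappa> \<theta> (\<phi>d S) e"
  have F: "?F \<subseteq> tgt.X" by (rule tgt.F_copy_subset)
  obtain g h c where g: "gate_map H' Y g" and "gate_map H' ?F h"
    and qi: "quasi_inverses c (submetric (ambient H') ?F) (submetric (ambient H') Y) g h"
    using gates unfolding gates_quasi_inverse_def by blast
  have "\<exists>z\<in>?F. mdist (ambient H') (g z) y \<le> c" if "y \<in> Y" for y
    using qi that Y_subset unfolding quasi_inverses_def by (intro bexI[of _ "h y"]) auto
  then show ?thesis by (rule gates_cover_imp_bounded_outside[OF hq e pos g])
qed

end

section \<open>The transported structure\<close>

text \<open>Uniqueness of the transported structure concerns the subspace metric: source points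
  within \<open>2 * C\<close> have close transported projections, hence uniformly close
  images.\<close>

lemma (in full_hiero) transported_hhs_imp_lipschitz:
  assumes "image_admits_transported_hhs H H' \<phi> \<phi>d \<phi>s"
  shows "coarsely_lipschitz (ambient H) (ambient H') \<phi>"
proof -
  obtain \<psi> where hT: "hhs (transported_structure H H' \<phi> \<phi>d \<phi>s \<psi>)"
    using assms unfolding image_admits_transported_hhs_def by blast
  define T where "T = transported_structure H H' \<phi> \<phi>d \<phi>s \<psi>"
  have T: "ambient T = submetric (ambient H') Y" "index T = \<phi>d ` src.I" "hyp T = hyp H'"
    "prj T = (\<lambda>W y. \<Union>x\<in>{x \<in> points H. \<phi> x = y}. \<phi>s (inv_into (index H) \<phi>d W) ` prj H (inv_into (index H) \<phi>d W) x)"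
    by (simp_all add: T_def transported_structure_def Let_def)
  have "index T \<noteq> {}" using T(2) S_in by blast
  then obtain D where "coarse_hhs T D" using hhs_imp_coarse_hhs hT unfolding T_def by blast
  then interpret trn: coarse_hhs T D .
  define r where "r = L * (C * (2 * C) + C) + L"
  obtain t where t: "\<forall>x\<in>points T. \<forall>y\<in>points T.
      (\<forall>V\<in>index T. \<exists>u\<in>prj T V x. \<exists>v\<in>prj T V y. mdist (hyp T V) u v \<le> r) \<longrightarrow> mdist (ambient T) x y \<le> t"
    using trn.uniqueness by blast
  have born: "mdist (ambient H') (\<phi> x) (\<phi> y) \<le> t"
    if x: "x \<in> src.X" and y: "y \<in> src.X" and xy: "mdist (ambient H) x y \<le> 2 * C" for x y
  proof -
    have "\<exists>u\<in>prj T V (\<phi> x). \<exists>v\<in>prj T V (\<phi> y). mdist (hyp T V) u v \<le> r" if V: "V \<in> index T" for V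
    proof -
      obtain U where U: "U \<in> src.I" "V = \<phi>d U" using V T(2) by blast
      have inv: "inv_into (index H) \<phi>d V = U" using U phid_inj by simp
      have "C * mdist (ambient H) x y \<le> C * (2 * C)" using xy src.C_ge_1 by (intro mult_left_mono) auto
      then have "src.d U (pt H U x) (pt H U y) \<le> C * (2 * C) + C" using src.pt_lipschitz[OF U(1) x y] by linarith
      then have "L * src.d U (pt H U x) (pt H U y) \<le> L * (C * (2 * C) + C)" using L_ge_1 by (intro mult_left_mono) auto
      then have "tgt.d V (\<phi>s U (pt H U x)) (\<phi>s U (pt H U y)) \<le> r"
        using phis_upper[OF U(1) src.pt_in[OF U(1) x] src.pt_in[OF U(1) y]] unfolding r_def U(2) by linarith
      moreover have "\<phi>s U (pt H U x) \<in> prj T V (\<phi> x)" "\<phi>s U (pt H U y) \<in> prj T V (\<phi> y)"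
        unfolding T(4) inv using src.pt_in_prj[OF U(1)] x y by blast+
      ultimately show ?thesis unfolding T(3) by blast
    qed
    then show ?thesis using t x y unfolding T(1) by auto
  qed
  have "\<exists>K K'. 0 \<le> K \<and> 0 \<le> K' \<and>
    (\<forall>x\<in>src.X. \<forall>y\<in>src.X. mdist (ambient H') (\<phi> x) (\<phi> y) \<le> K * mdist (ambient H) x y + K')"
  proof (rule quasigeodesic_bornologous_lipschitz[OF src.quasigeodesic src.C_ge_1 _ born])
    show "\<phi> \<in> src.X \<rightarrow> tgt.X" by auto
  qed
  then show ?thesis unfolding coarsely_lipschitz_def by auto
qed

section \<open>The axioms for the transported structure\<close>

locale full_hiero_inv = full_hiero H C H' C' \<phi> \<phi>d \<phi>s L S
  for H :: "('x, 'i, 'h) hhs_data" and C and H' :: "('y, 'j, 'k) hhs_data" and C' \<phi> \<phi>d \<phi>s L S +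
  fixes \<psi> :: "'i \<Rightarrow> 'k \<Rightarrow> 'h" and Q R :: real
  assumes psi_in [simp]: "U \<in> src.I \<Longrightarrow> w \<in> tgt.M (\<phi>d U) \<Longrightarrow> \<psi> U w \<in> src.M U"
    and psi_close: "U \<in> src.I \<Longrightarrow> w \<in> tgt.M (\<phi>d U) \<Longrightarrow> tgt.d (\<phi>d U) (\<phi>s U (\<psi> U w)) w \<le> L"
    and Q_ge_1: "1 \<le> Q" and R_nonneg: "0 \<le> R"
    and phi_upper: "x \<in> src.X \<Longrightarrow> y \<in> src.X \<Longrightarrow>
      mdist (ambient H') (\<phi> x) (\<phi> y) \<le> Q * mdist (ambient H) x y + R"
    and phi_lower: "x \<in> src.X \<Longrightarrow> y \<in> src.X \<Longrightarrow>
      mdist (ambient H) x y / Q - R \<le> mdist (ambient H') (\<phi> x) (\<phi> y)"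
begin

definition T where "T = transported_structure H H' \<phi> \<phi>d \<phi>s \<psi>"

abbreviation \<iota> where "\<iota> \<equiv> inv_into src.I \<phi>d"

lemma iota [simp]: "U \<in> src.I \<Longrightarrow> \<iota> (\<phi>d U) = U"
  using phid_inj by simp

lemma phid_eq_iff [simp]: "U \<in> src.I \<Longrightarrow> V \<in> src.I \<Longrightarrow> \<phi>d U = \<phi>d V \<longleftrightarrow> U = V"
  using phid_inj by (meson inj_on_eq_iff)

lemma T_points [simp]: "points T = Y"
  and T_dist [simp]: "mdist (ambient T) = mdist (ambient H')"
  and T_index [simp]: "index T = \<phi>d ` src.I"
  and T_hyp [simp]: "hyp T = hyp H'"
  using Y_subset by (auto simp: T_def transported_structure_def Let_def)

lemma T_nest [simp]: "U \<in> src.I \<Longrightarrow> V \<in> src.I \<Longrightarrow> nest T (\<phi>d U) (\<phi>d V) \<longleftrightarrow> nest H U V"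
  and T_orth [simp]: "U \<in> src.I \<Longrightarrow> V \<in> src.I \<Longrightarrow> orth T (\<phi>d U) (\<phi>d V) \<longleftrightarrow> orth H U V"
  and T_rho_set [simp]: "U \<in> src.I \<Longrightarrow> V \<in> src.I \<Longrightarrow> rho_set T (\<phi>d U) (\<phi>d V) = \<phi>s V ` rho_set H U V"
  and T_rho_map [simp]: "U \<in> src.I \<Longrightarrow> V \<in> src.I \<Longrightarrow>
    rho_map T (\<phi>d U) (\<phi>d V) p = \<phi>s V ` rho_map H U V (\<psi> U p)"
  and T_prj: "U \<in> src.I \<Longrightarrow> prj T (\<phi>d U) y = (\<Union>x\<in>{x \<in> src.X. \<phi> x = y}. \<phi>s U ` prj H U x)"
  by (simp_all add: T_def transported_structure_def Let_def)

lemma T_snest [simp]: "U \<in> src.I \<Longrightarrow> V \<in> src.I \<Longrightarrow> snest T (\<phi>d U) (\<phi>d V) \<longleftrightarrow> snest H U V"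
  and T_transverse [simp]: "U \<in> src.I \<Longrightarrow> V \<in> src.I \<Longrightarrow> transverse T (\<phi>d U) (\<phi>d V) \<longleftrightarrow> transverse H U V"
  and T_has_rho [simp]: "U \<in> src.I \<Longrightarrow> V \<in> src.I \<Longrightarrow> has_rho T (\<phi>d U) (\<phi>d V) \<longleftrightarrow> has_rho H U V"
  by (simp_all add: snest_def transverse_def has_rho_def)

lemma T_nested_in: "U \<in> src.I \<Longrightarrow> nested_in T (\<phi>d U) = \<phi>d ` nested_in H U"
  by (auto simp: nested_in_def)

lemma T_prjE:
  assumes "U \<in> src.I" "u \<in> prj T (\<phi>d U) y"
  obtains x a where "x \<in> src.X" "\<phi> x = y" "a \<in> prj H U x" "a \<in> src.M U" "u = \<phi>s U a"
  using assms src.prj_subset unfolding T_prj[OF assms(1)] by blast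

lemma T_prj_pt: "U \<in> src.I \<Longrightarrow> u \<in> prj T (\<phi>d U) y \<Longrightarrow> tgt.d (\<phi>d U) (pt H' (\<phi>d U) y) u \<le> L"
proof (erule T_prjE[rotated])
  fix x a assume "U \<in> src.I" "x \<in> src.X" "\<phi> x = y" "a \<in> prj H U x" "u = \<phi>s U a"
  then show ?thesis
    using phis_prj[of U x] tgt.pt_in_prj[of "\<phi>d U" "\<phi> x"] by (auto simp: all_within_def)
qed

lemma T_prj_in: "U \<in> src.I \<Longrightarrow> u \<in> prj T (\<phi>d U) y \<Longrightarrow> u \<in> tgt.M (\<phi>d U)"
  by (erule T_prjE[rotated]) auto

text \<open>Different preimages of \<open>y\<close> contribute different sets, but each lies within
  \<open>L\<close> of \<open>pt H' (\<phi>d U) y\<close>, which depends on \<open>y\<close>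
  alone.\<close>

lemma T_prj_close:
  assumes U: "U \<in> src.I" and uv: "u \<in> prj T (\<phi>d U) y" "v \<in> prj T (\<phi>d U) y"
  shows "tgt.d (\<phi>d U) u v \<le> 2 * L"
proof -
  have y: "y \<in> tgt.X" by (rule T_prjE[OF U uv(1)]) auto
  have "tgt.d (\<phi>d U) u v \<le> tgt.d (\<phi>d U) u (pt H' (\<phi>d U) y) + tgt.d (\<phi>d U) (pt H' (\<phi>d U) y) v"
    using U uv y T_prj_in by (intro tgt.d_triangle) auto
  then show ?thesis
    using T_prj_pt[OF U uv(1)] T_prj_pt[OF U uv(2)] mdist_commute[of "hyp H' (\<phi>d U)" u "pt H' (\<phi>d U) y"] by linarith
qed

lemma T_prj_image: "U \<in> src.I \<Longrightarrow> x \<in> src.X \<Longrightarrow> a \<in> prj H U x \<Longrightarrow> \<phi>s U a \<in> prj T (\<phi>d U) (\<phi> x)"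
  unfolding T_prj by blast

lemma phis_le:
  assumes "U \<in> src.I" "a \<in> src.M U" "b \<in> src.M U" "src.d U a b \<le> r"
  shows "tgt.d (\<phi>d U) (\<phi>s U a) (\<phi>s U b) \<le> L * r + L"
proof -
  have "L * src.d U a b \<le> L * r" using assms(4) L_ge_1 by (intro mult_left_mono) auto
  then show ?thesis using phis_upper[OF assms(1-3)] by linarith
qed

lemma phis_all_within:
  assumes "U \<in> src.I" "A \<subseteq> src.M U" "B \<subseteq> src.M U" "all_within (hyp H U) r A B"
  shows "all_within (hyp H' (\<phi>d U)) (L * r + L) (\<phi>s U ` A) (\<phi>s U ` B)"
  using assms phis_le[OF assms(1), of _ _ r] unfolding all_within_def by blast

text \<open>The projection of \<open>\<phi> x\<close> collects all preimages; \<open>2 * L\<close>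
  leads from any contribution to that of \<open>x\<close> itself.\<close>

lemma T_prj_all_within:
  assumes U: "U \<in> src.I" and x: "x \<in> src.X" and A: "A \<subseteq> src.M U" "all_within (hyp H U) r (prj H U x) A"
  shows "all_within (hyp H' (\<phi>d U)) (2 * L + (L * r + L)) (prj T (\<phi>d U) (\<phi> x)) (\<phi>s U ` A)"
proof (rule all_withinI)
  fix u w assume u: "u \<in> prj T (\<phi>d U) (\<phi> x)" and "w \<in> \<phi>s U ` A"
  then obtain b where b: "b \<in> A" "b \<in> src.M U" "w = \<phi>s U b" using A(1) by blast
  have p: "pt H U x \<in> src.M U" "\<phi>s U (pt H U x) \<in> prj T (\<phi>d U) (\<phi> x)"
    using U x src.pt_in_prj T_prj_image by auto
  have "src.d U (pt H U x) b \<le> r" using A(2) b src.pt_in_prj[OF U x] by (simp add: all_within_def)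
  then have "tgt.d (\<phi>d U) (\<phi>s U (pt H U x)) w \<le> L * r + L" using phis_le[OF U p(1) b(2)] b by simp
  moreover have "tgt.d (\<phi>d U) u w \<le> tgt.d (\<phi>d U) u (\<phi>s U (pt H U x)) + tgt.d (\<phi>d U) (\<phi>s U (pt H U x)) w"
    using U p b T_prj_in[OF U u] by (intro tgt.d_triangle) auto
  ultimately show "tgt.d (\<phi>d U) u w \<le> 2 * L + (L * r + L)" using T_prj_close[OF U u p(2)] by linarith
qed

text \<open>Source quasigeodesics are pushed forward by \<open>\<phi>\<close>; the lower
  quasigeodesic bound is where the embedding estimate \<open>phi_lower\<close> enters.\<close>

lemma T_quasigeodesic: "quasigeodesic_space (2 * Q * C + R) (ambient T)"
  unfolding quasigeodesic_space_def T_points T_dist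
proof (intro ballI)
  fix y y' assume "y \<in> Y" "y' \<in> Y"
  then obtain x x' where x: "x \<in> src.X" "y = \<phi> x" "x' \<in> src.X" "y' = \<phi> x'" by blast
  let ?q = "2 * Q * C + R"
  have QC: "C \<le> Q * C" "0 < Q * C" using Q_ge_1 src.C_ge_1 by (simp_all add: mult_le_cancel_right1)
  obtain c N where c: "0 \<le> N" "c ` {0..N} \<subseteq> src.X" "c 0 = x" "c N = x'"
    and qg: "\<forall>s\<in>{0..N}. \<forall>t\<in>{0..N}. \<bar>s - t\<bar> / C - C \<le> mdist (ambient H) (c s) (c t) \<and>
        mdist (ambient H) (c s) (c t) \<le> C * \<bar>s - t\<bar> + C"
    using src.quasigeodesic x unfolding quasigeodesic_space_def by blast
  have "\<bar>s - t\<bar> / ?q - ?q \<le> mdist (ambient H') (\<phi> (c s)) (\<phi> (c t)) \<and>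
      mdist (ambient H') (\<phi> (c s)) (\<phi> (c t)) \<le> ?q * \<bar>s - t\<bar> + ?q" if st: "s \<in> {0..N}" "t \<in> {0..N}" for s t
  proof
    have cX: "c s \<in> src.X" "c t \<in> src.X" using c st by auto
    have "Q * mdist (ambient H) (c s) (c t) \<le> Q * (C * \<bar>s - t\<bar> + C)"
      using qg st Q_ge_1 by (intro mult_left_mono) auto
    moreover have qQ: "Q * C \<le> ?q" using QC R_nonneg by linarith
    then have "Q * C * \<bar>s - t\<bar> \<le> ?q * \<bar>s - t\<bar>" by (intro mult_right_mono) auto
    ultimately show "mdist (ambient H') (\<phi> (c s)) (\<phi> (c t)) \<le> ?q * \<bar>s - t\<bar> + ?q"
      using phi_upper[OF cX] QC by (simp add: algebra_simps)
    have "(\<bar>s - t\<bar> / C - C) / Q \<le> mdist (ambient H) (c s) (c t) / Q"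
      using qg st Q_ge_1 by (intro divide_right_mono) auto
    moreover have "(\<bar>s - t\<bar> / C - C) / Q = \<bar>s - t\<bar> / (Q * C) - C / Q"
      using Q_ge_1 src.C_ge_1 by (simp add: field_simps)
    moreover have "C / Q \<le> C" using Q_ge_1 src.C_ge_1 by (simp add: divide_le_eq mult_le_cancel_left1)
    moreover have "\<bar>s - t\<bar> / ?q \<le> \<bar>s - t\<bar> / (Q * C)"
      by (rule frac_le) (use qQ QC in auto)
    ultimately show "\<bar>s - t\<bar> / ?q - ?q \<le> mdist (ambient H') (\<phi> (c s)) (\<phi> (c t))"
      using phi_lower[OF cX] QC by linarith
  qed
  then show "\<exists>(c :: real \<Rightarrow> 'y) N. 0 \<le> N \<and> c ` {0..N} \<subseteq> Y \<and>
        (\<forall>s\<in>{0..N}. \<forall>t\<in>{0..N}. \<bar>s - t\<bar> / ?q - ?q \<le> mdist (ambient H') (c s) (c t) \<and>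
           mdist (ambient H') (c s) (c t) \<le> ?q * \<bar>s - t\<bar> + ?q) \<and> c 0 = y \<and> c N = y'"
    using c x by (intro exI[of _ "\<lambda>t. \<phi> (c t)"] exI[of _ N]) auto
qed

text \<open>The map \<open>rho_map H W V\<close> is not coarsely Lipschitz, so the discrepancy between \<open>\<psi> \<circ> \<phi>s\<close> and the
  identity has to be absorbed by bounded geodesic image, away from the rho point.\<close>

lemma T_consistency_nested:
  assumes V [simp]: "V \<in> src.I" and W [simp]: "W \<in> src.I" and x [simp]: "x \<in> src.X" and s: "snest H V W"
  shows "all_within (hyp H' (\<phi>d W)) (2 * L + (L * (4 * L * L + 4 * L + 6 * C) + L)) (prj T (\<phi>d W) (\<phi> x)) (rho_set T (\<phi>d V) (\<phi>d W)) \<or>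
    all_within (hyp H' (\<phi>d V)) (2 * L + 2 * (L * C + L)) (prj T (\<phi>d V) (\<phi> x))
      (rho_image T (\<phi>d W) (\<phi>d V) (prj T (\<phi>d W) (\<phi> x)))"
proof (cases "src.d W (pt H W x) (rp H V W) \<le> 4 * L * L + 4 * L + 4 * C")
  case True
  have h: "has_rho H V W" using s src.snest_has_rho by blast
  have "all_within (hyp H W) (4 * L * L + 4 * L + 6 * C) (prj H W x) (rho_set H V W)"
  proof (rule all_withinI)
    fix a b assume ab: "a \<in> prj H W x" "b \<in> rho_set H V W"
    have "src.d W a b \<le> src.d W a (pt H W x) + src.d W (pt H W x) (rp H V W) + src.d W (rp H V W) b"
      using ab h src.prj_subset[OF W x] src.rho_subset[OF V W h] by (intro mdist_triangle3) auto
    moreover have "src.d W (rp H V W) b \<le> C" using src.rho_diam[OF V W h] src.rp_in_rho[OF V W h] ab by (simp add: all_within_def)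
    ultimately show "src.d W a b \<le> 4 * L * L + 4 * L + 6 * C"
      using True src.pt_prj_close[OF W x ab(1)] mdist_commute[of "hyp H W" a "pt H W x"] by linarith
  qed
  then show ?thesis using T_prj_all_within[OF W x src.rho_subset[OF V W h]] by simp
next
  case False
  have h [simp]: "has_rho H V W" using s src.snest_has_rho by blast
  note L1 = L_ge_1 and C1 = src.C_ge_1
  \<comment> \<open>Every preimage \<open>x'\<close> of \<open>\<phi> x\<close> contributes, and its
    coordinates differ from those of \<open>x\<close> by at most \<open>2 * L * L + L\<close>. The
    room left afterwards absorbs the error of \<open>\<psi>\<close>.\<close>
  have far: "2 * L * L + 2 * L + 3 * C < src.d W a (rp H V W)"
    if x': "x' \<in> src.X" "\<phi> x' = \<phi> x" and a: "a \<in> prj H W x'" for x' a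
  proof -
    have aM: "a \<in> src.M W" using src.prj_subset W x'(1) a by blast
    have "tgt.d (\<phi>d W) (\<phi>s W (pt H W x)) (\<phi>s W a) \<le> 2 * L"
      using T_prj_image[OF W x src.pt_in_prj[OF W x]] T_prj_image[OF W x'(1) a] x'(2) by (intro T_prj_close[OF W]) auto
    then have "L * tgt.d (\<phi>d W) (\<phi>s W (pt H W x)) (\<phi>s W a) \<le> L * (2 * L)" using L1 by (intro mult_left_mono) auto
    then have "src.d W (pt H W x) a \<le> L * (2 * L) + L" using phis_lower[OF W _ aM, of "pt H W x"] by simp
    moreover have "src.d W (pt H W x) (rp H V W) \<le> src.d W (pt H W x) a + src.d W a (rp H V W)"
      using aM by (intro src.d_triangle) auto
    moreover have "L * (2 * L) = 2 * L * L" by simp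
    moreover have "0 \<le> L * L" by simp
    ultimately show ?thesis using False L1 C1 by linarith
  qed
  have "tgt.d (\<phi>d V) u v \<le> 2 * L + 2 * (L * C + L)"
    if u: "u \<in> prj T (\<phi>d V) (\<phi> x)" and v: "v \<in> rho_image T (\<phi>d W) (\<phi>d V) (prj T (\<phi>d W) (\<phi> x))" for u v
  proof -
    obtain p where p: "p \<in> prj T (\<phi>d W) (\<phi> x)" "v \<in> rho_map T (\<phi>d W) (\<phi>d V) p" using v unfolding rho_image_def by blast
    obtain x' a where x': "x' \<in> src.X" "\<phi> x' = \<phi> x" and a: "a \<in> prj H W x'" "a \<in> src.M W" "p = \<phi>s W a"
      by (rule T_prjE[OF W p(1)])
    obtain m where m: "m \<in> rho_map H W V (\<psi> W p)" "v = \<phi>s V m" using p(2) by auto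
    have pM: "p \<in> tgt.M (\<phi>d W)" using a by simp
    have mM: "m \<in> src.M V" using m src.rho_map_subset[OF V W s psi_in[OF W pM]] by blast
    have "L * tgt.d (\<phi>d W) (\<phi>s W (\<psi> W p)) (\<phi>s W a) \<le> L * L"
      using psi_close[OF W pM] a(3) L1 by (intro mult_left_mono) auto
    then have pa: "src.d W (\<psi> W p) a \<le> L * L + L" using phis_lower[OF W psi_in[OF W pM] a(2)] by linarith
    have "C + src.d W (\<psi> W p) a < src.d W a (rp H V W)"
      using far[OF x' a(1)] pa L1 C1 zero_le_square[of L] by linarith
    then have bg: "all_within (hyp H V) C (rho_map H W V (\<psi> W p)) (rho_map H W V a)"
      using src.bgi_far_all[OF V W s psi_in[OF W pM] a(2)] by simp
    obtain m' where m': "m' \<in> rho_map H W V a" using src.rho_map_nonempty[OF V W s a(2)] by blast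
    have m'M: "m' \<in> src.M V" using m' src.rho_map_subset[OF V W s a(2)] by blast
    have "C < src.d W a (rp H V W)" using far[OF x' a(1)] L1 C1 zero_le_square[of L] by linarith
    then have "\<not> all_within (hyp H W) C (prj H W x') (rho_set H V W)"
      using a(1) src.rp_in_rho[OF V W h] unfolding all_within_def by force
    then have "all_within (hyp H V) C (prj H V x') (rho_image H W V (prj H W x'))"
      using src.consistency_nested[OF V W x'(1) s] by blast
    then have bm: "src.d V (pt H V x') m' \<le> C"
      using src.pt_in_prj[OF V x'(1)] m' a(1) unfolding all_within_def rho_image_def by blast
    have "tgt.d (\<phi>d V) u (\<phi>s V (pt H V x')) \<le> 2 * L"
      using T_prj_image[OF V x'(1) src.pt_in_prj[OF V x'(1)]] x'(2) u by (intro T_prj_close[OF V]) auto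
    moreover have "tgt.d (\<phi>d V) (\<phi>s V (pt H V x')) (\<phi>s V m') \<le> L * C + L"
      using bm m'M x' by (intro phis_le) auto
    moreover have "tgt.d (\<phi>d V) (\<phi>s V m) (\<phi>s V m') \<le> L * C + L"
      using bg m(1) m' mM m'M by (intro phis_le) (auto simp: all_within_def)
    moreover have "tgt.d (\<phi>d V) u v \<le> tgt.d (\<phi>d V) u (\<phi>s V (pt H V x'))
        + tgt.d (\<phi>d V) (\<phi>s V (pt H V x')) (\<phi>s V m') + tgt.d (\<phi>d V) (\<phi>s V m') (\<phi>s V m)"
      unfolding m(2) using T_prj_in[OF V u] x' m'M mM by (intro mdist_triangle3) auto
    ultimately have "tgt.d (\<phi>d V) u v \<le> 2 * L + (L * C + L) + (L * C + L)"
      using mdist_commute[of "hyp H' (\<phi>d V)" "\<phi>s V m" "\<phi>s V m'"] by linarith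
    then show ?thesis by (simp add: algebra_simps)
  qed
  then show ?thesis by (simp add: all_within_def)
qed

text \<open>Bounded geodesic image is inherited from the target, where geodesics are geodesics; this avoids
  the stability of quasigeodesics.\<close>

lemma T_bounded_geodesic_image:
  assumes V [simp]: "V \<in> src.I" and W [simp]: "W \<in> src.I" and s: "snest H V W"
    and G: "geodesic_segment (hyp H' (\<phi>d W)) p q G"
  shows "all_within (hyp H' (\<phi>d V)) (2 * L + 3 * C') (rho_image T (\<phi>d W) (\<phi>d V) G) (rho_image T (\<phi>d W) (\<phi>d V) G) \<or>
      (\<exists>g\<in>G. all_within (hyp H' (\<phi>d W)) (C' + 2 * L + 1) {g} (rho_set T (\<phi>d V) (\<phi>d W)))"
proof (cases "\<exists>g\<in>G. tgt.d (\<phi>d W) g (rp H' (\<phi>d V) (\<phi>d W)) \<le> C' + L + 1")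
  case True
  have h: "has_rho H V W" using s src.snest_has_rho by blast
  have h': "has_rho H' (\<phi>d V) (\<phi>d W)" using has_rho_image h by simp
  obtain g where g: "g \<in> G" "tgt.d (\<phi>d W) g (rp H' (\<phi>d V) (\<phi>d W)) \<le> C' + L + 1" using True by blast
  have gM: "g \<in> tgt.M (\<phi>d W)" using G g(1) unfolding geodesic_segment_def by blast
  have "tgt.d (\<phi>d W) g w \<le> C' + 2 * L + 1" if w: "w \<in> \<phi>s W ` rho_set H V W" for w
  proof -
    have wM: "w \<in> tgt.M (\<phi>d W)" using w src.rho_subset[OF V W h] by auto
    have "tgt.d (\<phi>d W) w (rp H' (\<phi>d V) (\<phi>d W)) \<le> L"
      using phis_rho_set[OF V W h] w tgt.rp_in_rho[OF _ _ h'] by (auto simp: all_within_def)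
    moreover have "tgt.d (\<phi>d W) g w \<le> tgt.d (\<phi>d W) g (rp H' (\<phi>d V) (\<phi>d W)) + tgt.d (\<phi>d W) (rp H' (\<phi>d V) (\<phi>d W)) w"
      using gM wM h' by (intro tgt.d_triangle) auto
    ultimately show ?thesis using g(2) mdist_commute[of "hyp H' (\<phi>d W)" w "rp H' (\<phi>d V) (\<phi>d W)"] by linarith
  qed
  then have "all_within (hyp H' (\<phi>d W)) (C' + 2 * L + 1) {g} (rho_set T (\<phi>d V) (\<phi>d W))"
    by (simp add: all_within_def)
  then show ?thesis using g(1) by blast
next
  case False
  have h: "has_rho H V W" using s src.snest_has_rho by blast
  have h': "has_rho H' (\<phi>d V) (\<phi>d W)" using has_rho_image h by simp
  have s': "snest H' (\<phi>d V) (\<phi>d W)" using s phid_nest unfolding snest_def by simp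
  have GM: "G \<subseteq> tgt.M (\<phi>d W)" using G unfolding geodesic_segment_def by blast
  have far: "C' + L + 1 < tgt.d (\<phi>d W) g (rp H' (\<phi>d V) (\<phi>d W))" if "g \<in> G" for g using False that by force
  have "\<not> (\<exists>g\<in>G. all_within (hyp H' (\<phi>d W)) C' {g} (rho_set H' (\<phi>d V) (\<phi>d W)))"
    using far tgt.rp_in_rho[OF _ _ h'] L_ge_1 unfolding all_within_def by force
  then have G': "all_within (hyp H' (\<phi>d V)) C' (rho_image H' (\<phi>d W) (\<phi>d V) G) (rho_image H' (\<phi>d W) (\<phi>d V) G)"
    using tgt.bounded_geodesic_image[OF _ _ s' G] by simp
  have approx: "\<exists>w\<in>rho_image H' (\<phi>d W) (\<phi>d V) G. w \<in> tgt.M (\<phi>d V) \<and> u \<in> tgt.M (\<phi>d V) \<and> tgt.d (\<phi>d V) u w \<le> L + C'"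
    if u: "u \<in> rho_image T (\<phi>d W) (\<phi>d V) G" for u
  proof -
    obtain g m where g: "g \<in> G" and m: "m \<in> rho_map H W V (\<psi> W g)" "u = \<phi>s V m" using u unfolding rho_image_def by auto
    have gM: "g \<in> tgt.M (\<phi>d W)" using g GM by blast
    have mM: "m \<in> src.M V" using m src.rho_map_subset[OF V W s psi_in[OF W gM]] by blast
    let ?g = "\<phi>s W (\<psi> W g)"
    have g'M: "?g \<in> tgt.M (\<phi>d W)" using gM by simp
    obtain m1 where m1: "m1 \<in> rho_map H' (\<phi>d W) (\<phi>d V) ?g" "tgt.d (\<phi>d V) (\<phi>s V m) m1 \<le> L"
      using phis_rho_map[OF W V s psi_in[OF W gM] m(1)] by blast
    have m1M: "m1 \<in> tgt.M (\<phi>d V)" using m1 tgt.rho_map_subset[OF _ _ s' g'M] by auto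
    \<comment> \<open>\<open>\<psi>\<close> displaces \<open>g\<close> by at most \<open>L\<close>,
      and \<open>far\<close> leaves this much room beyond \<open>C'\<close>; hence target values at
      the displaced point and at \<open>g\<close> are close.\<close>
    have "C' + tgt.d (\<phi>d W) ?g g < tgt.d (\<phi>d W) g (rp H' (\<phi>d V) (\<phi>d W))"
      using far[OF g] psi_close[OF W gM] by linarith
    then have bg: "all_within (hyp H' (\<phi>d V)) C' (rho_map H' (\<phi>d W) (\<phi>d V) ?g) (rho_map H' (\<phi>d W) (\<phi>d V) g)"
      using tgt.bgi_far_all[OF _ _ s' g'M gM] by simp
    obtain w where w: "w \<in> rho_map H' (\<phi>d W) (\<phi>d V) g" using tgt.rho_map_nonempty[OF _ _ s' gM] by auto
    have wM: "w \<in> tgt.M (\<phi>d V)" using w tgt.rho_map_subset[OF _ _ s' gM] by auto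
    have "tgt.d (\<phi>d V) u w \<le> tgt.d (\<phi>d V) u m1 + tgt.d (\<phi>d V) m1 w"
      unfolding m(2) using mM m1M wM by (intro tgt.d_triangle) auto
    moreover have "tgt.d (\<phi>d V) m1 w \<le> C'" using bg m1(1) w by (simp add: all_within_def)
    ultimately have "tgt.d (\<phi>d V) u w \<le> L + C'" using m1(2) m(2) by simp
    then show ?thesis using w g wM mM m(2) unfolding rho_image_def by auto
  qed
  have "tgt.d (\<phi>d V) u v \<le> 2 * L + 3 * C'"
    if u: "u \<in> rho_image T (\<phi>d W) (\<phi>d V) G" and v: "v \<in> rho_image T (\<phi>d W) (\<phi>d V) G" for u v
  proof -
    obtain w where w: "w \<in> rho_image H' (\<phi>d W) (\<phi>d V) G" "w \<in> tgt.M (\<phi>d V)" "u \<in> tgt.M (\<phi>d V)" "tgt.d (\<phi>d V) u w \<le> L + C'"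
      using approx[OF u] by blast
    obtain z where z: "z \<in> rho_image H' (\<phi>d W) (\<phi>d V) G" "z \<in> tgt.M (\<phi>d V)" "v \<in> tgt.M (\<phi>d V)" "tgt.d (\<phi>d V) v z \<le> L + C'"
      using approx[OF v] by blast
    have "tgt.d (\<phi>d V) u v \<le> tgt.d (\<phi>d V) u w + tgt.d (\<phi>d V) w z + tgt.d (\<phi>d V) z v"
      using w z by (intro mdist_triangle3) auto
    moreover have "tgt.d (\<phi>d V) w z \<le> C'" using G' w(1) z(1) by (simp add: all_within_def)
    ultimately show ?thesis using w(4) z(4) mdist_commute[of "hyp H' (\<phi>d V)" z v] by linarith
  qed
  then show ?thesis by (simp add: all_within_def)
qed

lemma T_finite_complexity: "hhs_finite_complexity T"
proof -
  obtain n where n: "\<forall>\<C>. \<C> \<subseteq> src.I \<and> (\<forall>V\<in>\<C>. \<forall>W\<in>\<C>. nest H V W \<or> nest H W V) \<longrightarrow> finite \<C> \<and> card \<C> \<le> n"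
    using src.finite_complexity unfolding hhs_finite_complexity_def ..
  have "finite \<C> \<and> card \<C> \<le> n" if \<C>: "\<C> \<subseteq> \<phi>d ` src.I" "\<forall>V\<in>\<C>. \<forall>W\<in>\<C>. nest T V W \<or> nest T W V" for \<C>
  proof -
    obtain A where A: "A \<subseteq> src.I" "\<C> = \<phi>d ` A" using \<C>(1) by (auto simp: subset_image_iff)
    have "nest H V W \<or> nest H W V" if "V \<in> A" "W \<in> A" for V W
      using \<C>(2) A that T_nest[of V W] T_nest[of W V] by blast
    then have "finite A \<and> card A \<le> n" using n[rule_format, of A] A(1) by blast
    then show ?thesis using A(2) card_image_le[of A \<phi>d] by auto
  qed
  then show ?thesis unfolding hhs_finite_complexity_def T_index by blast
qed

text \<open>The family obtained for chosen preimages is transported. The bounds on \<open>D\<close>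
  absorb the linear losses of \<open>phis_lower\<close>, on the way to source distances, and of
  \<open>phis_upper\<close>, on the way back.\<close>

lemma T_large_links:
  assumes W: "W \<in> src.I" and uv: "u \<in> prj T (\<phi>d W) y" "v \<in> prj T (\<phi>d W) y'"
    and D: "C * L + C \<le> D" "4 * L + (L * C + L) \<le> D" "2 * L + L * (C * L + C) + L \<le> D"
  shows "\<exists>\<T> \<subseteq> nested_in T (\<phi>d W) - {\<phi>d W}. finite \<T> \<and> real (card \<T>) \<le> D * tgt.d (\<phi>d W) u v + D \<and>
        (\<forall>Z\<in>nested_in T (\<phi>d W) - {\<phi>d W}. (\<exists>Z'\<in>\<T>. nest T Z Z') \<or>
           all_within (hyp H' Z) D (prj T Z y) (prj T Z y')) \<and>
        (\<forall>Z'\<in>\<T>. all_within (hyp H' (\<phi>d W)) (D * tgt.d (\<phi>d W) u v + D) (prj T (\<phi>d W) y) (rho_set T Z' (\<phi>d W)))"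
proof -
  note L1 = L_ge_1 and C1 = src.C_ge_1
  obtain x a where x: "x \<in> src.X" "\<phi> x = y" and a: "a \<in> prj H W x" "a \<in> src.M W" "u = \<phi>s W a"
    by (rule T_prjE[OF W uv(1)])
  obtain x' b where x': "x' \<in> src.X" "\<phi> x' = y'" and b: "b \<in> prj H W x'" "b \<in> src.M W" "v = \<phi>s W b"
    by (rule T_prjE[OF W uv(2)])
  obtain \<T> where \<T>: "\<T> \<subseteq> nested_in H W - {W}" "finite \<T>"
    and card\<T>: "real (card \<T>) \<le> C * src.d W a b + C"
    and cover: "\<And>Z. Z\<in>nested_in H W - {W} \<Longrightarrow> (\<exists>Z'\<in>\<T>. nest H Z Z') \<or>
       all_within (hyp H Z) C (prj H Z x) (prj H Z x')"
    and rho: "\<And>Z'. Z' \<in> \<T> \<Longrightarrow> all_within (hyp H W) (C * src.d W a b + C) (prj H W x) (rho_set H Z' W)"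
    using src.large_links[OF W x(1) x'(1) a(1) b(1)] by blast
  let ?d = "tgt.d (\<phi>d W) u v"
  have "C * src.d W a b \<le> C * (L * ?d + L)"
    using phis_lower[OF W a(2) b(2)] a(3) b(3) C1 by (intro mult_left_mono) auto
  then have le1: "C * src.d W a b + C \<le> C * L * ?d + (C * L + C)" by (simp add: algebra_simps)
  have CL: "0 \<le> C" "C * L \<le> D" using D(1) C1 by auto
  have "C * L * ?d \<le> D * ?d" using CL by (intro mult_right_mono) auto
  then have le2: "C * src.d W a b + C \<le> D * ?d + D" using le1 D(1) by linarith
  have "2 * L + (L * (C * src.d W a b + C) + L) \<le> D * ?d + D"
  proof -
    have "L * (C * src.d W a b + C) \<le> L * (C * L * ?d + (C * L + C))" using le1 L1 by (intro mult_left_mono) auto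
    also have "\<dots> = L * (C * L) * ?d + L * (C * L + C)" by (simp add: algebra_simps)
    finally have *: "L * (C * src.d W a b + C) \<le> L * (C * L) * ?d + L * (C * L + C)" .
    have "L * (C * L) \<le> L * (C * L + C)" using L1 C1 by (intro mult_left_mono) auto
    then have "L * (C * L) \<le> D" using D(3) L1 by linarith
    then have "L * (C * L) * ?d \<le> D * ?d" by (intro mult_right_mono) auto
    then show ?thesis using * D(3) by linarith
  qed
  note le3 = this
  have \<T>I: "Z \<in> src.I" "Z \<noteq> W" "snest H Z W" if "Z \<in> \<T>" for Z using \<T>(1) that by (auto simp: nested_in_def snest_def)
  show ?thesis
  proof (intro exI[of _ "\<phi>d ` \<T>"] conjI ballI)
    show "\<phi>d ` \<T> \<subseteq> nested_in T (\<phi>d W) - {\<phi>d W}" using \<T>(1) \<T>I W by (auto simp: T_nested_in)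
    show "finite (\<phi>d ` \<T>)" using \<T> by simp
    have "card (\<phi>d ` \<T>) \<le> card \<T>" using \<T> by (intro card_image_le)
    then show "real (card (\<phi>d ` \<T>)) \<le> D * ?d + D" using card\<T> le2 by linarith
  next
    fix Z assume "Z \<in> nested_in T (\<phi>d W) - {\<phi>d W}"
    then obtain Z0 where Z0: "Z0 \<in> nested_in H W - {W}" "Z = \<phi>d Z0" using W by (auto simp: T_nested_in)
    have Z0I: "Z0 \<in> src.I" using Z0 by (auto simp: nested_in_def)
    from cover[OF Z0(1)] show "(\<exists>Z'\<in>\<phi>d ` \<T>. nest T Z Z') \<or> all_within (hyp H' Z) D (prj T Z y) (prj T Z y')"
    proof
      assume "\<exists>Z'\<in>\<T>. nest H Z0 Z'"
      then show ?thesis using Z0 Z0I \<T>I by auto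
    next
      assume aw: "all_within (hyp H Z0) C (prj H Z0 x) (prj H Z0 x')"
      have 1: "all_within (hyp H' Z) (2 * L + (L * C + L)) (prj T Z y) (\<phi>s Z0 ` prj H Z0 x')"
        using T_prj_all_within[OF Z0I x(1) src.prj_subset[OF Z0I x'(1)] aw] x(2) Z0(2) by simp
      have 2: "all_within (hyp H' Z) (2 * L) (\<phi>s Z0 ` prj H Z0 x') (prj T Z y')"
      proof (rule all_withinI)
        fix u w assume "u \<in> \<phi>s Z0 ` prj H Z0 x'" "w \<in> prj T Z y'"
        then show "tgt.d Z u w \<le> 2 * L"
          using T_prj_close[OF Z0I, of u y' w] T_prj_image[OF Z0I x'(1)] x'(2) Z0(2) by auto
      qed
      have "all_within (hyp H' Z) (2 * L + (L * C + L) + 2 * L) (prj T Z y) (prj T Z y')"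
        by (rule all_within_trans[OF 1 2])
          (use src.prj_nonempty[OF Z0I x'(1)] src.prj_subset[OF Z0I x'(1)] T_prj_in[OF Z0I] Z0I Z0(2) in auto)
      then show ?thesis using D(2) by (intro disjI2) (elim all_within_mono, linarith)
    qed
  next
    fix Z' assume "Z' \<in> \<phi>d ` \<T>"
    then obtain Z0 where Z0: "Z0 \<in> \<T>" "Z' = \<phi>d Z0" by blast
    have sub: "rho_set H Z0 W \<subseteq> src.M W" using src.rho_subset[OF _ W] \<T>I[OF Z0(1)] src.snest_has_rho by blast
    show "all_within (hyp H' (\<phi>d W)) (D * ?d + D) (prj T (\<phi>d W) y) (rho_set T Z' (\<phi>d W))"
      using all_within_mono[OF T_prj_all_within[OF W x(1) sub rho[OF Z0(1)]] le3] x(2) Z0 \<T>I W by simp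
  qed
qed

text \<open>Targets are pulled back by \<open>\<psi>\<close> and realized in the source; the last
  \<open>L\<close> is the error of \<open>\<psi>\<close>.\<close>

lemma T_partial_realization:
  assumes \<V>: "\<V> \<subseteq> \<phi>d ` src.I" and ort: "\<And>V W. V \<in> \<V> \<Longrightarrow> W \<in> \<V> \<Longrightarrow> V \<noteq> W \<Longrightarrow> orth T V W"
    and c: "\<And>V. V \<in> \<V> \<Longrightarrow> c V \<in> tgt.M V"
  shows "\<exists>y\<in>Y. \<forall>V\<in>\<V>. all_within (hyp H' V) (2 * L + (L * C + L) + L) (prj T V y) {c V} \<and>
        (\<forall>U\<in>\<phi>d ` src.I. has_rho T V U \<longrightarrow>
          all_within (hyp H' U) (2 * L + (L * C + L) + L) (prj T U y) (rho_set T V U))"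
proof -
  obtain A where A: "A \<subseteq> src.I" "\<V> = \<phi>d ` A" using \<V> by (auto simp: subset_image_iff)
  have AI: "U \<in> src.I" if "U \<in> A" for U using A that by blast
  define c0 where "c0 U = \<psi> U (c (\<phi>d U))" for U
  have cM: "c (\<phi>d U) \<in> tgt.M (\<phi>d U)" if "U \<in> A" for U using c A that by blast
  have "\<exists>x\<in>src.X. \<forall>V\<in>A. all_within (hyp H V) C (prj H V x) {c0 V} \<and>
        (\<forall>U\<in>src.I. has_rho H V U \<longrightarrow> all_within (hyp H U) C (prj H U x) (rho_set H V U))"
  proof (rule src.partial_realization[OF A(1)])
    show "orth H V W" if "V \<in> A" "W \<in> A" "V \<noteq> W" for V W
      using ort[of "\<phi>d V" "\<phi>d W"] that A AI by simp
    show "c0 V \<in> src.M V" if "V \<in> A" for V using cM that AI by (simp add: c0_def)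
  qed
  then obtain x where x: "x \<in> src.X" and 1: "\<And>V. V \<in> A \<Longrightarrow> all_within (hyp H V) C (prj H V x) {c0 V}"
    and 2: "\<And>V U. V \<in> A \<Longrightarrow> U \<in> src.I \<Longrightarrow> has_rho H V U \<Longrightarrow> all_within (hyp H U) C (prj H U x) (rho_set H V U)"
    by blast
  show ?thesis
  proof (intro bexI[of _ "\<phi> x"] ballI conjI impI)
    fix V' assume "V' \<in> \<V>"
    then obtain V where V: "V \<in> A" "V' = \<phi>d V" using A by blast
    have VI: "V \<in> src.I" using V A by blast
    have c0M: "c0 V \<in> src.M V" using cM[OF V(1)] VI by (simp add: c0_def)
    have "all_within (hyp H' V') (2 * L + (L * C + L)) (prj T V' (\<phi> x)) (\<phi>s V ` {c0 V})"
      using T_prj_all_within[OF VI x _ 1[OF V(1)]] c0M V(2) by simp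
    moreover have "all_within (hyp H' V') L (\<phi>s V ` {c0 V}) {c V'}"
      using psi_close[OF VI cM[OF V(1)]] V(2) by (simp add: all_within_def c0_def)
    ultimately show "all_within (hyp H' V') (2 * L + (L * C + L) + L) (prj T V' (\<phi> x)) {c V'}"
      by (rule all_within_trans) (use c0M VI cM[OF V(1)] V(2) T_prj_in[OF VI] in auto)
    fix U' assume "U' \<in> \<phi>d ` src.I" "has_rho T V' U'"
    then obtain U where U: "U \<in> src.I" "U' = \<phi>d U" "has_rho H V U" using VI V(2) by auto
    have "all_within (hyp H' U') (2 * L + (L * C + L)) (prj T U' (\<phi> x)) (rho_set T V' U')"
      using T_prj_all_within[OF U(1) x src.rho_subset[OF VI U(1,3)] 2[OF V(1) U(1,3)]] U VI V(2) by simp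
    then show "all_within (hyp H' U') (2 * L + (L * C + L) + L) (prj T U' (\<phi> x)) (rho_set T V' U')"
      using L_ge_1 by (elim all_within_mono) linarith
  qed (use x in simp)
qed

text \<open>Uniqueness in the source bounds the distance of preimages, and \<open>phi_upper\<close>
  carries this bound to the subspace metric.\<close>

lemma T_uniqueness:
  "\<exists>t. \<forall>y\<in>Y. \<forall>y'\<in>Y. (\<forall>V\<in>\<phi>d ` src.I. \<exists>u\<in>prj T V y. \<exists>v\<in>prj T V y'. tgt.d V u v \<le> k) \<longrightarrow>
    mdist (ambient H') y y' \<le> t"
proof -
  obtain t where t: "0 \<le> t" "\<forall>x\<in>src.X. \<forall>y\<in>src.X.
    (\<forall>V\<in>\<phi>d ` src.I. tgt.d V (pt H' V (\<phi> x)) (pt H' V (\<phi> y)) \<le> k + 2 * L) \<longrightarrow> mdist (ambient H) x y \<le> t"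
    using image_points_close by blast
  have "mdist (ambient H') y y' \<le> Q * t + R"
    if y: "y \<in> Y" "y' \<in> Y" and close: "\<forall>V\<in>\<phi>d ` src.I. \<exists>u\<in>prj T V y. \<exists>v\<in>prj T V y'. tgt.d V u v \<le> k" for y y'
  proof -
    obtain x x' where x: "x \<in> src.X" "y = \<phi> x" "x' \<in> src.X" "y' = \<phi> x'" using y by blast
    have "tgt.d V (pt H' V y) (pt H' V y') \<le> k + 2 * L" if V: "V \<in> \<phi>d ` src.I" for V
    proof -
      obtain U where U: "U \<in> src.I" "V = \<phi>d U" using V by blast
      obtain u v where uv: "u \<in> prj T (\<phi>d U) y" "v \<in> prj T (\<phi>d U) y'" "tgt.d V u v \<le> k" using bspec[OF close V] unfolding U(2) by blast
      have "tgt.d V (pt H' V y) (pt H' V y') \<le> tgt.d V (pt H' V y) u + tgt.d V u v + tgt.d V v (pt H' V y')"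
        using U x T_prj_in[OF U(1) uv(1)] T_prj_in[OF U(1) uv(2)] by (intro mdist_triangle3) auto
      then show ?thesis
        using T_prj_pt[OF U(1) uv(1)] T_prj_pt[OF U(1) uv(2)] uv(3) U(2)
          mdist_commute[of "hyp H' V" v "pt H' V y'"] by simp
    qed
    then have "mdist (ambient H) x x' \<le> t" using t(2) x by blast
    then have "Q * mdist (ambient H) x x' \<le> Q * t" using Q_ge_1 by (intro mult_left_mono) auto
    then show ?thesis using phi_upper[of x x'] x by simp
  qed
  then show ?thesis by blast
qed

lemma T_coarse_hhs: "\<exists>D. coarse_hhs T D"
proof -
  note L1 = L_ge_1 and C1 = src.C_ge_1 and C'1 = tgt.C_ge_1 and Q1 = Q_ge_1 and R0 = R_nonneg
  define D where "D = (2 * Q * C + R) + C' + (L * C + 10 * L) + (2 * L + (L * (4 * L * L + 4 * L + 6 * C) + L))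
    + (2 * L + 2 * (L * C + L)) + (C * L + C) + (2 * L + L * (C * L + C) + L) + (2 * L + 3 * C') + 1"
  have pos: "0 \<le> 2 * Q * C + R" "0 \<le> L * C + 10 * L" "0 \<le> 2 * L + (L * (4 * L * L + 4 * L + 6 * C) + L)"
    "0 \<le> 2 * L + 2 * (L * C + L)" "0 \<le> C * L + C" "0 \<le> 2 * L + L * (C * L + C) + L" "0 \<le> 2 * L + 3 * C'" "0 \<le> L * C"
    using L1 C1 C'1 Q1 R0 by simp_all
  have D: "2 * Q * C + R \<le> D" "C' \<le> D" "L * C + 10 * L \<le> D" "2 * L + (L * (4 * L * L + 4 * L + 6 * C) + L) \<le> D"
    "2 * L + 2 * (L * C + L) \<le> D" "C * L + C \<le> D" "2 * L + L * (C * L + C) + L \<le> D" "2 * L + 3 * C' \<le> D"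
    "1 \<le> D" "2 * L \<le> D" "C' + 2 * L \<le> D" "L * C + L \<le> D" "2 * L + (L * C + L) \<le> D" "C' + 2 * L + 1 \<le> D"
    "4 * L + (L * C + L) \<le> D" "2 * L + (L * C + L) + L \<le> D" "L * C + 4 * L \<le> D"
    using pos L1 C'1 unfolding D_def by linarith+
  have QC: "1 \<le> 2 * Q * C + R"
  proof -
    have "1 * 1 \<le> Q * C" using Q1 C1 by (intro mult_mono) auto
    then show ?thesis using R0 by linarith
  qed
  have rho_aw: "all_within (hyp H' (\<phi>d W)) D (\<phi>s W ` A) (\<phi>s W ` B)"
    if "W \<in> src.I" "A \<subseteq> src.M W" "B \<subseteq> src.M W" "all_within (hyp H W) C A B" for W A B
    using all_within_mono[OF phis_all_within[OF that] D(12)] .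
  have prj_aw: "all_within (hyp H' (\<phi>d U)) D (prj T (\<phi>d U) (\<phi> x)) (\<phi>s U ` A)"
    if "U \<in> src.I" "x \<in> src.X" "A \<subseteq> src.M U" "all_within (hyp H U) C (prj H U x) A" for U x A
    using all_within_mono[OF T_prj_all_within[OF that] D(13)] .
  \<comment> \<open>The numbered cases follow the order of the assumptions of
    \<open>coarse_hhs\<close>.\<close>
  have "coarse_hhs T D"
  proof (unfold_locales, goal_cases)
    case 1
    then show ?case by (rule D(9))
  next
    case 2
    show ?case by (rule quasigeodesic_space_mono[OF T_quasigeodesic QC D(1)])
  next
    case (3 W)
    then show ?case using hyperbolic_space_mono[OF tgt.hyperbolic D(2)] by auto
  next
    case (4 W x)
    then show ?case using src.prj_nonempty by (fastforce simp: T_prj)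
  next
    case (5 W x)
    then show ?case using T_prj_in by auto
  next
    case (6 W x)
    then show ?case using T_prj_close D(10) by (fastforce simp: all_within_def)
  next
    \<comment> \<open>The Lipschitz bound is inherited from the target projections, since every
      contribution lies within \<open>L\<close> of \<open>pt\<close>.\<close>
    case (7 W x y)
    then obtain U where U: "U \<in> src.I" "W = \<phi>d U" by auto
    have xy: "x \<in> tgt.X" "y \<in> tgt.X" using 7 by auto
    have "tgt.d W u v \<le> D * mdist (ambient H') x y + D" if uv: "u \<in> prj T W x" "v \<in> prj T W y" for u v
    proof -
      have uM: "u \<in> tgt.M W" "v \<in> tgt.M W" using uv U T_prj_in by auto
      have "tgt.d W u v \<le> tgt.d W u (pt H' W x) + tgt.d W (pt H' W x) (pt H' W y) + tgt.d W (pt H' W y) v"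
        using uM xy U by (intro mdist_triangle3) auto
      moreover have "C' * mdist (ambient H') x y \<le> D * mdist (ambient H') x y" using D(2) by (intro mult_right_mono) auto
      ultimately show ?thesis
        using tgt.pt_lipschitz[of W x y] xy U T_prj_pt[OF U(1), of u x] T_prj_pt[OF U(1), of v y] uv D(11)
          mdist_commute[of "hyp H' W" u "pt H' W x"] by simp
    qed
    then show ?case by (simp add: all_within_def)
  next
    case (8 W)
    then show ?case using src.nest_refl by auto
  next
    case (9 V W)
    then show ?case using src.nest_antisym by auto
  next
    case (10 U V W)
    then obtain U0 V0 W0 where I: "U0 \<in> src.I" "V0 \<in> src.I" "W0 \<in> src.I" "U = \<phi>d U0" "V = \<phi>d V0" "W = \<phi>d W0"
      by auto
    then show ?case using 10 src.nest_trans[OF I(1-3)] by simp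
  next
    case 11
    then show ?case using src.top_index by auto
  next
    case (12 V W)
    then show ?case using src.rho_nonempty by auto
  next
    case (13 V W)
    then show ?case using src.rho_subset by fastforce
  next
    case (14 V W)
    then obtain U Z where UZ: "U \<in> src.I" "Z \<in> src.I" "V = \<phi>d U" "W = \<phi>d Z" "has_rho H U Z" by auto
    then show ?case using rho_aw[OF UZ(2) src.rho_subset src.rho_subset src.rho_diam] by simp
  next
    case (15 V W p)
    then show ?case using src.rho_map_nonempty psi_in by auto
  next
    case (16 V W p)
    then obtain U Z where UZ: "U \<in> src.I" "Z \<in> src.I" "V = \<phi>d U" "W = \<phi>d Z" "snest H U Z" "p \<in> tgt.M (\<phi>d Z)" by auto
    then show ?case using src.rho_map_subset[OF UZ(1,2,5) psi_in[OF UZ(2,6)]] by auto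
  next
    case (17 V W)
    then show ?case using src.orth_sym by auto
  next
    case (18 V)
    then show ?case using src.orth_irrefl by auto
  next
    case (19 U V W)
    then obtain U0 V0 W0 where I: "U0 \<in> src.I" "V0 \<in> src.I" "W0 \<in> src.I" "U = \<phi>d U0" "V = \<phi>d V0" "W = \<phi>d W0"
      by auto
    then show ?case using 19 src.orth_nest[OF I(1-3)] by simp
  next
    case (20 Z U V)
    then obtain Z0 where Z0: "Z0 \<in> src.I" "Z = \<phi>d Z0" by auto
    obtain U0 where U0: "U0 \<in> nested_in H Z0" "U = \<phi>d U0" using 20 Z0 T_nested_in by auto
    obtain V0 where V0: "V0 \<in> nested_in H Z0" "V = \<phi>d V0" using 20 Z0 T_nested_in by auto
    have I: "U0 \<in> src.I" "V0 \<in> src.I" using U0 V0 by (auto simp: nested_in_def)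
    have "orth H V0 U0" using 20 U0 V0 I by simp
    then obtain T0 where T0: "T0 \<in> nested_in H Z0 - {Z0}" "\<forall>V\<in>nested_in H Z0. orth H V U0 \<longrightarrow> nest H V T0"
      using src.container[OF Z0(1) U0(1) V0(1)] by blast
    have T0I: "T0 \<in> src.I" using T0 by (auto simp: nested_in_def)
    show ?case
    proof (intro bexI[of _ "\<phi>d T0"] ballI impI)
      show "\<phi>d T0 \<in> nested_in T Z - {Z}" using T0 T0I Z0 T_nested_in by auto
      fix V' assume V': "V' \<in> nested_in T Z" "orth T V' U"
      then obtain V1 where V1: "V1 \<in> nested_in H Z0" "V' = \<phi>d V1" using Z0 T_nested_in by auto
      have "V1 \<in> src.I" using V1 by (auto simp: nested_in_def)
      then show "nest T V' (\<phi>d T0)" using T0 V' V1 U0 I T0I by simp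
    qed
  next
    case (21 V W)
    then show ?case using src.nest_not_orth by auto
  next
    case (22 V W y)
    then obtain U Z x where UZ: "U \<in> src.I" "Z \<in> src.I" "V = \<phi>d U" "W = \<phi>d Z" and x: "x \<in> src.X" "y = \<phi> x" by auto
    have t: "transverse H U Z" using 22 UZ by simp
    note h = src.transverse_has_rho[OF t] src.transverse_has_rho[OF src.transverse_commute[OF UZ(1,2) t]]
    show ?case
      using src.consistency_transverse[OF UZ(1,2) x(1) t]
        prj_aw[OF UZ(2) x(1) src.rho_subset[OF UZ(1,2) h(1)]] prj_aw[OF UZ(1) x(1) src.rho_subset[OF UZ(2,1) h(2)]]
      unfolding UZ(3,4) x(2) T_hyp T_rho_set[OF UZ(1,2)] T_rho_set[OF UZ(2,1)] by blast
  next
    case (23 V W y)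
    then obtain U Z x where UZ: "U \<in> src.I" "Z \<in> src.I" "V = \<phi>d U" "W = \<phi>d Z" and x: "x \<in> src.X" "y = \<phi> x"
      and s: "snest H U Z" by auto
    from T_consistency_nested[OF UZ(1,2) x(1) s] show ?case
      unfolding T_hyp UZ(3,4) x(2) using all_within_mono D(4,5) by blast
  next
    case (24 U V W)
    then obtain U0 V0 W0 where I: "U0 \<in> src.I" "V0 \<in> src.I" "W0 \<in> src.I" "U = \<phi>d U0" "V = \<phi>d V0" "W = \<phi>d W0" by auto
    have n: "nest H V0 W0" "snest H W0 U0 \<or> transverse H W0 U0 \<and> \<not> orth H U0 V0" using 24 I by auto
    have hW: "has_rho H W0 U0" using n by (auto simp: has_rho_def)
    have hV: "has_rho H V0 U0"
    proof (rule src.has_rho_down(1)[OF I(1-3) n(1) hW])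
      show "\<not> orth H V0 U0"
        using n(2) src.orth_sym[OF I(2,1)] src.nest_not_orth[OF I(2,1)] src.nest_trans[OF I(2,3,1) n(1)]
        by (auto simp: snest_def)
    qed
    show ?case
      using rho_aw[OF I(1) src.rho_subset[OF I(2,1) hV] src.rho_subset[OF I(3,1) hW] src.rho_consistency[OF I(1-3) n]] I
      by simp
  next
    case 25
    show ?case by (rule T_finite_complexity)
  next
    case (26 W x y u v)
    then obtain U where U: "U \<in> src.I" "W = \<phi>d U" by auto
    show ?case
      using T_large_links[OF U(1), of u x v y D] 26 U D(6,15,7) by simp
  next
    case (27 V W u v G)
    then obtain U Z where UZ: "U \<in> src.I" "Z \<in> src.I" "V = \<phi>d U" "W = \<phi>d Z" and s: "snest H U Z" by auto
    have "geodesic_segment (hyp H' (\<phi>d Z)) u v G" using 27 UZ by simp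
    from T_bounded_geodesic_image[OF UZ(1,2) s this] show ?case
      unfolding T_hyp UZ(3,4) using all_within_mono D(8,14) by meson
  next
    case (28 \<V> c)
    have "\<exists>y\<in>Y. \<forall>V\<in>\<V>. all_within (hyp H' V) (2 * L + (L * C + L) + L) (prj T V y) {c V} \<and>
        (\<forall>U\<in>\<phi>d ` src.I. has_rho T V U \<longrightarrow>
          all_within (hyp H' U) (2 * L + (L * C + L) + L) (prj T U y) (rho_set T V U))"
      by (rule T_partial_realization) (use 28 in auto)
    then show ?case unfolding T_hyp T_points T_index using all_within_mono[OF _ D(16)] by meson
  next
    case (29 k)
    show ?case unfolding T_hyp T_points T_index T_dist by (rule T_uniqueness)
  next
    case (30 W w)
    then obtain U where U: "U \<in> src.I" "W = \<phi>d U" by auto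
    have w: "w \<in> tgt.M W" using 30 by simp
    obtain x where x: "x \<in> src.X" "tgt.d W w (pt H' W (\<phi> x)) \<le> L * C + 3 * L" using pt_image_dense[OF _ w] U by blast
    have "tgt.d W w v \<le> D" if v: "v \<in> prj T W (\<phi> x)" for v
    proof -
      have "tgt.d W w v \<le> tgt.d W w (pt H' W (\<phi> x)) + tgt.d W (pt H' W (\<phi> x)) v"
        using w x U v T_prj_in by (intro tgt.d_triangle) auto
      then show ?thesis using x(2) T_prj_pt[OF U(1), of v "\<phi> x"] v U(2) D(17) by simp
    qed
    then show ?case using x(1) by (auto simp: all_within_def)
  qed
  then show ?thesis by blast
qed

end

lemma (in full_hiero) qi_embedding_imp_transported_hhs:
  assumes qi: "qi_embedding K0 R (ambient H) (ambient H') \<phi>"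
  shows "image_admits_transported_hhs H H' \<phi> \<phi>d \<phi>s"
proof -
  define \<psi> where "\<psi> U w = (SOME u. u \<in> src.M U \<and> tgt.d (\<phi>d U) (\<phi>s U u) w \<le> L)" for U w
  have psi: "\<psi> U w \<in> src.M U \<and> tgt.d (\<phi>d U) (\<phi>s U (\<psi> U w)) w \<le> L"
    if "U \<in> src.I" "w \<in> tgt.M (\<phi>d U)" for U w
    unfolding \<psi>_def by (rule someI_ex) (use phis_surj[OF that] in blast)
  interpret full_hiero_inv H C H' C' \<phi> \<phi>d \<phi>s L S \<psi> K0 R
    using psi qi unfolding qi_embedding_def by unfold_locales auto
  obtain D where "coarse_hhs T D" using T_coarse_hhs by blast
  then have "hhs (transported_structure H H' \<phi> \<phi>d \<phi>s \<psi>)" unfolding T_def by (rule coarse_hhs_imp_hhs)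
  moreover have "quasi_inverses (L * L + L) (hyp H U) (hyp H' (\<phi>d U)) (\<phi>s U) (\<psi> U)" if U: "U \<in> src.I" for U
    unfolding quasi_inverses_def
  proof (intro conjI ballI)
    show "\<phi>s U \<in> src.M U \<rightarrow> tgt.M (\<phi>d U)" "\<psi> U \<in> tgt.M (\<phi>d U) \<rightarrow> src.M U" using U by auto
    fix u assume u: "u \<in> src.M U"
    have "L * tgt.d (\<phi>d U) (\<phi>s U (\<psi> U (\<phi>s U u))) (\<phi>s U u) \<le> L * L"
      using psi_close[OF U phis_in[OF U u]] L_ge_1 by (intro mult_left_mono) auto
    then show "src.d U (\<psi> U (\<phi>s U u)) u \<le> L * L + L"
      using phis_lower[OF U psi_in[OF U phis_in[OF U u]] u] by linarith
  next
    fix w assume "w \<in> tgt.M (\<phi>d U)"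
    moreover have "0 \<le> L * L" by simp
    ultimately show "tgt.d (\<phi>d U) (\<phi>s U (\<psi> U w)) w \<le> L * L + L" using psi_close[OF U, of w] by linarith
  qed
  ultimately show ?thesis unfolding image_admits_transported_hhs_def by blast
qed

theorem theorem5:
  fixes H' :: "('y, 'j, 'k) hhs_data"
  assumes "hhs H'"
  shows "\<forall>\<^sub>F \<kappa> in at_top. \<forall>\<^sub>F \<theta> in at_top.
    \<forall>(H :: ('x, 'i, 'h) hhs_data) \<phi> \<phi>d \<phi>s S e.
      hhs H \<and> full_hieromorphism H H' \<phi> \<phi>d \<phi>s \<and>
      hierarchically_quasiconvex H' (\<phi> ` points H) \<and>
      maximal_index H S \<and> e \<in> E_tuples H' \<kappa> (\<phi>d S) \<longrightarrow>
      (let P1 = coarsely_lipschitz (ambient H) (ambient H') \<phi>;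
           P2 = (\<exists>K C. qi_embedding K C (ambient H) (ambient H') \<phi>);
           P3 = gates_quasi_inverse H' (\<phi> ` points H) (F_copy H' \<kappa> \<theta> (\<phi>d S) e);
           P4 = image_admits_transported_hhs H H' \<phi> \<phi>d \<phi>s;
           P5 = (\<exists>\<mu>::real. \<forall>W\<in>index H' - \<phi>d ` index H.
                   hdiam H' W (prj_image H' W (\<phi> ` points H)) \<le> ennreal \<mu>)
       in (P1 \<longleftrightarrow> P2) \<and> (P1 \<longleftrightarrow> P3) \<and> (P1 \<longleftrightarrow> P4) \<and> (P1 \<longleftrightarrow> P5))"
proof (cases "index H' = {}")
  case True
  \<comment> \<open>A maximal \<open>S\<close> would have to be sent into the empty index
    set.\<close>
  have "\<not> (full_hieromorphism H H' \<phi> \<phi>d \<phi>s \<and> maximal_index H S)"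
    for H :: "('x, 'i, 'h) hhs_data" and \<phi> \<phi>d \<phi>s S
    using True unfolding full_hieromorphism_def hieromorphism_def maximal_index_def by auto
  then show ?thesis by (intro always_eventually allI) blast
next
  case False
  then obtain C' where "coarse_hhs H' C'" using hhs_imp_coarse_hhs assms by blast
  then interpret tgt: coarse_hhs H' C' .
  \<comment> \<open>Above \<open>\<kappa>1\<close> the projections of every point of the target form
    a consistent tuple, so they are admissible as inner coordinates of the copies.\<close>
  obtain \<kappa>1 where \<kappa>1: "0 \<le> \<kappa>1"
    "\<And>\<kappa> x J. \<kappa>1 \<le> \<kappa> \<Longrightarrow> x \<in> points H' \<Longrightarrow> J \<subseteq> index H' \<Longrightarrow> consistent_tuple H' \<kappa> J (\<lambda>V. prj H' V x)"
    using hhs_prj_consistent[OF assms] by blast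
  show ?thesis
  proof (rule eventually_at_top_linorderI[of \<kappa>1])
    fix \<kappa> assume \<kappa>: "\<kappa>1 \<le> \<kappa>"
    have \<kappa>0: "0 \<le> \<kappa>" using \<kappa> \<kappa>1(1) by simp
    \<comment> \<open>\<open>\<theta>0\<close> depends only on \<open>H'\<close> and
      \<open>\<kappa>\<close>, so it is fixed before \<open>H\<close>, \<open>\<phi>\<close> and
      \<open>e\<close>, as the order of the quantifiers demands.\<close>
    obtain \<theta>0 where \<theta>0: "0 \<le> \<theta>0" "\<And>\<theta> U e x. \<theta>0 \<le> \<theta> \<Longrightarrow> U \<in> tgt.I \<Longrightarrow> e \<in> E_tuples H' \<kappa> U \<Longrightarrow> x \<in> tgt.X \<Longrightarrow>
       \<exists>z\<in>F_copy H' \<kappa> \<theta> U e. \<forall>V\<in>tgt.I. nest H' V U \<longrightarrow> tgt.d V (pt H' V z) (pt H' V x) \<le> \<theta>0"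
      using tgt.F_copy_realization[OF \<kappa>0 \<kappa>1(2)[OF \<kappa>]] by blast
    show "\<forall>\<^sub>F \<theta> in at_top.
      \<forall>(H :: ('x, 'i, 'h) hhs_data) \<phi> \<phi>d \<phi>s S e.
      hhs H \<and> full_hieromorphism H H' \<phi> \<phi>d \<phi>s \<and>
      hierarchically_quasiconvex H' (\<phi> ` points H) \<and>
      maximal_index H S \<and> e \<in> E_tuples H' \<kappa> (\<phi>d S) \<longrightarrow>
      (let P1 = coarsely_lipschitz (ambient H) (ambient H') \<phi>;
           P2 = (\<exists>K C. qi_embedding K C (ambient H) (ambient H') \<phi>);
           P3 = gates_quasi_inverse H' (\<phi> ` points H) (F_copy H' \<kappa> \<theta> (\<phi>d S) e);
           P4 = image_admits_transported_hhs H H' \<phi> \<phi>d \<phi>s;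
           P5 = (\<exists>\<mu>::real. \<forall>W\<in>index H' - \<phi>d ` index H.
                   hdiam H' W (prj_image H' W (\<phi> ` points H)) \<le> ennreal \<mu>)
       in (P1 \<longleftrightarrow> P2) \<and> (P1 \<longleftrightarrow> P3) \<and> (P1 \<longleftrightarrow> P4) \<and> (P1 \<longleftrightarrow> P5))"
    proof (rule eventually_at_top_linorderI[of \<theta>0], intro allI impI, elim conjE)
      fix \<theta> and H :: "('x, 'i, 'h) hhs_data" and \<phi> \<phi>d \<phi>s S e
      assume \<theta>: "\<theta>0 \<le> \<theta>" and H: "hhs H" and fh: "full_hieromorphism H H' \<phi> \<phi>d \<phi>s"
        and hq: "hierarchically_quasiconvex H' (\<phi> ` points H)" and S: "maximal_index H S"
        and e: "e \<in> E_tuples H' \<kappa> (\<phi>d S)"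
      have \<theta>': "0 \<le> \<theta>" using \<theta> \<theta>0(1) by simp
      have "index H \<noteq> {}" using S by (auto simp: maximal_index_def)
      then obtain C where C: "coarse_hhs H C" using hhs_imp_coarse_hhs H by blast
      obtain L where "full_hiero H C H' C' \<phi> \<phi>d \<phi>s L S"
        using full_hieromorphism_imp_full_hiero[OF C \<open>coarse_hhs H' C'\<close> fh S] by blast
      then interpret full_hiero H C H' C' \<phi> \<phi>d \<phi>s L S .
      have SI: "\<phi>d S \<in> tgt.I" by simp
      note real = \<theta>0(2)[OF \<theta> SI e]
      have 12: "coarsely_lipschitz (ambient H) (ambient H') \<phi> \<longleftrightarrow> (\<exists>K C. qi_embedding K C (ambient H) (ambient H') \<phi>)"
        using lipschitz_imp_qi_embedding[OF hq] unfolding qi_embedding_def coarsely_lipschitz_def by blast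
      have 15: "coarsely_lipschitz (ambient H) (ambient H') \<phi> \<longleftrightarrow> bounded_outside"
        using lipschitz_imp_bounded_outside[OF hq e \<kappa>0 \<theta>' real] bounded_outside_imp_lipschitz by blast
      have 53: "bounded_outside \<longleftrightarrow> gates_quasi_inverse H' (\<phi> ` points H) (F_copy H' \<kappa> \<theta> (\<phi>d S) e)"
        using bounded_outside_imp_gates[OF hq e \<kappa>0 \<theta>' \<theta>0(1) real] gates_imp_bounded_outside[OF hq e \<kappa>0 \<theta>'] by blast
      have 14: "coarsely_lipschitz (ambient H) (ambient H') \<phi> \<longleftrightarrow> image_admits_transported_hhs H H' \<phi> \<phi>d \<phi>s"
        using transported_hhs_imp_lipschitz qi_embedding_imp_transported_hhs 12 by blast
      show "let P1 = coarsely_lipschitz (ambient H) (ambient H') \<phi>;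
           P2 = (\<exists>K C. qi_embedding K C (ambient H) (ambient H') \<phi>);
           P3 = gates_quasi_inverse H' (\<phi> ` points H) (F_copy H' \<kappa> \<theta> (\<phi>d S) e);
           P4 = image_admits_transported_hhs H H' \<phi> \<phi>d \<phi>s;
           P5 = (\<exists>\<mu>::real. \<forall>W\<in>index H' - \<phi>d ` index H.
                   hdiam H' W (prj_image H' W (\<phi> ` points H)) \<le> ennreal \<mu>)
       in (P1 \<longleftrightarrow> P2) \<and> (P1 \<longleftrightarrow> P3) \<and> (P1 \<longleftrightarrow> P4) \<and> (P1 \<longleftrightarrow> P5)"
        unfolding Let_def using 12 15 53 14 unfolding bounded_outside_def by blast
    qed
  qed
qed

end
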